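(* Let $p\ge2$, let $\mathbf{a}=(a_1,\dots,a_p)$, $\mathbf{b}=(b_1,\dots,b_p)$ be complex vectors, let $\psi_p=\sum_{i=1}^p(b_i-a_i)$, and let $h^s_p(n)$ and $D^{[k,s]}_n$ be the coefficients defined in the context. The identities below are asserted for all parameters for which the quantities occurring in them are defined. (i) For each nonnegative integer $n$ and arbitrary $s\in\{1,\dots,p\}$, $$h_p^s(n)=-\frac{1}{\pi\sin(\pi\psi_p)}\sum_{\substack{k=1\\k\ne s}}^{p}\frac{\prod_{i=1}^p\sin(\pi(b_i-a_k))}{\prod_{i\ne k,s}\sin(\pi(a_i-a_k))}\,D_n^{[k,s]}.$$ (ii) For each nonnegative integer $n$ and arbitrary distinct integers $s,i,k$ from $\{1,2,\dots,p\}$, $$\sum_{j=0}^{n}\frac{(-1)^{j}}{j!}\Bigl([a_i]_j\sin(\pi(a_s-a_i))D_{n-j}^{[s,i]}+[a_k]_j\sin(\pi(a_i-a_k))D_{n-j}^{[i,k]}+[a_s]_j\sin(\pi(a_k-a_s))D_{n-j}^{[k,s]}\Bigr)=0.$$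
   Context: Notation: $(x)_n=x(x+1)\cdots(x+n-1)$ is the rising factorial, $[x]_j=x(x-1)\cdots(x-j+1)$ the falling factorial, $(x)_0=[x]_0=1$; $\psi_m=\sum_{i=1}^m(b_i-a_i)$; $\prod_{i\ne k,s}$ runs over $i\in\{1,\dots,p\}\setminus\{k,s\}$ (empty product $=1$). ${}_pF_{q}$ is the generalized hypergeometric function; ${}_pF_q$ without argument means its value at $z=1$. Inside hypergeometric symbols, $(x_i)_{i\in I}$ denotes a list of parameters. Coefficients $h^s_p(n)$ (Bühring): for $\psi_p\notin\mathbb{Z}$ they are defined by the unique expansion, for $z\in(0,1)$ near $1$, $$\frac{\prod_{i=1}^p\Gamma(1-b_i+a_s)}{\prod_{i\ne s}\Gamma(1-a_i+a_s)}\;{}_pF_{p-1}\left({1-b_1+a_s,\dots,1-b_p+a_s\atop (1-a_i+a_s)_{i\ne s}};z\right)=(1-z)^{\psi_p-1}\sum_{n=0}^{\infty}f_p^s(n)(1-z)^n+\sum_{n=0}^{\infty}h_p^s(n)(1-z)^n.$$ When $\Re(1-b_i+a_p+n)>0$, $i=1,\dots,p-2$, they are given explicitly by Bühring's formula $$\begin{aligned}h_p^p(n)=&-\frac{\Gamma(\psi_p)\Gamma(1-b_p+a_p+n)\Gamma(1-b_{p-1}+a_p+n)}{(1-\psi_p)_{n+1}\Gamma(\psi_{p-1})\Gamma(\psi_p-b_{p-1}+a_p)\,n!}\sum_{j_{p-2}=0}^{\infty}\frac{(\psi_p-n-1)_{j_{p-2}}}{(\psi_{p-1})_{j_{p-2}}(\psi_p-b_{p-1}+a_p)_{j_{p-2}}}\\&\times\sum_{j_{p-3}=0}^{j_{p-2}}\cdots\sum_{j_1=0}^{j_2}\prod_{m=1}^{p-2}\frac{(\psi_m+j_{m-1})_{j_m-j_{m-1}}}{(j_m-j_{m-1})!}(b_m-a_{m+1})_{j_m-j_{m-1}},\qquad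 j_0=0\end{aligned}$$ (for $p=2$ the summation is the single term $j_0=0$), and $h^s_p(n)$ is obtained by exchanging the roles of $a_p$ and $a_s$. Coefficients $D^{[k,s]}_n$ ($k\ne s$): let $$G^{[k,s]}(z)=G^{2,p}_{p,p}\left(z\,\Big|\,{\mathbf{b}\atop a_k,a_s,\mathbf{a}_{[k,s]}}\right)=\frac{1}{2\pi i}\int_{\mathcal{L}}\frac{\Gamma(a_k+t)\Gamma(a_s+t)\prod_{i=1}^p\Gamma(1-b_i-t)}{\prod_{i\ne k,s}\Gamma(1-a_i-t)}z^{-t}\,dt$$ be Meijer's $G$-function, which is defined when $b_i-a_k\notin\mathbb{N}$ and $b_i-a_s\notin\mathbb{N}$ for all $i=1,\dots,p$ ($\mathbb{N}=\{1,2,\dots\}$). Here $\mathbf{a}_{[k,s]}$ is $\mathbf{a}$ with $a_k,a_s$ removed and $\mathcal{L}$ goes from $\gamma-i\infty$ to $\gamma+i\infty$, separating the poles of $\Gamma(a_k+t)\Gamma(a_s+t)$ (on its left) from those of $\prod_i\Gamma(1-b_i-t)$ (on its right); the function is analytic for $|\arg z|<2\pi$. The numbers $D^{[k,s]}_n$ are the coefficients in $$G^{[k,s]}(z)=z^{a_s}\sum_{n=0}^{\infty}D_n^{[k,s]}(1-z)^n,\qquad |1-z|<1.$$ They are given by either of the following formulas of Nørlund (where no gamma function in the numerators has a pole): when $\Re(1-b_i+a_s)>0$ for $i=3,\dots,p$, $$\begin{aligned}D_n^{[k,s]}=&\frac{\prod_{i=1}^p\Gamma(1-b_i+a_k)\,\Gamma(1-b_1+a_s+n)\Gamma(1-b_2+a_s+n)}{\prod_{i\ne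 k,s}\Gamma(1-a_i+a_k)\,\Gamma(2+a_k+a_s-b_1-b_2+n)\,n!}\\&\times\sum_{j=0}^{\infty}\frac{(1-b_1+a_k)_j(1-b_2+a_k)_j}{j!\,(2+a_k+a_s-b_1-b_2+n)_j}\;{}_{p-1}F_{p-2}\left({-j,\ (1-b_i+a_k)_{i=3,\dots,p}\atop (1-a_i+a_k)_{i\ne k,s}}\right),\end{aligned}$$ and, when $\Re(1-b_i+a_s)>0$ for $i=2,\dots,p$, $$D_n^{[k,s]}=\frac{\prod_{i=1}^p\Gamma(1-b_i+a_k)\,\Gamma(1-a_k+a_s+n)}{\prod_{i\ne k,s}\Gamma(1-a_i+a_k)\,n!}\sum_{j=0}^{\infty}\frac{(1-b_1+a_k)_j}{(1-b_1+a_s+n)_{j+1}}\;{}_{p}F_{p-1}\left({-j,\ (1-b_i+a_k)_{i=2,\dots,p}\atop 1,\ (1-a_i+a_k)_{i\ne k,s}}\right).$$ *)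

theory Defs
  imports "HOL-Complex_Analysis.Complex_Analysis"
begin

text \<open>
  The parameter vectors \<open>(a\<^sub>1, \<dots>, a\<^sub>p)\<close> and \<open>(b\<^sub>1, \<dots>, b\<^sub>p)\<close> are functions on \<open>nat\<close>, of which
  only the values on \<open>{1..p}\<close> are used. In Isabelle, \<open>\<nat>\<close> contains 0; the set of positive integers
  is \<open>\<nat> - {0}\<close>.
\<close>

definition psi :: "(nat \<Rightarrow> complex) \<Rightarrow> (nat \<Rightarrow> complex) \<Rightarrow> nat \<Rightarrow> complex" where
  "psi a b m = (\<Sum>i=1..m. b i - a i)"

definition falling_fact :: "complex \<Rightarrow> nat \<Rightarrow> complex" where
  "falling_fact x j = (\<Prod>i<j. x - of_nat i)"


section \<open>The coefficients h\<close>

definition hypergeom :: "complex list \<Rightarrow> complex list \<Rightarrow> complex \<Rightarrow> complex" where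
  "hypergeom as bs z =
     (\<Sum>n. (\<Prod>x\<leftarrow>as. pochhammer x n) / (\<Prod>y\<leftarrow>bs. pochhammer y n) * z ^ n / fact n)"

text \<open>
  The hypergeometric function multiplied by the gamma prefactor
  \<open>\<Prod>\<^sub>i \<Gamma>(1 - b\<^sub>i + a\<^sub>s) / \<Prod>\<^bsub>i\<noteq>s\<^esub> \<Gamma>(1 - a\<^sub>i + a\<^sub>s)\<close>, with the prefactor moved into the series. As
  usual for this normalization, the product makes sense also if some \<open>1 - a\<^sub>i + a\<^sub>s\<close> is a nonpositive
  integer, where the prefactor vanishes and the hypergeometric function alone is undefined.
  Elsewhere it is literally the product, see \<open>gamma_hypergeom_eq\<close>.
\<close>

definition gamma_hypergeom ::
  "nat \<Rightarrow> (nat \<Rightarrow> complex) \<Rightarrow> (nat \<Rightarrow> complex) \<Rightarrow> nat \<Rightarrow> complex \<Rightarrow> complex" where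
  "gamma_hypergeom p a b s z =
     (\<Sum>n. (\<Prod>i=1..p. Gamma (1 - b i + a s + of_nat n))
          * (\<Prod>i\<in>{1..p}-{s}. rGamma (1 - a i + a s + of_nat n)) * z ^ n / fact n)"

lemma gamma_hypergeom_eq:
  fixes p s :: nat and a b :: "nat \<Rightarrow> complex" and z :: complex
  defines "us \<equiv> map (\<lambda>i. 1 - b i + a s) [1..<Suc p]"
      and "ls \<equiv> map (\<lambda>i. 1 - a i + a s) (filter (\<lambda>i. i \<noteq> s) [1..<Suc p])"
  assumes u: "\<And>i. i \<in> {1..p} \<Longrightarrow> 1 - b i + a s \<notin> \<int>\<^sub>\<le>\<^sub>0"
      and l: "\<And>i. i \<in> {1..p} - {s} \<Longrightarrow> 1 - a i + a s \<notin> \<int>\<^sub>\<le>\<^sub>0"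
      and conv: "summable (\<lambda>n. (\<Prod>x\<leftarrow>us. pochhammer x n) / (\<Prod>y\<leftarrow>ls. pochhammer y n) * z ^ n / fact n)"
  shows "gamma_hypergeom p a b s z =
     (\<Prod>i=1..p. Gamma (1 - b i + a s)) / (\<Prod>i\<in>{1..p}-{s}. Gamma (1 - a i + a s)) * hypergeom us ls z"
proof -
  define c where "c = (\<Prod>i=1..p. Gamma (1 - b i + a s)) / (\<Prod>i\<in>{1..p}-{s}. Gamma (1 - a i + a s))"
  have U: "(\<Prod>x\<leftarrow>us. pochhammer x n) = (\<Prod>i=1..p. pochhammer (1 - b i + a s) n)" for n
  proof -
    have "(\<Prod>x\<leftarrow>us. pochhammer x n) = prod_list (map (\<lambda>i. pochhammer (1 - b i + a s) n) [1..<Suc p])"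
      by (simp add: us_def comp_def del: upt_Suc)
    also have "\<dots> = (\<Prod>i\<in>set [1..<Suc p]. pochhammer (1 - b i + a s) n)"
      by (rule prod.distinct_set_conv_list [symmetric]) simp
    also have "set [1..<Suc p] = {1..p}" by auto
    finally show ?thesis .
  qed
  have L: "(\<Prod>y\<leftarrow>ls. pochhammer y n) = (\<Prod>i\<in>{1..p}-{s}. pochhammer (1 - a i + a s) n)" for n
  proof -
    let ?xs = "filter (\<lambda>i. i \<noteq> s) [1..<Suc p]"
    have "(\<Prod>y\<leftarrow>ls. pochhammer y n) = prod_list (map (\<lambda>i. pochhammer (1 - a i + a s) n) ?xs)"
      by (simp add: ls_def comp_def del: upt_Suc)
    also have "\<dots> = (\<Prod>i\<in>set ?xs. pochhammer (1 - a i + a s) n)"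
      by (rule prod.distinct_set_conv_list [symmetric]) simp
    also have "set ?xs = {1..p} - {s}" by auto
    finally show ?thesis .
  qed
  have pu: "Gamma (1 - b i + a s + of_nat n) = Gamma (1 - b i + a s) * pochhammer (1 - b i + a s) n"
    if "i \<in> {1..p}" for i n
    using u[OF that] by (simp add: pochhammer_Gamma Gamma_eq_zero_iff)
  have pl: "rGamma (1 - a i + a s + of_nat n) = inverse (Gamma (1 - a i + a s) * pochhammer (1 - a i + a s) n)"
    if "i \<in> {1..p} - {s}" for i n
    using l[OF that] by (simp add: pochhammer_Gamma Gamma_eq_zero_iff rGamma_inverse_Gamma)
  have term_eq: "(\<Prod>i=1..p. Gamma (1 - b i + a s + of_nat n))
          * (\<Prod>i\<in>{1..p}-{s}. rGamma (1 - a i + a s + of_nat n)) * z ^ n / fact n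
        = c * ((\<Prod>x\<leftarrow>us. pochhammer x n) / (\<Prod>y\<leftarrow>ls. pochhammer y n) * z ^ n / fact n)" for n
  proof -
    have "(\<Prod>i=1..p. Gamma (1 - b i + a s + of_nat n)) =
        (\<Prod>i=1..p. Gamma (1 - b i + a s)) * (\<Prod>i=1..p. pochhammer (1 - b i + a s) n)"
      by (subst prod.distrib [symmetric], rule prod.cong [OF refl pu])
    moreover have "(\<Prod>i\<in>{1..p}-{s}. rGamma (1 - a i + a s + of_nat n)) =
        inverse ((\<Prod>i\<in>{1..p}-{s}. Gamma (1 - a i + a s))
          * (\<Prod>i\<in>{1..p}-{s}. pochhammer (1 - a i + a s) n))"
      by (subst prod.distrib [symmetric], subst prod_inversef [symmetric],
          simp only: comp_def, rule prod.cong [OF refl pl])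
    ultimately show ?thesis
      unfolding U L c_def by (simp add: divide_inverse mult_ac)
  qed
  show ?thesis
    unfolding gamma_hypergeom_def term_eq hypergeom_def c_def [symmetric]
    by (rule suminf_mult [OF conv])
qed

definition buehring_expansion ::
  "nat \<Rightarrow> (nat \<Rightarrow> complex) \<Rightarrow> (nat \<Rightarrow> complex) \<Rightarrow> nat \<Rightarrow> (nat \<Rightarrow> complex) \<Rightarrow> (nat \<Rightarrow> complex) \<Rightarrow> bool"
where
  "buehring_expansion p a b s f h \<longleftrightarrow>
     (\<forall>\<^sub>F z in at_left (1::real).
        summable (\<lambda>n. f n * of_real (1 - z) ^ n) \<and>
        summable (\<lambda>n. h n * of_real (1 - z) ^ n) \<and>
        gamma_hypergeom p a b s (of_real z) =
          of_real (1 - z) powr (psi a b p - 1) * (\<Sum>n. f n * of_real (1 - z) ^ n)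
          + (\<Sum>n. h n * of_real (1 - z) ^ n))"

text \<open>The expansion is unique only if \<open>psi a b p \<notin> \<int>\<close>; otherwise the value of \<open>h_coeff\<close> is irrelevant.\<close>

definition h_coeff :: "nat \<Rightarrow> (nat \<Rightarrow> complex) \<Rightarrow> (nat \<Rightarrow> complex) \<Rightarrow> nat \<Rightarrow> nat \<Rightarrow> complex" where
  "h_coeff p a b s = (THE h. \<exists>f. buehring_expansion p a b s f h)"


section \<open>Meijer's G-function as a Mellin--Barnes integral\<close>

text \<open>
  A contour from \<open>\<gamma> - \<i>\<infinity>\<close> to \<open>\<gamma> + \<i>\<infinity>\<close> consists of a piecewise smooth middle part \<open>c\<close> between two
  points of the line \<open>Re t = \<gamma>\<close> and of the two vertical rays of this line that start there. The
  middle part is needed because in general no straight line separates the two sets of poles. The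
  path \<open>mb_truncate c Y\<close> consists of \<open>c\<close> and segments of length \<open>Y\<close> of both rays.
\<close>

definition mb_truncate :: "(real \<Rightarrow> complex) \<Rightarrow> real \<Rightarrow> real \<Rightarrow> complex" where
  "mb_truncate c Y =
     linepath (pathstart c - \<i> * of_real Y) (pathstart c) +++ c
     +++ linepath (pathfinish c) (pathfinish c + \<i> * of_real Y)"

definition mb_integral :: "(real \<Rightarrow> complex) \<Rightarrow> (complex \<Rightarrow> complex) \<Rightarrow> complex" where
  "mb_integral c f = Lim at_top (\<lambda>Y. contour_integral (mb_truncate c Y) f)"

text \<open>
  The path \<open>c\<close> followed by a detour that returns to its start through points with real part \<open>M\<close>
  less. For large \<open>M\<close>, the winding number of this loop is 1 around points that are on the left of
  the contour, and 0 around points that are on the right of it.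
\<close>

definition left_loop :: "(real \<Rightarrow> complex) \<Rightarrow> real \<Rightarrow> real \<Rightarrow> complex" where
  "left_loop c M =
     c +++ linepath (pathfinish c) (pathfinish c - of_real M)
     +++ linepath (pathfinish c - of_real M) (pathstart c - of_real M)
     +++ linepath (pathstart c - of_real M) (pathstart c)"

definition separating_contour :: "complex set \<Rightarrow> complex set \<Rightarrow> (real \<Rightarrow> complex) \<Rightarrow> bool" where
  "separating_contour A B c \<longleftrightarrow>
     valid_path c \<and> Re (pathstart c) = Re (pathfinish c) \<and>
     (\<forall>w\<in>A \<union> B. Im (pathstart c) < Im w \<and> Im w < Im (pathfinish c) \<and> w \<notin> path_image c) \<and>
     (\<forall>w\<in>A. \<forall>\<^sub>F M in at_top. winding_number (left_loop c M) w = 1) \<and>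
     (\<forall>w\<in>B. \<forall>\<^sub>F M in at_top. winding_number (left_loop c M) w = 0)"

definition G_integrand ::
  "nat \<Rightarrow> (nat \<Rightarrow> complex) \<Rightarrow> (nat \<Rightarrow> complex) \<Rightarrow> nat \<Rightarrow> nat \<Rightarrow> complex \<Rightarrow> complex \<Rightarrow> complex" where
  "G_integrand p a b k s z t =
     Gamma (a k + t) * Gamma (a s + t) * (\<Prod>i=1..p. Gamma (1 - b i - t))
     / (\<Prod>i\<in>{1..p}-{k,s}. Gamma (1 - a i - t)) * z powr (- t)"

definition G_left_poles :: "(nat \<Rightarrow> complex) \<Rightarrow> nat \<Rightarrow> nat \<Rightarrow> complex set" where
  "G_left_poles a k s = (\<Union>m::nat. {- a k - of_nat m, - a s - of_nat m})"

definition G_right_poles :: "nat \<Rightarrow> (nat \<Rightarrow> complex) \<Rightarrow> complex set" where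
  "G_right_poles p b = (\<Union>i\<in>{1..p}. \<Union>m::nat. {1 - b i + of_nat m})"

text \<open>By Cauchy's theorem, the value does not depend on the choice of the separating contour.\<close>

definition meijer_G ::
  "nat \<Rightarrow> (nat \<Rightarrow> complex) \<Rightarrow> (nat \<Rightarrow> complex) \<Rightarrow> nat \<Rightarrow> nat \<Rightarrow> complex \<Rightarrow> complex" where
  "meijer_G p a b k s z =
     1 / (2 * of_real pi * \<i>)
     * mb_integral (SOME c. separating_contour (G_left_poles a k s) (G_right_poles p b) c)
         (G_integrand p a b k s z)"

text \<open>This condition says that the left and the right poles are disjoint.\<close>

definition meijer_G_defined ::
  "nat \<Rightarrow> (nat \<Rightarrow> complex) \<Rightarrow> (nat \<Rightarrow> complex) \<Rightarrow> nat \<Rightarrow> nat \<Rightarrow> bool" where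
  "meijer_G_defined p a b k s \<longleftrightarrow>
     (\<forall>i\<in>{1..p}. b i - a k \<notin> \<nat> - {0} \<and> b i - a s \<notin> \<nat> - {0})"

definition D_coeff ::
  "nat \<Rightarrow> (nat \<Rightarrow> complex) \<Rightarrow> (nat \<Rightarrow> complex) \<Rightarrow> nat \<Rightarrow> nat \<Rightarrow> nat \<Rightarrow> complex" where
  "D_coeff p a b k s =
     (THE d. \<forall>z. norm (1 - z) < 1 \<longrightarrow>
        summable (\<lambda>n. d n * (1 - z) ^ n) \<and>
        meijer_G p a b k s z = z powr a s * (\<Sum>n. d n * (1 - z) ^ n))"

end

theory Submission
  imports Defs "HOL-Real_Asymp.Real_Asymp"
begin

text \<open>
  All functions are Mellin--Barnes integrals of a kernel times \<open>exp (- \<zeta> t)\<close>, where \<open>z = exp \<zeta>\<close>. On a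
  common contour, part (ii) follows from the reflection formula and a cyclic identity for products
  of two sines, because \<open>z powr (- a s)\<close> times the G-function generates the coefficients \<open>D\<close>.

  For part (i), a partial fraction expansion of a product of sines shows that the combination of
  the G-functions on the right-hand side plus the hypergeometric function is, up to a factor, the
  integral of \<open>\<Prod>\<^sub>i \<Gamma>(1 - b\<^sub>i - t) / \<Gamma>(1 - a\<^sub>i - t)\<close>. For \<open>Re \<zeta> > 0\<close> this integral converges after
  its ends are turned to the right, and the phases \<open>exp (\<plusminus> \<i> \<pi> \<psi>)\<close> that occur for \<open>Im \<zeta> > 0\<close> and
  \<open>Im \<zeta> < 0\<close> are those of \<open>(- \<zeta>)\<close> to the power \<open>\<psi> - 1\<close>. Hence the sum is \<open>(- \<zeta>)\<close> to the power
  \<open>\<psi> - 1\<close> times a function with at most a pole at \<open>\<zeta> = 0\<close>. The growth of the coefficients of the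
  hypergeometric series excludes the pole, so this is the nonanalytic part of the expansion at
  \<open>z = 1\<close>, and the coefficients \<open>h\<close> come from the G-functions.
\<close>

section \<open>Growth of quotients of Gamma functions\<close>

text \<open>Quotients of Gamma functions are only bounded polynomially; every exponential rate of a
  kernel comes from an inverse sine or an exponential factor. These rates decide for which ln z the
  ends of a contour may be vertical. The obstacle in part (i) is that no single integral represents
  the hypergeometric function all around z = 1. The factor exp (\<plusminus> i pi (a_s + t)), which
  removes the alternating sign of the residues, destroys the decay at one vertical end, so each sign
  serves only one side of the real axis of ln z. Closing the contour to the left works for both
  signs and gives the same series, which joins the two pieces. After multiplication by (- ln z) to
  the power 1 - psi all pieces become one single-valued function on a punctured disc. The argument
  that excludes the pole compares it with a bound that blows up at z = 1. For large Re psi the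
  series need not blow up there, and it is first differentiated sufficiently often.\<close>

lemma norm_mult_le:
  fixes x y :: complex
  shows "norm x \<le> A \<Longrightarrow> norm y \<le> B \<Longrightarrow> norm (x * y) \<le> A * B"
  by (simp add: norm_mult mult_mono')

text \<open>Euler's limit formula: in the n-th approximants the powers of n cancel because the real
  parts have equal sums, and a comparison of the linear factors of the denominators remains. The
  comparisons of values of Gamma along vertical and horizontal lines derive from this.\<close>

lemma norm_Gamma_mult_le:
  fixes z1 z2 z3 z4 :: complex
  assumes nz: "z1 \<notin> \<int>\<^sub>\<le>\<^sub>0" "z2 \<notin> \<int>\<^sub>\<le>\<^sub>0" "z3 \<notin> \<int>\<^sub>\<le>\<^sub>0" "z4 \<notin> \<int>\<^sub>\<le>\<^sub>0"
    and Re_eq: "Re z1 + Re z2 = Re z3 + Re z4"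
    and le: "\<And>k::nat. norm (z3 + of_nat k) * norm (z4 + of_nat k)
               \<le> norm (z1 + of_nat k) * norm (z2 + of_nat k)"
  shows "norm (Gamma z1) * norm (Gamma z2) \<le> norm (Gamma z3) * norm (Gamma z4)"
proof (rule LIMSEQ_le)
  show "(\<lambda>n. norm (Gamma_series z1 n) * norm (Gamma_series z2 n))
          \<longlonglongrightarrow> norm (Gamma z1) * norm (Gamma z2)"
    by (intro tendsto_intros)
  show "(\<lambda>n. norm (Gamma_series z3 n) * norm (Gamma_series z4 n))
          \<longlonglongrightarrow> norm (Gamma z3) * norm (Gamma z4)"
    by (intro tendsto_intros)
  show "\<exists>N. \<forall>n\<ge>N. norm (Gamma_series z1 n) * norm (Gamma_series z2 n)
          \<le> norm (Gamma_series z3 n) * norm (Gamma_series z4 n)"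
  proof (intro exI allI impI)
    fix n :: nat assume "n \<ge> 0"
    define P where "P z = (\<Prod>k<Suc n. norm (z + of_nat k))" for z :: complex
    have series: "norm (Gamma_series z n) = fact n * exp (Re z * ln (real n)) / P z" for z
      by (simp add: Gamma_series_def norm_divide norm_mult pochhammer_prod P_def norm_exp_eq_Re
          atLeast0LessThan flip: prod_norm del: prod.lessThan_Suc)
    have pos: "P z > 0" if "z \<notin> \<int>\<^sub>\<le>\<^sub>0" for z
      unfolding P_def using that
      by (intro prod_pos) (auto simp: plus_of_nat_eq_0_imp)
    have "P z3 * P z4 \<le> P z1 * P z2"
      unfolding P_def prod.distrib [symmetric] by (intro prod_mono) (use le in auto)
    moreover have "exp (Re z1 * ln (real n)) * exp (Re z2 * ln (real n))
        = exp (Re z3 * ln (real n)) * exp (Re z4 * ln (real n))"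
      unfolding exp_add [symmetric] ring_distribs(2) [symmetric] by (simp only: Re_eq)
    ultimately show "norm (Gamma_series z1 n) * norm (Gamma_series z2 n)
          \<le> norm (Gamma_series z3 n) * norm (Gamma_series z4 n)"
      using nz[THEN pos] unfolding series
      by (simp add: field_simps) (simp add: mult.assoc [symmetric] mult_left_mono)?
  qed
qed

lemma pos_Re_not_nonpos_Int: "Re z > 0 \<Longrightarrow> z \<notin> \<int>\<^sub>\<le>\<^sub>0"
  by (auto elim!: nonpos_Ints_cases)

lemma Im_nonzero_not_nonpos_Int: "Im z \<noteq> 0 \<Longrightarrow> z \<notin> \<int>\<^sub>\<le>\<^sub>0"
  by (auto elim!: nonpos_Ints_cases)

text \<open>On the line Re z = 1/2 the reflection z -> 1 - z is complex conjugation, so the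
  reflection formula gives the modulus exactly. The line serves as reference for
  \<open>norm_Gamma_vertical_le\<close>.\<close>

lemma norm_Gamma_half: "norm (Gamma (Complex (1/2) y)) ^ 2 = pi / cosh (pi * y)"
proof -
  let ?z = "Complex (1/2) y"
  have "1 - ?z = cnj ?z"
    by (simp add: complex_eq_iff)
  then have "Gamma ?z * cnj (Gamma ?z) = of_real pi / sin (of_real pi * ?z)"
    using Gamma_reflection_complex[of ?z] by (simp add: cnj_Gamma)
  moreover have "sin (of_real pi * ?z) = cosh (of_real (pi * y))"
  proof -
    have "of_real pi * ?z = of_real pi / 2 + \<i> * of_real (pi * y)"
      by (simp add: complex_eq_iff)
    then show ?thesis
      by (simp add: sin_add cosh_conv_cos flip: sin_of_real cos_of_real)
  qed
  moreover have "cosh (complex_of_real u) = of_real (cosh u)" for u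
    by (simp add: cosh_def scaleR_conv_of_real exp_of_real flip: of_real_minus)
  ultimately have "of_real (norm (Gamma ?z) ^ 2) = (of_real (pi / cosh (pi * y)) :: complex)"
    unfolding complex_norm_square by (simp flip: of_real_mult)
  then show ?thesis
    by (simp only: of_real_eq_iff)
qed


lemma cosh_le_exp_mult_cosh: "cosh (y::real) \<le> exp \<bar>y - x\<bar> * cosh x"
proof -
  have "exp y \<le> exp \<bar>y - x\<bar> * exp x" "exp (- y) \<le> exp \<bar>y - x\<bar> * exp (- x)"
    unfolding exp_add [symmetric] by auto
  then show ?thesis
    by (simp add: cosh_def field_simps)
qed

text \<open>If y' is at most as far from the real axis as y, the linear factors at y' are the
  smaller ones and no constant is lost. Otherwise the quotient of the two values is at most the
  corresponding quotient on the line Re = 1/2, which is known explicitly.\<close>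

lemma norm_Gamma_vertical_le:
  assumes "x \<ge> 1/2"
  shows "norm (Gamma (Complex x y)) \<le> exp (pi * \<bar>y' - y\<bar>) * norm (Gamma (Complex x y'))"
proof (cases "\<bar>y'\<bar> \<le> \<bar>y\<bar>")
  case True
  \<comment> \<open>The value at 1 on both sides turns the comparison of pairs into one of single
    values.\<close>
  have "norm (Gamma (Complex x y)) * norm (Gamma (1::complex))
      \<le> norm (Gamma (Complex x y')) * norm (Gamma (1::complex))"
  proof (rule norm_Gamma_mult_le)
    fix k :: nat
    have "y'\<^sup>2 \<le> y\<^sup>2"
      using True by (simp add: abs_le_square_iff)
    then show "norm (Complex x y' + of_nat k) * norm (1 + of_nat k :: complex)
        \<le> norm (Complex x y + of_nat k) * norm (1 + of_nat k :: complex)"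
      by (intro mult_right_mono) (auto simp: cmod_def)
  qed (use assms in \<open>auto intro!: pos_Re_not_nonpos_Int\<close>)
  then have "norm (Gamma (Complex x y)) \<le> 1 * norm (Gamma (Complex x y'))"
    by simp
  also have "\<dots> \<le> exp (pi * \<bar>y' - y\<bar>) * norm (Gamma (Complex x y'))"
    by (intro mult_right_mono) auto
  finally show ?thesis .
next
  case False
  let ?h = "Complex (1/2)"
  have "norm (Gamma (Complex x y)) * norm (Gamma (?h y'))
      \<le> norm (Gamma (Complex x y')) * norm (Gamma (?h y))"
  proof (rule norm_Gamma_mult_le)
    fix k :: nat
    have sq: "y\<^sup>2 \<le> y'\<^sup>2" "(1/2 + real k)\<^sup>2 \<le> (x + real k)\<^sup>2"
      using False assms by (auto simp: abs_le_square_iff intro!: power_mono)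
    have "((x + real k)\<^sup>2 + y'\<^sup>2) * ((1/2 + real k)\<^sup>2 + y\<^sup>2)
        \<le> ((x + real k)\<^sup>2 + y\<^sup>2) * ((1/2 + real k)\<^sup>2 + y'\<^sup>2)"
      using mult_nonneg_nonneg[of "y'\<^sup>2 - y\<^sup>2" "(x + real k)\<^sup>2 - (1/2 + real k)\<^sup>2"] sq
      by (simp add: algebra_simps)
    then show "norm (Complex x y' + of_nat k) * norm (?h y + of_nat k)
        \<le> norm (Complex x y + of_nat k) * norm (?h y' + of_nat k)"
      by (simp add: cmod_def real_sqrt_mult [symmetric])
  qed (use assms in \<open>auto intro!: pos_Re_not_nonpos_Int\<close>)
  moreover have "norm (Gamma (?h y)) \<le> exp (pi * \<bar>y' - y\<bar>) * norm (Gamma (?h y'))"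
  proof (rule power2_le_imp_le)
    have "cosh (pi * y') \<le> exp (pi * \<bar>y' - y\<bar>) * cosh (pi * y)"
      using cosh_le_exp_mult_cosh[of "pi * y'" "pi * y"] by (simp add: abs_mult flip: right_diff_distrib)
    also have "\<dots> \<le> (exp (pi * \<bar>y' - y\<bar>))\<^sup>2 * cosh (pi * y)"
      by (intro mult_right_mono) (auto simp: power2_eq_square)
    finally show "(norm (Gamma (?h y)))\<^sup>2 \<le> (exp (pi * \<bar>y' - y\<bar>) * norm (Gamma (?h y')))\<^sup>2"
      by (simp add: power_mult_distrib norm_Gamma_half field_simps)
  qed auto
  ultimately have "norm (Gamma (Complex x y)) * norm (Gamma (?h y'))
      \<le> (exp (pi * \<bar>y' - y\<bar>) * norm (Gamma (Complex x y'))) * norm (Gamma (?h y'))"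
    by (smt (verit) mult.assoc mult.commute mult_left_mono norm_ge_zero)
  moreover have "norm (Gamma (?h y')) > 0"
    by (auto simp: Gamma_eq_zero_iff intro!: pos_Re_not_nonpos_Int)
  ultimately show ?thesis
    by (simp only: mult_le_cancel_right_pos)
qed

text \<open>The comparison of linear factors reduces the claim to real arguments. There Gamma
  increases from 3/2 on, its minimum being near 1.46.\<close>

lemma norm_Gamma_horizontal_le:
  assumes "3/2 \<le> x" "x \<le> x'"
  shows "norm (Gamma (Complex x y)) \<le> norm (Gamma (Complex x' y))"
proof -
  have "norm (Gamma (Complex x y)) * norm (Gamma (Complex x' 0))
      \<le> norm (Gamma (Complex x' y)) * norm (Gamma (Complex x 0))"
  proof (rule norm_Gamma_mult_le)
    fix k :: nat
    have "(x + real k)\<^sup>2 \<le> (x' + real k)\<^sup>2"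
      using assms by (intro power_mono) auto
    then have "((x' + real k)\<^sup>2 + y\<^sup>2) * (x + real k)\<^sup>2 \<le> ((x + real k)\<^sup>2 + y\<^sup>2) * (x' + real k)\<^sup>2"
      using mult_nonneg_nonneg[of "y\<^sup>2" "(x' + real k)\<^sup>2 - (x + real k)\<^sup>2"] by (simp add: algebra_simps)
    then show "norm (Complex x' y + of_nat k) * norm (Complex x 0 + of_nat k)
        \<le> norm (Complex x y + of_nat k) * norm (Complex x' 0 + of_nat k)"
      unfolding cmod_def real_sqrt_mult [symmetric] by (intro real_sqrt_le_mono) simp
  qed (use assms in \<open>auto intro!: pos_Re_not_nonpos_Int\<close>)
  moreover have real: "norm (Gamma (Complex u 0)) = Gamma u" if "u \<ge> 3/2" for u :: real
  proof -
    have "Gamma (Complex u 0) = of_real (Gamma u)"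
      using Gamma_complex_of_real[of u] by (simp add: complex_of_real_def)
    then show ?thesis
      using Gamma_real_pos[of u] that by simp
  qed
  moreover have "Gamma x \<le> Gamma x'"
    using assms Gamma_real_strict_mono[of x x'] by (cases "x = x'") auto
  ultimately have "norm (Gamma (Complex x y)) * Gamma x' \<le> norm (Gamma (Complex x' y)) * Gamma x'"
    using assms by (smt (verit) mult_left_mono norm_ge_zero)
  then show ?thesis
    using Gamma_real_pos[of x'] assms by simp
qed

lemma norm_pochhammer_le:
  fixes t b :: complex
  shows "norm (pochhammer (t + b) m) \<le> (1 + norm b + real m) ^ m * (1 + norm t) ^ m"
proof -
  have "norm (pochhammer (t + b) m) = (\<Prod>k<m. norm (t + b + of_nat k))"
    by (simp add: pochhammer_prod prod_norm atLeast0LessThan)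
  also have "\<dots> \<le> (\<Prod>k<m. (1 + norm b + real m) * (1 + norm t))"
  proof (intro prod_mono conjI)
    fix k assume "k \<in> {..<m}"
    have "norm (t + b + of_nat k) \<le> norm t + norm b + real k"
      by (metis norm_of_nat norm_triangle_le norm_triangle_ineq add_mono_thms_linordered_semiring(3))
    also have "\<dots> \<le> norm t + norm b + real m"
      using \<open>k \<in> {..<m}\<close> by simp
    also have "\<dots> \<le> (1 + norm b + real m) * (1 + norm t)"
      by (simp add: algebra_simps)
    finally show "norm (t + b + of_nat k) \<le> (1 + norm b + real m) * (1 + norm t)" .
  qed auto
  also have "\<dots> = (1 + norm b + real m) ^ m * (1 + norm t) ^ m"
    by (simp add: power_mult_distrib)
  finally show ?thesis .
qed

text \<open>The argument t + a is moved vertically to the height of t + b and then to the right to t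
  + b + m; by the functional equation the remaining quotient is a polynomial of degree m.\<close>

lemma norm_Gamma_quotient_right_half_plane:
  fixes a b :: complex
  obtains C N x0 where "C > 0"
    "\<And>t. Re t \<ge> x0 \<Longrightarrow> norm (Gamma (t + a) * rGamma (t + b)) \<le> C * (1 + norm t) ^ N"
proof -
  define m where "m = nat \<lceil>Re a - Re b\<rceil>"
  define C where "C = exp (pi * \<bar>Im b - Im a\<bar>) * (1 + norm b + real m) ^ m"
  define x0 where "x0 = 2 + norm a + norm b"
  have "norm (Gamma (t + a) * rGamma (t + b)) \<le> C * (1 + norm t) ^ m" if "Re t \<ge> x0" for t
  proof -
    have x: "Re (t + a) \<ge> 3/2" "Re (t + b) > 0"
      using that abs_Re_le_cmod[of a] abs_Re_le_cmod[of b] by (auto simp: x0_def)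
    have nz: "t + b \<notin> \<int>\<^sub>\<le>\<^sub>0"
      by (rule pos_Re_not_nonpos_Int[OF x(2)])
    have "norm (Gamma (Complex (Re (t + a)) (Im (t + a))))
        \<le> exp (pi * \<bar>Im (t + b) - Im (t + a)\<bar>) * norm (Gamma (Complex (Re (t + a)) (Im (t + b))))"
      by (rule norm_Gamma_vertical_le) (use x in simp)
    also have "norm (Gamma (Complex (Re (t + a)) (Im (t + b))))
        \<le> norm (Gamma (Complex (Re (t + b + of_nat m)) (Im (t + b))))"
      by (rule norm_Gamma_horizontal_le) (use x of_nat_ceiling[of "Re a - Re b"] in \<open>simp_all add: m_def\<close>)
    also have "Complex (Re (t + b + of_nat m)) (Im (t + b)) = t + b + of_nat m"
      by (simp add: complex_eq_iff)
    also have "Gamma (t + b + of_nat m) = pochhammer (t + b) m * Gamma (t + b)"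
      using nz by (simp add: pochhammer_Gamma Gamma_eq_zero_iff)
    also have "norm \<dots> \<le> (1 + norm b + real m) ^ m * (1 + norm t) ^ m * norm (Gamma (t + b))"
      unfolding norm_mult by (intro mult_right_mono norm_pochhammer_le) auto
    finally have "norm (Gamma (t + a)) \<le> C * (1 + norm t) ^ m * norm (Gamma (t + b))"
      unfolding complex_surj by (simp add: C_def mult_ac)
    moreover have "norm (Gamma (t + b)) > 0"
      using nz by (simp add: Gamma_eq_zero_iff)
    ultimately show ?thesis
      by (simp add: rGamma_inverse_Gamma norm_divide pos_divide_le_eq flip: divide_inverse)
  qed
  moreover have "C > 0"
    by (simp add: C_def add_pos_nonneg)
  ultimately show ?thesis
    using that by blast
qed

section \<open>The sine away from the real axis, and Gamma quotients outside a left
  half-strip\<close>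

lemma norm_sin_pi_le: "norm (sin (of_real pi * w :: complex)) \<le> exp (pi * \<bar>Im w\<bar>)"
proof -
  have "norm (sin (of_real pi * w)) \<le> (exp (pi * Im w) + exp (- (pi * Im w))) / 2"
    using norm_triangle_ineq4[of "exp (\<i> * (of_real pi * w))" "exp (- (\<i> * (of_real pi * w)))"]
    by (simp add: sin_exp_eq norm_divide norm_mult norm_exp_eq_Re)
  also have "\<dots> \<le> exp (pi * \<bar>Im w\<bar>)"
  proof -
    have "pi * Im w \<le> pi * \<bar>Im w\<bar>" "- (pi * Im w) \<le> pi * \<bar>Im w\<bar>"
      using mult_left_mono[of "Im w" "\<bar>Im w\<bar>" pi] mult_left_mono[of "- Im w" "\<bar>Im w\<bar>" pi] by auto
    then have "exp (pi * Im w) \<le> exp (pi * \<bar>Im w\<bar>)" "exp (- (pi * Im w)) \<le> exp (pi * \<bar>Im w\<bar>)"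
      by (simp_all only: exp_le_cancel_iff)
    then have "exp (pi * Im w) + exp (- (pi * Im w)) \<le> exp (pi * \<bar>Im w\<bar>) + exp (pi * \<bar>Im w\<bar>)"
      by (rule add_mono)
    then show ?thesis by simp
  qed
  finally show ?thesis .
qed

text \<open>One of the two exponentials dominates: at height at least 1 the other is at most half of
  it, which leaves a quarter after the division by 2.\<close>

lemma exp_le_norm_sin_pi:
  assumes "\<bar>Im w\<bar> \<ge> 1"
  shows "exp (pi * \<bar>Im w\<bar>) \<le> 4 * norm (sin (of_real pi * w :: complex))"
proof -
  have "\<bar>exp (pi * Im w) - exp (- (pi * Im w))\<bar> \<le> 2 * norm (sin (of_real pi * w))"
    using norm_triangle_ineq3[of "exp (\<i> * (of_real pi * w))" "exp (- (\<i> * (of_real pi * w)))"]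
    by (simp add: sin_exp_eq norm_divide norm_mult norm_exp_eq_Re abs_minus_commute)
  moreover have "\<bar>exp (pi * Im w) - exp (- (pi * Im w))\<bar> = exp (pi * \<bar>Im w\<bar>) - exp (- (pi * \<bar>Im w\<bar>))"
  proof (cases "Im w \<ge> 0")
    case True
    then have "- (pi * Im w) \<le> pi * Im w"
      by simp
    then have "exp (- (pi * Im w)) \<le> exp (pi * Im w)"
      by (simp only: exp_le_cancel_iff)
    then show ?thesis
      using True by simp
  next
    case False
    then have "pi * Im w \<le> - (pi * Im w)"
      by (simp add: mult_nonneg_nonpos)
    then have "exp (pi * Im w) \<le> exp (- (pi * Im w))"
      by (simp only: exp_le_cancel_iff)
    then show ?thesis
      using False by simp
  qed
  moreover have "exp (- (pi * \<bar>Im w\<bar>)) \<le> exp (pi * \<bar>Im w\<bar>) / 2"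
  proof -
    have "1 \<le> pi * \<bar>Im w\<bar>"
      using assms pi_gt3 by (smt (verit) mult_le_cancel_left1)
    then have "2 \<le> exp (pi * \<bar>Im w\<bar>)"
      using exp_ge_add_one_self[of "pi * \<bar>Im w\<bar>"] by linarith
    moreover have "exp (- (pi * \<bar>Im w\<bar>)) \<le> 1"
      by simp
    ultimately show ?thesis
      by linarith
  qed
  ultimately show ?thesis
    by linarith
qed

text \<open>Three regions. Far to the right the half-plane bound applies. Far to the left the
  reflection formula exchanges numerator and denominator and leaves a quotient of sines, which is
  bounded because the arguments stay away from the real axis. The strip between them is shifted to
  the right by n steps of the functional equation.\<close>

lemma norm_Gamma_quotient:
  fixes a b :: complex
  obtains C N H where "C > 0" "H > 0"
    "\<And>t. Re t \<ge> H \<or> \<bar>Im t\<bar> \<ge> H \<Longrightarrow> norm (Gamma (t + a) * rGamma (t + b)) \<le> C * (1 + norm t) ^ N"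
proof -
  obtain C1 N1 x1 where C1: "C1 > 0"
    "\<And>t. Re t \<ge> x1 \<Longrightarrow> norm (Gamma (t + a) * rGamma (t + b)) \<le> C1 * (1 + norm t) ^ N1"
    by (rule norm_Gamma_quotient_right_half_plane[of a b]) blast
  obtain C2 N2 x2 where C2: "C2 > 0"
    "\<And>t. Re t \<ge> x2 \<Longrightarrow> norm (Gamma (t + (1 - b)) * rGamma (t + (1 - a))) \<le> C2 * (1 + norm t) ^ N2"
    by (rule norm_Gamma_quotient_right_half_plane[of "1 - b" "1 - a"]) blast
  \<comment> \<open>Large enough that a point outside the left region lands to the right of x1 after
    n steps.\<close>
  define n where "n = nat \<lceil>\<bar>x1\<bar> + \<bar>x2\<bar>\<rceil>"
  define E where "E = 4 * exp (pi * \<bar>Im a - Im b\<bar>)"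
  define C3 where "C3 = (1 + real n) ^ N1 * C1 * (1 + norm b + real n) ^ n"
  define C where "C = C1 + E * C2 + C3"
  define N where "N = N1 + N2 + n"
  define H where "H = 1 + \<bar>x1\<bar> + norm a + norm b"
  have pos: "E > 0" "C3 > 0" "C > 0"
    using C1(1) C2(1) by (auto simp: E_def C3_def C_def intro!: add_pos_pos mult_pos_pos add_pos_nonneg zero_less_power)
  have up: "c * (1 + norm t) ^ k \<le> C * (1 + norm t) ^ N"
    if "c \<ge> 0" "c \<le> C" "k \<le> N" for c k and t :: complex
    using that by (intro mult_mono power_increasing) auto
  have "norm (Gamma (t + a) * rGamma (t + b)) \<le> C * (1 + norm t) ^ N"
    if t: "Re t \<ge> H \<or> \<bar>Im t\<bar> \<ge> H" for t
  proof -
    have n: "real n \<ge> \<bar>x1\<bar> + \<bar>x2\<bar>"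
      unfolding n_def by (rule of_nat_ceiling)
    have H: "H > x1"
      using norm_ge_zero[of a] norm_ge_zero[of b] unfolding H_def by linarith
    consider "Re t \<ge> x1" | "Re t \<le> - x2" "\<bar>Im t\<bar> \<ge> H" | "Re t + real n \<ge> x1" "\<bar>Im t\<bar> \<ge> H"
    proof (cases "Re t \<ge> x1")
      case False
      then have "\<bar>Im t\<bar> \<ge> H"
        using t H by linarith
      moreover have "Re t \<le> - x2 \<or> Re t + real n \<ge> x1"
        using n by linarith
      ultimately show ?thesis
        using that by blast
    qed (use that in blast)
    then show ?thesis
    proof cases
      case 1
      show ?thesis
        by (rule order.trans[OF C1(2)[OF 1] up]) (use C1(1) C2(1) pos in \<open>auto simp: C_def N_def\<close>)
    next
      case 2
      have Ima: "\<bar>Im (t + a)\<bar> \<ge> 1"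
        using 2(2) abs_Im_le_cmod[of a] norm_ge_zero[of b] unfolding H_def plus_complex.sel by linarith
      have nz: "sin (of_real pi * (t + a)) \<noteq> 0"
        using exp_le_norm_sin_pi[OF Ima] by (metis exp_gt_zero mult_zero_right norm_zero not_le)
      have "Gamma (t + a) * rGamma (t + b) = sin (of_real pi * (t + b)) / sin (of_real pi * (t + a))
          * (Gamma (1 - b - t) * rGamma (1 - a - t))"
      proof -
        have arg: "1 - (t + a) = 1 - a - t" "1 - (t + b) = 1 - b - t"
          by simp_all
        have sa: "sin (of_real pi * (t + a)) = of_real pi * (rGamma (t + a) * rGamma (1 - a - t))"
          using rGamma_reflection_complex[of "t + a"] by (simp add: arg)
        have sb: "sin (of_real pi * (t + b)) = of_real pi * (rGamma (t + b) * rGamma (1 - b - t))"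
          using rGamma_reflection_complex[of "t + b"] by (simp add: arg)
        have "rGamma (t + a) \<noteq> 0" "rGamma (1 - a - t) \<noteq> 0"
          using nz sa by auto
        moreover have "Im (1 - b - t) \<noteq> 0"
          using 2(2) abs_Im_le_cmod[of b] norm_ge_zero[of a]
          unfolding H_def minus_complex.sel one_complex.sel by linarith
        then have "1 - b - t \<notin> \<int>\<^sub>\<le>\<^sub>0"
          by (rule Im_nonzero_not_nonpos_Int)
        then have "rGamma (1 - b - t) \<noteq> 0"
          by (simp add: rGamma_eq_zero_iff)
        ultimately show ?thesis
          unfolding sa sb by (simp add: Gamma_def field_simps)
      qed
      moreover have "norm (sin (of_real pi * (t + b)) / sin (of_real pi * (t + a))) \<le> E"
      proof -
        have "norm (sin (of_real pi * (t + b))) \<le> exp (pi * \<bar>Im (t + b)\<bar>)"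
          by (rule norm_sin_pi_le)
        also have "\<dots> \<le> exp (pi * \<bar>Im a - Im b\<bar>) * exp (pi * \<bar>Im (t + a)\<bar>)"
          unfolding exp_add [symmetric] exp_le_cancel_iff distrib_left [symmetric]
          by (intro mult_left_mono) auto
        also have "\<dots> \<le> exp (pi * \<bar>Im a - Im b\<bar>) * (4 * norm (sin (of_real pi * (t + a))))"
          by (intro mult_left_mono exp_le_norm_sin_pi Ima) auto
        finally show ?thesis
          using nz by (simp add: norm_divide E_def field_simps)
      qed
      moreover have "norm (Gamma (1 - b - t) * rGamma (1 - a - t)) \<le> C2 * (1 + norm t) ^ N2"
        using C2(2)[of "- t"] 2(1) by (simp add: algebra_simps)
      ultimately have "norm (Gamma (t + a) * rGamma (t + b)) \<le> E * (C2 * (1 + norm t) ^ N2)"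
        by (simp only: norm_mult_le)
      also have "\<dots> = (E * C2) * (1 + norm t) ^ N2"
        by simp
      also have "\<dots> \<le> C * (1 + norm t) ^ N"
        by (rule up) (use C1(1) C2(1) pos in \<open>auto simp: C_def N_def\<close>)
      finally show ?thesis .
    next
      case 3
      have Ima: "\<bar>Im (t + a)\<bar> \<ge> 1"
        using 3(2) abs_Im_le_cmod[of a] norm_ge_zero[of b] unfolding H_def plus_complex.sel by linarith
      have nz: "t + a \<notin> \<int>\<^sub>\<le>\<^sub>0"
        by (rule Im_nonzero_not_nonpos_Int) (use Ima in linarith)
      have poch: "norm (pochhammer (t + a) n) \<ge> 1"
      proof -
        have "1 \<le> norm (t + a + of_nat k)" for k
          using Ima abs_Im_le_cmod[of "t + a + of_nat k"] by simp
        then show ?thesis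
          by (simp add: pochhammer_prod flip: prod_norm) (rule prod_ge_1, simp)
      qed
      have "Gamma (t + of_nat n + a) = pochhammer (t + a) n * Gamma (t + a)"
        using nz by (simp add: pochhammer_Gamma Gamma_eq_zero_iff add_ac)
      moreover have "rGamma (t + b) = pochhammer (t + b) n * rGamma (t + of_nat n + b)"
        using pochhammer_rGamma[of "t + b" n] by (simp add: add_ac)
      ultimately have "norm (Gamma (t + a) * rGamma (t + b)) * norm (pochhammer (t + a) n)
          = norm (Gamma (t + of_nat n + a) * rGamma (t + of_nat n + b)) * norm (pochhammer (t + b) n)"
        by (simp add: norm_mult)
      then have "norm (Gamma (t + a) * rGamma (t + b))
          \<le> norm (Gamma (t + of_nat n + a) * rGamma (t + of_nat n + b)) * norm (pochhammer (t + b) n)"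
        using poch by (metis mult_left_mono mult.right_neutral norm_ge_zero)
      also have "\<dots> \<le> (C1 * (1 + norm (t + of_nat n)) ^ N1)
          * ((1 + norm b + real n) ^ n * (1 + norm t) ^ n)"
        by (intro mult_mono C1(2) norm_pochhammer_le) (use 3 C1(1) in auto)
      also have "\<dots> \<le> (C1 * ((1 + real n) * (1 + norm t)) ^ N1)
          * ((1 + norm b + real n) ^ n * (1 + norm t) ^ n)"
      proof (intro mult_right_mono mult_left_mono power_mono)
        have "norm (t + of_nat n) \<le> norm t + real n"
          by (metis norm_of_nat norm_triangle_ineq)
        then show "1 + norm (t + of_nat n) \<le> (1 + real n) * (1 + norm t)"
          using mult_nonneg_nonneg[OF of_nat_0_le_iff[of n, where 'a=real] norm_ge_zero[of t]]
          unfolding ring_distribs mult_1_left mult_1_right by linarith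
      qed (use C1(1) in auto)
      also have "\<dots> = C3 * (1 + norm t) ^ (N1 + n)"
        by (simp add: C3_def power_add power_mult_distrib)
      also have "\<dots> \<le> C * (1 + norm t) ^ N"
        by (rule up) (use C1(1) C2(1) pos in \<open>auto simp: C_def N_def\<close>)
      finally show ?thesis .
    qed
  qed
  moreover have "H > 0"
    by (simp add: H_def add_pos_nonneg)
  ultimately show ?thesis
    using that[of C H N] pos by blast
qed

section \<open>Contours separating two sets of points\<close>

text \<open>A primitive on a convex set makes all integrals over segments telescope, so that
  triangles and parallelograms need no separate form of Cauchy's theorem.\<close>

lemma convex_line_primitive:
  assumes "convex S" "f holomorphic_on S"
  obtains g where "\<And>a b. a \<in> S \<Longrightarrow> b \<in> S \<Longrightarrow> (f has_contour_integral (g b - g a)) (linepath a b)"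
proof -
  have "f field_differentiable at x" if "x \<in> interior S - {}" for x
    using that assms(2) holomorphic_on_imp_differentiable_at[OF holomorphic_on_subset[OF _ interior_subset]]
    by blast
  then obtain g where g: "\<And>x. x \<in> S \<Longrightarrow> (g has_field_derivative f x) (at x within S)"
    using holomorphic_convex_primitive[OF assms(1) finite.emptyI holomorphic_on_imp_continuous_on[OF assms(2)]]
    by metis
  have "(f has_contour_integral (g b - g a)) (linepath a b)" if "a \<in> S" "b \<in> S" for a b
  proof -
    have "(f has_contour_integral (g (pathfinish (linepath a b)) - g (pathstart (linepath a b)))) (linepath a b)"
      by (rule contour_integral_primitive[OF g])
        (use that assms(1) in \<open>auto simp: closed_segment_subset\<close>)
    then show ?thesis by simp
  qed
  with that show ?thesis by blast
qed

lemma closed_segment_half_planes: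
  "Im w < Im a \<Longrightarrow> Im w < Im b \<Longrightarrow> closed_segment a b \<subseteq> {t. Im w < Im t}"
  "Im a < Im w \<Longrightarrow> Im b < Im w \<Longrightarrow> closed_segment a b \<subseteq> {t. Im t < Im w}"
  "Re a < Re w \<Longrightarrow> Re b < Re w \<Longrightarrow> closed_segment a b \<subseteq> {t. Re t < Re w}"
  by (rule closed_segment_subset;
      simp add: convex_halfspace_Im_gt convex_halfspace_Im_lt convex_halfspace_Re_lt)+

section \<open>Winding numbers of left loops and Cauchy's theorem for separating contours\<close>

lemma valid_path_left_loop: "valid_path c \<Longrightarrow> valid_path (left_loop c M)"
  by (simp add: left_loop_def)

lemma pathfinish_left_loop [simp]: "pathfinish (left_loop c M) = pathstart c"
  and pathstart_left_loop [simp]: "pathstart (left_loop c M) = pathstart c"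
  by (simp_all add: left_loop_def)

lemma path_image_left_loop:
  "path_image (left_loop c M) = path_image c
     \<union> closed_segment (pathfinish c) (pathfinish c - of_real M)
     \<union> closed_segment (pathfinish c - of_real M) (pathstart c - of_real M)
     \<union> closed_segment (pathstart c - of_real M) (pathstart c)"
  by (auto simp: left_loop_def path_image_join)

lemma not_in_left_loop:
  assumes "w \<notin> path_image c" "Im (pathstart c) < Im w" "Im w < Im (pathfinish c)"
    and "Re (pathstart c) - M < Re w" "Re (pathfinish c) - M < Re w"
  shows "w \<notin> path_image (left_loop c M)"
  using assms closed_segment_half_planes(1)[of w "pathfinish c" "pathfinish c - of_real M"]
    closed_segment_half_planes(2)[of "pathstart c - of_real M" w "pathstart c"]
    closed_segment_half_planes(3)[of "pathfinish c - of_real M" w "pathstart c - of_real M"]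
  by (auto simp: path_image_left_loop)

text \<open>
  The integral of \<open>1 / (t - w)\<close> over \<open>c\<close> is the winding number of its left loop plus a
  contribution of the end points, since the other sides of the loop lie in half-planes in which
  \<open>1 / (t - w)\<close> has a primitive.
\<close>

lemma contour_integral_winding_left_loop:
  fixes w :: complex
  obtains gu gl \<kappa> where
    "\<And>a b. Im w < Im a \<Longrightarrow> Im w < Im b \<Longrightarrow> contour_integral (linepath a b) (\<lambda>t. 1 / (t - w)) = gu b - gu a"
    "\<And>a b. Im a < Im w \<Longrightarrow> Im b < Im w \<Longrightarrow> contour_integral (linepath a b) (\<lambda>t. 1 / (t - w)) = gl b - gl a"
    "\<And>c M. valid_path c \<Longrightarrow> w \<notin> path_image c \<Longrightarrow> Im (pathstart c) < Im w \<Longrightarrow> Im w < Im (pathfinish c)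
       \<Longrightarrow> Re (pathstart c) - M < Re w \<Longrightarrow> Re (pathfinish c) - M < Re w \<Longrightarrow>
       contour_integral c (\<lambda>t. 1 / (t - w)) =
         2 * of_real pi * \<i> * winding_number (left_loop c M) w + gu (pathfinish c) - gl (pathstart c) + \<kappa>"
proof -
  let ?f = "\<lambda>t. 1 / (t - w)"
  have hol: "?f holomorphic_on S" if "w \<notin> S" for S
    using that by (auto intro!: holomorphic_intros)
  obtain gu where gu: "\<And>a b. Im w < Im a \<Longrightarrow> Im w < Im b \<Longrightarrow> (?f has_contour_integral (gu b - gu a)) (linepath a b)"
    using convex_line_primitive[of "{t. Im w < Im t}" ?f, OF convex_halfspace_Im_gt hol]
    by auto
  obtain gl where gl: "\<And>a b. Im a < Im w \<Longrightarrow> Im b < Im w \<Longrightarrow> (?f has_contour_integral (gl b - gl a)) (linepath a b)"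
    using convex_line_primitive[of "{t. Im t < Im w}" ?f, OF convex_halfspace_Im_lt hol]
    by auto
  obtain gr where gr: "\<And>a b. Re a < Re w \<Longrightarrow> Re b < Re w \<Longrightarrow> (?f has_contour_integral (gr b - gr a)) (linepath a b)"
    using convex_line_primitive[of "{t. Re t < Re w}" ?f, OF convex_halfspace_Re_lt hol]
    by auto
  \<comment> \<open>P0 and Q0 lie where the left half-plane meets the upper and the lower one. On
    these overlaps the primitives differ by constants; \<kappa> collects them and depends on w
    only.\<close>
  define P0 where "P0 = w + Complex (- 1) 1"
  define Q0 where "Q0 = w + Complex (- 1) (- 1)"
  define \<kappa> where "\<kappa> = (gr P0 - gu P0) + (gl Q0 - gr Q0)"
  have "contour_integral c ?f =
      2 * of_real pi * \<i> * winding_number (left_loop c M) w + gu (pathfinish c) - gl (pathstart c) + \<kappa>"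
    if c: "valid_path c" "w \<notin> path_image c" "Im (pathstart c) < Im w" "Im w < Im (pathfinish c)"
      and M: "Re (pathstart c) - M < Re w" "Re (pathfinish c) - M < Re w" for c M
  proof -
    let ?P = "pathfinish c - of_real M" and ?Q = "pathstart c - of_real M"
    have "(?f has_contour_integral (gu ?P - gu P0)) (linepath P0 ?P)"
      "(?f has_contour_integral (gr ?P - gr P0)) (linepath P0 ?P)"
      by (rule gu gr; use c M in \<open>simp add: P0_def\<close>)+
    then have "gu ?P - gu P0 = gr ?P - gr P0"
      using has_contour_integral_unique by blast
    then have P: "gr ?P = gu ?P - gu P0 + gr P0"
      by (simp add: algebra_simps)
    have "(?f has_contour_integral (gl ?Q - gl Q0)) (linepath Q0 ?Q)"
      "(?f has_contour_integral (gr ?Q - gr Q0)) (linepath Q0 ?Q)"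
      by (rule gl gr; use c M in \<open>simp add: Q0_def\<close>)+
    then have "gl ?Q - gl Q0 = gr ?Q - gr Q0"
      using has_contour_integral_unique by blast
    then have Q: "gr ?Q = gl ?Q - gl Q0 + gr Q0"
      by (simp add: algebra_simps)
    have "(?f has_contour_integral contour_integral c ?f + ((gu ?P - gu (pathfinish c))
        + ((gr ?Q - gr ?P) + (gl (pathstart c) - gl ?Q)))) (left_loop c M)"
      unfolding left_loop_def
      by (intro has_contour_integral_join gu gl gr valid_path_join has_contour_integral_integral
          contour_integrable_inversediff)
        (use c M in \<open>simp_all\<close>)
    then have "contour_integral (left_loop c M) ?f = contour_integral c ?f + ((gu ?P - gu (pathfinish c))
        + ((gr ?Q - gr ?P) + (gl (pathstart c) - gl ?Q)))"
      by (rule contour_integral_unique)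
    moreover have "contour_integral (left_loop c M) ?f = 2 * of_real pi * \<i> * winding_number (left_loop c M) w"
      using winding_number_valid_path[OF valid_path_left_loop[OF c(1)] not_in_left_loop[OF c(2-4) M]]
      by simp
    ultimately show ?thesis
      unfolding P Q \<kappa>_def by (simp add: algebra_simps)
  qed
  then show ?thesis
    using that[of gu gl \<kappa>] gu gl contour_integral_unique by blast
qed

lemma separating_contourD:
  assumes "separating_contour A B c"
  shows "valid_path c" "Re (pathstart c) = Re (pathfinish c)"
    "w \<in> A \<union> B \<Longrightarrow> Im (pathstart c) < Im w" "w \<in> A \<union> B \<Longrightarrow> Im w < Im (pathfinish c)"
    "w \<in> A \<union> B \<Longrightarrow> w \<notin> path_image c"
  using assms by (auto simp: separating_contour_def)

text \<open>The definition speaks of large M only. By the preceding formula the winding number is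
  determined by the integral over c and the end points, hence it is the same for every M for which
  the loop reaches beyond w.\<close>

lemma winding_number_left_loop_eq:
  assumes "separating_contour A B c" "w \<in> A \<union> B" "Re (pathstart c) - M < Re w"
  shows "winding_number (left_loop c M) w = (if w \<in> A then 1 else 0)"
proof -
  note c = separating_contourD[OF assms(1)]
  have "\<forall>\<^sub>F N in at_top. winding_number (left_loop c N) w = (if w \<in> A then 1 else 0)"
    using assms(1,2) by (auto simp: separating_contour_def)
  moreover have "\<forall>\<^sub>F N in at_top. Re (pathstart c) - Re w < N"
    by (rule eventually_gt_at_top)
  ultimately have "\<forall>\<^sub>F N in at_top. winding_number (left_loop c N) w = (if w \<in> A then 1 else 0)
      \<and> Re (pathstart c) - Re w < N"
    by (rule eventually_conj)
  then obtain N where N: "winding_number (left_loop c N) w = (if w \<in> A then 1 else 0)"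
      "Re (pathstart c) - Re w < N"
    by (auto simp: eventually_at_top_linorder)
  obtain gu gl \<kappa> where *: "\<And>M. Re (pathstart c) - M < Re w \<Longrightarrow> contour_integral c (\<lambda>t. 1 / (t - w)) =
         2 * of_real pi * \<i> * winding_number (left_loop c M) w + gu (pathfinish c) - gl (pathstart c) + \<kappa>"
    using contour_integral_winding_left_loop[of w] c assms(2) by metis
  have "winding_number (left_loop c M) w = winding_number (left_loop c N) w"
    using *[of M] *[of N] assms(3) N(2) by simp
  with N show ?thesis by simp
qed

lemma separating_contour_subset:
  "separating_contour A B c \<Longrightarrow> A' \<subseteq> A \<Longrightarrow> B' \<subseteq> B \<Longrightarrow> separating_contour A' B' c"
  unfolding separating_contour_def by blast

text \<open>Homology form of Cauchy's theorem: the closed path made of c, the reverse of c' and the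
  two connecting segments winds around no point of A or B, because the left loops of both contours
  have the same winding numbers.\<close>

lemma separating_contour_integral_eq:
  assumes cl: "closed (A \<union> B)" and f: "f holomorphic_on - (A \<union> B)"
    and c: "separating_contour A B c" and c': "separating_contour A B c'"
  shows "contour_integral c f + contour_integral (linepath (pathfinish c) (pathfinish c')) f
       = contour_integral (linepath (pathstart c) (pathstart c')) f + contour_integral c' f"
proof -
  note cD = separating_contourD[OF c] and cD' = separating_contourD[OF c']
  let ?S = "- (A \<union> B)"
  let ?l1 = "linepath (pathfinish c) (pathfinish c')" and ?l2 = "linepath (pathstart c') (pathstart c)"
  let ?\<gamma> = "c +++ ?l1 +++ reversepath c' +++ ?l2"
  have opS: "open ?S"
    using cl by (rule open_Compl)
  have seg: "path_image ?l1 \<subseteq> ?S" "path_image ?l2 \<subseteq> ?S"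
  proof -
    have "w \<notin> closed_segment (pathfinish c) (pathfinish c')"
      "w \<notin> closed_segment (pathstart c') (pathstart c)" if "w \<in> A \<union> B" for w
      using closed_segment_half_planes(1)[OF cD(4)[OF that] cD'(4)[OF that]]
        closed_segment_half_planes(2)[OF cD'(3)[OF that] cD(3)[OF that]] by auto
    then show "path_image ?l1 \<subseteq> ?S" "path_image ?l2 \<subseteq> ?S"
      by auto
  qed
  have im: "path_image c \<subseteq> ?S" "path_image c' \<subseteq> ?S"
    using cD(5) cD'(5) by auto
  have v: "valid_path ?\<gamma>" "pathfinish ?\<gamma> = pathstart ?\<gamma>" "path_image ?\<gamma> \<subseteq> ?S"
    using cD(1) cD'(1) seg im by (auto simp: path_image_join)
  have wn: "winding_number ?\<gamma> w = 0" if "w \<notin> ?S" for w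
  proof -
    have w: "w \<in> A \<union> B"
      using that by simp
    obtain gu gl \<kappa> where g:
      "\<And>a b. Im w < Im a \<Longrightarrow> Im w < Im b \<Longrightarrow> contour_integral (linepath a b) (\<lambda>t. 1 / (t - w)) = gu b - gu a"
      "\<And>a b. Im a < Im w \<Longrightarrow> Im b < Im w \<Longrightarrow> contour_integral (linepath a b) (\<lambda>t. 1 / (t - w)) = gl b - gl a"
      "\<And>c M. valid_path c \<Longrightarrow> w \<notin> path_image c \<Longrightarrow> Im (pathstart c) < Im w \<Longrightarrow> Im w < Im (pathfinish c)
         \<Longrightarrow> Re (pathstart c) - M < Re w \<Longrightarrow> Re (pathfinish c) - M < Re w \<Longrightarrow>
         contour_integral c (\<lambda>t. 1 / (t - w)) =
           2 * of_real pi * \<i> * winding_number (left_loop c M) w + gu (pathfinish c) - gl (pathstart c) + \<kappa>"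
      using contour_integral_winding_left_loop[of w] by blast
    define M where "M = 1 + \<bar>Re (pathstart c) - Re w\<bar> + \<bar>Re (pathstart c') - Re w\<bar>"
    have M: "Re (pathstart c) - M < Re w" "Re (pathstart c') - M < Re w"
      unfolding M_def by linarith+
    have "contour_integral ?\<gamma> (\<lambda>t. 1 / (t - w)) = contour_integral c (\<lambda>t. 1 / (t - w))
        + (contour_integral ?l1 (\<lambda>t. 1 / (t - w))
        + (- contour_integral c' (\<lambda>t. 1 / (t - w)) + contour_integral ?l2 (\<lambda>t. 1 / (t - w))))"
      using w im seg cD(1) cD'(1)
      by (subst contour_integral_join contour_integral_reversepath;
          (auto intro!: contour_integrable_inversediff contour_integrable_joinI contour_integrable_reversepath
            valid_path_join; fail)?)+
    \<comment> \<open>The segments contribute differences of the same functions gu and gl that occur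
      as end-point terms of both contours, so everything telescopes.\<close>
    also have "\<dots> = 0"
      using g(1)[OF cD(4)[OF w] cD'(4)[OF w]] g(2)[OF cD'(3)[OF w] cD(3)[OF w]]
        g(3)[OF cD(1) cD(5,3,4)[OF w] M(1)] g(3)[OF cD'(1) cD'(5,3,4)[OF w] M(2)] M
        winding_number_left_loop_eq[OF c w M(1)] winding_number_left_loop_eq[OF c' w M(2)]
        cD(2) cD'(2)
      by simp
    finally show ?thesis
      using winding_number_valid_path[OF v(1), of w] v(3) that by auto
  qed
  have "(f has_contour_integral 0) ?\<gamma>"
    by (rule Cauchy_theorem_global[OF opS f v wn])
  then have "contour_integral ?\<gamma> f = 0"
    by (rule contour_integral_unique)
  moreover have int: "f contour_integrable_on c" "f contour_integrable_on c'"
    "f contour_integrable_on ?l1" "f contour_integrable_on ?l2"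
    using contour_integrable_holomorphic_simple[OF f opS] cD(1) cD'(1) im seg by auto
  moreover have "contour_integral ?\<gamma> f = contour_integral c f
      + (contour_integral ?l1 f + (- contour_integral c' f + contour_integral ?l2 f))"
    using int cD(1) cD'(1)
    by (simp add: contour_integral_reversepath contour_integrable_reversepath)
  moreover have "contour_integral ?l2 f = - contour_integral (linepath (pathstart c) (pathstart c')) f"
    by (rule contour_integral_reverse_linepath)
      (use seg(2) f in \<open>auto intro: holomorphic_on_imp_continuous_on holomorphic_on_subset\<close>)
  ultimately show ?thesis
    by (simp add: algebra_simps)
qed


section \<open>Existence of separating contours\<close>

lemma separating_contour_vertical_line:
  assumes "H > 0"
    and A: "\<And>w. w \<in> A \<Longrightarrow> Re w < \<gamma>" "\<And>w. w \<in> A \<Longrightarrow> \<bar>Im w\<bar> < H"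
    and B: "\<And>w. w \<in> B \<Longrightarrow> \<gamma> < Re w" "\<And>w. w \<in> B \<Longrightarrow> \<bar>Im w\<bar> < H"
  shows "separating_contour A B (linepath (Complex \<gamma> (- H)) (Complex \<gamma> H))"
proof -
  let ?s = "Complex \<gamma> (- H)" and ?f = "Complex \<gamma> H"
  let ?c = "linepath ?s ?f"
  have im: "closed_segment ?s ?f \<subseteq> {t. Re t = \<gamma>}"
    using closed_segment_same_Re[of ?s ?f] by auto
  have 1: "winding_number (left_loop ?c M) w = 1" if w: "w \<in> A" and M: "\<gamma> - Re w < M" for w M
  proof -
    have box: "w \<in> box (?s - of_real M) ?f"
      using A[OF w] M by (auto simp: in_box_complex_iff)
    have notin: "w \<notin> path_image (left_loop ?c M)"
      by (rule not_in_left_loop) (use A[OF w] M im in auto)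
    \<comment> \<open>The left loop of a vertical segment is the boundary of a rectangle, traversed
      from another corner; both winding numbers are sums over the same four sides.\<close>
    then have "winding_number (left_loop ?c M) w
        = winding_number ?c w + (winding_number (linepath ?f (?f - of_real M)) w
          + (winding_number (linepath (?f - of_real M) (?s - of_real M)) w
          + winding_number (linepath (?s - of_real M) ?s) w))"
      by (simp add: left_loop_def winding_number_join path_image_join)
    also have "\<dots> = winding_number (rectpath (?s - of_real M) ?f) w"
    proof -
      have "Complex (Re ?f) (Im (?s - of_real M)) = ?s" "Complex (Re (?s - of_real M)) (Im ?f) = ?f - of_real M"
        by (simp_all add: complex_eq_iff)
      then show ?thesis
        using notin by (simp add: rectpath_def Let_def winding_number_join path_image_join path_image_left_loop)
    qed
    also have "\<dots> = 1"
      by (rule winding_number_rectpath[OF box])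
    finally show ?thesis .
  qed
  have 2: "winding_number (left_loop ?c M) w = 0" if w: "w \<in> B" and M: "0 < M" for w M
  proof (rule winding_number_zero_outside[where s = "{t. Re t \<le> \<gamma>}"])
    show "path_image (left_loop ?c M) \<subseteq> {t. Re t \<le> \<gamma>}"
      unfolding path_image_left_loop using M
      by (intro Un_least; (simp only: path_image_linepath pathstart_linepath pathfinish_linepath)?;
          intro closed_segment_subset convex_halfspace_Re_le) auto
  qed (use B(1)[OF w] in \<open>auto simp: convex_halfspace_Re_le valid_path_imp_path valid_path_left_loop\<close>)
  show ?thesis
    unfolding separating_contour_def
  proof (intro conjI ballI)
    fix w assume "w \<in> A"
    show "\<forall>\<^sub>F M in at_top. winding_number (left_loop ?c M) w = 1"
      by (rule eventually_mono[OF eventually_gt_at_top[of "\<gamma> - Re w"]]) (rule 1[OF \<open>w \<in> A\<close>])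
  next
    fix w assume "w \<in> B"
    show "\<forall>\<^sub>F M in at_top. winding_number (left_loop ?c M) w = 0"
      by (rule eventually_mono[OF eventually_gt_at_top[of 0]]) (rule 2[OF \<open>w \<in> B\<close>])
  next
    fix w assume w: "w \<in> A \<union> B"
    then have "\<bar>Im w\<bar> < H" "Re w \<noteq> \<gamma>"
      using A B by force+
    then show "Im (pathstart ?c) < Im w" "Im w < Im (pathfinish ?c)" "w \<notin> path_image ?c"
      using im by auto
  qed auto
qed

text \<open>A point is moved to the left of the contour by appending a loop around it.\<close>

lemma separating_contour_insert:
  assumes c: "separating_contour A (insert w B) c"
    and w: "w \<notin> A \<union> B" and cl: "closed (A \<union> B)" and cnt: "countable (A \<union> B)"
  obtains c' where "separating_contour (insert w A) B c'"
    "pathstart c' = pathstart c" "pathfinish c' = pathfinish c"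
proof -
  note cD = separating_contourD[OF c]
  obtain e where e: "e > 0" "cball w e \<inter> (A \<union> B) = {}"
  proof -
    have "open (- (A \<union> B))" "w \<in> - (A \<union> B)"
      using w open_Compl[OF cl] by simp_all
    then obtain e where "e > 0" "cball w e \<subseteq> - (A \<union> B)"
      using open_contains_cball by blast
    then show ?thesis
      using that by blast
  qed
  \<comment> \<open>The complement of a countable closed set is connected, so the end of c can be
    joined to the circle around w without meeting a pole.\<close>
  define S where "S = - (insert w (A \<union> B))"
  have "open S" "connected S"
    using cl cnt unfolding S_def
    by (intro open_Compl closed_insert path_connected_imp_connected
        path_connected_complement_countable; simp)+
  moreover have "w \<noteq> pathfinish c" "pathfinish c \<notin> A \<union> B"
    using cD(4)[of w] cD(4)[of "pathfinish c"] by auto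
  then have "pathfinish c \<in> S" by (simp add: S_def)
  moreover have "w + of_real e \<in> S"
  proof -
    have "w + of_real e \<in> cball w e"
      using e(1) by (simp add: dist_norm)
    then show ?thesis
      using e by (auto simp: S_def)
  qed
  ultimately obtain q where q: "polynomial_function q" "path_image q \<subseteq> S"
      "pathstart q = pathfinish c" "pathfinish q = w + of_real e"
    using connected_open_polynomial_connected by blast
  have vq: "valid_path q"
    using q(1) by (rule valid_path_polynomial_function)
  \<comment> \<open>The two traversals of q cancel in every winding number; only the circle
    counts.\<close>
  define l where "l = q +++ circlepath w e +++ reversepath q"
  define c' where "c' = c +++ l"
  have l: "valid_path l" "pathstart l = pathfinish c" "pathfinish l = pathfinish c"
    "path_image l = path_image q \<union> sphere w e"
    using vq q(3,4) e(1) by (auto simp: l_def path_image_join)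
  have wl: "winding_number l u = (if u = w then 1 else 0)" "u \<notin> path_image l"
    if u: "u \<in> insert w (A \<union> B)" for u
  proof -
    have notin: "u \<notin> path_image q" "u \<notin> sphere w e"
      using u q(2) e by (auto simp: S_def)
    then show "u \<notin> path_image l"
      by (simp add: l(4))
    have "winding_number l u = winding_number (circlepath w e) u"
      using notin vq q(3,4) e(1)
      by (simp add: l_def winding_number_join winding_number_reversepath path_image_join valid_path_imp_path)
    also have "\<dots> = (if u = w then 1 else 0)"
    proof (cases "u = w")
      case False
      then have "u \<notin> cball w e"
        using u e(2) by auto
      then have "winding_number (circlepath w e) u = 0"
        by (intro winding_number_zero_outside[where s = "cball w e"]) (use e(1) in auto)
      then show ?thesis
        using False by simp
    qed (use e(1) winding_number_circlepath_centre in simp)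
    finally show "winding_number l u = (if u = w then 1 else 0)" .
  qed
  have loop: "winding_number (left_loop c' M) u = (if u \<in> insert w A then 1 else 0)"
    if u: "u \<in> insert w (A \<union> B)" and M: "Re (pathstart c) - Re u < M" for u M
  proof -
    have "u \<notin> path_image (left_loop c M)"
      by (rule not_in_left_loop) (use cD u M in auto)
    then have "winding_number (left_loop c' M) u = winding_number (left_loop c M) u + winding_number l u"
      using wl(2)[OF u] cD(1) l(1-3) unfolding path_image_left_loop
      by (simp add: left_loop_def c'_def winding_number_join path_image_join valid_path_imp_path)
    also have "winding_number (left_loop c M) u = (if u \<in> A then 1 else 0)"
      by (rule winding_number_left_loop_eq[OF c]) (use u M in auto)
    finally show ?thesis
      using wl(1)[OF u] w by auto
  qed
  have ev: "\<forall>\<^sub>F M in at_top. winding_number (left_loop c' M) u = (if u \<in> insert w A then 1 else 0)"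
    if "u \<in> insert w (A \<union> B)" for u
    by (rule eventually_mono[OF eventually_gt_at_top[of "Re (pathstart c) - Re u"]]) (rule loop[OF that])
  have AB: "A \<inter> B = {}"
  proof -
    have False if "u \<in> A" "u \<in> B" for u
    proof -
      have "\<forall>\<^sub>F M in at_top. winding_number (left_loop c M) u = 1"
        "\<forall>\<^sub>F M in at_top. winding_number (left_loop c M) u = 0"
        using c that by (auto simp: separating_contour_def)
      then have "\<forall>\<^sub>F M :: real in at_top. False"
        by eventually_elim simp
      then show False by simp
    qed
    then show ?thesis by auto
  qed
  have "separating_contour (insert w A) B c'"
    unfolding separating_contour_def
  proof (intro conjI ballI)
    show "valid_path c'"
      using cD(1) l by (simp add: c'_def)
  next
    fix u assume u: "u \<in> insert w A"
    show "\<forall>\<^sub>F M in at_top. winding_number (left_loop c' M) u = 1"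
      using ev[of u] u by auto
  next
    fix u assume u: "u \<in> B"
    then have "u \<notin> insert w A"
      using AB w by auto
    then show "\<forall>\<^sub>F M in at_top. winding_number (left_loop c' M) u = 0"
      using ev[of u] u by auto
  next
    fix u assume u: "u \<in> insert w A \<union> B"
    then show "Im (pathstart c') < Im u" "Im u < Im (pathfinish c')" "u \<notin> path_image c'"
      using cD(3-5)[of u] wl(2)[of u] l(2,3) by (auto simp: c'_def path_image_join)
  qed (use cD(2) l in \<open>simp add: c'_def\<close>)
  then show ?thesis
    using that[of c'] l(3) by (simp add: c'_def)
qed

text \<open>The line Re t = \<gamma> already has B on its right, and only finitely many points of A
  are on the wrong side. The induction moves them over one at a time, F being the set of points
  already moved. At each stage the point to be moved is left out of both sets, hence closedness is
  asked of all subsets.\<close>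

lemma exists_separating_contour:
  assumes "A \<inter> B = {}" and cl: "\<And>T. T \<subseteq> A \<union> B \<Longrightarrow> closed T" and cnt: "countable (A \<union> B)"
    and H: "H > 0" "\<And>w. w \<in> A \<union> B \<Longrightarrow> \<bar>Im w\<bar> < H"
    and \<gamma>: "\<And>w. w \<in> B \<Longrightarrow> \<gamma> < Re w" "\<And>w. w \<in> A \<Longrightarrow> Re w \<noteq> \<gamma>" "finite {w \<in> A. \<gamma> < Re w}"
  obtains c where "separating_contour A B c"
    "pathstart c = Complex \<gamma> (- H)" "pathfinish c = Complex \<gamma> H"
proof -
  have "\<exists>c. separating_contour ({w \<in> A. Re w < \<gamma>} \<union> F) (B \<union> ({w \<in> A. \<gamma> < Re w} - F)) c
      \<and> pathstart c = Complex \<gamma> (- H) \<and> pathfinish c = Complex \<gamma> H"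
    if "finite F" "F \<subseteq> {w \<in> A. \<gamma> < Re w}" for F
    using that
  proof (induction F rule: finite_induct)
    case empty
    have "separating_contour {w \<in> A. Re w < \<gamma>} (B \<union> {w \<in> A. \<gamma> < Re w})
        (linepath (Complex \<gamma> (- H)) (Complex \<gamma> H))"
      by (rule separating_contour_vertical_line) (use H \<gamma> in auto)
    then show ?case
      by auto
  next
    case (insert w F)
    let ?A = "{w \<in> A. Re w < \<gamma>} \<union> F" and ?B = "B \<union> ({w \<in> A. \<gamma> < Re w} - insert w F)"
    have "insert w ?B = B \<union> ({w \<in> A. \<gamma> < Re w} - F)"
      using insert by auto
    with insert obtain c where c: "separating_contour ?A (insert w ?B) c"
      "pathstart c = Complex \<gamma> (- H)" "pathfinish c = Complex \<gamma> H"
      by auto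
    have sub: "?A \<union> ?B \<subseteq> A \<union> B"
      using insert by auto
    have "w \<notin> ?A \<union> ?B" "closed (?A \<union> ?B)" "countable (?A \<union> ?B)"
      using insert assms(1) cl[OF sub] countable_subset[OF sub cnt] by auto
    then obtain c' where "separating_contour (insert w ?A) ?B c'"
      "pathstart c' = pathstart c" "pathfinish c' = pathfinish c"
      using separating_contour_insert[OF c(1)] by blast
    then show ?case
      using c by auto
  qed
  from this[OF \<gamma>(3) order_refl] obtain c where
    c: "separating_contour ({w \<in> A. Re w < \<gamma>} \<union> {w \<in> A. \<gamma> < Re w}) B c"
    "pathstart c = Complex \<gamma> (- H)" "pathfinish c = Complex \<gamma> H"
    by auto
  have "{w \<in> A. Re w < \<gamma>} \<union> {w \<in> A. \<gamma> < Re w} = A"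
    using \<gamma>(2) by force
  then show ?thesis
    using that c by simp
qed

section \<open>Integrals along rays\<close>

definition ray :: "complex \<Rightarrow> complex \<Rightarrow> complex set" where
  "ray z u = (\<lambda>x. z + u * of_real x) ` {0..}"

text \<open>An improper integral. \<open>Lim\<close> carries information only where convergence is
  known; \<open>tendsto_ray_integral\<close> provides it under exponential decay.\<close>

definition ray_integral :: "complex \<Rightarrow> complex \<Rightarrow> (complex \<Rightarrow> complex) \<Rightarrow> complex" where
  "ray_integral z u f = Lim at_top (\<lambda>Y. contour_integral (linepath z (z + u * of_real Y)) f)"

lemma in_ray: "0 \<le> x \<Longrightarrow> z + u * of_real x \<in> ray z u"
  by (auto simp: ray_def)

lemma closed_segment_ray: "0 \<le> Y \<Longrightarrow> closed_segment z (z + u * of_real Y) \<subseteq> ray z u"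
proof
  fix w assume Y: "0 \<le> Y" and "w \<in> closed_segment z (z + u * of_real Y)"
  then obtain s where s: "0 \<le> s" "w = (1 - s) *\<^sub>R z + s *\<^sub>R (z + u * of_real Y)"
    by (auto simp: closed_segment_def)
  then have "w = z + u * of_real (s * Y)"
    by (simp add: scaleR_conv_of_real algebra_simps)
  then show "w \<in> ray z u"
    using in_ray[of "s * Y" z u] s Y by simp
qed

text \<open>Rescaling the parameter from [0, 1] to [0, Y] makes integrals over initial segments of
  different lengths comparable by additivity of the real integral.\<close>

lemma has_contour_integral_ray:
  assumes cont: "continuous_on (ray z u) f" and "0 < Y"
  shows "(f has_contour_integral integral {0..Y} (\<lambda>x. f (z + u * of_real x) * u))
           (linepath z (z + u * of_real Y))"
proof -
  define F where "F x = f (z + u * of_real x) * u" for x :: real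
  have "continuous_on {0..Y} F"
    unfolding F_def
    by (intro continuous_intros continuous_on_compose2[OF cont]) (auto simp: in_ray)
  then have "(F has_integral integral {0..Y} F) (cbox 0 Y)"
    by (simp add: integrable_continuous_interval integrable_integral)
  then have "((\<lambda>x. F (Y *\<^sub>R x + 0)) has_integral (1 / (\<bar>Y\<bar> ^ DIM(real))) *\<^sub>R integral {0..Y} F)
      ((\<lambda>x. (1 / Y) *\<^sub>R x + - ((1 / Y) *\<^sub>R 0)) ` cbox 0 Y)"
    by (rule has_integral_affinity) (use assms in auto)
  moreover have "(\<lambda>x. (1 / Y) *\<^sub>R x + - ((1 / Y) *\<^sub>R 0)) ` cbox 0 Y = {0..1}"
    using image_mult_atLeastAtMost[of "1 / Y" 0 Y] assms by simp
  ultimately have "((\<lambda>x. F (Y * x)) has_integral (1 / Y) *\<^sub>R integral {0..Y} F) {0..1}"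
    using assms by simp
  then have "((\<lambda>x. F (Y * x) * of_real Y) has_integral (1 / Y) *\<^sub>R integral {0..Y} F * of_real Y) {0..1}"
    by (rule has_integral_mult_left)
  moreover have "(1 / Y) *\<^sub>R integral {0..Y} F * of_real Y = integral {0..Y} F"
    using assms by (simp add: scaleR_conv_of_real)
  moreover have "linepath z (z + u * of_real Y) x = z + u * of_real (Y * x)" for x
    by (simp add: linepath_def scaleR_conv_of_real algebra_simps)
  ultimately show ?thesis
    unfolding has_contour_integral_linepath F_def [symmetric]
    by (simp add: F_def algebra_simps)
qed

text \<open>The tails are dominated by those of an exponential integral, so the truncated integrals
  form a Cauchy family. The explicit remainder is kept because it later gives locally uniform
  convergence in a parameter.\<close>

lemma ray_integral:
  assumes cont: "continuous_on (ray z u) f" and u: "norm u = 1" and \<delta>: "\<delta> > 0"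
    and bound: "\<And>x. x \<ge> 0 \<Longrightarrow> norm (f (z + u * of_real x)) \<le> C * exp (- \<delta> * x)"
  shows tendsto_ray_integral:
      "((\<lambda>Y. contour_integral (linepath z (z + u * of_real Y)) f) \<longlongrightarrow> ray_integral z u f) at_top"
    and ray_integral_remainder: "\<And>Y. Y \<ge> 0 \<Longrightarrow>
      norm (contour_integral (linepath z (z + u * of_real Y)) f - ray_integral z u f) \<le> C / \<delta> * exp (- \<delta> * Y)"
    and norm_ray_integral_le: "norm (ray_integral z u f) \<le> C / \<delta>"
proof -
  define F where "F x = f (z + u * of_real x) * u" for x :: real
  define I where "I Y = contour_integral (linepath z (z + u * of_real Y)) f" for Y
  have C: "C \<ge> 0"
    using order.trans[OF norm_ge_zero bound[of 0]] by simp
  have F: "continuous_on {0..} F"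
    unfolding F_def
    by (intro continuous_intros continuous_on_compose2[OF cont]) (auto simp: in_ray)
  have I: "I Y = integral {0..Y} F" if "Y \<ge> 0" for Y
  proof (cases "Y = 0")
    case False
    then show ?thesis
      using that contour_integral_unique[OF has_contour_integral_ray[OF cont]]
      by (simp add: I_def F_def[abs_def])
  qed (simp add: I_def)
  have int: "F integrable_on {X..Y}" if "X \<ge> 0" for X Y
    by (rule integrable_continuous_interval, rule continuous_on_subset[OF F]) (use that in auto)
  have diff: "norm (I X - I Y) \<le> C / \<delta> * exp (- \<delta> * X)" if "0 \<le> X" "X \<le> Y" for X Y
  proof -
    have "I Y = I X + integral {X..Y} F"
      unfolding I[OF that(1)] I[OF order.trans[OF that]]
      by (rule Henstock_Kurzweil_Integration.integral_combine [symmetric]) (use that int in auto)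
    then have "norm (I X - I Y) = norm (integral {X..Y} F)"
      by simp
    also have "\<dots> \<le> integral {X..Y} (\<lambda>x. C * exp (- \<delta> * x))"
    proof (rule integral_norm_bound_integral)
      show "norm (F x) \<le> C * exp (- \<delta> * x)" if "x \<in> {X..Y}" for x
        using bound[of x] that \<open>0 \<le> X\<close> u by (simp add: F_def norm_mult)
    qed (use int that in \<open>auto intro!: integrable_continuous_interval continuous_intros\<close>)
    also have "\<dots> = C / \<delta> * exp (- \<delta> * X) - C / \<delta> * exp (- \<delta> * Y)"
    proof (rule integral_unique)
      have "((\<lambda>x. C * exp (- \<delta> * x)) has_integral (- C / \<delta> * exp (- \<delta> * Y)) - (- C / \<delta> * exp (- \<delta> * X))) {X..Y}"
        by (rule fundamental_theorem_of_calculus)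
          (use that \<delta> in \<open>auto intro!: derivative_eq_intros simp flip: has_real_derivative_iff_has_vector_derivative\<close>)
      then show "((\<lambda>x. C * exp (- \<delta> * x)) has_integral C / \<delta> * exp (- \<delta> * X) - C / \<delta> * exp (- \<delta> * Y)) {X..Y}"
        by simp
    qed
    also have "\<dots> \<le> C / \<delta> * exp (- \<delta> * X)"
      using C \<delta> by simp
    finally show ?thesis .
  qed
  have zero: "((\<lambda>Y. C / \<delta> * exp (- \<delta> * Y)) \<longlongrightarrow> 0) at_top"
  proof -
    have "((\<lambda>Y. exp (- \<delta> * Y)) \<longlongrightarrow> 0) at_top"
      using \<delta> by (intro filterlim_compose[OF exp_at_bot] filterlim_tendsto_neg_mult_at_bot[OF tendsto_const])
        (auto simp: filterlim_ident)
    then show ?thesis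
      by (rule tendsto_mult_right_zero)
  qed
  \<comment> \<open>The limit is found along the integers; the remainder estimate then extends
    convergence to real Y.\<close>
  have "Cauchy (\<lambda>n. I (real n))"
  proof (rule CauchyI')
    fix e :: real assume "e > 0"
    have "eventually (\<lambda>n. C / \<delta> * exp (- \<delta> * real n) < e) sequentially"
      using zero order_tendstoD(2)[OF _ \<open>e > 0\<close>] filterlim_compose[OF _ filterlim_real_sequentially]
      by blast
    then obtain N where N: "\<And>n. n \<ge> N \<Longrightarrow> C / \<delta> * exp (- \<delta> * real n) < e"
      by (auto simp: eventually_sequentially)
    show "\<exists>M. \<forall>m\<ge>M. \<forall>n>m. dist (I (real m)) (I (real n)) < e"
      unfolding dist_norm
    proof (intro exI[of _ N] allI impI)
      fix m n assume "N \<le> m" "m < n"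
      then show "norm (I (real m) - I (real n)) < e"
        using diff[of "real m" "real n"] N[of m] by linarith
    qed
  qed
  then obtain L where L: "(\<lambda>n. I (real n)) \<longlonglongrightarrow> L"
    by (auto simp: Cauchy_convergent_iff convergent_def)
  have rem: "norm (I X - L) \<le> C / \<delta> * exp (- \<delta> * X)" if "X \<ge> 0" for X
  proof (rule Lim_bounded)
    show "(\<lambda>n. norm (I X - I (real n))) \<longlonglongrightarrow> norm (I X - L)"
      by (intro tendsto_intros L)
    show "\<forall>n\<ge>nat \<lceil>X\<rceil>. norm (I X - I (real n)) \<le> C / \<delta> * exp (- \<delta> * X)"
      using diff that by (auto simp: nat_le_iff ceiling_le_iff)
  qed
  have lim: "(I \<longlongrightarrow> L) at_top"
    by (rule LIM_zero_cancel, rule Lim_null_comparison[OF _ zero])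
      (use rem in \<open>auto intro: eventually_mono[OF eventually_ge_at_top[of 0]]\<close>)
  then have "ray_integral z u f = L"
    unfolding ray_integral_def I_def by (intro tendsto_Lim) auto
  with lim show "((\<lambda>Y. contour_integral (linepath z (z + u * of_real Y)) f) \<longlongrightarrow> ray_integral z u f) at_top"
    by (simp add: I_def[abs_def])
  have rem': "norm (contour_integral (linepath z (z + u * of_real Y)) f - ray_integral z u f)
      \<le> C / \<delta> * exp (- \<delta> * Y)" if "Y \<ge> 0" for Y
    using rem[OF that] \<open>ray_integral z u f = L\<close> by (simp add: I_def)
  show "\<And>Y. Y \<ge> 0 \<Longrightarrow>
      norm (contour_integral (linepath z (z + u * of_real Y)) f - ray_integral z u f) \<le> C / \<delta> * exp (- \<delta> * Y)"
    by (rule rem')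
  show "norm (ray_integral z u f) \<le> C / \<delta>"
    using rem'[of 0] by simp
qed

text \<open>
  Rotating a ray: on the segment that joins \<open>z + u x\<close> and \<open>z + v x\<close>, the two coordinates in the
  sector spanned by \<open>u\<close> and \<open>v\<close> add up to \<open>x\<close>.
\<close>

lemma ray_integral_rotate:
  assumes S: "convex S" "f holomorphic_on S" and uv: "norm u = 1" "norm v = 1" and \<delta>: "\<delta> > 0"
    and sector: "\<And>x y. x \<ge> 0 \<Longrightarrow> y \<ge> 0 \<Longrightarrow> z + u * of_real x + v * of_real y \<in> S"
    and bound: "\<And>x y. x \<ge> 0 \<Longrightarrow> y \<ge> 0 \<Longrightarrow>
      norm (f (z + u * of_real x + v * of_real y)) \<le> C * exp (- \<delta> * (x + y))"
  shows "ray_integral z u f = ray_integral z v f"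
proof -
  obtain g where g: "\<And>a b. a \<in> S \<Longrightarrow> b \<in> S \<Longrightarrow> (f has_contour_integral (g b - g a)) (linepath a b)"
    using convex_line_primitive[OF S] by blast
  have C: "C \<ge> 0"
    using order.trans[OF norm_ge_zero bound[of 0 0]] by simp
  have inS: "z \<in> S" "x \<ge> 0 \<Longrightarrow> z + u * of_real x \<in> S" "x \<ge> 0 \<Longrightarrow> z + v * of_real x \<in> S" for x
    using sector[of 0 0] sector[of x 0] sector[of 0 x] by auto
  have "ray z u \<subseteq> S" "ray z v \<subseteq> S"
    using inS by (auto simp: ray_def)
  then have cont: "continuous_on (ray z u) f" "continuous_on (ray z v) f"
    using S(2) holomorphic_on_imp_continuous_on continuous_on_subset by blast+
  have "((\<lambda>Y. contour_integral (linepath z (z + u * of_real Y)) f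
        - contour_integral (linepath z (z + v * of_real Y)) f)
      \<longlongrightarrow> ray_integral z u f - ray_integral z v f) at_top"
    by (intro tendsto_diff tendsto_ray_integral[OF cont(1) uv(1) \<delta>] tendsto_ray_integral[OF cont(2) uv(2) \<delta>])
      (use bound[of _ 0] bound[of 0] in auto)
  moreover have "((\<lambda>Y. contour_integral (linepath z (z + u * of_real Y)) f
        - contour_integral (linepath z (z + v * of_real Y)) f) \<longlongrightarrow> 0) at_top"
  proof (rule Lim_null_comparison)
    show "\<forall>\<^sub>F Y in at_top. norm (contour_integral (linepath z (z + u * of_real Y)) f
        - contour_integral (linepath z (z + v * of_real Y)) f) \<le> 2 * C * (Y * exp (- \<delta> * Y))"
      using eventually_ge_at_top[of 0]
    proof eventually_elim
      case (elim Y)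
      \<comment> \<open>The truncated rays differ by the third side of a triangle. Its length grows
        linearly in Y, while f decays exponentially on it.\<close>
      let ?a = "z + v * of_real Y" and ?b = "z + u * of_real Y"
      have seg: "(f has_contour_integral (g ?b - g ?a)) (linepath ?a ?b)"
        by (rule g) (use inS elim in auto)
      have "norm (g ?b - g ?a) \<le> C * exp (- \<delta> * Y) * norm (?b - ?a)"
      proof (rule has_contour_integral_bound_linepath[OF seg])
        fix w assume "w \<in> closed_segment ?a ?b"
        then obtain s where s: "0 \<le> s" "s \<le> 1" "w = (1 - s) *\<^sub>R ?a + s *\<^sub>R ?b"
          by (auto simp: closed_segment_def)
        have "w = z + u * of_real (s * Y) + v * of_real ((1 - s) * Y)"
          unfolding s(3) by (simp add: scaleR_conv_of_real algebra_simps)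
        moreover have "s * Y + (1 - s) * Y = Y"
          by (simp add: algebra_simps)
        ultimately show "norm (f w) \<le> C * exp (- \<delta> * Y)"
          using bound[of "s * Y" "(1 - s) * Y"] s(1,2) elim by simp
      qed (use C in auto)
      also have "norm (?b - ?a) \<le> 2 * Y"
      proof -
        have "?b - ?a = (u - v) * of_real Y"
          by (simp add: algebra_simps)
        moreover have "norm (u - v) \<le> 2"
          using norm_triangle_ineq4[of u v] uv by simp
        ultimately show ?thesis
          using elim by (simp add: norm_mult mult_right_mono)
      qed
      finally have "norm (g ?b - g ?a) \<le> C * exp (- \<delta> * Y) * (2 * Y)"
        using C by (simp add: mult_left_mono)
      moreover have eqs: "contour_integral (linepath z ?b) f = g ?b - g z"
        "contour_integral (linepath z ?a) f = g ?a - g z"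
        by (rule contour_integral_unique, rule g; use inS elim in auto)+
      ultimately show ?case
        unfolding eqs by (simp add: mult_ac)
    qed
    have "((\<lambda>Y. Y * exp (- \<delta> * Y)) \<longlongrightarrow> 0) at_top"
      using \<delta> by real_asymp
    then show "((\<lambda>Y. 2 * C * (Y * exp (- \<delta> * Y))) \<longlongrightarrow> 0) at_top"
      by (rule tendsto_mult_right_zero)
  qed
  ultimately have "ray_integral z u f - ray_integral z v f = 0"
    by (intro tendsto_unique[OF trivial_limit_at_top_linorder])
  then show ?thesis by simp
qed

text \<open>The truncated rays, the segment from z to z' and its translate by u Y bound a
  parallelogram. The translate has fixed length, so its contribution vanishes as Y grows.\<close>

lemma ray_integral_shift:
  assumes S: "convex S" "f holomorphic_on S" and u: "norm u = 1" and \<delta>: "\<delta> > 0"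
    and strip: "\<And>p x. p \<in> closed_segment z z' \<Longrightarrow> x \<ge> 0 \<Longrightarrow> p + u * of_real x \<in> S"
    and bound: "\<And>p x. p \<in> closed_segment z z' \<Longrightarrow> x \<ge> 0 \<Longrightarrow>
      norm (f (p + u * of_real x)) \<le> C * exp (- \<delta> * x)"
  shows "ray_integral z u f = contour_integral (linepath z z') f + ray_integral z' u f"
proof -
  obtain g where g: "\<And>a b. a \<in> S \<Longrightarrow> b \<in> S \<Longrightarrow> (f has_contour_integral (g b - g a)) (linepath a b)"
    using convex_line_primitive[OF S] by blast
  have C: "C \<ge> 0"
    using order.trans[OF norm_ge_zero bound[of z 0]] by simp
  have inS: "x \<ge> 0 \<Longrightarrow> z + u * of_real x \<in> S" "x \<ge> 0 \<Longrightarrow> z' + u * of_real x \<in> S" "z \<in> S" "z' \<in> S" for x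
    using strip[of z x] strip[of z' x] strip[of z 0] strip[of z' 0] by auto
  have "ray z u \<subseteq> S" "ray z' u \<subseteq> S"
    using inS by (auto simp: ray_def)
  then have cont: "continuous_on (ray z u) f" "continuous_on (ray z' u) f"
    using S(2) holomorphic_on_imp_continuous_on continuous_on_subset by blast+
  have "((\<lambda>Y. contour_integral (linepath z (z + u * of_real Y)) f
        - contour_integral (linepath z' (z' + u * of_real Y)) f - contour_integral (linepath z z') f)
      \<longlongrightarrow> ray_integral z u f - ray_integral z' u f - contour_integral (linepath z z') f) at_top"
    by (intro tendsto_diff tendsto_const tendsto_ray_integral[OF cont(1) u \<delta>] tendsto_ray_integral[OF cont(2) u \<delta>])
      (use bound in auto)
  moreover have "((\<lambda>Y. contour_integral (linepath z (z + u * of_real Y)) f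
        - contour_integral (linepath z' (z' + u * of_real Y)) f - contour_integral (linepath z z') f)
      \<longlongrightarrow> 0) at_top"
  proof (rule Lim_null_comparison)
    show "\<forall>\<^sub>F Y in at_top. norm (contour_integral (linepath z (z + u * of_real Y)) f
        - contour_integral (linepath z' (z' + u * of_real Y)) f - contour_integral (linepath z z') f)
        \<le> C * norm (z - z') * exp (- \<delta> * Y)"
      using eventually_ge_at_top[of 0]
    proof eventually_elim
      case (elim Y)
      let ?a = "z' + u * of_real Y" and ?b = "z + u * of_real Y"
      have seg: "(f has_contour_integral (g ?b - g ?a)) (linepath ?a ?b)"
        by (rule g) (use inS elim in auto)
      have "norm (g ?b - g ?a) \<le> C * exp (- \<delta> * Y) * norm (?b - ?a)"
      proof (rule has_contour_integral_bound_linepath[OF seg])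
        fix w assume "w \<in> closed_segment ?a ?b"
        then obtain s where s: "0 \<le> s" "s \<le> 1" "w = (1 - s) *\<^sub>R ?a + s *\<^sub>R ?b"
          by (auto simp: closed_segment_def)
        define p where "p = (1 - s) *\<^sub>R z' + s *\<^sub>R z"
        have "p \<in> closed_segment z z'"
          using s unfolding closed_segment_commute[of z] by (auto simp: closed_segment_def p_def)
        moreover have "w = p + u * of_real Y"
          unfolding s(3) p_def by (simp add: scaleR_conv_of_real algebra_simps)
        ultimately show "norm (f w) \<le> C * exp (- \<delta> * Y)"
          using bound[of p Y] elim by simp
      qed (use C in auto)
      moreover have eqs: "contour_integral (linepath z ?b) f = g ?b - g z"
        "contour_integral (linepath z' ?a) f = g ?a - g z'" "contour_integral (linepath z z') f = g z' - g z"
        by (rule contour_integral_unique, rule g; use inS elim in auto)+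
      moreover have "?b - ?a = z - z'"
        by simp
      ultimately show ?case
        unfolding eqs by (simp add: mult_ac)
    qed
    show "((\<lambda>Y. C * norm (z - z') * exp (- \<delta> * Y)) \<longlongrightarrow> 0) at_top"
      using \<delta> by real_asymp
  qed
  ultimately have "ray_integral z u f - ray_integral z' u f - contour_integral (linepath z z') f = 0"
    by (intro tendsto_unique[OF trivial_limit_at_top_linorder])
  then show ?thesis by (simp add: algebra_simps)
qed

section \<open>Contour integrals with two infinite ends\<close>

text \<open>The contour arrives from infinity along the ray at its start and leaves along the ray at
  its end, whence the signs. Vertical directions give Mellin-Barnes integrals; the directions 1 and
  -1 give contours that open to the right and to the left.\<close>

definition horn_integral ::
  "(real \<Rightarrow> complex) \<Rightarrow> complex \<Rightarrow> complex \<Rightarrow> (complex \<Rightarrow> complex) \<Rightarrow> complex" where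
  "horn_integral c u v f =
     contour_integral c f - ray_integral (pathstart c) u f + ray_integral (pathfinish c) v f"

lemma mb_integral_eq_horn_integral:
  assumes c: "valid_path c" "f contour_integrable_on c"
    and s: "continuous_on (ray (pathstart c) (- \<i>)) f"
      "\<And>x. x \<ge> 0 \<Longrightarrow> norm (f (pathstart c + - \<i> * of_real x)) \<le> C * exp (- \<delta> * x)" "\<delta> > 0"
    and t: "continuous_on (ray (pathfinish c) \<i>) f"
      "\<And>x. x \<ge> 0 \<Longrightarrow> norm (f (pathfinish c + \<i> * of_real x)) \<le> C' * exp (- \<delta>' * x)" "\<delta>' > 0"
  shows "mb_integral c f = horn_integral c (- \<i>) \<i> f"
proof -
  have "((\<lambda>Y. contour_integral c f - contour_integral (linepath (pathstart c) (pathstart c + - \<i> * of_real Y)) f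
      + contour_integral (linepath (pathfinish c) (pathfinish c + \<i> * of_real Y)) f)
      \<longlongrightarrow> horn_integral c (- \<i>) \<i> f) at_top"
    unfolding horn_integral_def
    by (intro tendsto_intros tendsto_ray_integral[OF s(1) _ s(3,2)] tendsto_ray_integral[OF t(1) _ t(3,2)]) auto
  moreover have "\<forall>\<^sub>F Y in at_top. contour_integral c f
      - contour_integral (linepath (pathstart c) (pathstart c + - \<i> * of_real Y)) f
      + contour_integral (linepath (pathfinish c) (pathfinish c + \<i> * of_real Y)) f
      = contour_integral (mb_truncate c Y) f"
    using eventually_ge_at_top[of 0]
  proof eventually_elim
    case (elim Y)
    have cont: "continuous_on (closed_segment (pathstart c) (pathstart c + - \<i> * of_real Y)) f"
      "continuous_on (closed_segment (pathfinish c) (pathfinish c + \<i> * of_real Y)) f"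
      using closed_segment_ray[OF elim] s(1) t(1) continuous_on_subset by blast+
    then have "f contour_integrable_on linepath (pathstart c - \<i> * of_real Y) (pathstart c)"
      "f contour_integrable_on linepath (pathfinish c) (pathfinish c + \<i> * of_real Y)"
      by (auto intro!: contour_integrable_continuous_linepath simp: closed_segment_commute)
    moreover have "contour_integral (linepath (pathstart c - \<i> * of_real Y) (pathstart c)) f
        = - contour_integral (linepath (pathstart c) (pathstart c - \<i> * of_real Y)) f"
      by (rule contour_integral_reverse_linepath) (use cont in \<open>simp add: closed_segment_commute\<close>)
    ultimately show ?case
      using c by (simp add: mb_truncate_def)
  qed
  ultimately have "((\<lambda>Y. contour_integral (mb_truncate c Y) f) \<longlongrightarrow> horn_integral c (- \<i>) \<i> f) at_top"
    by (rule Lim_transform_eventually)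
  then show ?thesis
    unfolding mb_integral_def by (intro tendsto_Lim) auto
qed

section \<open>Independence of the separating contour\<close>

lemma strip_decay:
  fixes f :: "complex \<Rightarrow> complex"
  assumes u: "u = \<i> \<or> u = - \<i>" and \<delta>: "\<delta> > 0"
    and cont: "continuous_on ((\<lambda>(p, x). p + u * of_real x) ` (closed_segment z z' \<times> {0..})) f"
    and decay: "\<And>t. Re t \<in> closed_segment (Re z) (Re z') \<Longrightarrow> \<bar>Im t\<bar> \<ge> H \<Longrightarrow> norm (f t) \<le> C * exp (- \<delta> * \<bar>Im t\<bar>)"
  obtains C' where "\<And>p x. p \<in> closed_segment z z' \<Longrightarrow> x \<ge> 0 \<Longrightarrow> norm (f (p + u * of_real x)) \<le> C' * exp (- \<delta> * x)"
proof -
  define m where "m = max \<bar>Im z\<bar> \<bar>Im z'\<bar>"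
  define x0 where "x0 = m + \<bar>H\<bar>"
  have m: "\<bar>Im p\<bar> \<le> m" if "p \<in> closed_segment z z'" for p
  proof -
    have "closed_segment z z' \<subseteq> {t. Im t \<le> m} \<inter> {t. Im t \<ge> - m}"
      by (intro closed_segment_subset convex_Int convex_halfspace_Im_le convex_halfspace_Im_ge)
        (auto simp: m_def)
    then show ?thesis
      using that by (auto simp: abs_le_iff)
  qed
  have re: "Re p \<in> closed_segment (Re z) (Re z')" if "p \<in> closed_segment z z'" for p
    using that by (auto simp: closed_segment_def)
  have "compact ((\<lambda>(p, x). p + u * of_real x) ` (closed_segment z z' \<times> {0..x0}))"
    by (intro compact_continuous_image compact_Times) (auto intro!: continuous_intros simp: case_prod_unfold)
  moreover have "continuous_on ((\<lambda>(p, x). p + u * of_real x) ` (closed_segment z z' \<times> {0..x0})) f"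
    by (rule continuous_on_subset[OF cont]) auto
  ultimately have "bounded (f ` (\<lambda>(p, x). p + u * of_real x) ` (closed_segment z z' \<times> {0..x0}))"
    by (metis compact_imp_bounded compact_continuous_image)
  then obtain B where B: "B > 0" "\<And>p x. p \<in> closed_segment z z' \<Longrightarrow> x \<in> {0..x0} \<Longrightarrow> norm (f (p + u * of_real x)) \<le> B"
    unfolding bounded_pos by force
  \<comment> \<open>The first summand serves the tail. The second serves the compact part x \<le>
    x0, where B bounds f and the exponential is at least
    \<open>exp (- \<delta> * x0)\<close>.\<close>
  define C' where "C' = \<bar>C\<bar> * exp (\<delta> * m) + B * exp (\<delta> * x0)"
  have "norm (f (p + u * of_real x)) \<le> C' * exp (- \<delta> * x)" if p: "p \<in> closed_segment z z'" and x: "x \<ge> 0" for p x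
  proof (cases "x \<le> x0")
    case True
    have "norm (f (p + u * of_real x)) \<le> B * 1"
      using B(2)[OF p, of x] True x by simp
    also have "\<dots> \<le> B * (exp (\<delta> * x0) * exp (- \<delta> * x))"
      unfolding exp_add [symmetric] using B(1) True \<delta> by (intro mult_left_mono) auto
    also have "\<dots> \<le> C' * exp (- \<delta> * x)"
      by (simp add: C'_def algebra_simps)
    finally show ?thesis .
  next
    case False
    have im: "\<bar>Im (p + u * of_real x)\<bar> \<ge> x - m"
      using m[OF p] u by auto
    then have "norm (f (p + u * of_real x)) \<le> C * exp (- \<delta> * \<bar>Im (p + u * of_real x)\<bar>)"
      using False u re[OF p] by (intro decay) (auto simp: x0_def)
    also have "\<dots> \<le> \<bar>C\<bar> * exp (- \<delta> * (x - m))"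
      using im \<delta> by (intro mult_mono) auto
    also have "\<dots> = \<bar>C\<bar> * exp (\<delta> * m) * exp (- \<delta> * x)"
      by (simp add: algebra_simps flip: exp_add)
    also have "\<dots> \<le> C' * exp (- \<delta> * x)"
      using B(1) by (simp add: C'_def algebra_simps)
    finally show ?thesis .
  qed
  then show ?thesis
    using that by blast
qed

text \<open>This makes the choice of a contour in the definition of the G-function harmless.
  Cauchy's theorem compares the compact parts up to two connecting segments, and shifting the
  vertical rays sideways produces exactly the integrals over these segments.\<close>

lemma mb_integral_separating_contour_eq:
  assumes cl: "closed (A \<union> B)" and f: "f holomorphic_on - (A \<union> B)"
    and c: "separating_contour A B c" and c': "separating_contour A B c'" and \<delta>: "\<delta> > 0"
    and decay: "\<And>x y. \<exists>C. \<forall>t. x \<le> Re t \<longrightarrow> Re t \<le> y \<longrightarrow> \<bar>Im t\<bar> \<ge> H \<longrightarrow> norm (f t) \<le> C * exp (- \<delta> * \<bar>Im t\<bar>)"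
  shows "mb_integral c f = mb_integral c' f" "mb_integral c f = horn_integral c (- \<i>) \<i> f"
proof -
  note cD = separating_contourD[OF c] and cD' = separating_contourD[OF c']
  have opS: "open (- (A \<union> B))"
    using cl by (rule open_Compl)
  have contf: "continuous_on X f" if "X \<subseteq> - (A \<union> B)" for X
    using f that by (meson continuous_on_subset holomorphic_on_imp_continuous_on)
  have int: "f contour_integrable_on c" "f contour_integrable_on c'"
    using contour_integrable_holomorphic_simple[OF f opS] cD(1,5) cD'(1,5) by auto
  \<comment> \<open>The half-planes beyond the ends of both contours are convex and free of poles,
    so rays can be shifted in them.\<close>
  let ?m = "min (Im (pathfinish c)) (Im (pathfinish c'))" and ?M = "max (Im (pathstart c)) (Im (pathstart c'))"
  let ?U = "{t. Im t \<ge> ?m}" and ?L = "{t. Im t \<le> ?M}"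
  have U: "?U \<subseteq> - (A \<union> B)" and L: "?L \<subseteq> - (A \<union> B)"
    using cD(3,4) cD'(3,4) by fastforce+
  have hol: "f holomorphic_on ?U" "f holomorphic_on ?L"
    using f U L holomorphic_on_subset by blast+
  have segU: "p + \<i> * of_real x \<in> ?U" if "p \<in> closed_segment (pathfinish c) (pathfinish c')" "x \<ge> 0" for p x
  proof -
    have "closed_segment (pathfinish c) (pathfinish c') \<subseteq> ?U"
      by (intro closed_segment_subset convex_halfspace_Im_ge) auto
    with that show ?thesis by force
  qed
  have segL: "p + - \<i> * of_real x \<in> ?L" if "p \<in> closed_segment (pathstart c) (pathstart c')" "x \<ge> 0" for p x
  proof -
    have "closed_segment (pathstart c) (pathstart c') \<subseteq> ?L"
      by (intro closed_segment_subset convex_halfspace_Im_le) auto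
    with that show ?thesis by force
  qed
  have dec: "\<exists>C. \<forall>t. Re t \<in> closed_segment x y \<longrightarrow> \<bar>Im t\<bar> \<ge> H \<longrightarrow> norm (f t) \<le> C * exp (- \<delta> * \<bar>Im t\<bar>)" for x y
  proof -
    obtain C where "\<forall>t. min x y \<le> Re t \<longrightarrow> Re t \<le> max x y \<longrightarrow> \<bar>Im t\<bar> \<ge> H \<longrightarrow>
        norm (f t) \<le> C * exp (- \<delta> * \<bar>Im t\<bar>)"
      using decay by blast
    then show ?thesis
      by (intro exI[of _ C]) (auto simp: closed_segment_eq_real_ivl split: if_splits)
  qed
  obtain CU where CU: "\<And>p x. p \<in> closed_segment (pathfinish c) (pathfinish c') \<Longrightarrow> x \<ge> 0 \<Longrightarrow>
      norm (f (p + \<i> * of_real x)) \<le> CU * exp (- \<delta> * x)"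
  proof -
    obtain C where C: "\<And>t. Re t \<in> closed_segment (Re (pathfinish c)) (Re (pathfinish c')) \<Longrightarrow> \<bar>Im t\<bar> \<ge> H
        \<Longrightarrow> norm (f t) \<le> C * exp (- \<delta> * \<bar>Im t\<bar>)"
      using dec by blast
    have cont: "continuous_on ((\<lambda>(p, x). p + \<i> * of_real x)
        ` (closed_segment (pathfinish c) (pathfinish c') \<times> {0..})) f"
      by (rule contf, rule order.trans[OF _ U], rule image_subsetI)
        (simp only: mem_Times_iff atLeast_iff case_prod_unfold segU)
    obtain C' where "\<And>p x. p \<in> closed_segment (pathfinish c) (pathfinish c') \<Longrightarrow> x \<ge> 0 \<Longrightarrow>
        norm (f (p + \<i> * of_real x)) \<le> C' * exp (- \<delta> * x)"
      by (rule strip_decay[OF disjI1[OF refl] \<delta> cont, of H C]) (rule C, assumption, assumption, rule that)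
    then show ?thesis
      by (rule that)
  qed
  obtain CL where CL: "\<And>p x. p \<in> closed_segment (pathstart c) (pathstart c') \<Longrightarrow> x \<ge> 0 \<Longrightarrow>
      norm (f (p + - \<i> * of_real x)) \<le> CL * exp (- \<delta> * x)"
  proof -
    obtain C where C: "\<And>t. Re t \<in> closed_segment (Re (pathstart c)) (Re (pathstart c')) \<Longrightarrow> \<bar>Im t\<bar> \<ge> H
        \<Longrightarrow> norm (f t) \<le> C * exp (- \<delta> * \<bar>Im t\<bar>)"
      using dec by blast
    have cont: "continuous_on ((\<lambda>(p, x). p + - \<i> * of_real x)
        ` (closed_segment (pathstart c) (pathstart c') \<times> {0..})) f"
      by (rule contf, rule order.trans[OF _ L], rule image_subsetI)
        (simp only: mem_Times_iff atLeast_iff case_prod_unfold segL)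
    obtain C' where "\<And>p x. p \<in> closed_segment (pathstart c) (pathstart c') \<Longrightarrow> x \<ge> 0 \<Longrightarrow>
        norm (f (p + - \<i> * of_real x)) \<le> C' * exp (- \<delta> * x)"
      by (rule strip_decay[OF disjI2[OF refl] \<delta> cont, of H C]) (rule C, assumption, assumption, rule that)
    then show ?thesis
      by (rule that)
  qed
  have rays: "continuous_on (ray (pathfinish c) \<i>) f" "continuous_on (ray (pathfinish c') \<i>) f"
    "continuous_on (ray (pathstart c) (- \<i>)) f" "continuous_on (ray (pathstart c') (- \<i>)) f"
  proof -
    have "ray (pathfinish c) \<i> \<subseteq> ?U" "ray (pathfinish c') \<i> \<subseteq> ?U"
      "ray (pathstart c) (- \<i>) \<subseteq> ?L" "ray (pathstart c') (- \<i>) \<subseteq> ?L"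
      by (auto simp: ray_def)
    with U L show "continuous_on (ray (pathfinish c) \<i>) f" "continuous_on (ray (pathfinish c') \<i>) f"
      "continuous_on (ray (pathstart c) (- \<i>)) f" "continuous_on (ray (pathstart c') (- \<i>)) f"
      by (meson contf order.trans)+
  qed
  have horn: "mb_integral c f = horn_integral c (- \<i>) \<i> f" "mb_integral c' f = horn_integral c' (- \<i>) \<i> f"
    by (rule mb_integral_eq_horn_integral[OF _ _ _ CL \<delta> _ CU \<delta>]; use cD(1) cD'(1) int rays in simp)+
  show "mb_integral c f = horn_integral c (- \<i>) \<i> f"
    by (rule horn)
  have "ray_integral (pathfinish c) \<i> f
      = contour_integral (linepath (pathfinish c) (pathfinish c')) f + ray_integral (pathfinish c') \<i> f"
    by (rule ray_integral_shift[OF convex_halfspace_Im_ge hol(1) _ \<delta> segU CU]) auto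
  moreover have "ray_integral (pathstart c) (- \<i>) f
      = contour_integral (linepath (pathstart c) (pathstart c')) f + ray_integral (pathstart c') (- \<i>) f"
    by (rule ray_integral_shift[OF convex_halfspace_Im_le hol(2) _ \<delta> segL CL]) auto
  ultimately show "mb_integral c f = mb_integral c' f"
    using separating_contour_integral_eq[OF cl f c c']
    unfolding horn horn_integral_def by (simp add: algebra_simps)
qed

section \<open>Holomorphic dependence on the exponent \<zeta>\<close>

lemma contour_integral_exp_holomorphic:
  assumes S: "open S" "f holomorphic_on S" and p: "valid_path p" "path_image p \<subseteq> S"
  shows "(\<lambda>\<zeta>. contour_integral p (\<lambda>t. f t * exp (- \<zeta> * t))) holomorphic_on UNIV"
proof -
  have P: "path_image p \<noteq> {}" "compact (path_image p)"
    using p by (auto simp: compact_valid_path_image path_image_nonempty)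
  then obtain e where e: "e > 0" "{x. infdist x (path_image p) \<le> e} \<subseteq> S"
    using compact_in_open_separated[OF P S(1) p(2)] by blast
  \<comment> \<open>The estimate for the integral over p works with a bound on an open neighbourhood
    of the path; inside the compact tube K both f and t are bounded.\<close>
  define U where "U = {x. infdist x (path_image p) < e}"
  define K where "K = {x. infdist x (path_image p) \<le> e}"
  have U: "open U" "path_image p \<subseteq> U" "U \<subseteq> K"
    using e by (auto simp: U_def K_def intro!: open_Collect_less continuous_intros)
  have K: "compact K" "K \<subseteq> S"
    using compact_infdist_le[OF P e(1)] e(2) by (auto simp: K_def)
  obtain R where R: "R > 0" "\<And>t. t \<in> K \<Longrightarrow> norm t \<le> R"
    using compact_imp_bounded[OF K(1)] by (auto simp: bounded_pos)
  have "compact (f ` K)"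
    using K S(2) by (meson compact_continuous_image continuous_on_subset holomorphic_on_imp_continuous_on)
  then obtain B where B: "B > 0" "\<And>t. t \<in> K \<Longrightarrow> norm (f t) \<le> B"
    using compact_imp_bounded[of "f ` K"] by (auto simp: bounded_pos)
  obtain L where L: "L > 0" "\<And>h M. h holomorphic_on U \<Longrightarrow> (\<And>t. t \<in> U \<Longrightarrow> norm (h t) \<le> M)
      \<Longrightarrow> norm (contour_integral p h) \<le> L * M"
    using contour_integral_bound_exists[OF U(1) p(1) U(2)] by blast
  have fU: "f holomorphic_on U"
    using S(2) U(3) K(2) holomorphic_on_subset by blast
  have int: "h contour_integrable_on p" if "h holomorphic_on U" for h
    by (rule contour_integrable_holomorphic_simple[OF that U(1) p(1) U(2)])
  \<comment> \<open>Expanding the exponential under the integral gives a power series in \<zeta>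
    that converges everywhere; its coefficients are moments of f along p.\<close>
  define a where "a n = (- 1) ^ n / fact n * contour_integral p (\<lambda>t. f t * t ^ n)" for n
  have sums: "(\<lambda>n. a n * (\<zeta> - 0) ^ n) sums contour_integral p (\<lambda>t. f t * exp (- \<zeta> * t))" for \<zeta>
  proof -
    define E where "E N x = (\<Sum>n<N. x ^ n /\<^sub>R fact n)" for N and x :: complex
    have unif: "uniform_limit (cball 0 (norm \<zeta> * R)) E exp sequentially"
      unfolding E_def exp_def
      by (rule Weierstrass_m_test[where M = "\<lambda>n. (norm \<zeta> * R) ^ n /\<^sub>R fact n"])
        (use summable_exp[of "norm \<zeta> * R"] in \<open>auto simp: norm_power intro!: mult_left_mono power_mono\<close>)
    have part: "(\<Sum>n<N. a n * (\<zeta> - 0) ^ n) = contour_integral p (\<lambda>t. f t * E N (- \<zeta> * t))" for N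
    proof -
      have "((\<lambda>t. \<Sum>n<N. ((- 1) ^ n / fact n * \<zeta> ^ n) * (f t * t ^ n)) has_contour_integral
          (\<Sum>n<N. ((- 1) ^ n / fact n * \<zeta> ^ n) * contour_integral p (\<lambda>t. f t * t ^ n))) p"
        by (intro has_contour_integral_sum has_contour_integral_lmul has_contour_integral_integral int
            holomorphic_intros fU finite_lessThan)
      then have "contour_integral p (\<lambda>t. \<Sum>n<N. ((- 1) ^ n / fact n * \<zeta> ^ n) * (f t * t ^ n))
          = (\<Sum>n<N. a n * (\<zeta> - 0) ^ n)"
        by (simp add: contour_integral_unique a_def mult_ac)
      moreover have "(\<lambda>t. \<Sum>n<N. ((- 1) ^ n / fact n * \<zeta> ^ n) * (f t * t ^ n)) = (\<lambda>t. f t * E N (- \<zeta> * t))"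
        by (simp add: E_def sum_distrib_left fun_eq_iff scaleR_conv_of_real power_minus[of "_ * \<zeta>"]
            power_mult_distrib field_simps)
      ultimately show ?thesis
        by simp
    qed
    have "(\<lambda>N. contour_integral p (\<lambda>t. f t * E N (- \<zeta> * t)) - contour_integral p (\<lambda>t. f t * exp (- \<zeta> * t)))
        \<longlonglongrightarrow> 0"
    proof (rule LIMSEQ_I)
      fix r :: real assume "r > 0"
      \<comment> \<open>Chosen so that \<open>L * (B * \<eta>)\<close> equals r / 2.\<close>
      define \<eta> where "\<eta> = r / (2 * L * B)"
      have \<eta>: "\<eta> > 0" "L * (B * \<eta>) < r"
        using \<open>r > 0\<close> L(1) B(1) by (auto simp: \<eta>_def)
      obtain N0 where
        N0: "\<And>N x. N \<ge> N0 \<Longrightarrow> x \<in> cball 0 (norm \<zeta> * R) \<Longrightarrow> dist (E N x) (exp x) < \<eta>"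
        using uniform_limitD[OF unif \<eta>(1)] unfolding eventually_sequentially by blast
      have "norm (contour_integral p (\<lambda>t. f t * E N (- \<zeta> * t)) - contour_integral p (\<lambda>t. f t * exp (- \<zeta> * t))) < r"
        if "N \<ge> N0" for N
      proof -
        have hol: "(\<lambda>t. f t * E N (- \<zeta> * t)) holomorphic_on U" "(\<lambda>t. f t * exp (- \<zeta> * t)) holomorphic_on U"
          unfolding E_def scaleR_conv_of_real by (intro holomorphic_intros fU)+
        have "contour_integral p (\<lambda>t. f t * E N (- \<zeta> * t)) - contour_integral p (\<lambda>t. f t * exp (- \<zeta> * t))
            = contour_integral p (\<lambda>t. f t * E N (- \<zeta> * t) - f t * exp (- \<zeta> * t))"
          by (intro contour_integral_diff [symmetric] int hol)
        also have "norm \<dots> \<le> L * (B * \<eta>)"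
        proof (rule L(2))
          fix t assume "t \<in> U"
          then have t: "norm (f t) \<le> B" "norm t \<le> R"
            using U(3) B R by auto
          have "- \<zeta> * t \<in> cball 0 (norm \<zeta> * R)"
            using t(2) by (simp add: norm_mult mult_left_mono)
          then have "norm (E N (- \<zeta> * t) - exp (- \<zeta> * t)) \<le> \<eta>"
            using less_imp_le[OF N0[OF that]] by (simp only: dist_norm)
          then have "norm (f t * (E N (- \<zeta> * t) - exp (- \<zeta> * t))) \<le> B * \<eta>"
            by (rule norm_mult_le[OF t(1)])
          then show "norm (f t * E N (- \<zeta> * t) - f t * exp (- \<zeta> * t)) \<le> B * \<eta>"
            by (simp only: right_diff_distrib)
        qed (intro holomorphic_on_diff hol)
        finally show ?thesis
          using \<eta>(2) by simp
      qed
      then show "\<exists>no. \<forall>n\<ge>no. norm (contour_integral p (\<lambda>t. f t * E n (- \<zeta> * t))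
          - contour_integral p (\<lambda>t. f t * exp (- \<zeta> * t)) - 0) < r"
        by auto
    qed
    then show ?thesis
      unfolding sums_def part by (rule LIM_zero_cancel)
  qed
  show ?thesis
  proof (rule holomorphic_on_subset)
    show "(\<lambda>\<zeta>. contour_integral p (\<lambda>t. f t * exp (- \<zeta> * t))) holomorphic_on (\<Union>r. ball 0 r)"
      by (rule holomorphic_on_UN_open) (use power_series_holomorphic[OF sums] in auto)
    show "UNIV \<subseteq> (\<Union>r. ball (0::complex) r)"
      by (auto simp: gt_ex)
  qed
qed

lemma norm_exp_ray:
  "norm (exp (- \<zeta> * (z + u * of_real x))) = exp (- Re (\<zeta> * z)) * exp (- Re (\<zeta> * u) * x)"
  by (simp add: norm_exp_eq_Re algebra_simps flip: exp_add)

lemma ray_exp_decay: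
  assumes "norm (f (z + u * of_real x)) \<le> C * exp (\<beta> * x)"
  shows "norm (f (z + u * of_real x) * exp (- \<zeta> * (z + u * of_real x)))
    \<le> C * exp (- Re (\<zeta> * z)) * exp (- (Re (\<zeta> * u) - \<beta>) * x)"
proof -
  have "norm (f (z + u * of_real x) * exp (- \<zeta> * (z + u * of_real x)))
      \<le> (C * exp (\<beta> * x)) * (exp (- Re (\<zeta> * z)) * exp (- Re (\<zeta> * u) * x))"
    using assms by (intro norm_mult_le) (simp_all only: norm_exp_ray order_refl)
  also have "\<dots> = C * exp (- Re (\<zeta> * z)) * (exp (\<beta> * x) * exp (- Re (\<zeta> * u) * x))"
    by simp
  also have "exp (\<beta> * x) * exp (- Re (\<zeta> * u) * x) = exp (- (Re (\<zeta> * u) - \<beta>) * x)"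
    unfolding exp_add [symmetric] by (simp add: algebra_simps)
  finally show ?thesis .
qed

text \<open>The integrals over finite segments are entire in \<zeta>, and the remainder estimate
  makes their convergence uniform on small discs. The exponential growth rate \<beta> of f
  determines the half-plane of convergence.\<close>

lemma ray_integral_exp:
  assumes S: "open S" "f holomorphic_on S" "ray z u \<subseteq> S" and u: "norm u = 1"
    and bound: "\<And>x. x \<ge> 0 \<Longrightarrow> norm (f (z + u * of_real x)) \<le> C * exp (\<beta> * x)"
  shows ray_integral_exp_holomorphic:
      "(\<lambda>\<zeta>. ray_integral z u (\<lambda>t. f t * exp (- \<zeta> * t))) holomorphic_on {\<zeta>. \<beta> < Re (\<zeta> * u)}"
    and norm_ray_integral_exp_le: "\<And>\<zeta>. \<beta> < Re (\<zeta> * u) \<Longrightarrow>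
      norm (ray_integral z u (\<lambda>t. f t * exp (- \<zeta> * t))) \<le> C * exp (norm \<zeta> * norm z) / (Re (\<zeta> * u) - \<beta>)"
proof -
  have C: "C \<ge> 0"
    using order.trans[OF norm_ge_zero bound[of 0]] by simp
  have cont: "continuous_on (ray z u) (\<lambda>t. f t * exp (- \<zeta> * t))" for \<zeta>
    by (intro continuous_intros continuous_on_subset[OF _ S(3)] holomorphic_on_imp_continuous_on[OF S(2)])
  have exp_le: "exp (- Re (\<zeta> * z)) \<le> exp (norm \<zeta> * norm z)" for \<zeta>
    using abs_Re_le_cmod[of "\<zeta> * z"] by (simp only: exp_le_cancel_iff norm_mult [symmetric])
  have decay: "norm (f (z + u * of_real x) * exp (- \<zeta> * (z + u * of_real x)))
    \<le> C * exp (norm \<zeta> * norm z) * exp (- (Re (\<zeta> * u) - \<beta>) * x)" if "x \<ge> 0" for x \<zeta>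
    by (rule order.trans[OF ray_exp_decay[where f = f and z = z and u = u, OF bound[OF that]]]) (intro mult_right_mono mult_left_mono exp_le C exp_ge_zero)
  show "norm (ray_integral z u (\<lambda>t. f t * exp (- \<zeta> * t))) \<le> C * exp (norm \<zeta> * norm z) / (Re (\<zeta> * u) - \<beta>)"
    if "\<beta> < Re (\<zeta> * u)" for \<zeta>
    by (rule norm_ray_integral_le[OF cont u _ decay]) (use that in simp)
  have rem: "norm (contour_integral (linepath z (z + u * of_real Y)) (\<lambda>t. f t * exp (- \<zeta> * t))
      - ray_integral z u (\<lambda>t. f t * exp (- \<zeta> * t)))
      \<le> C * exp (norm \<zeta> * norm z) / (Re (\<zeta> * u) - \<beta>) * exp (- (Re (\<zeta> * u) - \<beta>) * Y)"
    if "\<beta> < Re (\<zeta> * u)" "Y \<ge> 0" for \<zeta> Y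
    by (rule ray_integral_remainder[OF cont u _ decay]) (use that in auto)
  show "(\<lambda>\<zeta>. ray_integral z u (\<lambda>t. f t * exp (- \<zeta> * t))) holomorphic_on {\<zeta>. \<beta> < Re (\<zeta> * u)}"
  proof (rule holomorphic_uniform_sequence)
    show "open {\<zeta>. \<beta> < Re (\<zeta> * u)}"
      by (intro open_Collect_less continuous_intros)
    show "(\<lambda>\<zeta>. contour_integral (linepath z (z + u * of_real (real n))) (\<lambda>t. f t * exp (- \<zeta> * t)))
        holomorphic_on {\<zeta>. \<beta> < Re (\<zeta> * u)}" for n
      by (rule holomorphic_on_subset[OF contour_integral_exp_holomorphic[OF S(1,2)]])
        (use closed_segment_ray[of "real n" z u] S(3) in auto)
    fix \<zeta>0 assume "\<zeta>0 \<in> {\<zeta>. \<beta> < Re (\<zeta> * u)}"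
    \<comment> \<open>With this radius the rate \<open>Re (\<zeta> * u) - \<beta>\<close> stays at
      least d on the whole disc, because u has norm 1.\<close>
    define d where "d = (Re (\<zeta>0 * u) - \<beta>) / 2"
    have d: "d > 0"
      using \<open>\<zeta>0 \<in> _\<close> by (simp add: d_def)
    have re: "Re (\<zeta> * u) - \<beta> \<ge> d" if "\<zeta> \<in> cball \<zeta>0 d" for \<zeta>
    proof -
      have "Re ((\<zeta>0 - \<zeta>) * u) \<le> norm ((\<zeta>0 - \<zeta>) * u)"
        by (rule complex_Re_le_cmod)
      also have "\<dots> \<le> d"
        using that u by (simp add: norm_mult dist_norm)
      finally show ?thesis
        unfolding left_diff_distrib minus_complex.sel by (simp add: d_def field_simps)
    qed
    define C' where "C' = C * exp ((norm \<zeta>0 + d) * norm z) / d"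
    have "uniform_limit (cball \<zeta>0 d)
      (\<lambda>n \<zeta>. contour_integral (linepath z (z + u * of_real (real n))) (\<lambda>t. f t * exp (- \<zeta> * t)))
      (\<lambda>\<zeta>. ray_integral z u (\<lambda>t. f t * exp (- \<zeta> * t))) sequentially"
    proof (rule uniform_limitI)
      fix e :: real assume "e > 0"
      have "(\<lambda>n. C' * exp (- d * real n)) \<longlonglongrightarrow> 0"
        using d by real_asymp
      then have "\<forall>\<^sub>F n in sequentially. C' * exp (- d * real n) < e"
        using \<open>e > 0\<close> by (rule order_tendstoD)
      then show "\<forall>\<^sub>F n in sequentially. \<forall>\<zeta>\<in>cball \<zeta>0 d.
          dist (contour_integral (linepath z (z + u * of_real (real n))) (\<lambda>t. f t * exp (- \<zeta> * t)))
            (ray_integral z u (\<lambda>t. f t * exp (- \<zeta> * t))) < e"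
      proof eventually_elim
        case (elim n)
        show ?case
        proof
          fix \<zeta> assume \<zeta>: "\<zeta> \<in> cball \<zeta>0 d"
          have "norm \<zeta> \<le> norm \<zeta>0 + d"
            using \<zeta> norm_triangle_sub[of \<zeta> \<zeta>0] by (simp add: dist_norm norm_minus_commute)
          moreover have "- (Re (\<zeta> * u) - \<beta>) * real n \<le> - d * real n"
            using re[OF \<zeta>] by (intro mult_right_mono) auto
          ultimately have "C * exp (norm \<zeta> * norm z) / (Re (\<zeta> * u) - \<beta>) * exp (- (Re (\<zeta> * u) - \<beta>) * real n)
              \<le> C' * exp (- d * real n)"
            unfolding C'_def using re[OF \<zeta>] d C
            by (intro mult_mono frac_le) (auto intro!: mult_left_mono mult_right_mono)
          then show "dist (contour_integral (linepath z (z + u * of_real (real n))) (\<lambda>t. f t * exp (- \<zeta> * t)))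
            (ray_integral z u (\<lambda>t. f t * exp (- \<zeta> * t))) < e"
            unfolding dist_norm using rem[of \<zeta> "real n"] re[OF \<zeta>] d elim by force
        qed
      qed
    qed
    then show "\<exists>d>0. cball \<zeta>0 d \<subseteq> {\<zeta>. \<beta> < Re (\<zeta> * u)} \<and> uniform_limit (cball \<zeta>0 d)
      (\<lambda>n \<zeta>. contour_integral (linepath z (z + u * of_real (real n))) (\<lambda>t. f t * exp (- \<zeta> * t)))
      (\<lambda>\<zeta>. ray_integral z u (\<lambda>t. f t * exp (- \<zeta> * t))) sequentially"
      using re d by (intro exI[of _ d]) force
  qed
qed

lemma horn_integral_exp_holomorphic:
  assumes S: "open S" "f holomorphic_on S" and c: "valid_path c" "path_image c \<subseteq> S"
    and u: "ray (pathstart c) u \<subseteq> S" "norm u = 1"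
      "\<And>x. x \<ge> 0 \<Longrightarrow> norm (f (pathstart c + u * of_real x)) \<le> C * exp (\<beta> * x)"
    and v: "ray (pathfinish c) v \<subseteq> S" "norm v = 1"
      "\<And>x. x \<ge> 0 \<Longrightarrow> norm (f (pathfinish c + v * of_real x)) \<le> C' * exp (\<beta>' * x)"
  shows "(\<lambda>\<zeta>. horn_integral c u v (\<lambda>t. f t * exp (- \<zeta> * t)))
    holomorphic_on {\<zeta>. \<beta> < Re (\<zeta> * u) \<and> \<beta>' < Re (\<zeta> * v)}"
  unfolding horn_integral_def
  by (intro holomorphic_intros holomorphic_on_subset[OF contour_integral_exp_holomorphic[OF S c]]
      holomorphic_on_subset[OF ray_integral_exp_holomorphic[OF S u]]
      holomorphic_on_subset[OF ray_integral_exp_holomorphic[OF S v]]) auto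

text \<open>With y = \<beta> (1 + x) this is (y / N)^N \<le> (1 + y / N)^N \<le> exp y, solved for 1
  + x. It trades polynomial growth for an arbitrarily small exponential rate, and the dependence of
  the constant on the rate is explicit.\<close>

lemma power_le_exp:
  fixes x \<beta> :: real
  assumes "x \<ge> 0" "\<beta> > 0"
  shows "(1 + x) ^ N \<le> (real N / \<beta>) ^ N * exp \<beta> * exp (\<beta> * x)"
proof (cases "N = 0")
  case False
  define y where "y = \<beta> * (1 + x)"
  have "(y / real N) ^ N \<le> (1 + y / real N) ^ N"
    using assms by (intro power_mono) (auto simp: y_def)
  also have "\<dots> \<le> exp y"
    using assms False by (intro exp_ge_one_plus_x_over_n_power_n) (auto simp: y_def add_nonneg_nonneg
        intro: order.trans[of _ 0])
  finally have "(y / real N) ^ N * (real N / \<beta>) ^ N \<le> exp y * (real N / \<beta>) ^ N"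
    using assms by (intro mult_right_mono) auto
  moreover have "(y / real N) ^ N * (real N / \<beta>) ^ N = (1 + x) ^ N"
    using assms False by (simp add: y_def flip: power_mult_distrib)
  moreover have "exp y = exp \<beta> * exp (\<beta> * x)"
    by (simp add: y_def ring_distribs exp_add)
  ultimately show ?thesis
    by (simp add: mult_ac)
qed (use assms in \<open>auto simp flip: exp_add\<close>)

text \<open>Growth of degree N along the ray becomes a singularity of order at most N + 1 at \<zeta>
  = 0: with a rate proportional to |\<zeta>|, the constant of \<open>power_le_exp\<close>
  contributes the order N and the integration of the exponential one more.\<close>

lemma norm_ray_integral_exp_polynomial_le:
  assumes S: "open S" "f holomorphic_on S" "ray z u \<subseteq> S" and u: "norm u = 1"
    and bound: "\<And>x. x \<ge> 0 \<Longrightarrow> norm (f (z + u * of_real x)) \<le> C * (1 + x) ^ N"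
  obtains C' where "\<And>\<zeta>. \<zeta> \<noteq> 0 \<Longrightarrow> norm \<zeta> \<le> 1 \<Longrightarrow> Re (\<zeta> * u) \<ge> norm \<zeta> / 2 \<Longrightarrow>
    norm (ray_integral z u (\<lambda>t. f t * exp (- \<zeta> * t))) \<le> C' / norm \<zeta> ^ (N + 1)"
proof -
  have C: "C \<ge> 0"
    using order.trans[OF norm_ge_zero bound[of 0]] by simp
  define C' where "C' = C * (4 * real N) ^ N * exp 1 * exp (norm z) * 4"
  have "norm (ray_integral z u (\<lambda>t. f t * exp (- \<zeta> * t))) \<le> C' / norm \<zeta> ^ (N + 1)"
    if \<zeta>: "\<zeta> \<noteq> 0" "norm \<zeta> \<le> 1" "Re (\<zeta> * u) \<ge> norm \<zeta> / 2" for \<zeta>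
  proof -
    \<comment> \<open>A quarter leaves at least another quarter of |\<zeta>| as rate of decay in the
      given sector.\<close>
    define \<beta> where "\<beta> = norm \<zeta> / 4"
    have \<beta>: "\<beta> > 0" "\<beta> \<le> 1"
      using \<zeta> by (auto simp: \<beta>_def)
    have "norm (f (z + u * of_real x)) \<le> C * (real N / \<beta>) ^ N * exp 1 * exp (\<beta> * x)" if "x \<ge> 0" for x
    proof -
      have "(1 + x) ^ N \<le> (real N / \<beta>) ^ N * exp \<beta> * exp (\<beta> * x)"
        by (rule power_le_exp[OF that \<beta>(1)])
      also have "\<dots> \<le> (real N / \<beta>) ^ N * exp 1 * exp (\<beta> * x)"
        using \<beta> by (intro mult_right_mono mult_left_mono) auto
      finally have "C * (1 + x) ^ N \<le> C * ((real N / \<beta>) ^ N * exp 1 * exp (\<beta> * x))"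
        by (rule mult_left_mono[OF _ C])
      with bound[OF that] show ?thesis
        by (simp add: mult_ac)
    qed
    moreover have "\<beta> < Re (\<zeta> * u)"
      using \<zeta>(3) \<beta>(1) unfolding \<beta>_def by linarith
    ultimately have "norm (ray_integral z u (\<lambda>t. f t * exp (- \<zeta> * t)))
        \<le> C * (real N / \<beta>) ^ N * exp 1 * exp (norm \<zeta> * norm z) / (Re (\<zeta> * u) - \<beta>)"
      by (intro norm_ray_integral_exp_le[OF S u])
    also have "\<dots> \<le> C * (real N / \<beta>) ^ N * exp 1 * exp (norm z) / \<beta>"
    proof (rule frac_le)
      show "\<beta> \<le> Re (\<zeta> * u) - \<beta>"
        using \<zeta>(3) unfolding \<beta>_def by linarith
      show "C * (real N / \<beta>) ^ N * exp 1 * exp (norm \<zeta> * norm z) \<le> C * (real N / \<beta>) ^ N * exp 1 * exp (norm z)"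
        using C \<beta> \<zeta>(2) by (intro mult_left_mono) (auto simp: mult_left_le_one_le)
    qed (use C \<beta> in auto)
    also have "\<dots> = C' / norm \<zeta> ^ (N + 1)"
      using \<zeta>(1) by (simp add: C'_def \<beta>_def power_divide power_mult_distrib field_simps)
    finally show ?thesis .
  qed
  then show ?thesis
    using that by blast
qed

section \<open>Linearity of integrals over horns\<close>

text \<open>The relational form records existence of the integrals, which linearity and the
  replacement of integrands need; the value \<open>ray_integral\<close> alone does not contain
  it.\<close>

definition has_ray_integral :: "complex \<Rightarrow> complex \<Rightarrow> (complex \<Rightarrow> complex) \<Rightarrow> complex \<Rightarrow> bool" where
  "has_ray_integral z u f l \<longleftrightarrow>
     (\<forall>Y\<ge>0. f contour_integrable_on linepath z (z + u * of_real Y)) \<and>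
     ((\<lambda>Y. contour_integral (linepath z (z + u * of_real Y)) f) \<longlongrightarrow> l) at_top"

definition has_horn_integral ::
  "(real \<Rightarrow> complex) \<Rightarrow> complex \<Rightarrow> complex \<Rightarrow> (complex \<Rightarrow> complex) \<Rightarrow> complex \<Rightarrow> bool" where
  "has_horn_integral c u v f l \<longleftrightarrow> f contour_integrable_on c \<and>
     (\<exists>l1 l2. has_ray_integral (pathstart c) u f l1 \<and> has_ray_integral (pathfinish c) v f l2
        \<and> l = contour_integral c f - l1 + l2)"

lemma ray_integral_unique: "has_ray_integral z u f l \<Longrightarrow> ray_integral z u f = l"
  unfolding has_ray_integral_def ray_integral_def by (auto intro!: tendsto_Lim)

lemma horn_integral_unique: "has_horn_integral c u v f l \<Longrightarrow> horn_integral c u v f = l"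
  unfolding has_horn_integral_def horn_integral_def by (auto simp: ray_integral_unique)

lemma has_ray_integral_add:
  assumes "has_ray_integral z u f l" "has_ray_integral z u g m"
  shows "has_ray_integral z u (\<lambda>t. f t + g t) (l + m)"
  unfolding has_ray_integral_def
proof (intro conjI allI impI)
  show "((\<lambda>Y. contour_integral (linepath z (z + u * of_real Y)) (\<lambda>t. f t + g t)) \<longlongrightarrow> l + m) at_top"
  proof (rule Lim_transform_eventually)
    show "((\<lambda>Y. contour_integral (linepath z (z + u * of_real Y)) f
        + contour_integral (linepath z (z + u * of_real Y)) g) \<longlongrightarrow> l + m) at_top"
      using assms by (intro tendsto_add) (auto simp: has_ray_integral_def)
    show "\<forall>\<^sub>F Y in at_top. contour_integral (linepath z (z + u * of_real Y)) f
        + contour_integral (linepath z (z + u * of_real Y)) g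
        = contour_integral (linepath z (z + u * of_real Y)) (\<lambda>t. f t + g t)"
      using eventually_ge_at_top[of 0]
      by eventually_elim (use assms in \<open>auto simp: has_ray_integral_def contour_integral_add\<close>)
  qed
qed (use assms in \<open>auto simp: has_ray_integral_def contour_integrable_add\<close>)

lemma has_ray_integral_cmult:
  assumes "has_ray_integral z u f l"
  shows "has_ray_integral z u (\<lambda>t. a * f t) (a * l)"
  unfolding has_ray_integral_def
proof (intro conjI allI impI)
  show "((\<lambda>Y. contour_integral (linepath z (z + u * of_real Y)) (\<lambda>t. a * f t)) \<longlongrightarrow> a * l) at_top"
  proof (rule Lim_transform_eventually)
    show "((\<lambda>Y. a * contour_integral (linepath z (z + u * of_real Y)) f) \<longlongrightarrow> a * l) at_top"
      using assms by (intro tendsto_intros) (auto simp: has_ray_integral_def)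
    show "\<forall>\<^sub>F Y in at_top. a * contour_integral (linepath z (z + u * of_real Y)) f
        = contour_integral (linepath z (z + u * of_real Y)) (\<lambda>t. a * f t)"
      using eventually_ge_at_top[of 0]
      by eventually_elim (use assms in \<open>auto simp: has_ray_integral_def contour_integral_lmul\<close>)
  qed
qed (use assms in \<open>auto simp: has_ray_integral_def contour_integrable_lmul\<close>)

lemma has_horn_integral_add:
  assumes "has_horn_integral c u v f l" "has_horn_integral c u v g m"
  shows "has_horn_integral c u v (\<lambda>t. f t + g t) (l + m)"
proof -
  obtain l1 l2 m1 m2 where *: "f contour_integrable_on c" "g contour_integrable_on c"
    "has_ray_integral (pathstart c) u f l1" "has_ray_integral (pathfinish c) v f l2"
    "has_ray_integral (pathstart c) u g m1" "has_ray_integral (pathfinish c) v g m2"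
    "l = contour_integral c f - l1 + l2" "m = contour_integral c g - m1 + m2"
    using assms by (auto simp: has_horn_integral_def)
  then have "has_ray_integral (pathstart c) u (\<lambda>t. f t + g t) (l1 + m1)"
    "has_ray_integral (pathfinish c) v (\<lambda>t. f t + g t) (l2 + m2)"
    "(\<lambda>t. f t + g t) contour_integrable_on c"
    "l + m = contour_integral c (\<lambda>t. f t + g t) - (l1 + m1) + (l2 + m2)"
    by (simp_all add: has_ray_integral_add contour_integrable_add contour_integral_add)
  then show ?thesis
    unfolding has_horn_integral_def by blast
qed

lemma has_horn_integral_cmult:
  assumes "has_horn_integral c u v f l"
  shows "has_horn_integral c u v (\<lambda>t. a * f t) (a * l)"
proof -
  obtain l1 l2 where *: "f contour_integrable_on c"
    "has_ray_integral (pathstart c) u f l1" "has_ray_integral (pathfinish c) v f l2"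
    "l = contour_integral c f - l1 + l2"
    using assms by (auto simp: has_horn_integral_def)
  then have "has_ray_integral (pathstart c) u (\<lambda>t. a * f t) (a * l1)"
    "has_ray_integral (pathfinish c) v (\<lambda>t. a * f t) (a * l2)"
    "(\<lambda>t. a * f t) contour_integrable_on c"
    "a * l = contour_integral c (\<lambda>t. a * f t) - a * l1 + a * l2"
    by (simp_all add: has_ray_integral_cmult contour_integrable_lmul contour_integral_lmul
        right_diff_distrib distrib_left)
  then show ?thesis
    unfolding has_horn_integral_def by blast
qed

lemma has_horn_integral_0: "has_horn_integral c u v (\<lambda>t. 0) 0"
  unfolding has_horn_integral_def has_ray_integral_def
  by (auto intro!: exI[of _ 0] has_contour_integral_integrable[OF has_contour_integral_0])

lemma has_horn_integral_sum:
  assumes "finite K" "\<And>k. k \<in> K \<Longrightarrow> has_horn_integral c u v (f k) (l k)"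
  shows "has_horn_integral c u v (\<lambda>t. \<Sum>k\<in>K. f k t) (\<Sum>k\<in>K. l k)"
  using assms by (induction K rule: finite_induct) (auto intro: has_horn_integral_add has_horn_integral_0)

text \<open>Allows identities between kernels to be integrated although they hold only off the
  poles.\<close>

lemma has_horn_integral_cong:
  assumes "has_horn_integral c u v f l"
    and eq: "\<And>t. t \<in> path_image c \<union> ray (pathstart c) u \<union> ray (pathfinish c) v \<Longrightarrow> f t = g t"
  shows "has_horn_integral c u v g l"
proof -
  have path: "(g has_contour_integral i) p"
    if "(f has_contour_integral i) p"
      "path_image p \<subseteq> path_image c \<union> ray (pathstart c) u \<union> ray (pathfinish c) v" for p i
    by (rule has_contour_integral_eq[OF that(1)]) (use eq that(2) in blast)
  have *: "g contour_integrable_on p \<and> contour_integral p g = contour_integral p f"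
    if "f contour_integrable_on p"
      "path_image p \<subseteq> path_image c \<union> ray (pathstart c) u \<union> ray (pathfinish c) v" for p
    using path[OF has_contour_integral_integral[OF that(1)] that(2)]
    by (auto simp: contour_integral_unique contour_integrable_on_def)
  have ray: "has_ray_integral z w g l"
    if "has_ray_integral z w f l" "z = pathstart c \<and> w = u \<or> z = pathfinish c \<and> w = v" for z w l
  proof -
    have Y: "g contour_integrable_on linepath z (z + w * of_real Y)
        \<and> contour_integral (linepath z (z + w * of_real Y)) g = contour_integral (linepath z (z + w * of_real Y)) f"
      if "Y \<ge> 0" for Y
      by (rule *) (use that closed_segment_ray[OF that, of z w] \<open>has_ray_integral z w f l\<close>
          \<open>_ \<or> _\<close> in \<open>auto simp: has_ray_integral_def\<close>)
    have "\<forall>\<^sub>F Y in at_top. contour_integral (linepath z (z + w * of_real Y)) f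
        = contour_integral (linepath z (z + w * of_real Y)) g"
      using eventually_ge_at_top[of 0] by eventually_elim (simp add: Y)
    then show ?thesis
      using that(1) Y unfolding has_ray_integral_def by (blast intro: Lim_transform_eventually)
  qed
  obtain l1 l2 where l: "f contour_integrable_on c" "has_ray_integral (pathstart c) u f l1"
    "has_ray_integral (pathfinish c) v f l2" "l = contour_integral c f - l1 + l2"
    using assms(1) by (auto simp: has_horn_integral_def)
  have "g contour_integrable_on c" "contour_integral c g = contour_integral c f"
    using *[OF l(1)] by auto
  moreover have "has_ray_integral (pathstart c) u g l1" "has_ray_integral (pathfinish c) v g l2"
    using ray[OF l(2)] ray[OF l(3)] by auto
  ultimately show ?thesis
    using l(4) unfolding has_horn_integral_def by metis
qed

lemma has_horn_integral_exp:
  assumes S: "open S" "f holomorphic_on S" and c: "valid_path c" "path_image c \<subseteq> S"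
    and u: "ray (pathstart c) u \<subseteq> S" "norm u = 1"
      "\<And>x. x \<ge> 0 \<Longrightarrow> norm (f (pathstart c + u * of_real x)) \<le> C * exp (\<beta> * x)" "\<beta> < Re (\<zeta> * u)"
    and v: "ray (pathfinish c) v \<subseteq> S" "norm v = 1"
      "\<And>x. x \<ge> 0 \<Longrightarrow> norm (f (pathfinish c + v * of_real x)) \<le> C' * exp (\<beta>' * x)" "\<beta>' < Re (\<zeta> * v)"
  shows "has_horn_integral c u v (\<lambda>t. f t * exp (- \<zeta> * t)) (horn_integral c u v (\<lambda>t. f t * exp (- \<zeta> * t)))"
proof -
  let ?f = "\<lambda>t. f t * exp (- \<zeta> * t)"
  have hol: "?f holomorphic_on S"
    by (intro holomorphic_intros S)
  have ray: "has_ray_integral z w ?f (ray_integral z w ?f)"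
    if "ray z w \<subseteq> S" "norm w = 1" "\<beta> < Re (\<zeta> * w)"
      "\<And>x. x \<ge> 0 \<Longrightarrow> norm (f (z + w * of_real x)) \<le> C * exp (\<beta> * x)" for z w C \<beta>
    unfolding has_ray_integral_def
  proof (intro conjI allI impI)
    have cont: "continuous_on (ray z w) ?f"
      using hol that(1) by (meson continuous_on_subset holomorphic_on_imp_continuous_on)
    show "?f contour_integrable_on linepath z (z + w * of_real Y)" if "Y \<ge> 0" for Y
      using closed_segment_ray[OF that] cont
      by (intro contour_integrable_continuous_linepath) (rule continuous_on_subset)
    show "((\<lambda>Y. contour_integral (linepath z (z + w * of_real Y)) ?f) \<longlongrightarrow> ray_integral z w ?f) at_top"
      by (rule tendsto_ray_integral[OF cont that(2) _ ray_exp_decay[where f = f and z = z and u = w, OF that(4)]]) (use that(3) in auto)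
  qed
  show ?thesis
    unfolding has_horn_integral_def horn_integral_def
    using contour_integrable_holomorphic_simple[OF hol S(1) c]
      ray[OF u(1,2,4,3)] ray[OF v(1,2,4,3)] by blast
qed

section \<open>The kernel of the G-function\<close>

definition left_poles :: "(nat \<Rightarrow> complex) \<Rightarrow> nat set \<Rightarrow> complex set" where
  "left_poles a I = (\<Union>i\<in>I. range (\<lambda>m::nat. - a i - of_nat m))"

lemma G_left_poles_eq: "G_left_poles a k s = left_poles a {k, s}"
  by (auto simp: G_left_poles_def left_poles_def)

lemma G_right_poles_eq: "G_right_poles p b = (\<Union>i\<in>{1..p}. range (\<lambda>m::nat. 1 - b i + of_nat m))"
  by (auto simp: G_right_poles_def)

text \<open>Two points of one progression coincide as soon as their distance is less than 1, and
  there are finitely many progressions. All subsets are covered because the construction of contours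
  works with partial sets of poles.\<close>

lemma closed_subset_poles:
  assumes "finite I" "T \<subseteq> left_poles a I \<union> G_right_poles p b"
  shows "closed T"
proof -
  have *: "closed (T \<inter> range (\<lambda>m::nat. w + \<epsilon> * of_nat m))" if "\<epsilon> = 1 \<or> \<epsilon> = - 1" for w \<epsilon> :: complex
  proof (rule discrete_imp_closed[of 1], simp, intro ballI impI)
    fix x y assume "x \<in> T \<inter> range (\<lambda>m::nat. w + \<epsilon> * of_nat m)" "y \<in> T \<inter> range (\<lambda>m::nat. w + \<epsilon> * of_nat m)"
      and d: "dist y x < 1"
    then obtain m n :: nat where xy: "x = w + \<epsilon> * of_nat m" "y = w + \<epsilon> * of_nat n"
      by auto
    have "y - x = \<epsilon> * of_int (int n - int m)"
      by (simp add: xy algebra_simps)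
    then have "dist y x = real_of_int \<bar>int n - int m\<bar>"
      using that by (auto simp: dist_norm norm_mult simp del: of_int_diff)
    then have "\<bar>int n - int m\<bar> < 1"
      using d by linarith
    then show "y = x"
      by (simp add: xy)
  qed
  have *: "closed (T \<inter> range (\<lambda>m::nat. w - of_nat m))" "closed (T \<inter> range (\<lambda>m::nat. w + of_nat m))" for w
    using *[of "- 1" w] *[of 1 w] by simp_all
  have "T = T \<inter> (left_poles a I \<union> G_right_poles p b)"
    using assms(2) by blast
  also have "\<dots> = (\<Union>i\<in>I. T \<inter> range (\<lambda>m::nat. - a i - of_nat m))
      \<union> (\<Union>i\<in>{1..p}. T \<inter> range (\<lambda>m::nat. 1 - b i + of_nat m))"
    unfolding left_poles_def G_right_poles_eq Int_Un_distrib Int_UN_distrib by (rule refl)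
  also have "closed \<dots>"
    by (intro closed_Un closed_UN ballI * finite_atLeastAtMost assms(1))
  finally show ?thesis .
qed

lemma exists_contour_poles:
  assumes I: "finite I" and ab: "\<And>i j. i \<in> I \<Longrightarrow> j \<in> {1..p} \<Longrightarrow> b j - a i \<notin> \<nat> - {0}"
  obtains c \<gamma> H where "separating_contour (left_poles a I) (G_right_poles p b) c"
    "pathstart c = Complex \<gamma> (- H)" "pathfinish c = Complex \<gamma> H" "H > H0"
proof -
  let ?A = "left_poles a I" and ?B = "G_right_poles p b"
  \<comment> \<open>All right poles have real part at least \<beta> + 1; the vertical line is placed
    between \<beta> and \<beta> + 1.\<close>
  define \<beta> where "\<beta> = - (\<Sum>j=1..p. norm (b j))"
  define H where "H = \<bar>H0\<bar> + 1 + (\<Sum>i\<in>I. norm (a i)) + (\<Sum>j=1..p. norm (b j))"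
  have na: "norm (a i) \<le> (\<Sum>i\<in>I. norm (a i))" if "i \<in> I" for i
    using that I by (intro member_le_sum) auto
  have nb: "norm (b j) \<le> (\<Sum>j=1..p. norm (b j))" if "j \<in> {1..p}" for j
    using that by (intro member_le_sum) auto
  have cnt: "countable (?A \<union> ?B)"
    using I by (auto simp: left_poles_def G_right_poles_eq intro!: countable_UN countable_finite)
  \<comment> \<open>Countably many left poles cannot meet every vertical line of an open
    strip.\<close>
  have "uncountable ({\<beta><..<\<beta> + 1} - Re ` ?A)"
    using cnt by (intro uncountable_minus_countable uncountable_open_interval[THEN iffD2]) auto
  then obtain \<gamma> where \<gamma>: "\<gamma> < \<beta> + 1" "\<gamma> > \<beta>" "\<gamma> \<notin> Re ` ?A"
    by (metis (no_types, lifting) DiffE countable_empty equals0I greaterThanLessThan_iff)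
  have "\<exists>c. separating_contour ?A ?B c \<and> pathstart c = Complex \<gamma> (- H) \<and> pathfinish c = Complex \<gamma> H"
  proof (rule exists_separating_contour[of ?A ?B H \<gamma>])
    show "?A \<inter> ?B = {}"
    proof -
      have False if "i \<in> I" "j \<in> {1..p}" "- a i - of_nat m = 1 - b j + of_nat n" for i j and m n :: nat
      proof -
        \<comment> \<open>A common point of both sets would make this difference a positive integer,
          which is what definedness of the G-function excludes.\<close>
        have "b j - a i = of_nat (Suc (m + n))"
          using that(3) by (simp add: algebra_simps)
        then have "b j - a i \<in> \<nat> - {0}"
          by (metis Diff_iff of_nat_in_Nats of_nat_neq_0 singletonD)
        then show False
          using ab that by blast
      qed
      then show ?thesis
        unfolding left_poles_def G_right_poles_eq by blast
    qed
    show "closed T" if "T \<subseteq> ?A \<union> ?B" for T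
      using closed_subset_poles[OF I that] .
    show "countable (?A \<union> ?B)" by (rule cnt)
    show "H > 0"
    proof -
      have "0 \<le> (\<Sum>i\<in>I. norm (a i))" "0 \<le> (\<Sum>j=1..p. norm (b j))"
        by (auto intro: sum_nonneg)
      then show ?thesis
        unfolding H_def by linarith
    qed
    show "\<bar>Im w\<bar> < H" if "w \<in> ?A \<union> ?B" for w
    proof -
      have "0 \<le> (\<Sum>i\<in>I. norm (a i))" "0 \<le> (\<Sum>j=1..p. norm (b j))"
        by (auto intro: sum_nonneg)
      moreover from that consider i and m :: nat where "i \<in> I" "w = - a i - of_nat m"
        | j and m :: nat where "j \<in> {1..p}" "w = 1 - b j + of_nat m"
        unfolding left_poles_def G_right_poles_eq by blast
      then have "\<bar>Im w\<bar> \<le> (\<Sum>i\<in>I. norm (a i)) \<or> \<bar>Im w\<bar> \<le> (\<Sum>j=1..p. norm (b j))"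
      proof cases
        case 1
        then show ?thesis
          using na[OF 1(1)] abs_Im_le_cmod[of "a i"] by simp
      next
        case 2
        then show ?thesis
          using nb[OF 2(1)] abs_Im_le_cmod[of "b j"] by simp
      qed
      ultimately show ?thesis
        unfolding H_def by linarith
    qed
    show "\<gamma> < Re w" if w: "w \<in> ?B" for w
    proof -
      obtain j and m :: nat where "j \<in> {1..p}" "w = 1 - b j + of_nat m"
        using w by (auto simp: G_right_poles_eq)
      then show ?thesis
        using \<gamma> nb[of j] complex_Re_le_cmod[of "b j"] by (simp add: \<beta>_def)
    qed
    show "Re w \<noteq> \<gamma>" if "w \<in> ?A" for w
      using \<gamma>(3) that by auto
    show "finite {w \<in> ?A. \<gamma> < Re w}"
    proof (rule finite_subset)
      show "{w \<in> ?A. \<gamma> < Re w} \<subseteq> (\<Union>i\<in>I. (\<lambda>m::nat. - a i - of_nat m) ` {m. real m < - Re (a i) - \<gamma>})"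
        by (auto simp: left_poles_def)
      have "finite {m::nat. real m < x}" for x
        by (rule finite_subset[of _ "{..nat \<lceil>x\<rceil>}"]) (auto simp: le_nat_iff, linarith)
      then show "finite (\<Union>i\<in>I. (\<lambda>m::nat. - a i - of_nat m) ` {m. real m < - Re (a i) - \<gamma>})"
        using I by auto
    qed
  qed blast
  moreover have "H > H0"
  proof -
    have "0 \<le> (\<Sum>i\<in>I. norm (a i))" "0 \<le> (\<Sum>j=1..p. norm (b j))"
      by (auto intro: sum_nonneg)
    then show ?thesis
      unfolding H_def by linarith
  qed
  ultimately show ?thesis
    using that by blast
qed

text \<open>Since \<open>rGamma\<close> is entire, the singularities are right poles only. The
  counterpart with left poles only is \<open>Gamma_ratio'\<close>.\<close>

definition Gamma_ratio :: "nat \<Rightarrow> (nat \<Rightarrow> complex) \<Rightarrow> (nat \<Rightarrow> complex) \<Rightarrow> complex \<Rightarrow> complex" where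
  "Gamma_ratio p a b t = (\<Prod>i=1..p. Gamma (1 - b i - t)) * (\<Prod>i=1..p. rGamma (1 - a i - t))"

definition G_kernel ::
  "nat \<Rightarrow> (nat \<Rightarrow> complex) \<Rightarrow> (nat \<Rightarrow> complex) \<Rightarrow> nat \<Rightarrow> nat \<Rightarrow> complex \<Rightarrow> complex" where
  "G_kernel p a b k s t = Gamma (a k + t) * Gamma (a s + t) * (\<Prod>i=1..p. Gamma (1 - b i - t))
     * (\<Prod>i\<in>{1..p}-{k,s}. rGamma (1 - a i - t))"

lemma G_integrand_eq: "z \<noteq> 0 \<Longrightarrow> G_integrand p a b k s z t = G_kernel p a b k s t * exp (- Ln z * t)"
  by (simp add: G_integrand_def G_kernel_def powr_def divide_inverse rGamma_inverse_Gamma mult_ac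
      flip: prod_inversef)

text \<open>\<open>P H\<close> is a region that shrinks as H grows, so finitely many factors can be
  estimated together on the region of the largest H.\<close>

lemma norm_prod_polynomial_bound:
  fixes f :: "nat \<Rightarrow> complex \<Rightarrow> complex"
  assumes "\<And>i. i \<in> K \<Longrightarrow> \<exists>C N H. C > 0 \<and> H > 0 \<and> (\<forall>t. P H t \<longrightarrow> norm (f i t) \<le> C * (1 + norm t) ^ N)"
    and mono: "\<And>H H' t. H \<le> H' \<Longrightarrow> P H' t \<Longrightarrow> P H t" and "finite K"
  shows "\<exists>C N H. C > (0::real) \<and> H > (0::real) \<and>
    (\<forall>t. P H t \<longrightarrow> norm (\<Prod>i\<in>K. f i t) \<le> C * (1 + norm t) ^ N)"
  using assms(3,1)
proof (induction K rule: finite_induct)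
  case empty
  then show ?case by (auto intro!: exI[of _ "1::real"] exI[of _ "0::nat"])
next
  case (insert i K)
  obtain C1 N1 H1 where 1: "C1 > 0" "H1 > 0" "\<And>t. P H1 t \<Longrightarrow> norm (f i t) \<le> C1 * (1 + norm t) ^ N1"
    using insert.prems by blast
  obtain C2 N2 H2 where 2: "C2 > 0" "H2 > 0"
    "\<And>t. P H2 t \<Longrightarrow> norm (\<Prod>i\<in>K. f i t) \<le> C2 * (1 + norm t) ^ N2"
    using insert.IH insert.prems by blast
  have "norm (f i t * (\<Prod>i\<in>K. f i t)) \<le> C1 * C2 * (1 + norm t) ^ (N1 + N2)" if "P (max H1 H2) t" for t
    using norm_mult_le[OF 1(3)[of t] 2(3)[of t]] mono[OF _ that, of H1] mono[OF _ that, of H2]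
    by (simp add: power_add mult_ac)
  then show ?case
    using insert.hyps 1 2
    by (intro exI[of _ "C1 * C2"] exI[of _ "N1 + N2"] exI[of _ "max H1 H2"]) auto
qed

lemma Gamma_ratio_bound:
  obtains C N H where "C > 0" "H > 0"
    "\<And>t. Re t \<le> - H \<or> \<bar>Im t\<bar> \<ge> H \<Longrightarrow> norm (Gamma_ratio p a b t) \<le> C * (1 + norm t) ^ N"
proof -
  have "\<exists>C N H. C > 0 \<and> H > 0 \<and> (\<forall>t. Re t \<le> - H \<or> \<bar>Im t\<bar> \<ge> H \<longrightarrow>
      norm (\<Prod>i\<in>{1..p}. Gamma (1 - b i - t) * rGamma (1 - a i - t)) \<le> C * (1 + norm t) ^ N)"
  proof (rule norm_prod_polynomial_bound)
    fix i
    obtain C N H where CH: "C > 0" "H > 0" "\<And>t. Re t \<ge> H \<or> \<bar>Im t\<bar> \<ge> H \<Longrightarrow>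
        norm (Gamma (t + (1 - b i)) * rGamma (t + (1 - a i))) \<le> C * (1 + norm t) ^ N"
      by (rule norm_Gamma_quotient[of "1 - b i" "1 - a i"]) blast
    have "norm (Gamma (1 - b i - t) * rGamma (1 - a i - t)) \<le> C * (1 + norm t) ^ N"
      if "Re t \<le> - H \<or> \<bar>Im t\<bar> \<ge> H" for t
      using CH(3)[of "- t"] that by (auto simp: algebra_simps)
    with CH show "\<exists>C N H. C > 0 \<and> H > 0 \<and> (\<forall>t. Re t \<le> - H \<or> \<bar>Im t\<bar> \<ge> H \<longrightarrow>
      norm (Gamma (1 - b i - t) * rGamma (1 - a i - t)) \<le> C * (1 + norm t) ^ N)"
      by blast
  qed auto
  then show ?thesis
    unfolding prod.distrib Gamma_ratio_def [symmetric] using that by blast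
qed

text \<open>Replacing a Gamma factor with left poles by the reflected entire one costs an inverse
  sine. Its size exp (- pi |Im t|) is the source of the exponential decay of the kernels.\<close>

lemma Gamma_mult_Gamma_reflect:
  fixes a t :: complex
  assumes "\<bar>Im (a + t)\<bar> \<ge> 1"
  shows "Gamma (a + t) = of_real pi / sin (of_real pi * (a + t)) * rGamma (1 - a - t)"
    and "norm (of_real pi / sin (of_real pi * (a + t)) :: complex) \<le> 4 * pi * exp (pi * norm a) * exp (- pi * \<bar>Im t\<bar>)"
proof -
  have nz: "sin (of_real pi * (a + t)) \<noteq> 0"
    using exp_le_norm_sin_pi[OF assms] by (metis exp_gt_zero mult_zero_right norm_zero not_le)
  have eq: "sin (of_real pi * (a + t)) = of_real pi * (rGamma (a + t) * rGamma (1 - a - t))"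
    using rGamma_reflection_complex[of "a + t"] by (simp add: diff_diff_eq)
  then show "Gamma (a + t) = of_real pi / sin (of_real pi * (a + t)) * rGamma (1 - a - t)"
    using nz unfolding eq by (auto simp: Gamma_def field_simps)
  have "exp (pi * \<bar>Im t\<bar>) \<le> exp (pi * norm a) * exp (pi * \<bar>Im (a + t)\<bar>)"
    unfolding exp_add [symmetric] exp_le_cancel_iff ring_distribs(1) [symmetric]
    using abs_Im_le_cmod[of a] by (intro mult_left_mono) auto
  also have "\<dots> \<le> exp (pi * norm a) * (4 * norm (sin (of_real pi * (a + t))))"
    by (intro mult_left_mono exp_le_norm_sin_pi assms) auto
  finally show "norm (of_real pi / sin (of_real pi * (a + t)) :: complex)
      \<le> 4 * pi * exp (pi * norm a) * exp (- pi * \<bar>Im t\<bar>)"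
    using nz by (simp add: norm_divide exp_minus field_simps)
qed

text \<open>Reflecting the two factors of index k and s completes the product in the denominator:
  the kernel is a function of polynomial growth times two inverse sines, which yield the rate 2
  pi.\<close>

lemma G_kernel_eq:
  assumes ks: "k \<in> {1..p}" "s \<in> {1..p}" "k \<noteq> s" and Im: "\<bar>Im (a k + t)\<bar> \<ge> 1" "\<bar>Im (a s + t)\<bar> \<ge> 1"
  shows "G_kernel p a b k s t = of_real pi / sin (of_real pi * (a k + t))
    * (of_real pi / sin (of_real pi * (a s + t))) * Gamma_ratio p a b t"
proof -
  have "{1..p} = insert k (insert s ({1..p} - {k, s}))"
    using ks by auto
  then have "(\<Prod>i=1..p. rGamma (1 - a i - t)) = (\<Prod>i\<in>insert k (insert s ({1..p} - {k, s})). rGamma (1 - a i - t))"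
    by simp
  also have "\<dots> = rGamma (1 - a k - t) * (rGamma (1 - a s - t) * (\<Prod>i\<in>{1..p} - {k, s}. rGamma (1 - a i - t)))"
    using ks by (subst prod.insert; simp)+
  finally show ?thesis
    unfolding G_kernel_def Gamma_ratio_def Gamma_mult_Gamma_reflect(1)[OF Im(1)]
      Gamma_mult_Gamma_reflect(1)[OF Im(2)] by (simp add: mult_ac)
qed

lemma G_kernel_bound:
  assumes ks: "k \<in> {1..p}" "s \<in> {1..p}" "k \<noteq> s"
  obtains C N H where "C > 0" "H > 0"
    "\<And>t. \<bar>Im t\<bar> \<ge> H \<Longrightarrow> norm (G_kernel p a b k s t) \<le> C * (1 + norm t) ^ N * exp (- 2 * pi * \<bar>Im t\<bar>)"
proof -
  obtain C N H where CH: "C > 0" "H > 0"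
    "\<And>t. Re t \<le> - H \<or> \<bar>Im t\<bar> \<ge> H \<Longrightarrow> norm (Gamma_ratio p a b t) \<le> C * (1 + norm t) ^ N"
    by (rule Gamma_ratio_bound[of p a b]) blast
  define H' where "H' = H + 1 + norm (a k) + norm (a s)"
  define E where "E i = 4 * pi * exp (pi * norm (a i))" for i
  have "norm (G_kernel p a b k s t) \<le> E k * E s * C * (1 + norm t) ^ N * exp (- 2 * pi * \<bar>Im t\<bar>)"
    if t: "\<bar>Im t\<bar> \<ge> H'" for t
  proof -
    have Im: "\<bar>Im (a k + t)\<bar> \<ge> 1" "\<bar>Im (a s + t)\<bar> \<ge> 1" "\<bar>Im t\<bar> \<ge> H"
      using t CH(2) abs_Im_le_cmod[of "a k"] abs_Im_le_cmod[of "a s"] norm_ge_zero[of "a k"] norm_ge_zero[of "a s"]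
      unfolding H'_def plus_complex.sel by linarith+
    have "norm (G_kernel p a b k s t) \<le> (E k * exp (- pi * \<bar>Im t\<bar>)) * (E s * exp (- pi * \<bar>Im t\<bar>)) * (C * (1 + norm t) ^ N)"
      unfolding G_kernel_eq[OF ks Im(1,2)] E_def
      by (intro norm_mult_le Gamma_mult_Gamma_reflect(2) Im CH(3)) (use Im in auto)
    also have "exp (- 2 * pi * \<bar>Im t\<bar>) = exp (- pi * \<bar>Im t\<bar>) * exp (- pi * \<bar>Im t\<bar>)"
      by (simp flip: exp_add)
    then have "(E k * exp (- pi * \<bar>Im t\<bar>)) * (E s * exp (- pi * \<bar>Im t\<bar>)) * (C * (1 + norm t) ^ N)
        = E k * E s * C * (1 + norm t) ^ N * exp (- 2 * pi * \<bar>Im t\<bar>)"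
      by (simp only: mult_ac)
    finally show ?thesis .
  qed
  moreover have "E k * E s * C > 0" "H' > 0"
    using CH by (auto simp: E_def H'_def add_pos_nonneg)
  ultimately show ?thesis
    using that[of "E k * E s * C" H' N] by blast
qed

lemma Gamma_holomorphic_off_left_poles:
  assumes "i \<in> I"
  shows "(\<lambda>t. Gamma (a i + t)) holomorphic_on - (left_poles a I \<union> B)"
proof (rule holomorphic_Gamma')
  fix t assume t: "t \<in> - (left_poles a I \<union> B)"
  show "a i + t \<notin> \<int>\<^sub>\<le>\<^sub>0"
  proof
    assume "a i + t \<in> \<int>\<^sub>\<le>\<^sub>0"
    then obtain n :: nat where "a i + t = - of_nat n"
      by (auto elim: nonpos_Ints_cases')
    then have "t = - of_nat n - a i"
      by (metis add_diff_cancel_left')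
    then have "t = - a i - of_nat n"
      by simp
    then have "t \<in> left_poles a I"
      using assms unfolding left_poles_def by blast
    then show False
      using t by blast
  qed
qed (intro holomorphic_intros)

lemma Gamma_holomorphic_off_right_poles:
  assumes "i \<in> {1..p}"
  shows "(\<lambda>t. Gamma (1 - b i - t)) holomorphic_on - (A \<union> G_right_poles p b)"
proof (rule holomorphic_Gamma')
  fix t assume t: "t \<in> - (A \<union> G_right_poles p b)"
  show "1 - b i - t \<notin> \<int>\<^sub>\<le>\<^sub>0"
  proof
    assume "1 - b i - t \<in> \<int>\<^sub>\<le>\<^sub>0"
    then obtain n :: nat where "1 - b i - t = - of_nat n"
      by (auto elim: nonpos_Ints_cases')
    then have "t = 1 - b i + of_nat n"
      by (simp add: algebra_simps)
    then have "t \<in> G_right_poles p b"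
      using assms unfolding G_right_poles_eq by blast
    then show False
      using t by blast
  qed
qed (intro holomorphic_intros)

lemma G_kernel_holomorphic:
  assumes "k \<in> I" "s \<in> I"
  shows "G_kernel p a b k s holomorphic_on - (left_poles a I \<union> G_right_poles p b)"
  unfolding G_kernel_def[abs_def]
  by (intro holomorphic_on_mult holomorphic_on_prod Gamma_holomorphic_off_left_poles
      Gamma_holomorphic_off_right_poles holomorphic_rGamma' holomorphic_intros assms)

text \<open>The gap between \<alpha>' and \<alpha> absorbs the polynomial.\<close>

lemma ray_exp_bound:
  fixes f :: "complex \<Rightarrow> complex" and z u :: complex
  assumes u: "norm u = 1" and C: "C \<ge> 0" and \<alpha>: "\<alpha>' < \<alpha>"
    and bound: "\<And>x. x \<ge> 0 \<Longrightarrow>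
      norm (f (z + u * of_real x)) \<le> C * (1 + norm (z + u * of_real x)) ^ N * exp (- \<alpha> * x)"
  obtains C' where "\<And>x. x \<ge> 0 \<Longrightarrow> norm (f (z + u * of_real x)) \<le> C' * exp (- \<alpha>' * x)"
proof -
  define \<beta> where "\<beta> = \<alpha> - \<alpha>'"
  define K where "K = (real N / \<beta>) ^ N * exp \<beta>"
  have "norm (f (z + u * of_real x)) \<le> C * (1 + norm z) ^ N * K * exp (- \<alpha>' * x)" if x: "x \<ge> 0" for x
  proof -
    have "norm (z + u * of_real x) \<le> norm z + x"
      using norm_triangle_ineq[of z "u * of_real x"] u x by (simp add: norm_mult)
    then have "1 + norm (z + u * of_real x) \<le> (1 + norm z) * (1 + x)"
      using mult_nonneg_nonneg[OF norm_ge_zero[of z] x] unfolding ring_distribs mult_1_left mult_1_right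
      by linarith
    then have "(1 + norm (z + u * of_real x)) ^ N \<le> ((1 + norm z) * (1 + x)) ^ N"
      by (intro power_mono) auto
    also have "\<dots> = (1 + norm z) ^ N * (1 + x) ^ N"
      by (rule power_mult_distrib)
    also have "\<dots> \<le> (1 + norm z) ^ N * (K * exp (\<beta> * x))"
      unfolding K_def using power_le_exp[OF x, of \<beta> N] \<alpha> by (intro mult_left_mono) (auto simp: \<beta>_def)
    finally have "C * (1 + norm (z + u * of_real x)) ^ N * exp (- \<alpha> * x)
        \<le> C * ((1 + norm z) ^ N * (K * exp (\<beta> * x))) * exp (- \<alpha> * x)"
      using C by (intro mult_right_mono mult_left_mono) auto
    also have "\<dots> = C * (1 + norm z) ^ N * K * (exp (\<beta> * x) * exp (- \<alpha> * x))"
      by (simp only: mult_ac)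
    also have "exp (\<beta> * x) * exp (- \<alpha> * x) = exp (- \<alpha>' * x)"
      unfolding exp_add [symmetric] by (simp add: \<beta>_def algebra_simps)
    finally show ?thesis
      using bound[OF x] by linarith
  qed
  then show ?thesis
    using that by blast
qed

text \<open>The constants satisfy pi < 5 and 1/2 + 5 - 2 pi < - 1/2: the imaginary part of the
  principal logarithm is at most pi in modulus, and a rate of 1/2 pays for the polynomial.\<close>

lemma strip_exp_decay:
  assumes C: "C \<ge> 0" and \<zeta>: "\<bar>Im \<zeta>\<bar> \<le> 5"
    and bound: "\<And>t. \<bar>Im t\<bar> \<ge> H \<Longrightarrow> norm (f t) \<le> C * (1 + norm t) ^ N * exp (- 2 * pi * \<bar>Im t\<bar>)"
  shows "\<exists>C. \<forall>t. x \<le> Re t \<longrightarrow> Re t \<le> y \<longrightarrow> \<bar>Im t\<bar> \<ge> H \<longrightarrow>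
    norm (f t * exp (- \<zeta> * t)) \<le> C * exp (- (1/2) * \<bar>Im t\<bar>)"
proof -
  define m where "m = \<bar>x\<bar> + \<bar>y\<bar>"
  define K where "K = (real N / (1/2)) ^ N * exp (1/2)"
  define C' where "C' = C * (1 + m) ^ N * K * exp (norm \<zeta> * m)"
  have "norm (f t * exp (- \<zeta> * t)) \<le> C' * exp (- (1/2) * \<bar>Im t\<bar>)"
    if t: "x \<le> Re t" "Re t \<le> y" "\<bar>Im t\<bar> \<ge> H" for t
  proof -
    have m: "m \<ge> 0" "\<bar>Re t\<bar> \<le> m"
      using t by (auto simp: m_def)
    have "1 + norm t \<le> (1 + m) * (1 + \<bar>Im t\<bar>)"
      using cmod_le[of t] m mult_nonneg_nonneg[OF m(1) abs_ge_zero[of "Im t"]]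
      unfolding ring_distribs mult_1_left mult_1_right by linarith
    then have "(1 + norm t) ^ N \<le> ((1 + m) * (1 + \<bar>Im t\<bar>)) ^ N"
      by (intro power_mono) auto
    also have "\<dots> = (1 + m) ^ N * (1 + \<bar>Im t\<bar>) ^ N"
      by (rule power_mult_distrib)
    also have "\<dots> \<le> (1 + m) ^ N * (K * exp (1/2 * \<bar>Im t\<bar>))"
      unfolding K_def using m by (intro mult_left_mono power_le_exp) auto
    finally have "C * (1 + norm t) ^ N * exp (- 2 * pi * \<bar>Im t\<bar>)
        \<le> C * ((1 + m) ^ N * (K * exp (1/2 * \<bar>Im t\<bar>))) * exp (- 2 * pi * \<bar>Im t\<bar>)"
      using C by (intro mult_right_mono mult_left_mono) auto
    then have f: "norm (f t) \<le> C * ((1 + m) ^ N * (K * exp (1/2 * \<bar>Im t\<bar>))) * exp (- 2 * pi * \<bar>Im t\<bar>)"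
      using bound[OF t(3)] by linarith
    have "norm (exp (- \<zeta> * t)) \<le> exp (norm \<zeta> * m) * exp (5 * \<bar>Im t\<bar>)"
    proof -
      have "- (Re \<zeta> * Re t) \<le> norm \<zeta> * m"
        using mult_mono[OF abs_Re_le_cmod[of \<zeta>] m(2)] by (simp add: abs_mult [symmetric] abs_le_iff)
      moreover have "Im \<zeta> * Im t \<le> 5 * \<bar>Im t\<bar>"
        using mult_right_mono[OF \<zeta> abs_ge_zero[of "Im t"]] by (simp add: abs_mult [symmetric] abs_le_iff)
      ultimately have "Re (- \<zeta> * t) \<le> norm \<zeta> * m + 5 * \<bar>Im t\<bar>"
        by simp
      then show ?thesis
        unfolding norm_exp_eq_Re exp_add [symmetric] by (simp only: exp_le_cancel_iff)
    qed
    then have "norm (f t * exp (- \<zeta> * t)) \<le> (C * ((1 + m) ^ N * (K * exp (1/2 * \<bar>Im t\<bar>))) * exp (- 2 * pi * \<bar>Im t\<bar>))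
        * (exp (norm \<zeta> * m) * exp (5 * \<bar>Im t\<bar>))"
      by (rule norm_mult_le[OF f])
    also have "\<dots> = C' * exp (1/2 * \<bar>Im t\<bar> + - 2 * pi * \<bar>Im t\<bar> + 5 * \<bar>Im t\<bar>)"
      unfolding exp_add C'_def by (simp only: mult_ac)
    also have "\<dots> \<le> C' * exp (- (1/2) * \<bar>Im t\<bar>)"
    proof (intro mult_left_mono)
      have "3 * \<bar>Im t\<bar> \<le> pi * \<bar>Im t\<bar>"
        using pi_gt3 by (intro mult_right_mono) auto
      then have "1/2 * \<bar>Im t\<bar> + - 2 * pi * \<bar>Im t\<bar> + 5 * \<bar>Im t\<bar> \<le> - (1/2) * \<bar>Im t\<bar>"
        by linarith
      then show "exp (1/2 * \<bar>Im t\<bar> + - 2 * pi * \<bar>Im t\<bar> + 5 * \<bar>Im t\<bar>) \<le> exp (- (1/2) * \<bar>Im t\<bar>)"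
        by (simp only: exp_le_cancel_iff)
      show "C' \<ge> 0"
        using C m by (simp add: C'_def K_def)
    qed
    finally show ?thesis .
  qed
  then show ?thesis by blast
qed

text \<open>
  The end points lie outside the strip \<open>\<bar>Im t\<bar> \<le> H0\<close> so that the bounds for the kernels, which hold
  for large \<open>\<bar>Im t\<bar>\<close> only, apply on the whole rays.
\<close>

definition poles_contour ::
  "nat \<Rightarrow> (nat \<Rightarrow> complex) \<Rightarrow> (nat \<Rightarrow> complex) \<Rightarrow> nat set \<Rightarrow> real \<Rightarrow> (real \<Rightarrow> complex) \<Rightarrow> bool" where
  "poles_contour p a b I H0 c \<longleftrightarrow> separating_contour (left_poles a I) (G_right_poles p b) c \<and>
     (\<exists>\<gamma> H. pathstart c = Complex \<gamma> (- H) \<and> pathfinish c = Complex \<gamma> H \<and> H > H0)"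

lemma exists_poles_contour:
  assumes "finite I" "\<And>i j. i \<in> I \<Longrightarrow> j \<in> {1..p} \<Longrightarrow> b j - a i \<notin> \<nat> - {0}"
  shows "\<exists>c. poles_contour p a b I H0 c"
  using exists_contour_poles[of I p b a H0, OF assms] unfolding poles_contour_def by metis

lemma poles_contour_rays:
  assumes "poles_contour p a b I H0 c"
  shows "ray (pathfinish c) \<i> \<subseteq> - (left_poles a I \<union> G_right_poles p b)"
    "ray (pathstart c) (- \<i>) \<subseteq> - (left_poles a I \<union> G_right_poles p b)"
proof -
  have sep: "separating_contour (left_poles a I) (G_right_poles p b) c"
    using assms by (simp add: poles_contour_def)
  have "Im t \<ge> Im (pathfinish c)" if "t \<in> ray (pathfinish c) \<i>" for t
    using that by (auto simp: ray_def)
  then show "ray (pathfinish c) \<i> \<subseteq> - (left_poles a I \<union> G_right_poles p b)"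
    using separating_contourD(4)[OF sep] by (meson ComplI leD subsetI)
  have "Im t \<le> Im (pathstart c)" if "t \<in> ray (pathstart c) (- \<i>)" for t
    using that by (auto simp: ray_def)
  then show "ray (pathstart c) (- \<i>) \<subseteq> - (left_poles a I \<union> G_right_poles p b)"
    using separating_contourD(3)[OF sep] by (meson ComplI leD subsetI)
qed

text \<open>The rate 2 pi of the kernel exceeds 6, so the integral converges in a strip that
  contains the range of the principal logarithm. The set I may contain further indices, so that
  several kernels can share one contour.\<close>

lemma G_kernel_horn:
  assumes ks: "k \<in> {1..p}" "s \<in> {1..p}" "k \<noteq> s" and I: "k \<in> I" "s \<in> I" "finite I"
  obtains H0 where
    "\<And>c. poles_contour p a b I H0 c \<Longrightarrow>
      (\<lambda>\<zeta>. horn_integral c (- \<i>) \<i> (\<lambda>t. G_kernel p a b k s t * exp (- \<zeta> * t))) holomorphic_on {\<zeta>. \<bar>Im \<zeta>\<bar> < 6}"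
    "\<And>c \<zeta>. poles_contour p a b I H0 c \<Longrightarrow> \<bar>Im \<zeta>\<bar> < 6 \<Longrightarrow>
      has_horn_integral c (- \<i>) \<i> (\<lambda>t. G_kernel p a b k s t * exp (- \<zeta> * t))
        (horn_integral c (- \<i>) \<i> (\<lambda>t. G_kernel p a b k s t * exp (- \<zeta> * t)))"
proof -
  let ?S = "- (left_poles a I \<union> G_right_poles p b)" and ?g = "G_kernel p a b k s"
  obtain C N H where CH: "C > 0" "H > 0"
    "\<And>t. \<bar>Im t\<bar> \<ge> H \<Longrightarrow> norm (?g t) \<le> C * (1 + norm t) ^ N * exp (- 2 * pi * \<bar>Im t\<bar>)"
    by (rule G_kernel_bound[OF ks, of a b]) blast
  have S: "open ?S" "?g holomorphic_on ?S"
    using open_Compl[OF closed_subset_poles[OF I(3) order_refl]] G_kernel_holomorphic[OF I(1,2)] by blast+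
  have pi6: "6 < 2 * pi"
    using pi_gt3 by simp
  have *: "\<exists>C1 C2. valid_path c \<and> path_image c \<subseteq> ?S \<and> ray (pathstart c) (- \<i>) \<subseteq> ?S \<and> ray (pathfinish c) \<i> \<subseteq> ?S
     \<and> (\<forall>x\<ge>0. norm (?g (pathstart c + - \<i> * of_real x)) \<le> C1 * exp (- 6 * x))
     \<and> (\<forall>x\<ge>0. norm (?g (pathfinish c + \<i> * of_real x)) \<le> C2 * exp (- 6 * x))"
    if c: "poles_contour p a b I H c" for c
  proof -
    obtain \<gamma> H' where H': "pathstart c = Complex \<gamma> (- H')" "pathfinish c = Complex \<gamma> H'" "H' > H"
      and sep: "separating_contour (left_poles a I) (G_right_poles p b) c"
      using c by (auto simp: poles_contour_def)
    have "norm (?g t) \<le> C * (1 + norm t) ^ N * exp (- (2 * pi) * x)"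
      if "\<bar>Im t\<bar> = H' + x" "x \<ge> 0" for t x
    proof -
      have "norm (?g t) \<le> C * (1 + norm t) ^ N * exp (- 2 * pi * \<bar>Im t\<bar>)"
        by (rule CH(3)) (use that H' in linarith)
      also have "\<dots> \<le> C * (1 + norm t) ^ N * exp (- (2 * pi) * x)"
        using that H'(3) CH(1,2) by (intro mult_left_mono) auto
      finally show ?thesis .
    qed
    then have b: "norm (?g (pathstart c + - \<i> * of_real x))
          \<le> C * (1 + norm (pathstart c + - \<i> * of_real x)) ^ N * exp (- (2 * pi) * x)"
        "norm (?g (pathfinish c + \<i> * of_real x))
          \<le> C * (1 + norm (pathfinish c + \<i> * of_real x)) ^ N * exp (- (2 * pi) * x)" if "x \<ge> 0" for x
      using that H' CH(2) by (simp_all)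
    obtain C1 where "\<And>x. x \<ge> 0 \<Longrightarrow> norm (?g (pathstart c + - \<i> * of_real x)) \<le> C1 * exp (- 6 * x)"
      by (rule ray_exp_bound[OF _ less_imp_le[OF CH(1)] pi6 b(1)]) auto
    moreover obtain C2 where "\<And>x. x \<ge> 0 \<Longrightarrow> norm (?g (pathfinish c + \<i> * of_real x)) \<le> C2 * exp (- 6 * x)"
      by (rule ray_exp_bound[OF _ less_imp_le[OF CH(1)] pi6 b(2)]) auto
    moreover have "valid_path c" "path_image c \<subseteq> ?S"
      using separating_contourD[OF sep] by auto
    ultimately show ?thesis
      using poles_contour_rays[OF c] by blast
  qed
  show ?thesis
  proof (rule that[of H])
    fix c assume "poles_contour p a b I H c"
    then obtain C1 C2 where c: "valid_path c" "path_image c \<subseteq> ?S" "ray (pathstart c) (- \<i>) \<subseteq> ?S"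
      "ray (pathfinish c) \<i> \<subseteq> ?S"
      "\<And>x. x \<ge> 0 \<Longrightarrow> norm (?g (pathstart c + - \<i> * of_real x)) \<le> C1 * exp (- 6 * x)"
      "\<And>x. x \<ge> 0 \<Longrightarrow> norm (?g (pathfinish c + \<i> * of_real x)) \<le> C2 * exp (- 6 * x)"
      using * by blast
    have "(\<lambda>\<zeta>. horn_integral c (- \<i>) \<i> (\<lambda>t. ?g t * exp (- \<zeta> * t)))
        holomorphic_on {\<zeta>. - 6 < Re (\<zeta> * - \<i>) \<and> - 6 < Re (\<zeta> * \<i>)}"
      by (rule horn_integral_exp_holomorphic[OF S c(1,2,3) _ c(5) c(4) _ c(6)]) auto
    moreover have "{\<zeta>. - 6 < Re (\<zeta> * - \<i>) \<and> - 6 < Re (\<zeta> * \<i>)} = {\<zeta>. \<bar>Im \<zeta>\<bar> < 6}"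
      by auto
    ultimately show "(\<lambda>\<zeta>. horn_integral c (- \<i>) \<i> (\<lambda>t. ?g t * exp (- \<zeta> * t))) holomorphic_on {\<zeta>. \<bar>Im \<zeta>\<bar> < 6}"
      by simp
    fix \<zeta> :: complex assume \<zeta>: "\<bar>Im \<zeta>\<bar> < 6"
    show "has_horn_integral c (- \<i>) \<i> (\<lambda>t. ?g t * exp (- \<zeta> * t))
        (horn_integral c (- \<i>) \<i> (\<lambda>t. ?g t * exp (- \<zeta> * t)))"
      by (rule has_horn_integral_exp[OF S c(1,2,3) _ c(5) _ c(4) _ c(6)]) (use \<zeta> in auto)
  qed
qed

text \<open>The contour chosen in the definition separates the left poles of the indices k and s.
  One that keeps left poles of more indices on its left separates these as well, hence gives the
  same value.\<close>

lemma meijer_G_eq_horn_integral: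
  assumes ks: "k \<in> {1..p}" "s \<in> {1..p}" "k \<noteq> s" and I: "k \<in> I" "s \<in> I" "finite I"
    and df: "meijer_G_defined p a b k s" and c: "poles_contour p a b I H c" and z: "z \<noteq> 0"
  shows "meijer_G p a b k s z =
    1 / (2 * of_real pi * \<i>) * horn_integral c (- \<i>) \<i> (\<lambda>t. G_kernel p a b k s t * exp (- Ln z * t))"
proof -
  let ?A = "left_poles a {k, s}" and ?B = "G_right_poles p b"
  let ?f = "\<lambda>t. G_kernel p a b k s t * exp (- Ln z * t)"
  define c0 where "c0 = (SOME c. separating_contour ?A ?B c)"
  have "\<exists>c. separating_contour ?A ?B c"
    using exists_poles_contour[of "{k, s}" p b a 0] df unfolding poles_contour_def meijer_G_defined_def by blast
  then have c0: "separating_contour ?A ?B c0"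
    unfolding c0_def by (rule someI_ex)
  have c': "separating_contour ?A ?B c"
    using c I by (auto simp: poles_contour_def left_poles_def intro: separating_contour_subset)
  have cl: "closed (?A \<union> ?B)"
    by (rule closed_subset_poles[of "{k, s}"]) auto
  have hol: "?f holomorphic_on - (?A \<union> ?B)"
    by (intro holomorphic_intros G_kernel_holomorphic) auto
  obtain C N H where CH: "C > 0" "H > 0"
    "\<And>t. \<bar>Im t\<bar> \<ge> H \<Longrightarrow> norm (G_kernel p a b k s t) \<le> C * (1 + norm t) ^ N * exp (- 2 * pi * \<bar>Im t\<bar>)"
    by (rule G_kernel_bound[OF ks, of a b]) blast
  have "\<bar>Im (Ln z)\<bar> \<le> 5"
    using Im_Ln_le_pi[OF z] mpi_less_Im_Ln[OF z] pi_less_4 by (auto simp: abs_le_iff)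
  then have decay: "\<exists>C. \<forall>t. x \<le> Re t \<longrightarrow> Re t \<le> y \<longrightarrow> \<bar>Im t\<bar> \<ge> H \<longrightarrow> norm (?f t) \<le> C * exp (- (1/2) * \<bar>Im t\<bar>)" for x y
    by (rule strip_exp_decay[OF less_imp_le[OF CH(1)] _ CH(3)])
  have half: "(1/2::real) > 0" by simp
  have "mb_integral c0 ?f = mb_integral c ?f" "mb_integral c ?f = horn_integral c (- \<i>) \<i> ?f"
    using mb_integral_separating_contour_eq(1)[OF cl hol c0 c' half decay]
      mb_integral_separating_contour_eq(2)[OF cl hol c' c' half decay] by auto
  moreover have "G_integrand p a b k s z = ?f"
    using G_integrand_eq[OF z] by blast
  ultimately show ?thesis
    by (simp add: meijer_G_def G_left_poles_eq c0_def)
qed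

section \<open>Taylor coefficients of the G-function at z = 1\<close>

lemma power_series_unique:
  fixes a b :: "nat \<Rightarrow> complex"
  assumes "r > 0" "\<And>w. norm w < r \<Longrightarrow> (\<lambda>n. a n * w ^ n) sums f w"
    and "\<And>w. norm w < r \<Longrightarrow> (\<lambda>n. b n * w ^ n) sums f w"
  shows "a = b"
proof -
  have rad: "fps_conv_radius (Abs_fps c) > 0" if "\<And>w. norm w < r \<Longrightarrow> summable (\<lambda>n. c n * w ^ n)"
    for c :: "nat \<Rightarrow> complex"
  proof -
    have "norm (of_real (r / 2) :: complex) \<le> conv_radius c"
      by (rule conv_radius_geI) (use that[of "of_real (r / 2)"] assms(1) in simp)
    then show ?thesis
      using assms(1) by (simp add: fps_conv_radius_def) (metis ereal_less(2) half_gt_zero less_le_trans)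
  qed
  have "Abs_fps a = Abs_fps b"
  proof (rule eval_fps_eqD)
    show "fps_conv_radius (Abs_fps a) > 0" "fps_conv_radius (Abs_fps b) > 0"
      by (rule rad, use assms in \<open>force simp: sums_iff\<close>)+
    have "\<forall>\<^sub>F w in nhds 0. w \<in> ball (0::complex) r"
      using assms(1) by (intro eventually_nhds_in_open) auto
    then show "\<forall>\<^sub>F w in nhds 0. eval_fps (Abs_fps a) w = eval_fps (Abs_fps b) w"
      by eventually_elim (use assms in \<open>auto simp: eval_fps_def sums_iff\<close>)
  qed
  then show ?thesis
    by (metis fps_nth_Abs_fps ext)
qed

text \<open>The logarithm maps the disc |1 - z| < 1 into the strip of convergence, so the function
  on the right is holomorphic in the disc and has a Taylor series. Uniqueness of power series
  identifies its coefficients with the definite description.\<close>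

lemma D_coeff_sums:
  assumes ks: "k \<in> {1..p}" "s \<in> {1..p}" "k \<noteq> s" and df: "meijer_G_defined p a b k s"
    and z: "norm (1 - z) < 1"
  shows "(\<lambda>n. D_coeff p a b k s n * (1 - z) ^ n) sums (meijer_G p a b k s z * z powr (- a s))"
proof -
  obtain H0 where H0: "\<And>c. poles_contour p a b {k, s} H0 c \<Longrightarrow>
      (\<lambda>\<zeta>. horn_integral c (- \<i>) \<i> (\<lambda>t. G_kernel p a b k s t * exp (- \<zeta> * t))) holomorphic_on {\<zeta>. \<bar>Im \<zeta>\<bar> < 6}"
    by (rule G_kernel_horn[OF ks, of "{k, s}" a b]) auto
  obtain c where c: "poles_contour p a b {k, s} H0 c"
    using exists_poles_contour[of "{k, s}" p b a H0] df unfolding meijer_G_defined_def by blast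
  define M where "M \<zeta> = horn_integral c (- \<i>) \<i> (\<lambda>t. G_kernel p a b k s t * exp (- \<zeta> * t))" for \<zeta>
  define F where "F z = 1 / (2 * of_real pi * \<i>) * M (Ln z) * exp (- a s * Ln z)" for z
  have Re: "Re z > 0" if "norm (1 - z) < 1" for z
    using that complex_Re_le_cmod[of "1 - z"] by simp
  have G: "meijer_G p a b k s z * z powr (- a s) = F z" if "norm (1 - z) < 1" for z
  proof -
    have "z \<noteq> 0"
      using that by auto
    then show ?thesis
      using meijer_G_eq_horn_integral[OF ks _ _ _ df c, of z]
      by (simp add: F_def M_def powr_def)
  qed
  have hol: "F holomorphic_on ball 1 1"
  proof -
    have nonpos: "z \<notin> \<real>\<^sub>\<le>\<^sub>0" if "z \<in> ball 1 1" for z :: complex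
      using Re[of z] that by (auto simp: dist_norm complex_nonpos_Reals_iff)
    then have Ln: "Ln holomorphic_on ball 1 1"
      by (intro holomorphic_on_Ln) auto
    have "(M \<circ> Ln) holomorphic_on ball 1 1"
    proof (rule holomorphic_on_compose_gen[OF Ln])
      show "M holomorphic_on {\<zeta>. \<bar>Im \<zeta>\<bar> < 6}"
        unfolding M_def using H0[OF c] .
      show "Ln ` ball 1 1 \<subseteq> {\<zeta>. \<bar>Im \<zeta>\<bar> < 6}"
      proof safe
        fix z :: complex assume "z \<in> ball 1 1"
        then have "z \<noteq> 0"
          using nonpos by force
        then show "\<bar>Im (Ln z)\<bar> < 6"
          using Im_Ln_le_pi[of z] mpi_less_Im_Ln[of z] pi_less_4 by (auto simp: abs_less_iff)
      qed
    qed
    then show ?thesis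
      unfolding F_def comp_def by (intro holomorphic_intros Ln)
  qed
  \<comment> \<open>The sign converts powers of z - 1 into powers of 1 - z.\<close>
  define d where "d n = (- 1) ^ n * ((deriv ^^ n) F 1 / fact n)" for n
  have sums: "(\<lambda>n. d n * (1 - z) ^ n) sums F z" if "norm (1 - z) < 1" for z
  proof -
    have "(\<lambda>n. (deriv ^^ n) F 1 / fact n * (z - 1) ^ n) sums F z"
      by (rule holomorphic_power_series[OF hol]) (use that in \<open>simp add: dist_norm\<close>)
    moreover have "d n * (1 - z) ^ n = (deriv ^^ n) F 1 / fact n * (z - 1) ^ n" for n
    proof -
      have "(z - 1) ^ n = (- 1) ^ n * (1 - z) ^ n"
        by (simp flip: power_mult_distrib)
      then show ?thesis
        by (simp add: d_def)
    qed
    ultimately show ?thesis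
      by simp
  qed
  have "D_coeff p a b k s = d"
    unfolding D_coeff_def
  proof (rule the_equality)
    show "\<forall>z. norm (1 - z) < 1 \<longrightarrow> summable (\<lambda>n. d n * (1 - z) ^ n) \<and>
        meijer_G p a b k s z = z powr a s * (\<Sum>n. d n * (1 - z) ^ n)"
    proof (intro allI impI conjI)
      fix z :: complex assume z: "norm (1 - z) < 1"
      then have "z \<noteq> 0" by auto
      then show "meijer_G p a b k s z = z powr a s * (\<Sum>n. d n * (1 - z) ^ n)"
        using sums[OF z] G[OF z] by (simp add: sums_iff powr_minus field_simps)
      show "summable (\<lambda>n. d n * (1 - z) ^ n)"
        using sums[OF z] by (simp add: sums_iff)
    qed
    fix d' assume d': "\<forall>z. norm (1 - z) < 1 \<longrightarrow> summable (\<lambda>n. d' n * (1 - z) ^ n) \<and>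
        meijer_G p a b k s z = z powr a s * (\<Sum>n. d' n * (1 - z) ^ n)"
    show "d' = d"
    proof (rule power_series_unique[of 1])
      fix w :: complex assume w: "norm w < 1"
      then have "(1 - w) \<noteq> 0" by auto
      then show "(\<lambda>n. d' n * w ^ n) sums F (1 - w)"
        using d'[rule_format, of "1 - w"] G[of "1 - w"] w by (simp add: sums_iff powr_minus field_simps)
      show "(\<lambda>n. d n * w ^ n) sums F (1 - w)"
        using sums[of "1 - w"] w by simp
    qed simp
  qed
  then show ?thesis
    using sums[OF z] G[OF z] by simp
qed


section \<open>The three-term relation\<close>

text \<open>Newton's binomial series; the quotient of \<open>falling_fact x j\<close> and
  \<open>fact j\<close> is the generalized binomial coefficient.\<close>

lemma one_minus_powr_sums:
  fixes w x :: complex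
  assumes "norm w < 1"
  shows "(\<lambda>j. (- 1) ^ j / fact j * falling_fact x j * w ^ j) sums (1 - w) powr x"
proof -
  have "(\<lambda>j. (x gchoose j) * (- w) ^ j) sums (1 + - w) powr x"
    by (rule gen_binomial_complex) (use assms in simp)
  moreover have "(x gchoose j) * (- w) ^ j = (- 1) ^ j / fact j * falling_fact x j * w ^ j" for j
    by (simp add: gbinomial_prod_rev falling_fact_def atLeast0LessThan power_minus[of w])
  ultimately show ?thesis
    by simp
qed

lemma power_series_mult_sums:
  fixes A B :: "nat \<Rightarrow> complex"
  assumes A: "\<And>w. norm w < 1 \<Longrightarrow> (\<lambda>n. A n * w ^ n) sums f w"
    and B: "\<And>w. norm w < 1 \<Longrightarrow> (\<lambda>n. B n * w ^ n) sums g w"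
    and w: "norm w < 1"
  shows "(\<lambda>n. (\<Sum>j=0..n. A j * B (n - j)) * w ^ n) sums (f w * g w)"
proof -
  define r where "r = complex_of_real ((1 + norm w) / 2)"
  have r: "norm r < 1" "norm w < norm r"
    using w by (auto simp: r_def norm_of_real abs_of_nonneg simp del: of_real_divide of_real_add)
  have "summable (\<lambda>n. norm (A n * w ^ n))" "summable (\<lambda>n. norm (B n * w ^ n))"
    using powser_insidea[OF _ r(2)] A[OF r(1)] B[OF r(1)] by (auto simp: sums_iff)
  from Cauchy_product_sums[OF this]
  have "(\<lambda>n. \<Sum>j\<le>n. (A j * w ^ j) * (B (n - j) * w ^ (n - j))) sums (f w * g w)"
    using A[OF w] B[OF w] by (simp add: sums_iff)
  moreover have "(\<Sum>j\<le>n. (A j * w ^ j) * (B (n - j) * w ^ (n - j))) = (\<Sum>j=0..n. A j * B (n - j)) * w ^ n" for n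
  proof -
    have "(A j * w ^ j) * (B (n - j) * w ^ (n - j)) = A j * B (n - j) * w ^ n" if "j \<in> {..n}" for j
    proof -
      have "w ^ j * w ^ (n - j) = w ^ n"
        using that by (simp flip: power_add)
      then show ?thesis
        by (metis mult.assoc mult.left_commute)
    qed
    then show ?thesis
      unfolding sum_distrib_right atLeast0AtMost by (intro sum.cong refl)
  qed
  ultimately show ?thesis
    by simp
qed

text \<open>The trigonometric core of the three-term relation; it also drives the induction for the
  partial fractions.\<close>

lemma sin_cyclic:
  fixes u v w :: complex
  shows "sin (u - v) * sin w + sin (v - w) * sin u + sin (w - u) * sin v = 0"
  by (simp add: sin_diff algebra_simps)

lemma rGamma_one_minus:
  fixes x t :: complex
  assumes "x + t \<notin> \<int>\<^sub>\<le>\<^sub>0"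
  shows "rGamma (1 - x - t) = Gamma (x + t) * (sin (of_real pi * (x + t)) / of_real pi)"
proof -
  have "rGamma (x + t) * rGamma (1 - x - t) = sin (of_real pi * (x + t)) / of_real pi"
    using rGamma_reflection_complex[of "x + t"] by (simp add: diff_diff_eq)
  moreover have "rGamma (x + t) \<noteq> 0"
    using assms by (simp add: rGamma_eq_zero_iff)
  ultimately show ?thesis
    by (simp add: Gamma_def field_simps)
qed

lemma not_left_pole:
  assumes "t \<notin> left_poles a I" "i \<in> I"
  shows "a i + t \<notin> \<int>\<^sub>\<le>\<^sub>0"
proof
  assume "a i + t \<in> \<int>\<^sub>\<le>\<^sub>0"
  then obtain n :: nat where "a i + t = - of_nat n"
    by (auto elim: nonpos_Ints_cases')
  then have "t = - of_nat n - a i"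
    by (metis add_diff_cancel_left')
  then have "t = - a i - of_nat n"
    by simp
  then show False
    using assms unfolding left_poles_def by blast
qed

text \<open>Exhibits a factor that is symmetric in s, i and k. The kernels of the three pairs differ
  only in the sine of the index that is missing from the pair.\<close>

lemma G_kernel_third:
  assumes "k \<in> {1..p}" "k \<notin> {s, i}" "a k + t \<notin> \<int>\<^sub>\<le>\<^sub>0"
  shows "G_kernel p a b s i t = Gamma (a s + t) * Gamma (a i + t) * Gamma (a k + t) * (\<Prod>j=1..p. Gamma (1 - b j - t))
    * (\<Prod>j\<in>{1..p}-{s,i,k}. rGamma (1 - a j - t)) / of_real pi * sin (of_real pi * (a k + t))"
proof -
  have eq: "{1..p} - {s, i} = insert k ({1..p} - {s, i, k})"
    using assms by auto
  have "(\<Prod>j\<in>{1..p}-{s,i}. rGamma (1 - a j - t)) = rGamma (1 - a k - t) * (\<Prod>j\<in>{1..p}-{s,i,k}. rGamma (1 - a j - t))"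
    unfolding eq by (subst prod.insert) auto
  then show ?thesis
    using rGamma_one_minus[OF assms(3)] by (simp add: G_kernel_def mult_ac)
qed

lemma meijer_G_three_term:
  assumes p: "s \<in> {1..p}" "i \<in> {1..p}" "k \<in> {1..p}" and ne: "s \<noteq> i" "i \<noteq> k" "k \<noteq> s"
    and df: "meijer_G_defined p a b s i" "meijer_G_defined p a b i k" "meijer_G_defined p a b k s"
    and z: "z \<noteq> 0"
  shows "sin (of_real pi * (a s - a i)) * meijer_G p a b s i z
    + sin (of_real pi * (a i - a k)) * meijer_G p a b i k z
    + sin (of_real pi * (a k - a s)) * meijer_G p a b k s z = 0"
proof -
  let ?I = "{s, i, k}"
  let ?g = "\<lambda>k s t. G_kernel p a b k s t * exp (- Ln z * t)"
  obtain H1 where H1: "\<And>c \<zeta>. poles_contour p a b ?I H1 c \<Longrightarrow> \<bar>Im \<zeta>\<bar> < 6 \<Longrightarrow>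
      has_horn_integral c (- \<i>) \<i> (\<lambda>t. G_kernel p a b s i t * exp (- \<zeta> * t))
        (horn_integral c (- \<i>) \<i> (\<lambda>t. G_kernel p a b s i t * exp (- \<zeta> * t)))"
    by (rule G_kernel_horn[OF p(1,2) ne(1), of ?I a b]) auto
  obtain H2 where H2: "\<And>c \<zeta>. poles_contour p a b ?I H2 c \<Longrightarrow> \<bar>Im \<zeta>\<bar> < 6 \<Longrightarrow>
      has_horn_integral c (- \<i>) \<i> (\<lambda>t. G_kernel p a b i k t * exp (- \<zeta> * t))
        (horn_integral c (- \<i>) \<i> (\<lambda>t. G_kernel p a b i k t * exp (- \<zeta> * t)))"
    by (rule G_kernel_horn[OF p(2,3) ne(2), of ?I a b]) auto
  obtain H3 where H3: "\<And>c \<zeta>. poles_contour p a b ?I H3 c \<Longrightarrow> \<bar>Im \<zeta>\<bar> < 6 \<Longrightarrow>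
      has_horn_integral c (- \<i>) \<i> (\<lambda>t. G_kernel p a b k s t * exp (- \<zeta> * t))
        (horn_integral c (- \<i>) \<i> (\<lambda>t. G_kernel p a b k s t * exp (- \<zeta> * t)))"
    by (rule G_kernel_horn[OF p(3,1) ne(3), of ?I a b]) auto
  define H0 where "H0 = max H1 (max H2 H3)"
  have "\<exists>c. poles_contour p a b ?I H0 c"
    by (rule exists_poles_contour) (use df in \<open>auto simp: meijer_G_defined_def\<close>)
  then obtain c where c: "poles_contour p a b ?I H0 c"
    by blast
  then have c123: "poles_contour p a b ?I H1 c" "poles_contour p a b ?I H2 c" "poles_contour p a b ?I H3 c"
    by (auto simp: poles_contour_def H0_def)
  have z6: "\<bar>Im (Ln z)\<bar> < 6"
    using Im_Ln_le_pi[OF z] mpi_less_Im_Ln[OF z] pi_less_4 by (auto simp: abs_less_iff)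
  let ?h = "\<lambda>k s. horn_integral c (- \<i>) \<i> (?g k s)"
  have "has_horn_integral c (- \<i>) \<i> (\<lambda>t. sin (of_real pi * (a s - a i)) * ?g s i t
      + sin (of_real pi * (a i - a k)) * ?g i k t + sin (of_real pi * (a k - a s)) * ?g k s t)
      (sin (of_real pi * (a s - a i)) * ?h s i
      + sin (of_real pi * (a i - a k)) * ?h i k + sin (of_real pi * (a k - a s)) * ?h k s)"
    by (intro has_horn_integral_add has_horn_integral_cmult H1[OF c123(1) z6] H2[OF c123(2) z6] H3[OF c123(3) z6])
  \<comment> \<open>Once the symmetric factor is pulled out, the weights turn the integrand into an
    instance of \<open>sin_cyclic\<close>, so it vanishes on the common contour.\<close>
  then have "has_horn_integral c (- \<i>) \<i> (\<lambda>t. 0)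
      (sin (of_real pi * (a s - a i)) * ?h s i
      + sin (of_real pi * (a i - a k)) * ?h i k + sin (of_real pi * (a k - a s)) * ?h k s)"
  proof (rule has_horn_integral_cong)
    fix t assume "t \<in> path_image c \<union> ray (pathstart c) (- \<i>) \<union> ray (pathfinish c) \<i>"
    then have "t \<notin> left_poles a ?I"
      using poles_contour_rays[OF c] c separating_contourD(5)[of "left_poles a ?I" "G_right_poles p b" c t]
      unfolding poles_contour_def by blast
    then have np: "a s + t \<notin> \<int>\<^sub>\<le>\<^sub>0" "a i + t \<notin> \<int>\<^sub>\<le>\<^sub>0" "a k + t \<notin> \<int>\<^sub>\<le>\<^sub>0"
      using not_left_pole by blast+
    define T where "T = Gamma (a s + t) * Gamma (a i + t) * Gamma (a k + t) * (\<Prod>j=1..p. Gamma (1 - b j - t))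
      * (\<Prod>j\<in>{1..p}-{s,i,k}. rGamma (1 - a j - t)) / of_real pi"
    have "{1..p} - {i, k, s} = {1..p} - {s, i, k}" "{1..p} - {k, s, i} = {1..p} - {s, i, k}"
      by auto
    then have "G_kernel p a b s i t = T * sin (of_real pi * (a k + t))"
      "G_kernel p a b i k t = T * sin (of_real pi * (a s + t))"
      "G_kernel p a b k s t = T * sin (of_real pi * (a i + t))"
      using G_kernel_third[of k p s i a t b] G_kernel_third[of s p i k a t b] G_kernel_third[of i p k s a t b]
        np p ne by (simp_all add: T_def mult_ac)
    then have "sin (of_real pi * (a s - a i)) * ?g s i t
      + sin (of_real pi * (a i - a k)) * ?g i k t + sin (of_real pi * (a k - a s)) * ?g k s t
      = T * exp (- Ln z * t) * (sin (of_real pi * (a s + t) - of_real pi * (a i + t)) * sin (of_real pi * (a k + t))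
        + sin (of_real pi * (a i + t) - of_real pi * (a k + t)) * sin (of_real pi * (a s + t))
        + sin (of_real pi * (a k + t) - of_real pi * (a s + t)) * sin (of_real pi * (a i + t)))"
      by (simp add: ring_distribs)
    then show "sin (of_real pi * (a s - a i)) * ?g s i t
      + sin (of_real pi * (a i - a k)) * ?g i k t + sin (of_real pi * (a k - a s)) * ?g k s t = 0"
      by (simp only: sin_cyclic mult_zero_right)
  qed
  from horn_integral_unique[OF this] horn_integral_unique[OF has_horn_integral_0]
  have "sin (of_real pi * (a s - a i)) * ?h s i
      + sin (of_real pi * (a i - a k)) * ?h i k + sin (of_real pi * (a k - a s)) * ?h k s = 0"
    by (simp only:)
  moreover have "meijer_G p a b s i z = 1 / (2 * of_real pi * \<i>) * ?h s i"
    "meijer_G p a b i k z = 1 / (2 * of_real pi * \<i>) * ?h i k"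
    "meijer_G p a b k s z = 1 / (2 * of_real pi * \<i>) * ?h k s"
    by (rule meijer_G_eq_horn_integral; use p ne df c z in auto)+
  moreover have "x * (q * h) + x' * (q * h') + x'' * (q * h'') = q * (x * h + x' * h' + x'' * h'')"
    for x x' x'' h h' h'' q :: complex
    by (simp add: algebra_simps)
  ultimately show ?thesis
    by (simp only: mult_zero_right)
qed

text \<open>Multiplying the generating function of D by the power of z that was split off recovers G
  itself, and the binomial series of this power produces the falling factorials. The claim is the
  three-term relation of the G-functions, compared coefficient by coefficient in 1 - z.\<close>

lemma D_coeff_three_term:
  assumes p: "s \<in> {1..p}" "i \<in> {1..p}" "k \<in> {1..p}" and ne: "s \<noteq> i" "i \<noteq> k" "k \<noteq> s"
    and df: "meijer_G_defined p a b s i" "meijer_G_defined p a b i k" "meijer_G_defined p a b k s"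
  shows "(\<Sum>j=0..n. (-1) ^ j / fact j *
           (falling_fact (a i) j * sin (of_real pi * (a s - a i)) * D_coeff p a b s i (n - j)
            + falling_fact (a k) j * sin (of_real pi * (a i - a k)) * D_coeff p a b i k (n - j)
            + falling_fact (a s) j * sin (of_real pi * (a k - a s)) * D_coeff p a b k s (n - j))) = 0"
proof -
  define A where "A x j = (- 1) ^ j / fact j * falling_fact x j" for x :: complex and j
  define E where "E k s n = (\<Sum>j=0..n. A (a s) j * D_coeff p a b k s (n - j))" for k s n
  have E: "(\<lambda>n. E k s n * w ^ n) sums meijer_G p a b k s (1 - w)"
    if "k \<in> {1..p}" "s \<in> {1..p}" "k \<noteq> s" "meijer_G_defined p a b k s" "norm w < 1" for k s w
  proof -
    have "(\<lambda>n. E k s n * w ^ n) sums ((1 - w) powr a s * (meijer_G p a b k s (1 - w) * (1 - w) powr (- a s)))"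
      unfolding E_def
    proof (rule power_series_mult_sums)
      show "(\<lambda>n. A (a s) n * w ^ n) sums (1 - w) powr a s" if "norm w < 1" for w
        unfolding A_def by (rule one_minus_powr_sums[OF that])
      show "(\<lambda>n. D_coeff p a b k s n * w ^ n) sums (meijer_G p a b k s (1 - w) * (1 - w) powr (- a s))"
        if "norm w < 1" for w
        using D_coeff_sums[OF \<open>k \<in> _\<close> \<open>s \<in> _\<close> \<open>k \<noteq> s\<close> \<open>meijer_G_defined p a b k s\<close>, of "1 - w"] that by simp
    qed fact
    moreover have "1 - w \<noteq> 0"
      using that by auto
    ultimately show ?thesis
      by (simp add: powr_minus field_simps)
  qed
  have "(\<lambda>n. sin (of_real pi * (a s - a i)) * E s i n + sin (of_real pi * (a i - a k)) * E i k n
      + sin (of_real pi * (a k - a s)) * E k s n) = (\<lambda>n. 0)"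
  proof (rule power_series_unique[of 1 _ "\<lambda>_. 0"])
    fix w :: complex assume w: "norm w < 1"
    have "(\<lambda>n. sin (of_real pi * (a s - a i)) * (E s i n * w ^ n) + sin (of_real pi * (a i - a k)) * (E i k n * w ^ n)
      + sin (of_real pi * (a k - a s)) * (E k s n * w ^ n)) sums
      (sin (of_real pi * (a s - a i)) * meijer_G p a b s i (1 - w)
      + sin (of_real pi * (a i - a k)) * meijer_G p a b i k (1 - w)
      + sin (of_real pi * (a k - a s)) * meijer_G p a b k s (1 - w))"
      by (intro sums_add sums_mult E p ne df w)
    moreover have "1 - w \<noteq> 0"
      using w by auto
    ultimately show "(\<lambda>n. (sin (of_real pi * (a s - a i)) * E s i n + sin (of_real pi * (a i - a k)) * E i k n
      + sin (of_real pi * (a k - a s)) * E k s n) * w ^ n) sums 0"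
      using meijer_G_three_term[OF p ne df, of "1 - w"] by (simp add: algebra_simps)
  qed auto
  then have "sin (of_real pi * (a s - a i)) * E s i n + sin (of_real pi * (a i - a k)) * E i k n
      + sin (of_real pi * (a k - a s)) * E k s n = 0"
    by meson
  then show ?thesis
    by (simp add: E_def A_def sum_distrib_left distrib_left sum.distrib mult_ac)
qed

section \<open>Partial fractions of products of sines\<close>

lemma sin_mult_sin_shift:
  fixes A B D :: complex
  shows "sin A * sin B = sin (A + B - D) * sin D + sin (A - D) * sin (B - D)"
proof -
  have "A + B - D - D = A - D + (B - D)" "A + B - D + D = A + B" "A - D - (B - D) = A - B"
    by simp_all
  then show ?thesis
    by (simp only: sin_times_sin) (simp add: field_simps)
qed

text \<open>Divided by the product of the sines over K this is an expansion with simple poles at x =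
  - \<alpha> k. The surplus factor of the numerator leaves a sine where rational partial fractions
  would leave a linear polynomial. The induction removes one index from each of K and J.\<close>

lemma sin_partial_fractions:
  fixes \<alpha> \<beta> :: "nat \<Rightarrow> complex"
  assumes "finite K" "finite J" "card J = card K + 1"
    and "\<And>i k. i \<in> K \<Longrightarrow> k \<in> K \<Longrightarrow> i \<noteq> k \<Longrightarrow> sin (\<alpha> i - \<alpha> k) \<noteq> 0"
  shows "(\<Prod>j\<in>J. sin (\<beta> j + x)) = sin (x + (\<Sum>j\<in>J. \<beta> j) - (\<Sum>k\<in>K. \<alpha> k)) * (\<Prod>k\<in>K. sin (\<alpha> k + x))
    + (\<Sum>k\<in>K. (\<Prod>j\<in>J. sin (\<beta> j - \<alpha> k)) / (\<Prod>i\<in>K-{k}. sin (\<alpha> i - \<alpha> k)) * (\<Prod>i\<in>K-{k}. sin (\<alpha> i + x)))"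
  using assms
proof (induction K arbitrary: J x rule: finite_induct)
  case empty
  then obtain j where "J = {j}"
    by (auto simp: card_1_singleton_iff)
  then show ?case
    by (simp add: add.commute)
next
  case (insert k0 K)
  obtain j0 where j0: "j0 \<in> J"
    using insert.prems(2) by (metis add_is_0 all_not_in_conv card.empty zero_neq_one)
  define J0 where "J0 = J - {j0}"
  have J: "J = insert j0 J0" "j0 \<notin> J0" "finite J0" "card J0 = card K + 1"
    using j0 insert by (auto simp: J0_def)
  let ?\<alpha> = "\<alpha> k0" and ?\<beta> = "\<beta> j0"
  define \<sigma> where "\<sigma> = (\<Sum>j\<in>J0. \<beta> j) - (\<Sum>k\<in>K. \<alpha> k)"
  define S where "S k = (\<Prod>j\<in>J0. sin (\<beta> j - \<alpha> k)) / (\<Prod>i\<in>K-{k}. sin (\<alpha> i - \<alpha> k))" for k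
  define P where "P x = (\<Prod>k\<in>K. sin (\<alpha> k + x))" for x
  define Pk where "Pk k x = (\<Prod>i\<in>K-{k}. sin (\<alpha> i + x))" for k x
  have P: "P x = sin (\<alpha> k + x) * Pk k x" if "k \<in> K" for k x
    unfolding P_def Pk_def using insert.hyps(1) that by (rule prod.remove)
  have nz: "sin (?\<alpha> - \<alpha> k) \<noteq> 0" "sin (\<alpha> k - ?\<alpha>) \<noteq> 0" if "k \<in> K" for k
    using insert.prems(3)[of k0 k] insert.prems(3)[of k k0] insert.hyps(2) that by auto
  have IH: "(\<Prod>j\<in>J0. sin (\<beta> j + x)) = sin (x + \<sigma>) * P x + (\<Sum>k\<in>K. S k * Pk k x)" for x
    using insert.IH[OF J(3,4), of x] insert.prems(3) unfolding \<sigma>_def S_def P_def Pk_def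
    by (simp add: add_diff_eq)
  have P0: "P (- ?\<alpha>) \<noteq> 0"
    using nz(2) insert.hyps(1) by (auto simp: P_def)
  \<comment> \<open>The coefficient at the new pole, obtained from the induction hypothesis
    evaluated there.\<close>
  have S0: "(\<Prod>j\<in>J0. sin (\<beta> j - ?\<alpha>)) / P (- ?\<alpha>) = sin (\<sigma> - ?\<alpha>) + (\<Sum>k\<in>K. S k / sin (\<alpha> k - ?\<alpha>))"
  proof -
    have "S k * Pk k (- ?\<alpha>) / P (- ?\<alpha>) = S k / sin (\<alpha> k - ?\<alpha>)" if "k \<in> K" for k
      using P[OF that, of "- ?\<alpha>"] P0 nz(2)[OF that] by (auto simp: field_simps)
    then have "(\<Sum>k\<in>K. S k * Pk k (- ?\<alpha>)) / P (- ?\<alpha>) = (\<Sum>k\<in>K. S k / sin (\<alpha> k - ?\<alpha>))"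
      by (simp add: sum_divide_distrib)
    then show ?thesis
      using IH[of "- ?\<alpha>"] P0 by (simp add: add_divide_distrib)
  qed
  have coeff: "(\<Prod>j\<in>J. sin (\<beta> j - \<alpha> k)) / (\<Prod>i\<in>insert k0 K-{k}. sin (\<alpha> i - \<alpha> k)) * (\<Prod>i\<in>insert k0 K-{k}. sin (\<alpha> i + x))
      = sin (?\<beta> - \<alpha> k) / sin (?\<alpha> - \<alpha> k) * sin (?\<alpha> + x) * (S k * Pk k x)" if "k \<in> K" for k
  proof -
    have "insert k0 K - {k} = insert k0 (K - {k})" "k0 \<notin> K - {k}" "finite (K - {k})"
      using that insert.hyps by auto
    then show ?thesis
      using J by (simp add: S_def Pk_def)
  qed
  \<comment> \<open>The cyclic identity distributes the new numerator factor over the old pole and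
    the new one.\<close>
  have step: "sin (?\<beta> + x) * (S k * Pk k x) = sin (?\<beta> - \<alpha> k) / sin (?\<alpha> - \<alpha> k) * sin (?\<alpha> + x) * (S k * Pk k x)
      + sin (?\<beta> - ?\<alpha>) * (S k / sin (\<alpha> k - ?\<alpha>)) * P x" if "k \<in> K" for k
  proof -
    have "sin (?\<beta> - ?\<alpha>) * sin (\<alpha> k + x) + sin (?\<alpha> - \<alpha> k) * sin (?\<beta> + x) + sin (\<alpha> k - ?\<beta>) * sin (?\<alpha> + x) = 0"
      using sin_cyclic[of "?\<beta> + x" "?\<alpha> + x" "\<alpha> k + x"] by simp
    moreover have "sin (\<alpha> k - ?\<beta>) = - sin (?\<beta> - \<alpha> k)" "sin (\<alpha> k - ?\<alpha>) = - sin (?\<alpha> - \<alpha> k)"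
      using sin_minus[of "?\<beta> - \<alpha> k"] sin_minus[of "?\<alpha> - \<alpha> k"] by simp_all
    ultimately have "sin (?\<beta> + x) = sin (?\<beta> - \<alpha> k) / sin (?\<alpha> - \<alpha> k) * sin (?\<alpha> + x)
        + sin (?\<beta> - ?\<alpha>) / sin (\<alpha> k - ?\<alpha>) * sin (\<alpha> k + x)"
      using nz[OF that] by (simp add: field_simps)
    then show ?thesis
      unfolding P[OF that] by (simp add: algebra_simps)
  qed
  have "(\<Prod>j\<in>J. sin (\<beta> j + x)) = sin (?\<beta> + x) * (sin (x + \<sigma>) * P x + (\<Sum>k\<in>K. S k * Pk k x))"
    using J IH[of x] by simp
  also have "\<dots> = (sin (x + \<sigma>) * sin (?\<beta> + x)) * P x + (\<Sum>k\<in>K. sin (?\<beta> + x) * (S k * Pk k x))"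
    by (simp add: algebra_simps sum_distrib_left)
  also have "(\<Sum>k\<in>K. sin (?\<beta> + x) * (S k * Pk k x))
      = (\<Sum>k\<in>K. sin (?\<beta> - \<alpha> k) / sin (?\<alpha> - \<alpha> k) * sin (?\<alpha> + x) * (S k * Pk k x))
        + sin (?\<beta> - ?\<alpha>) * (\<Sum>k\<in>K. S k / sin (\<alpha> k - ?\<alpha>)) * P x"
    unfolding sum_distrib_left sum_distrib_right sum.distrib [symmetric]
    by (intro sum.cong refl step)
  also have "sin (x + \<sigma>) * sin (?\<beta> + x) = sin (x + \<sigma> + ?\<beta> - ?\<alpha>) * sin (?\<alpha> + x) + sin (\<sigma> - ?\<alpha>) * sin (?\<beta> - ?\<alpha>)"
    using sin_mult_sin_shift[of "x + \<sigma>" "?\<beta> + x" "?\<alpha> + x"] by (simp add: algebra_simps)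
  also have "(sin (x + \<sigma> + ?\<beta> - ?\<alpha>) * sin (?\<alpha> + x) + sin (\<sigma> - ?\<alpha>) * sin (?\<beta> - ?\<alpha>)) * P x
      + ((\<Sum>k\<in>K. sin (?\<beta> - \<alpha> k) / sin (?\<alpha> - \<alpha> k) * sin (?\<alpha> + x) * (S k * Pk k x))
        + sin (?\<beta> - ?\<alpha>) * (\<Sum>k\<in>K. S k / sin (\<alpha> k - ?\<alpha>)) * P x)
    = sin (x + \<sigma> + ?\<beta> - ?\<alpha>) * (sin (?\<alpha> + x) * P x)
      + (sin (?\<beta> - ?\<alpha>) * (sin (\<sigma> - ?\<alpha>) + (\<Sum>k\<in>K. S k / sin (\<alpha> k - ?\<alpha>))) * P x
      + (\<Sum>k\<in>K. sin (?\<beta> - \<alpha> k) / sin (?\<alpha> - \<alpha> k) * sin (?\<alpha> + x) * (S k * Pk k x)))"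
    by (simp add: algebra_simps)
  also have "sin (?\<beta> - ?\<alpha>) * (sin (\<sigma> - ?\<alpha>) + (\<Sum>k\<in>K. S k / sin (\<alpha> k - ?\<alpha>))) * P x
      = (\<Prod>j\<in>J. sin (\<beta> j - ?\<alpha>)) / (\<Prod>i\<in>insert k0 K-{k0}. sin (\<alpha> i - ?\<alpha>)) * (\<Prod>i\<in>insert k0 K-{k0}. sin (\<alpha> i + x))"
    unfolding S0 [symmetric] using insert.hyps(2) J by (simp add: P_def)
  also have "(\<Sum>k\<in>K. sin (?\<beta> - \<alpha> k) / sin (?\<alpha> - \<alpha> k) * sin (?\<alpha> + x) * (S k * Pk k x))
      = (\<Sum>k\<in>K. (\<Prod>j\<in>J. sin (\<beta> j - \<alpha> k)) / (\<Prod>i\<in>insert k0 K-{k}. sin (\<alpha> i - \<alpha> k)) * (\<Prod>i\<in>insert k0 K-{k}. sin (\<alpha> i + x)))"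
    by (intro sum.cong refl coeff [symmetric])
  also have "x + \<sigma> + ?\<beta> - ?\<alpha> = x + (\<Sum>j\<in>J. \<beta> j) - (\<Sum>k\<in>insert k0 K. \<alpha> k)"
    using J insert.hyps by (simp add: \<sigma>_def)
  also have "sin (?\<alpha> + x) * P x = (\<Prod>k\<in>insert k0 K. sin (\<alpha> k + x))"
    using insert.hyps by (simp add: P_def)
  finally show ?case
    using insert.hyps by simp
qed

lemma sin_pi_eq_0_iff: "sin (of_real pi * x :: complex) = 0 \<longleftrightarrow> x \<in> \<int>"
proof
  assume "sin (of_real pi * x) = 0"
  then obtain n :: int where "of_real pi * x = of_real (n * pi)"
    unfolding sin_eq_0 by blast
  then have "x = of_int n"
    by simp
  then show "x \<in> \<int>" by simp
next
  assume "x \<in> \<int>"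
  then obtain n :: int where "x = of_int n"
    by (auto elim: Ints_cases)
  then show "sin (of_real pi * x) = 0"
    unfolding sin_eq_0 by (intro exI[of _ n]) simp
qed

section \<open>Kernels on a common contour\<close>

definition Gamma_ratio' :: "nat \<Rightarrow> (nat \<Rightarrow> complex) \<Rightarrow> (nat \<Rightarrow> complex) \<Rightarrow> complex \<Rightarrow> complex" where
  "Gamma_ratio' p a b t = (\<Prod>i=1..p. Gamma (a i + t)) * (\<Prod>i=1..p. rGamma (b i + t))"

text \<open>At t = - a s - m the exponential equals (-1)^m and cancels the alternating sign of the
  residues of Gamma, so closing to the left gives a series in z instead of - z. In return, decay
  survives at one vertical end only, which \<sigma> selects: the upper one for 1 and the lower one
  for -1.\<close>

definition F_kernel ::
  "nat \<Rightarrow> (nat \<Rightarrow> complex) \<Rightarrow> (nat \<Rightarrow> complex) \<Rightarrow> nat \<Rightarrow> real \<Rightarrow> complex \<Rightarrow> complex" where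
  "F_kernel p a b s \<sigma> t = Gamma (a s + t) * (\<Prod>i=1..p. Gamma (1 - b i - t))
     * (\<Prod>i\<in>{1..p}-{s}. rGamma (1 - a i - t)) * exp (of_real \<sigma> * \<i> * (of_real pi * (a s + t)))"

definition residue_weight :: "nat \<Rightarrow> (nat \<Rightarrow> complex) \<Rightarrow> (nat \<Rightarrow> complex) \<Rightarrow> nat \<Rightarrow> nat \<Rightarrow> complex" where
  "residue_weight p a b s k =
     (\<Prod>i=1..p. sin (of_real pi * (b i - a k))) / (\<Prod>i\<in>{1..p}-{k,s}. sin (of_real pi * (a i - a k)))"

text \<open>Origin of the phase in the kernel identity: subtracting this exponential multiple leaves
  exactly the factor sin \<theta> that completes \<open>Gamma_ratio\<close>.\<close>

lemma sin_add_minus_exp: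
  fixes \<theta> \<psi> :: complex
  assumes "\<sigma> = 1 \<or> \<sigma> = - 1"
  shows "sin (\<theta> + \<psi>) - sin \<psi> * exp (of_real \<sigma> * \<i> * \<theta>) = sin \<theta> * exp (- of_real \<sigma> * \<i> * \<psi>)"
proof -
  have E: "exp (\<i> * x) = cos x + \<i> * sin x" for x :: complex
    by (rule exp_Euler)
  have E': "exp (- (\<i> * x)) = cos x - \<i> * sin x" for x :: complex
    using exp_Euler[of "- x"] by simp
  from assms show ?thesis
    by (elim disjE; simp add: sin_add E E'; simp add: algebra_simps)
qed

text \<open>
  Up to constants, the weighted kernels of the G-functions and the kernel of the hypergeometric
  function add up to a difference of two quotients, one with poles on the left only and one with
  poles on the right only. The choice of \<open>\<sigma>\<close> decides on which side of the real axis of \<open>ln z\<close> the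
  integral of \<open>F_kernel\<close> converges.
\<close>

lemma kernel_identity:
  assumes s: "s \<in> {1..p}" and \<sigma>: "\<sigma> = 1 \<or> \<sigma> = - 1" and \<psi>: "psi a b p \<notin> \<int>"
    and a: "\<And>i k. i \<in> {1..p} - {s} \<Longrightarrow> k \<in> {1..p} - {s} \<Longrightarrow> i \<noteq> k \<Longrightarrow> a i - a k \<notin> \<int>"
    and t: "t \<notin> left_poles a {1..p} \<union> G_right_poles p b"
  shows "1 / (of_real pi * sin (of_real pi * psi a b p))
      * (\<Sum>k\<in>{1..p}-{s}. residue_weight p a b s k * G_kernel p a b k s t) + F_kernel p a b s \<sigma> t
    = of_real pi / sin (of_real pi * psi a b p)
      * (Gamma_ratio' p a b t - exp (- of_real \<sigma> * \<i> * (of_real pi * psi a b p)) * Gamma_ratio p a b t)"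
proof -
  let ?K = "{1..p} - {s}" and ?\<pi> = "of_real pi :: complex"
  define \<psi> where "\<psi> = ?\<pi> * psi a b p"
  define \<theta> where "\<theta> = ?\<pi> * (a s + t)"
  \<comment> \<open>By reflection every kernel is T times sines and exponentials, which makes the
    identity purely trigonometric.\<close>
  define T where "T = (\<Prod>i=1..p. Gamma (a i + t)) * (\<Prod>i=1..p. Gamma (1 - b i - t))"
  define sa where "sa i = sin (?\<pi> * (a i + t))" for i
  define sb where "sb i = sin (?\<pi> * (b i + t))" for i
  define S where "S = residue_weight p a b s"
  have np: "a i + t \<notin> \<int>\<^sub>\<le>\<^sub>0" if "i \<in> {1..p}" for i
    using not_left_pole[of t a "{1..p}" i] t that by blast
  have nb: "1 - b i - t \<notin> \<int>\<^sub>\<le>\<^sub>0" if "i \<in> {1..p}" for i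
  proof
    assume "1 - b i - t \<in> \<int>\<^sub>\<le>\<^sub>0"
    then obtain n :: nat where "1 - b i - t = - of_nat n"
      by (auto elim: nonpos_Ints_cases')
    then have "t = 1 - b i + of_nat n"
      by (simp add: algebra_simps)
    then show False
      using t that unfolding G_right_poles_eq by blast
  qed
  have ra: "(\<Prod>i\<in>L. rGamma (1 - a i - t)) = (\<Prod>i\<in>L. Gamma (a i + t)) * (\<Prod>i\<in>L. sa i / ?\<pi>)"
    if "L \<subseteq> {1..p}" for L
    unfolding prod.distrib [symmetric] sa_def
    by (intro prod.cong refl rGamma_one_minus np) (use that in auto)
  have rb: "rGamma (b i + t) = Gamma (1 - b i - t) * (sb i / ?\<pi>)" if "i \<in> {1..p}" for i
  proof -
    have "rGamma (1 - (1 - b i - t)) = Gamma (1 - b i - t) * (sin (?\<pi> * (1 - b i - t)) / ?\<pi>)"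
      using rGamma_one_minus[of "1 - b i" "- t"] nb[OF that] by simp
    moreover have "sin (?\<pi> * (1 - b i - t)) = sb i"
    proof -
      have "?\<pi> * (1 - b i - t) = ?\<pi> - ?\<pi> * (b i + t)"
        by (simp add: algebra_simps)
      then show ?thesis
        by (simp add: sin_diff sb_def flip: sin_of_real cos_of_real)
    qed
    ultimately show ?thesis
      by simp
  qed
  have G: "G_kernel p a b k s t = T * (\<Prod>i\<in>?K - {k}. sa i / ?\<pi>)" if "k \<in> ?K" for k
  proof -
    have e: "{1..p} - {k, s} = ?K - {k}"
      by auto
    have "(\<Prod>i=1..p. Gamma (a i + t)) = Gamma (a s + t) * (Gamma (a k + t) * (\<Prod>i\<in>?K - {k}. Gamma (a i + t)))"
      using prod.remove[of "{1..p}" s "\<lambda>i. Gamma (a i + t)"] prod.remove[of ?K k "\<lambda>i. Gamma (a i + t)"] s that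
      by simp
    then show ?thesis
      unfolding G_kernel_def e ra[of "?K - {k}", OF order.trans[OF Diff_subset Diff_subset]] T_def by (simp only: mult_ac)
  qed
  have F: "F_kernel p a b s \<sigma> t = T * (\<Prod>i\<in>?K. sa i / ?\<pi>) * exp (of_real \<sigma> * \<i> * \<theta>)"
  proof -
    have "(\<Prod>i=1..p. Gamma (a i + t)) = Gamma (a s + t) * (\<Prod>i\<in>?K. Gamma (a i + t))"
      by (rule prod.remove) (use s in auto)
    then show ?thesis
      unfolding F_kernel_def ra[of ?K, OF Diff_subset] T_def \<theta>_def by (simp only: mult_ac)
  qed
  have Phi: "Gamma_ratio p a b t = T * (\<Prod>i\<in>?K. sa i / ?\<pi>) * (sin \<theta> / ?\<pi>)"
  proof -
    have "(\<Prod>i=1..p. sa i / ?\<pi>) = sa s / ?\<pi> * (\<Prod>i\<in>?K. sa i / ?\<pi>)"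
      by (rule prod.remove) (use s in auto)
    then show ?thesis
      unfolding Gamma_ratio_def ra[OF order_refl] T_def \<theta>_def sa_def by (simp only: mult_ac)
  qed
  have Psi: "Gamma_ratio' p a b t = T * (\<Prod>i=1..p. sb i / ?\<pi>)"
  proof -
    have "(\<Prod>i=1..p. rGamma (b i + t)) = (\<Prod>i=1..p. Gamma (1 - b i - t)) * (\<Prod>i=1..p. sb i / ?\<pi>)"
      unfolding prod.distrib [symmetric] by (intro prod.cong refl rb)
    then show ?thesis
      unfolding Gamma_ratio'_def T_def by (simp only: mult_ac)
  qed
  have card: "card ?K = p - 1" "p \<ge> 1"
    using s by auto
  have trig: "(\<Prod>i=1..p. sb i / ?\<pi>) = sin (\<theta> + \<psi>) / ?\<pi> * (\<Prod>i\<in>?K. sa i / ?\<pi>)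
      + (\<Sum>k\<in>?K. S k * (\<Prod>i\<in>?K - {k}. sa i / ?\<pi>)) / ?\<pi>\<^sup>2"
  proof -
    have e: "(\<Sum>k\<in>?K. ?\<pi> * a k) = (\<Sum>k=1..p. ?\<pi> * a k) - ?\<pi> * a s"
      using sum.remove[of "{1..p}" s "\<lambda>k. ?\<pi> * a k"] s by simp
    \<comment> \<open>The poles run over all indices but s; the term with a s that is missing from
      the subtracted sum turns the argument of the surplus sine into \<theta> + \<psi>.\<close>
    have arg: "?\<pi> * t + (\<Sum>j=1..p. ?\<pi> * b j) - (\<Sum>k\<in>?K. ?\<pi> * a k) = \<theta> + \<psi>"
      unfolding e \<theta>_def \<psi>_def psi_def by (simp add: sum_subtractf sum_distrib_left algebra_simps)
    have S: "S k = (\<Prod>j=1..p. sin (?\<pi> * b j - ?\<pi> * a k)) / (\<Prod>i\<in>?K-{k}. sin (?\<pi> * a i - ?\<pi> * a k))" for k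
    proof -
      have "{1..p} - {k, s} = ?K - {k}"
        by auto
      then show ?thesis
        by (simp add: S_def residue_weight_def right_diff_distrib)
    qed
    have "(\<Prod>j=1..p. sin (?\<pi> * b j + ?\<pi> * t)) = sin (\<theta> + \<psi>) * (\<Prod>k\<in>?K. sin (?\<pi> * a k + ?\<pi> * t))
        + (\<Sum>k\<in>?K. S k * (\<Prod>i\<in>?K-{k}. sin (?\<pi> * a i + ?\<pi> * t)))"
      unfolding arg [symmetric] S
    proof (rule sin_partial_fractions)
      fix i k assume "i \<in> ?K" "k \<in> ?K" "i \<noteq> k"
      then show "sin (?\<pi> * a i - ?\<pi> * a k) \<noteq> 0"
        using a[of i k] sin_pi_eq_0_iff[of "a i - a k"] by (simp add: right_diff_distrib)
    qed (use card in auto)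
    then have "(\<Prod>i=1..p. sb i) = sin (\<theta> + \<psi>) * (\<Prod>i\<in>?K. sa i) + (\<Sum>k\<in>?K. S k * (\<Prod>i\<in>?K - {k}. sa i))"
      by (simp add: sa_def sb_def distrib_left)
    moreover have "(\<Prod>i\<in>?K - {k}. sa i / ?\<pi>) = (\<Prod>i\<in>?K - {k}. sa i) * ?\<pi>\<^sup>2 / ?\<pi> ^ p" if "k \<in> ?K" for k
    proof -
      \<comment> \<open>These products have p - 2 factors, the left-hand side has p; the difference
        accounts for the factor pi^2.\<close>
      have "card (?K - {k}) = p - 2" "p \<ge> 2"
        using that s card by (auto simp: card_Diff_singleton)
      then have "p = 2 + card (?K - {k})"
        by linarith
      then have "?\<pi> ^ p = ?\<pi>\<^sup>2 * ?\<pi> ^ card (?K - {k})"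
        by (metis power_add)
      then show ?thesis
        by (simp add: prod_dividef)
    qed
    then have "(\<Sum>k\<in>?K. S k * (\<Prod>i\<in>?K - {k}. sa i / ?\<pi>)) / ?\<pi>\<^sup>2 = (\<Sum>k\<in>?K. S k * (\<Prod>i\<in>?K - {k}. sa i)) / ?\<pi> ^ p"
      by (simp add: sum_divide_distrib)
    moreover have "sin (\<theta> + \<psi>) / ?\<pi> * (\<Prod>i\<in>?K. sa i / ?\<pi>) = sin (\<theta> + \<psi>) * (\<Prod>i\<in>?K. sa i) / ?\<pi> ^ p"
    proof -
      have "p = Suc (card ?K)"
        using card by linarith
      then have "?\<pi> ^ p = ?\<pi> * ?\<pi> ^ card ?K"
        by (metis power_Suc)
      then show ?thesis
        by (simp add: prod_dividef)
    qed
    moreover have "(\<Prod>i=1..p. sb i / ?\<pi>) = (\<Prod>i=1..p. sb i) / ?\<pi> ^ p"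
      by (simp add: prod_dividef)
    ultimately show ?thesis
      by (simp add: add_divide_distrib)
  qed
  define Q where "Q = (\<Prod>i\<in>?K. sa i / ?\<pi>)"
  define R where "R = (\<Sum>k\<in>?K. S k * (\<Prod>i\<in>?K - {k}. sa i / ?\<pi>))"
  have sum: "(\<Sum>k\<in>?K. S k * G_kernel p a b k s t) = T * R"
    unfolding R_def sum_distrib_left by (intro sum.cong refl) (simp add: G)
  have nz: "sin \<psi> \<noteq> 0"
    using \<psi> by (simp add: \<psi>_def sin_pi_eq_0_iff)
  have "1 / (?\<pi> * sin \<psi>) * (T * R) + T * Q * exp (of_real \<sigma> * \<i> * \<theta>)
      = ?\<pi> / sin \<psi> * (T * (sin (\<theta> + \<psi>) / ?\<pi> * Q + R / ?\<pi>\<^sup>2)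
        - T * Q * ((sin (\<theta> + \<psi>) - sin \<psi> * exp (of_real \<sigma> * \<i> * \<theta>)) / ?\<pi>))"
    using nz by (simp add: field_simps power2_eq_square)
  also have "\<dots> = ?\<pi> / sin \<psi> * (T * (sin (\<theta> + \<psi>) / ?\<pi> * Q + R / ?\<pi>\<^sup>2)
      - exp (- of_real \<sigma> * \<i> * \<psi>) * (T * Q * (sin \<theta> / ?\<pi>)))"
    unfolding sin_add_minus_exp[OF \<sigma>] by simp
  finally show ?thesis
    unfolding S_def [symmetric] \<psi>_def [symmetric] sum F Phi Psi trig Q_def [symmetric] R_def [symmetric] .
qed

text \<open>The reflection t -> - t exchanges left and right poles, so the growth bounds carry over
  without a second proof.\<close>

lemma Gamma_ratio'_eq: "Gamma_ratio' p a b t = Gamma_ratio p (\<lambda>i. 1 - b i) (\<lambda>i. 1 - a i) (- t)"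
  by (simp add: Gamma_ratio'_def Gamma_ratio_def)

lemma Gamma_ratio'_bound:
  obtains C N H where "C > 0" "H > 0"
    "\<And>t. Re t \<ge> H \<or> \<bar>Im t\<bar> \<ge> H \<Longrightarrow> norm (Gamma_ratio' p a b t) \<le> C * (1 + norm t) ^ N"
proof -
  obtain C N H where CH: "C > 0" "H > 0" "\<And>t. Re t \<le> - H \<or> \<bar>Im t\<bar> \<ge> H \<Longrightarrow>
      norm (Gamma_ratio p (\<lambda>i. 1 - b i) (\<lambda>i. 1 - a i) t) \<le> C * (1 + norm t) ^ N"
    by (rule Gamma_ratio_bound[of p "\<lambda>i. 1 - b i" "\<lambda>i. 1 - a i"]) blast
  have "norm (Gamma_ratio' p a b t) \<le> C * (1 + norm t) ^ N" if "Re t \<ge> H \<or> \<bar>Im t\<bar> \<ge> H" for t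
    using CH(3)[of "- t"] that by (auto simp: Gamma_ratio'_eq)
  then show ?thesis
    using that[of C H N] CH by blast
qed

lemma Gamma_ratio'_holomorphic: "Gamma_ratio' p a b holomorphic_on - (left_poles a {1..p} \<union> B)"
  unfolding Gamma_ratio'_def[abs_def]
  by (intro holomorphic_on_mult holomorphic_on_prod Gamma_holomorphic_off_left_poles
      holomorphic_rGamma' holomorphic_intros)

lemma Gamma_ratio_holomorphic: "Gamma_ratio p a b holomorphic_on - (A \<union> G_right_poles p b)"
  unfolding Gamma_ratio_def[abs_def]
  by (intro holomorphic_on_mult holomorphic_on_prod Gamma_holomorphic_off_right_poles
      holomorphic_rGamma' holomorphic_intros)

lemma F_kernel_holomorphic:
  "s \<in> I \<Longrightarrow> F_kernel p a b s \<sigma> holomorphic_on - (left_poles a I \<union> G_right_poles p b)"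
  unfolding F_kernel_def[abs_def]
  by (intro holomorphic_on_mult holomorphic_on_prod Gamma_holomorphic_off_left_poles
      Gamma_holomorphic_off_right_poles holomorphic_rGamma' holomorphic_intros)

lemma F_kernel_eq:
  assumes s: "s \<in> {1..p}" and nz: "sin (of_real pi * (a s + t)) \<noteq> 0"
  shows "F_kernel p a b s \<sigma> t = of_real pi / sin (of_real pi * (a s + t))
    * exp (of_real \<sigma> * \<i> * (of_real pi * (a s + t))) * Gamma_ratio p a b t"
proof -
  have "(\<Prod>i=1..p. rGamma (1 - a i - t)) = rGamma (1 - a s - t) * (\<Prod>i\<in>{1..p} - {s}. rGamma (1 - a i - t))"
    by (rule prod.remove) (use s in auto)
  moreover have "sin (of_real pi * (a s + t)) = of_real pi * (rGamma (a s + t) * rGamma (1 - a s - t))"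
    using rGamma_reflection_complex[of "a s + t"] by (simp add: diff_diff_eq)
  then have "Gamma (a s + t) = of_real pi / sin (of_real pi * (a s + t)) * rGamma (1 - a s - t)"
    using nz by (auto simp: Gamma_def field_simps)
  ultimately show ?thesis
    by (simp add: F_kernel_def Gamma_ratio_def mult_ac)
qed

text \<open>The rate pi of the inverse sine and the rate of the exponential factor add up at one end
  and cancel at the other.\<close>

lemma F_kernel_bound:
  assumes s: "s \<in> {1..p}" and \<sigma>: "\<sigma> = 1 \<or> \<sigma> = - 1"
  obtains C N H where "C > 0" "H > 0"
    "\<And>t. \<bar>Im t\<bar> \<ge> H \<Longrightarrow> norm (F_kernel p a b s \<sigma> t)
      \<le> C * (1 + norm t) ^ N * exp (- pi * (\<bar>Im t\<bar> + \<sigma> * Im t))"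
proof -
  obtain C N H where CH: "C > 0" "H > 0"
    "\<And>t. Re t \<le> - H \<or> \<bar>Im t\<bar> \<ge> H \<Longrightarrow> norm (Gamma_ratio p a b t) \<le> C * (1 + norm t) ^ N"
    by (rule Gamma_ratio_bound[of p a b]) blast
  define E where "E = 4 * pi * exp (pi * norm (a s))"
  define E' where "E' = exp (pi * norm (a s))"
  have "norm (F_kernel p a b s \<sigma> t) \<le> E * E' * C * (1 + norm t) ^ N * exp (- pi * (\<bar>Im t\<bar> + \<sigma> * Im t))"
    if t: "\<bar>Im t\<bar> \<ge> H + 1 + norm (a s)" for t
  proof -
    have Im: "\<bar>Im (a s + t)\<bar> \<ge> 1" "\<bar>Im t\<bar> \<ge> H"
      using t CH(2) abs_Im_le_cmod[of "a s"] norm_ge_zero[of "a s"] unfolding plus_complex.sel by linarith+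
    have nz: "sin (of_real pi * (a s + t)) \<noteq> 0"
      using exp_le_norm_sin_pi[OF Im(1)] by (metis exp_gt_zero mult_zero_right norm_zero not_le)
    have e: "norm (exp (of_real \<sigma> * \<i> * (of_real pi * (a s + t)))) \<le> E' * exp (- pi * (\<sigma> * Im t))"
    proof -
      have "- \<sigma> * Im (a s) \<le> norm (a s)"
        using \<sigma> abs_Im_le_cmod[of "a s"] by auto
      then have "pi * (- \<sigma> * Im (a s)) \<le> pi * norm (a s)"
        by (intro mult_left_mono) auto
      then have "Re (of_real \<sigma> * \<i> * (of_real pi * (a s + t))) \<le> pi * norm (a s) + - pi * (\<sigma> * Im t)"
        by (simp add: algebra_simps)
      then show ?thesis
        unfolding norm_exp_eq_Re E'_def exp_add [symmetric] by (simp only: exp_le_cancel_iff)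
    qed
    have "norm (F_kernel p a b s \<sigma> t) \<le> (E * exp (- pi * \<bar>Im t\<bar>)) * (E' * exp (- pi * (\<sigma> * Im t))) * (C * (1 + norm t) ^ N)"
      unfolding F_kernel_eq[of s p a t b \<sigma>, OF s nz] E_def
      by (intro norm_mult_le e CH(3) Gamma_mult_Gamma_reflect(2) Im) (use Im in auto)
    also have "exp (- pi * (\<bar>Im t\<bar> + \<sigma> * Im t)) = exp (- pi * \<bar>Im t\<bar>) * exp (- pi * (\<sigma> * Im t))"
      unfolding exp_add [symmetric] by (simp add: algebra_simps)
    then have "(E * exp (- pi * \<bar>Im t\<bar>)) * (E' * exp (- pi * (\<sigma> * Im t))) * (C * (1 + norm t) ^ N)
        = E * E' * C * (1 + norm t) ^ N * exp (- pi * (\<bar>Im t\<bar> + \<sigma> * Im t))"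
      by (simp only: mult_ac)
    finally show ?thesis .
  qed
  moreover have "E * E' * C > 0" "H + 1 + norm (a s) > 0"
    using CH by (auto simp: E_def E'_def add_pos_nonneg)
  ultimately show ?thesis
    using that[of "E * E' * C" "H + 1 + norm (a s)" N] by blast
qed

section \<open>Turning the ends of a contour\<close>

text \<open>In the sector the integrand decays like exp (- \<delta> (x + y)) up to a polynomial,
  \<delta> being the smaller of the total rates along u and v; half of \<delta> pays for the
  polynomial. Along v the decay comes from the exponential in \<zeta> alone.\<close>

lemma ray_integral_exp_rotate:
  assumes S: "convex S" "f holomorphic_on S" and uv: "norm u = 1" "norm v = 1" and C: "C \<ge> 0"
    and sector: "\<And>x y. x \<ge> 0 \<Longrightarrow> y \<ge> 0 \<Longrightarrow> z + u * of_real x + v * of_real y \<in> S"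
    and bound: "\<And>x y. x \<ge> 0 \<Longrightarrow> y \<ge> 0 \<Longrightarrow> norm (f (z + u * of_real x + v * of_real y))
      \<le> C * (1 + norm (z + u * of_real x + v * of_real y)) ^ N * exp (- \<alpha> * x)"
    and u: "\<alpha> + Re (\<zeta> * u) > 0" and v: "Re (\<zeta> * v) > 0"
  shows "ray_integral z u (\<lambda>t. f t * exp (- \<zeta> * t)) = ray_integral z v (\<lambda>t. f t * exp (- \<zeta> * t))"
proof -
  define \<delta> where "\<delta> = min (\<alpha> + Re (\<zeta> * u)) (Re (\<zeta> * v))"
  have \<delta>: "\<delta> > 0" "\<delta> \<le> \<alpha> + Re (\<zeta> * u)" "\<delta> \<le> Re (\<zeta> * v)"
    using u v by (auto simp: \<delta>_def)
  define K where "K = (real N / (\<delta> / 2)) ^ N * exp (\<delta> / 2)"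
  define C' where "C' = C * (1 + norm z) ^ N * K * exp (- Re (\<zeta> * z))"
  show ?thesis
  proof (rule ray_integral_rotate[OF S(1) _ uv, of _ "\<delta> / 2" z C'])
    show "(\<lambda>t. f t * exp (- \<zeta> * t)) holomorphic_on S"
      by (intro holomorphic_intros S)
    fix x y :: real assume xy: "x \<ge> 0" "y \<ge> 0"
    define t where "t = z + u * of_real x + v * of_real y"
    have "norm t \<le> norm z + norm (u * of_real x) + norm (v * of_real y)"
      unfolding t_def by (meson norm_triangle_ineq norm_triangle_le add_right_mono order.trans)
    then have "norm t \<le> norm z + (x + y)"
      using uv xy by (simp add: norm_mult)
    then have "1 + norm t \<le> (1 + norm z) * (1 + (x + y))"
      using mult_nonneg_nonneg[OF norm_ge_zero[of z] add_nonneg_nonneg[OF xy]]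
      unfolding ring_distribs mult_1_left mult_1_right by linarith
    then have "(1 + norm t) ^ N \<le> ((1 + norm z) * (1 + (x + y))) ^ N"
      by (intro power_mono) auto
    also have "\<dots> = (1 + norm z) ^ N * (1 + (x + y)) ^ N"
      by (rule power_mult_distrib)
    also have "\<dots> \<le> (1 + norm z) ^ N * (K * exp (\<delta> / 2 * (x + y)))"
      unfolding K_def using xy \<delta> by (intro mult_left_mono power_le_exp) auto
    finally have "C * (1 + norm t) ^ N * exp (- \<alpha> * x)
        \<le> C * ((1 + norm z) ^ N * (K * exp (\<delta> / 2 * (x + y)))) * exp (- \<alpha> * x)"
      using C by (intro mult_right_mono mult_left_mono) auto
    then have f: "norm (f t) \<le> C * ((1 + norm z) ^ N * (K * exp (\<delta> / 2 * (x + y)))) * exp (- \<alpha> * x)"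
      using bound[OF xy] unfolding t_def by linarith
    have "norm (exp (- \<zeta> * t)) \<le> exp (- Re (\<zeta> * z)) * exp (- Re (\<zeta> * u) * x - Re (\<zeta> * v) * y)"
    proof -
      have "\<zeta> * t = \<zeta> * z + (\<zeta> * u) * of_real x + (\<zeta> * v) * of_real y"
        by (simp add: t_def algebra_simps)
      moreover have "Re (w * of_real r) = Re w * r" for w r
        by simp
      ultimately have "Re (\<zeta> * t) = Re (\<zeta> * z) + Re (\<zeta> * u) * x + Re (\<zeta> * v) * y"
        by (simp only: plus_complex.sel)
      then have "Re (- \<zeta> * t) = - Re (\<zeta> * z) + (- Re (\<zeta> * u) * x - Re (\<zeta> * v) * y)"
        by (simp only: mult_minus_left uminus_complex.sel)
      then show ?thesis
        unfolding norm_exp_eq_Re exp_add [symmetric] by (simp only: order_refl)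
    qed
    then have "norm (f t * exp (- \<zeta> * t)) \<le> (C * ((1 + norm z) ^ N * (K * exp (\<delta> / 2 * (x + y)))) * exp (- \<alpha> * x))
        * (exp (- Re (\<zeta> * z)) * exp (- Re (\<zeta> * u) * x - Re (\<zeta> * v) * y))"
      by (rule norm_mult_le[OF f])
    also have "\<dots> = C' * exp (\<delta> / 2 * (x + y) + - \<alpha> * x + (- Re (\<zeta> * u) * x - Re (\<zeta> * v) * y))"
      unfolding C'_def exp_add by (simp only: mult_ac)
    also have "\<dots> \<le> C' * exp (- (\<delta> / 2) * (x + y))"
    proof (rule mult_left_mono)
      have "\<delta> * x \<le> (\<alpha> + Re (\<zeta> * u)) * x" "\<delta> * y \<le> Re (\<zeta> * v) * y"
        using \<delta> xy by (auto intro: mult_right_mono)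
      then have "\<delta> / 2 * (x + y) + - \<alpha> * x + (- Re (\<zeta> * u) * x - Re (\<zeta> * v) * y) \<le> - (\<delta> / 2) * (x + y)"
        unfolding ring_distribs by (simp add: field_simps)
      then show "exp (\<delta> / 2 * (x + y) + - \<alpha> * x + (- Re (\<zeta> * u) * x - Re (\<zeta> * v) * y)) \<le> exp (- (\<delta> / 2) * (x + y))"
        by (simp only: exp_le_cancel_iff)
      show "C' \<ge> 0"
        using C \<delta> by (simp add: C'_def K_def)
    qed
    finally show "norm (f (z + u * of_real x + v * of_real y) * exp (- \<zeta> * (z + u * of_real x + v * of_real y)))
        \<le> C' * exp (- (\<delta> / 2) * (x + y))"
      unfolding t_def .
  qed (use \<delta> sector in auto)
qed

text \<open>\<alpha> and \<alpha>' are the rates of decay at the upper and the lower end; they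
  delimit the strip of \<zeta> in which the integral with vertical ends converges.\<close>

definition strip_bound :: "(complex \<Rightarrow> complex) \<Rightarrow> real \<Rightarrow> nat \<Rightarrow> real \<Rightarrow> real \<Rightarrow> real \<Rightarrow> bool" where
  "strip_bound f C N H \<alpha> \<alpha>' \<longleftrightarrow> C \<ge> 0 \<and> H \<ge> 0 \<and> \<alpha> \<ge> 0 \<and> \<alpha>' \<ge> 0 \<and>
     (\<forall>t. Im t \<ge> H \<longrightarrow> norm (f t) \<le> C * (1 + norm t) ^ N * exp (- \<alpha> * Im t)) \<and>
     (\<forall>t. Im t \<le> - H \<longrightarrow> norm (f t) \<le> C * (1 + norm t) ^ N * exp (\<alpha>' * Im t))"

lemma poles_contour_sector:
  assumes c: "poles_contour p a b I H0 c"
  shows "{t. Im t \<ge> Im (pathfinish c)} \<subseteq> - (left_poles a I \<union> G_right_poles p b)"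
    "{t. Im t \<le> Im (pathstart c)} \<subseteq> - (left_poles a I \<union> G_right_poles p b)"
proof -
  have sep: "separating_contour (left_poles a I) (G_right_poles p b) c"
    using c by (simp add: poles_contour_def)
  show "{t. Im t \<ge> Im (pathfinish c)} \<subseteq> - (left_poles a I \<union> G_right_poles p b)"
  proof (intro subsetI ComplI)
    fix t assume "t \<in> {t. Im t \<ge> Im (pathfinish c)}" "t \<in> left_poles a I \<union> G_right_poles p b"
    then show False
      using separating_contourD(4)[OF sep, of t] by simp
  qed
  show "{t. Im t \<le> Im (pathstart c)} \<subseteq> - (left_poles a I \<union> G_right_poles p b)"
  proof (intro subsetI ComplI)
    fix t assume "t \<in> {t. Im t \<le> Im (pathstart c)}" "t \<in> left_poles a I \<union> G_right_poles p b"
    then show False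
      using separating_contourD(3)[OF sep, of t] by simp
  qed
qed

text \<open>The total rate is \<open>\<alpha> - Im \<zeta>\<close> in the direction \<i> and
  \<open>\<alpha>' + Im \<zeta>\<close> in the direction - \<i>. If both are positive, and so is the
  rate along v, both ends can be turned.\<close>

lemma horn_integral_rotate_eq:
  assumes c: "poles_contour p a b I H0 c" and I: "finite I"
    and f: "f holomorphic_on - (left_poles a I \<union> G_right_poles p b)"
    and b: "strip_bound f C N H \<alpha> \<alpha>'" "H \<le> H0"
    and \<zeta>: "Im \<zeta> < \<alpha>" "- \<alpha>' < Im \<zeta>" and v: "v = 1 \<or> v = - 1" "Re (\<zeta> * v) > 0"
  shows "horn_integral c (- \<i>) \<i> (\<lambda>t. f t * exp (- \<zeta> * t)) = horn_integral c v v (\<lambda>t. f t * exp (- \<zeta> * t))"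
proof -
  obtain \<gamma> h where h: "pathstart c = Complex \<gamma> (- h)" "pathfinish c = Complex \<gamma> h" "h > H"
    and sep: "separating_contour (left_poles a I) (G_right_poles p b) c"
    using c b(2) by (fastforce simp: poles_contour_def)
  have C: "C \<ge> 0" "H \<ge> 0" "\<alpha> \<ge> 0" "\<alpha>' \<ge> 0"
    and fup: "\<And>t. Im t \<ge> H \<Longrightarrow> norm (f t) \<le> C * (1 + norm t) ^ N * exp (- \<alpha> * Im t)"
    and flow: "\<And>t. Im t \<le> - H \<Longrightarrow> norm (f t) \<le> C * (1 + norm t) ^ N * exp (\<alpha>' * Im t)"
    using b(1) unfolding strip_bound_def by blast+
  have up: "norm (f t) \<le> C * (1 + norm t) ^ N * exp (- \<alpha> * x)" if "Im t = h + x" "x \<ge> 0" for t x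
  proof -
    have "norm (f t) \<le> C * (1 + norm t) ^ N * exp (- \<alpha> * Im t)"
      by (rule fup) (use that h(3) in linarith)
    also have "\<dots> \<le> C * (1 + norm t) ^ N * exp (- \<alpha> * x)"
      using that h(3) C by (intro mult_left_mono) (auto intro: mult_left_mono)
    finally show ?thesis .
  qed
  have low: "norm (f t) \<le> C * (1 + norm t) ^ N * exp (- \<alpha>' * x)" if "Im t = - h - x" "x \<ge> 0" for t x
  proof -
    have "norm (f t) \<le> C * (1 + norm t) ^ N * exp (\<alpha>' * Im t)"
      by (rule flow) (use that h(3) in linarith)
    also have "\<dots> \<le> C * (1 + norm t) ^ N * exp (- \<alpha>' * x)"
    proof (intro mult_left_mono)
      have "\<alpha>' * (- h - x) \<le> \<alpha>' * (- x)"
        using h(3) C by (intro mult_left_mono) auto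
      then show "exp (\<alpha>' * Im t) \<le> exp (- \<alpha>' * x)"
        using that by simp
    qed (use C in auto)
    finally show ?thesis .
  qed
  have Im0: "Im (v * of_real y) = 0" for y
    using v(1) by auto
  have "ray_integral (pathfinish c) \<i> (\<lambda>t. f t * exp (- \<zeta> * t)) = ray_integral (pathfinish c) v (\<lambda>t. f t * exp (- \<zeta> * t))"
  proof (rule ray_integral_exp_rotate[where S = "{t. Im t \<ge> Im (pathfinish c)}" and C = C and N = N and \<alpha> = \<alpha>])
    show "f holomorphic_on {t. Im t \<ge> Im (pathfinish c)}"
      using f poles_contour_sector(1)[OF c] by (rule holomorphic_on_subset)
    show "norm (f (pathfinish c + \<i> * of_real x + v * of_real y))
      \<le> C * (1 + norm (pathfinish c + \<i> * of_real x + v * of_real y)) ^ N * exp (- \<alpha> * x)" if "x \<ge> 0" "y \<ge> 0" for x y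
      by (rule up) (use that h Im0 in auto)
  qed (use v C \<zeta> Im0 in \<open>auto simp: convex_halfspace_Im_ge\<close>)
  moreover have "ray_integral (pathstart c) (- \<i>) (\<lambda>t. f t * exp (- \<zeta> * t)) = ray_integral (pathstart c) v (\<lambda>t. f t * exp (- \<zeta> * t))"
  proof (rule ray_integral_exp_rotate[where S = "{t. Im t \<le> Im (pathstart c)}" and C = C and N = N and \<alpha> = \<alpha>'])
    show "f holomorphic_on {t. Im t \<le> Im (pathstart c)}"
      using f poles_contour_sector(2)[OF c] by (rule holomorphic_on_subset)
    show "norm (f (pathstart c + - \<i> * of_real x + v * of_real y))
      \<le> C * (1 + norm (pathstart c + - \<i> * of_real x + v * of_real y)) ^ N * exp (- \<alpha>' * x)" if "x \<ge> 0" "y \<ge> 0" for x y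
      by (rule low) (use that h Im0 in auto)
  qed (use v C \<zeta> Im0 in \<open>auto simp: convex_halfspace_Im_le\<close>)
  ultimately show "horn_integral c (- \<i>) \<i> (\<lambda>t. f t * exp (- \<zeta> * t)) = horn_integral c v v (\<lambda>t. f t * exp (- \<zeta> * t))"
    unfolding horn_integral_def by simp
qed


text \<open>P selects a sector with vertex 0. Such bounds in sectors that cover a punctured disc
  leave at most a pole at 0 for a function glued from pieces.\<close>

definition polynomial_growth :: "(complex \<Rightarrow> bool) \<Rightarrow> (complex \<Rightarrow> complex) \<Rightarrow> bool" where
  "polynomial_growth P g \<longleftrightarrow>
     (\<exists>C (M::nat). C \<ge> 0 \<and> (\<forall>\<zeta>. \<zeta> \<noteq> 0 \<longrightarrow> norm \<zeta> \<le> 1 \<longrightarrow> P \<zeta> \<longrightarrow> norm (g \<zeta>) \<le> C / norm \<zeta> ^ M))"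

lemma polynomial_growthI:
  assumes "\<And>\<zeta>. \<zeta> \<noteq> 0 \<Longrightarrow> norm \<zeta> \<le> 1 \<Longrightarrow> P \<zeta> \<Longrightarrow> norm (g \<zeta>) \<le> C / norm \<zeta> ^ M"
  shows "polynomial_growth P g"
  unfolding polynomial_growth_def
proof (intro exI conjI allI impI)
  fix \<zeta> :: complex assume "\<zeta> \<noteq> 0" "norm \<zeta> \<le> 1" "P \<zeta>"
  then have "norm (g \<zeta>) \<le> C / norm \<zeta> ^ M"
    by (rule assms)
  also have "\<dots> \<le> \<bar>C\<bar> / norm \<zeta> ^ M"
    by (intro divide_right_mono) auto
  finally show "norm (g \<zeta>) \<le> \<bar>C\<bar> / norm \<zeta> ^ M" .
qed simp

lemma polynomial_growth_raise:
  assumes "C \<ge> (0::real)" "M \<le> M'" "\<zeta> \<noteq> 0" "norm \<zeta> \<le> (1::real)"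
  shows "C / norm \<zeta> ^ M \<le> C / norm \<zeta> ^ M'"
  using assms by (intro divide_left_mono power_decreasing) auto

lemma polynomial_growth_add:
  assumes "polynomial_growth P g" "polynomial_growth P h"
  shows "polynomial_growth P (\<lambda>\<zeta>. g \<zeta> + h \<zeta>)"
proof -
  obtain C M where 1: "C \<ge> 0" "\<And>\<zeta>. \<zeta> \<noteq> 0 \<Longrightarrow> norm \<zeta> \<le> 1 \<Longrightarrow> P \<zeta> \<Longrightarrow> norm (g \<zeta>) \<le> C / norm \<zeta> ^ M"
    using assms(1) unfolding polynomial_growth_def by blast
  obtain C' M' where 2: "C' \<ge> 0" "\<And>\<zeta>. \<zeta> \<noteq> 0 \<Longrightarrow> norm \<zeta> \<le> 1 \<Longrightarrow> P \<zeta> \<Longrightarrow> norm (h \<zeta>) \<le> C' / norm \<zeta> ^ M'"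
    using assms(2) unfolding polynomial_growth_def by blast
  show ?thesis
  proof (rule polynomial_growthI[where C = "C + C'" and M = "max M M'"])
    fix \<zeta> :: complex assume \<zeta>: "\<zeta> \<noteq> 0" "norm \<zeta> \<le> 1" "P \<zeta>"
    have "norm (g \<zeta> + h \<zeta>) \<le> C / norm \<zeta> ^ M + C' / norm \<zeta> ^ M'"
      using 1(2)[OF \<zeta>] 2(2)[OF \<zeta>] by (rule norm_triangle_mono)
    also have "\<dots> \<le> C / norm \<zeta> ^ max M M' + C' / norm \<zeta> ^ max M M'"
      by (intro add_mono polynomial_growth_raise 1 2 \<zeta>) auto
    finally show "norm (g \<zeta> + h \<zeta>) \<le> (C + C') / norm \<zeta> ^ max M M'"
      by (simp add: add_divide_distrib)
  qed
qed

lemma polynomial_growth_mult: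
  assumes "polynomial_growth P g" "polynomial_growth P h"
  shows "polynomial_growth P (\<lambda>\<zeta>. g \<zeta> * h \<zeta>)"
proof -
  obtain C M where 1: "C \<ge> 0" "\<And>\<zeta>. \<zeta> \<noteq> 0 \<Longrightarrow> norm \<zeta> \<le> 1 \<Longrightarrow> P \<zeta> \<Longrightarrow> norm (g \<zeta>) \<le> C / norm \<zeta> ^ M"
    using assms(1) unfolding polynomial_growth_def by blast
  obtain C' M' where 2: "C' \<ge> 0" "\<And>\<zeta>. \<zeta> \<noteq> 0 \<Longrightarrow> norm \<zeta> \<le> 1 \<Longrightarrow> P \<zeta> \<Longrightarrow> norm (h \<zeta>) \<le> C' / norm \<zeta> ^ M'"
    using assms(2) unfolding polynomial_growth_def by blast
  show ?thesis
  proof (rule polynomial_growthI[where C = "C * C'" and M = "M + M'"])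
    fix \<zeta> :: complex assume \<zeta>: "\<zeta> \<noteq> 0" "norm \<zeta> \<le> 1" "P \<zeta>"
    have "norm (g \<zeta> * h \<zeta>) \<le> (C / norm \<zeta> ^ M) * (C' / norm \<zeta> ^ M')"
      by (rule norm_mult_le[OF 1(2)[OF \<zeta>] 2(2)[OF \<zeta>]])
    then show "norm (g \<zeta> * h \<zeta>) \<le> C * C' / norm \<zeta> ^ (M + M')"
      by (simp add: power_add)
  qed
qed

lemma polynomial_growth_mono: "polynomial_growth P g \<Longrightarrow> (\<And>\<zeta>. Q \<zeta> \<Longrightarrow> P \<zeta>) \<Longrightarrow> polynomial_growth Q g"
  unfolding polynomial_growth_def by blast

lemma polynomial_growth_continuous:
  assumes "continuous_on (cball 0 1) g"
  shows "polynomial_growth P g"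
proof -
  have "bounded (g ` cball 0 1)"
    using assms by (intro compact_imp_bounded compact_continuous_image) auto
  then obtain B where "\<forall>y \<in> g ` cball 0 1. norm y \<le> B"
    unfolding bounded_iff by blast
  then show ?thesis
    by (intro polynomial_growthI[where C = B and M = 0]) auto
qed

lemma ray_polynomial_growth:
  assumes S: "open S" "f holomorphic_on S" "ray z u \<subseteq> S" and u: "norm u = 1" and C: "C \<ge> 0"
    and bound: "\<And>x. x \<ge> 0 \<Longrightarrow> norm (f (z + u * of_real x)) \<le> C * (1 + norm (z + u * of_real x)) ^ N"
  shows "polynomial_growth (\<lambda>\<zeta>. norm \<zeta> / 2 \<le> Re (\<zeta> * u)) (\<lambda>\<zeta>. ray_integral z u (\<lambda>t. f t * exp (- \<zeta> * t)))"
proof -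
  have "norm (f (z + u * of_real x)) \<le> C * (1 + norm z) ^ N * (1 + x) ^ N" if x: "x \<ge> 0" for x
  proof -
    have "norm (z + u * of_real x) \<le> norm z + x"
      using norm_triangle_ineq[of z "u * of_real x"] u x by (simp add: norm_mult)
    then have "1 + norm (z + u * of_real x) \<le> (1 + norm z) * (1 + x)"
      using mult_nonneg_nonneg[OF norm_ge_zero[of z] x] unfolding ring_distribs mult_1_left mult_1_right
      by linarith
    then have "(1 + norm (z + u * of_real x)) ^ N \<le> ((1 + norm z) * (1 + x)) ^ N"
      by (intro power_mono) auto
    then have "C * (1 + norm (z + u * of_real x)) ^ N \<le> C * ((1 + norm z) * (1 + x)) ^ N"
      using C by (rule mult_left_mono)
    then show ?thesis
      using bound[OF x] by (simp add: power_mult_distrib mult_ac)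
  qed
  from norm_ray_integral_exp_polynomial_le[OF S u this] obtain C' where
    "\<And>\<zeta>. \<zeta> \<noteq> 0 \<Longrightarrow> norm \<zeta> \<le> 1 \<Longrightarrow> Re (\<zeta> * u) \<ge> norm \<zeta> / 2 \<Longrightarrow>
      norm (ray_integral z u (\<lambda>t. f t * exp (- \<zeta> * t))) \<le> C' / norm \<zeta> ^ (N + 1)"
    by blast
  then show ?thesis
    by (intro polynomial_growthI)
qed

text \<open>The rate 6 extends the region of holomorphy beyond the closed unit disc, so the integral
  is bounded near 0 from every direction.\<close>

lemma ray_bounded_growth:
  assumes S: "open S" "f holomorphic_on S" "ray z u \<subseteq> S" and u: "norm u = 1"
    and bound: "\<And>x. x \<ge> 0 \<Longrightarrow> norm (f (z + u * of_real x)) \<le> C * exp (- 6 * x)"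
  shows "polynomial_growth P (\<lambda>\<zeta>. ray_integral z u (\<lambda>t. f t * exp (- \<zeta> * t)))"
proof (rule polynomial_growth_continuous)
  have "(\<lambda>\<zeta>. ray_integral z u (\<lambda>t. f t * exp (- \<zeta> * t))) holomorphic_on {\<zeta>. - 6 < Re (\<zeta> * u)}"
    by (rule ray_integral_exp_holomorphic[OF S u bound])
  moreover have "cball 0 1 \<subseteq> {\<zeta>. - 6 < Re (\<zeta> * u)}"
  proof
    fix \<zeta> :: complex assume "\<zeta> \<in> cball 0 1"
    then have "norm (\<zeta> * u) \<le> 1"
      using u by (simp add: norm_mult)
    then show "\<zeta> \<in> {\<zeta>. - 6 < Re (\<zeta> * u)}"
      using abs_Re_le_cmod[of "\<zeta> * u"] unfolding mem_Collect_eq by linarith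
  qed
  ultimately show "continuous_on (cball 0 1) (\<lambda>\<zeta>. ray_integral z u (\<lambda>t. f t * exp (- \<zeta> * t)))"
    by (meson continuous_on_subset holomorphic_on_imp_continuous_on)
qed

lemma polynomial_growth_minus: "polynomial_growth P g \<Longrightarrow> polynomial_growth P (\<lambda>\<zeta>. - g \<zeta>)"
  by (simp add: polynomial_growth_def)

lemma horn_polynomial_growth:
  assumes S: "open S" "f holomorphic_on S" and c: "valid_path c" "path_image c \<subseteq> S"
    and u: "polynomial_growth P (\<lambda>\<zeta>. ray_integral (pathstart c) u (\<lambda>t. f t * exp (- \<zeta> * t)))"
    and v: "polynomial_growth P (\<lambda>\<zeta>. ray_integral (pathfinish c) v (\<lambda>t. f t * exp (- \<zeta> * t)))"
  shows "polynomial_growth P (\<lambda>\<zeta>. horn_integral c u v (\<lambda>t. f t * exp (- \<zeta> * t)))"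
proof -
  have "continuous_on (cball 0 1) (\<lambda>\<zeta>. contour_integral c (\<lambda>t. f t * exp (- \<zeta> * t)))"
    using contour_integral_exp_holomorphic[OF S c]
    by (meson continuous_on_subset holomorphic_on_imp_continuous_on subset_UNIV)
  then have "polynomial_growth P (\<lambda>\<zeta>. (contour_integral c (\<lambda>t. f t * exp (- \<zeta> * t))
      + - ray_integral (pathstart c) u (\<lambda>t. f t * exp (- \<zeta> * t)))
      + ray_integral (pathfinish c) v (\<lambda>t. f t * exp (- \<zeta> * t)))"
    by (intro polynomial_growth_add polynomial_growth_minus polynomial_growth_continuous u v)
  then show ?thesis
    by (simp add: horn_integral_def)
qed

text \<open>On horizontal rays f grows at most polynomially and the exponential in \<zeta> alone
  forces convergence, in the whole half-plane but with a possible singularity at its boundary point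
  0.\<close>

lemma horn_horizontal:
  assumes c: "poles_contour p a b I H0 c" and I: "finite I"
    and f: "f holomorphic_on - (left_poles a I \<union> G_right_poles p b)"
    and b: "strip_bound f C N H \<alpha> \<alpha>'" "H \<le> H0" and v: "v = 1 \<or> v = - 1"
  shows has_horn_integral_horizontal: "\<And>\<zeta>. Re (\<zeta> * v) > 0 \<Longrightarrow>
      has_horn_integral c v v (\<lambda>t. f t * exp (- \<zeta> * t)) (horn_integral c v v (\<lambda>t. f t * exp (- \<zeta> * t)))"
    and horn_horizontal_holomorphic:
      "(\<lambda>\<zeta>. horn_integral c v v (\<lambda>t. f t * exp (- \<zeta> * t))) holomorphic_on {\<zeta>. Re (\<zeta> * v) > 0}"
    and horn_horizontal_growth:
      "polynomial_growth (\<lambda>\<zeta>. norm \<zeta> / 2 \<le> Re (\<zeta> * v)) (\<lambda>\<zeta>. horn_integral c v v (\<lambda>t. f t * exp (- \<zeta> * t)))"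
proof -
  let ?S = "- (left_poles a I \<union> G_right_poles p b)"
  obtain \<gamma> h where h: "pathstart c = Complex \<gamma> (- h)" "pathfinish c = Complex \<gamma> h" "h > H"
    and sep: "separating_contour (left_poles a I) (G_right_poles p b) c"
    using c b(2) by (fastforce simp: poles_contour_def)
  have C: "C \<ge> 0" "H \<ge> 0" "\<alpha> \<ge> 0" "\<alpha>' \<ge> 0"
    and fup: "\<And>t. Im t \<ge> H \<Longrightarrow> norm (f t) \<le> C * (1 + norm t) ^ N * exp (- \<alpha> * Im t)"
    and flow: "\<And>t. Im t \<le> - H \<Longrightarrow> norm (f t) \<le> C * (1 + norm t) ^ N * exp (\<alpha>' * Im t)"
    using b(1) unfolding strip_bound_def by blast+
  have Im0: "Im v = 0"
    using v by auto
  have up: "norm (f (pathfinish c + v * of_real x)) \<le> C * (1 + norm (pathfinish c + v * of_real x)) ^ N" for x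
  proof -
    have "norm (f (pathfinish c + v * of_real x)) \<le> C * (1 + norm (pathfinish c + v * of_real x)) ^ N
        * exp (- \<alpha> * Im (pathfinish c + v * of_real x))"
      by (rule fup) (use h Im0 in simp)
    also have "\<dots> \<le> C * (1 + norm (pathfinish c + v * of_real x)) ^ N * 1"
      using C h Im0 by (intro mult_left_mono) (auto simp: mult_nonneg_nonneg)
    finally show ?thesis by simp
  qed
  have low: "norm (f (pathstart c + v * of_real x)) \<le> C * (1 + norm (pathstart c + v * of_real x)) ^ N" for x
  proof -
    have "norm (f (pathstart c + v * of_real x)) \<le> C * (1 + norm (pathstart c + v * of_real x)) ^ N
        * exp (\<alpha>' * Im (pathstart c + v * of_real x))"
      by (rule flow) (use h Im0 in simp)
    also have "\<dots> \<le> C * (1 + norm (pathstart c + v * of_real x)) ^ N * 1"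
      using C h Im0 by (intro mult_left_mono) (auto simp: mult_nonneg_nonneg)
    finally show ?thesis by simp
  qed
  have S: "open ?S"
    by (rule open_Compl[OF closed_subset_poles[OF I order_refl]])
  have cS: "valid_path c" "path_image c \<subseteq> ?S"
    using separating_contourD[OF sep] by auto
  have v1: "norm v = 1"
    using v by auto
  have rays: "ray (pathfinish c) v \<subseteq> ?S" "ray (pathstart c) v \<subseteq> ?S"
  proof -
    have "ray (pathfinish c) v \<subseteq> {t. Im t \<ge> Im (pathfinish c)}" "ray (pathstart c) v \<subseteq> {t. Im t \<le> Im (pathstart c)}"
      using Im0 by (auto simp: ray_def)
    then show "ray (pathfinish c) v \<subseteq> ?S" "ray (pathstart c) v \<subseteq> ?S"
      using poles_contour_sector[OF c] by (meson order.trans)+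
  qed
  have exp_bound: "\<exists>C1 C2. (\<forall>x\<ge>0. norm (f (pathstart c + v * of_real x)) \<le> C1 * exp (\<beta> * x))
      \<and> (\<forall>x\<ge>0. norm (f (pathfinish c + v * of_real x)) \<le> C2 * exp (\<beta> * x))" if "\<beta> > 0" for \<beta>
  proof -
    have "- \<beta> < 0"
      using that by simp
    obtain C1 where "\<And>x. x \<ge> 0 \<Longrightarrow> norm (f (pathstart c + v * of_real x)) \<le> C1 * exp (- (- \<beta>) * x)"
      by (rule ray_exp_bound[OF v1 C(1) \<open>- \<beta> < 0\<close>, where f = f and z = "pathstart c" and N = N]) (use low in auto)
    moreover obtain C2 where "\<And>x. x \<ge> 0 \<Longrightarrow> norm (f (pathfinish c + v * of_real x)) \<le> C2 * exp (- (- \<beta>) * x)"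
      by (rule ray_exp_bound[OF v1 C(1) \<open>- \<beta> < 0\<close>, where f = f and z = "pathfinish c" and N = N]) (use up in auto)
    ultimately show ?thesis
      by auto
  qed
  show "has_horn_integral c v v (\<lambda>t. f t * exp (- \<zeta> * t)) (horn_integral c v v (\<lambda>t. f t * exp (- \<zeta> * t)))"
    if \<zeta>: "Re (\<zeta> * v) > 0" for \<zeta>
  proof -
    obtain C1 C2 where *: "\<And>x. x \<ge> 0 \<Longrightarrow> norm (f (pathstart c + v * of_real x)) \<le> C1 * exp (Re (\<zeta> * v) / 2 * x)"
      "\<And>x. x \<ge> 0 \<Longrightarrow> norm (f (pathfinish c + v * of_real x)) \<le> C2 * exp (Re (\<zeta> * v) / 2 * x)"
      using exp_bound[of "Re (\<zeta> * v) / 2"] \<zeta> by auto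
    show ?thesis
      by (rule has_horn_integral_exp[OF S f cS rays(2) v1 *(1) _ rays(1) v1 *(2)]) (use \<zeta> in auto)
  qed
  \<comment> \<open>Every positive \<beta> absorbs the polynomial; the resulting half-planes exhaust
    the one of the claim.\<close>
  have "(\<lambda>\<zeta>. horn_integral c v v (\<lambda>t. f t * exp (- \<zeta> * t))) holomorphic_on (\<Union>\<beta>\<in>{0<..}. {\<zeta>. Re (\<zeta> * v) > \<beta>})"
  proof (rule holomorphic_on_UN_open)
    fix \<beta> :: real assume "\<beta> \<in> {0<..}"
    then obtain C1 C2 where *: "\<And>x. x \<ge> 0 \<Longrightarrow> norm (f (pathstart c + v * of_real x)) \<le> C1 * exp (\<beta> * x)"
      "\<And>x. x \<ge> 0 \<Longrightarrow> norm (f (pathfinish c + v * of_real x)) \<le> C2 * exp (\<beta> * x)"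
      using exp_bound[of \<beta>] by auto
    show "(\<lambda>\<zeta>. horn_integral c v v (\<lambda>t. f t * exp (- \<zeta> * t))) holomorphic_on {\<zeta>. Re (\<zeta> * v) > \<beta>}"
      by (rule holomorphic_on_subset[OF horn_integral_exp_holomorphic[OF S f cS rays(2) v1 *(1) rays(1) v1 *(2)]]) auto
    show "open {\<zeta>. Re (\<zeta> * v) > \<beta>}"
      by (intro open_Collect_less continuous_intros)
  qed
  moreover have "{\<zeta>. Re (\<zeta> * v) > 0} \<subseteq> (\<Union>\<beta>\<in>{0<..}. {\<zeta>. Re (\<zeta> * v) > \<beta>})"
    using dense by (auto simp del: times_complex.sel)
  ultimately show "(\<lambda>\<zeta>. horn_integral c v v (\<lambda>t. f t * exp (- \<zeta> * t))) holomorphic_on {\<zeta>. Re (\<zeta> * v) > 0}"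
    by (rule holomorphic_on_subset)
  show "polynomial_growth (\<lambda>\<zeta>. norm \<zeta> / 2 \<le> Re (\<zeta> * v)) (\<lambda>\<zeta>. horn_integral c v v (\<lambda>t. f t * exp (- \<zeta> * t)))"
    by (rule horn_polynomial_growth[OF S f cS ray_polynomial_growth[OF S f rays(2) v1 C(1) low]
          ray_polynomial_growth[OF S f rays(1) v1 C(1) up]])
qed

section \<open>Closing the contour to the right\<close>

lemma polynomial_exp_tendsto_0:
  fixes K h \<delta> :: real
  assumes "\<delta> > 0" "h \<ge> 0"
  shows "((\<lambda>Y. K * (1 + (h + Y)) ^ N * exp (- \<delta> * Y)) \<longlongrightarrow> 0) at_top"
proof (rule Lim_null_comparison)
  define K' where "K' = (real N / (\<delta> / 2)) ^ N * exp (\<delta> / 2) * exp (\<delta> / 2 * h)"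
  show "\<forall>\<^sub>F Y in at_top. norm (K * (1 + (h + Y)) ^ N * exp (- \<delta> * Y)) \<le> \<bar>K\<bar> * K' * exp (- (\<delta> / 2) * Y)"
    using eventually_ge_at_top[of 0]
  proof eventually_elim
    case (elim Y)
    have "(1 + (h + Y)) ^ N \<le> (real N / (\<delta> / 2)) ^ N * exp (\<delta> / 2) * exp (\<delta> / 2 * (h + Y))"
      by (rule power_le_exp) (use assms elim in auto)
    also have "\<dots> = K' * exp (\<delta> / 2 * Y)"
      unfolding K'_def distrib_left exp_add by (simp only: mult_ac)
    finally have "\<bar>K\<bar> * (1 + (h + Y)) ^ N * exp (- \<delta> * Y) \<le> \<bar>K\<bar> * (K' * exp (\<delta> / 2 * Y)) * exp (- \<delta> * Y)"
      by (intro mult_right_mono mult_left_mono) auto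
    also have "\<dots> = \<bar>K\<bar> * K' * (exp (\<delta> / 2 * Y) * exp (- \<delta> * Y))"
      by (simp only: mult_ac)
    also have "exp (\<delta> / 2 * Y) * exp (- \<delta> * Y) = exp (- (\<delta> / 2) * Y)"
      unfolding exp_add [symmetric] by (simp add: field_simps)
    finally show ?case
      using assms elim by (simp add: abs_mult)
  qed
  show "((\<lambda>Y. \<bar>K\<bar> * K' * exp (- (\<delta> / 2) * Y)) \<longlongrightarrow> 0) at_top"
    using assms by real_asymp
qed

lemma Complex_diff_of_real: "Complex x y - of_real r = Complex (x - r) y"
  by (simp add: complex_eq_iff)

lemma norm_contour_integral_vertical_le:
  assumes "continuous_on (closed_segment (Complex X (- h)) (Complex X h)) f" "h \<ge> 0" "B \<ge> 0"
    and "\<And>t. Re t = X \<Longrightarrow> \<bar>Im t\<bar> \<le> h \<Longrightarrow> norm (f t) \<le> B"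
  shows "norm (contour_integral (linepath (Complex X (- h)) (Complex X h)) f) \<le> B * (2 * h)"
proof -
  have "norm (contour_integral (linepath (Complex X (- h)) (Complex X h)) f)
      \<le> B * norm (Complex X h - Complex X (- h))"
  proof (rule contour_integral_bound_linepath)
    fix t assume "t \<in> closed_segment (Complex X (- h)) (Complex X h)"
    then have "Re t = X" "\<bar>Im t\<bar> \<le> h"
      using assms(2) closed_segment_same_Re[of "Complex X (- h)" "Complex X h"]
      by (auto simp: closed_segment_eq_real_ivl)
    then show "norm (f t) \<le> B"
      by (rule assms(4))
  qed (use assms in \<open>auto intro: contour_integrable_continuous_linepath\<close>)
  also have "Complex X h - Complex X (- h) = \<i> * of_real (2 * h)"
    by (simp add: complex_eq_iff)
  then have "norm (Complex X h - Complex X (- h)) = 2 * h"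
    using assms(2) by (simp add: norm_mult)
  finally show ?thesis .
qed

lemma norm_exp_vertical_le:
  assumes "Re t = X" "\<bar>Im t\<bar> \<le> h"
  shows "norm (exp (- \<zeta> * t)) \<le> exp (norm \<zeta> * h) * exp (- Re \<zeta> * X)"
proof -
  have "Im \<zeta> * Im t \<le> \<bar>Im \<zeta>\<bar> * \<bar>Im t\<bar>"
    by (metis abs_ge_self abs_mult)
  also have "\<dots> \<le> norm \<zeta> * h"
    using assms(2) abs_Im_le_cmod[of \<zeta>] by (intro mult_mono) auto
  finally show ?thesis
    unfolding norm_exp_eq_Re exp_add [symmetric] using assms(1) by simp
qed

lemma norm_power_vertical_le:
  assumes "Re t = X" "\<bar>Im t\<bar> \<le> h"
  shows "(1 + norm t) ^ N \<le> (1 + (h + \<bar>X\<bar>)) ^ N"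
  using cmod_le[of t] assms by (intro power_mono) auto

lemma left_poles_Re_le:
  assumes "finite I" "w \<in> left_poles a I"
  shows "Re w \<le> (\<Sum>i\<in>I. norm (a i))"
proof -
  obtain i and m :: nat where i: "i \<in> I" "w = - a i - of_nat m"
    using assms(2) by (auto simp: left_poles_def)
  have "norm (a i) \<le> (\<Sum>i\<in>I. norm (a i))"
    using i assms(1) by (intro member_le_sum) auto
  then show ?thesis
    using i abs_Re_le_cmod[of "a i"] by simp
qed

lemma right_poles_Re_ge:
  assumes "w \<in> G_right_poles p b"
  shows "Re w \<ge> - (\<Sum>i=1..p. norm (b i))"
proof -
  obtain i and m :: nat where i: "i \<in> {1..p}" "w = 1 - b i + of_nat m"
    using assms by (auto simp: G_right_poles_eq)
  have "norm (b i) \<le> (\<Sum>i=1..p. norm (b i))"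
    using i by (intro member_le_sum) auto
  then show ?thesis
    using i abs_Re_le_cmod[of "b i"] by simp
qed

text \<open>All poles of this kernel lie to the left of the contour, so the contour can be pushed
  off to the right, where the exponential beats the polynomial growth. This disposes of one of the
  two terms in the kernel identity.\<close>

lemma horn_integral_Gamma_ratio'_eq_0:
  assumes c: "poles_contour p a b {1..p} H0 c" and \<zeta>: "Re \<zeta> > 0"
    and sb: "strip_bound (Gamma_ratio' p a b) C N H \<alpha> \<alpha>'" "H \<le> H0"
  shows "horn_integral c 1 1 (\<lambda>t. Gamma_ratio' p a b t * exp (- \<zeta> * t)) = 0"
proof -
  let ?f = "\<lambda>t. Gamma_ratio' p a b t * exp (- \<zeta> * t)" and ?A = "left_poles a {1..p}"
  obtain \<gamma> h where h: "pathstart c = Complex \<gamma> (- h)" "pathfinish c = Complex \<gamma> h" "h > H"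
    and sep: "separating_contour ?A (G_right_poles p b) c"
    using c sb(2) by (fastforce simp: poles_contour_def)
  have h0: "h > 0"
    using sb(1) h by (auto simp: strip_bound_def)
  \<comment> \<open>Right poles are no singularities here; dropping them from the separation allows
    the contour to cross them.\<close>
  have sepA: "separating_contour ?A {} c"
    using sep by (rule separating_contour_subset) auto
  have cl: "closed (?A \<union> {})"
    by (rule closed_subset_poles[of "{1..p}" _ a p b]) auto
  have hol: "?f holomorphic_on - (?A \<union> {})"
    by (intro holomorphic_intros Gamma_ratio'_holomorphic)
  obtain C' N' H' where CH: "C' > 0" "H' > 0"
    "\<And>t. Re t \<ge> H' \<or> \<bar>Im t\<bar> \<ge> H' \<Longrightarrow> norm (Gamma_ratio' p a b t) \<le> C' * (1 + norm t) ^ N'"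
    by (rule Gamma_ratio'_bound[of p a b]) blast
  have "has_horn_integral c 1 1 ?f (horn_integral c 1 1 ?f)"
    by (rule has_horn_integral_horizontal[OF c _ Gamma_ratio'_holomorphic sb]) (use \<zeta> in auto)
  then obtain l1 l2 where l: "horn_integral c 1 1 ?f = contour_integral c ?f - l1 + l2"
    "((\<lambda>Y. contour_integral (linepath (pathstart c) (pathstart c + 1 * of_real Y)) ?f) \<longlongrightarrow> l1) at_top"
    "((\<lambda>Y. contour_integral (linepath (pathfinish c) (pathfinish c + 1 * of_real Y)) ?f) \<longlongrightarrow> l2) at_top"
    unfolding has_horn_integral_def has_ray_integral_def by blast
  define K where "K = C' * exp (norm \<zeta> * h) * exp (- Re \<zeta> * \<gamma>) * (2 * h)"
  define X0 where "X0 = \<bar>\<gamma>\<bar> + H' + (\<Sum>i=1..p. norm (a i)) + 1"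
  have "((\<lambda>Y. contour_integral c ?f
        - contour_integral (linepath (pathstart c) (pathstart c + 1 * of_real Y)) ?f
        + contour_integral (linepath (pathfinish c) (pathfinish c + 1 * of_real Y)) ?f)
      \<longlongrightarrow> horn_integral c 1 1 ?f) at_top"
    unfolding l(1) by (intro tendsto_intros l)
  moreover have "((\<lambda>Y. contour_integral c ?f
        - contour_integral (linepath (pathstart c) (pathstart c + 1 * of_real Y)) ?f
        + contour_integral (linepath (pathfinish c) (pathfinish c + 1 * of_real Y)) ?f) \<longlongrightarrow> 0) at_top"
  proof (rule Lim_null_comparison)
    show "\<forall>\<^sub>F Y in at_top. norm (contour_integral c ?f
        - contour_integral (linepath (pathstart c) (pathstart c + 1 * of_real Y)) ?f
        + contour_integral (linepath (pathfinish c) (pathfinish c + 1 * of_real Y)) ?f)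
        \<le> K * (1 + ((h + \<bar>\<gamma>\<bar>) + Y)) ^ N' * exp (- Re \<zeta> * Y)"
      using eventually_ge_at_top[of X0]
    proof eventually_elim
      case (elim Y)
      define X where "X = \<gamma> + Y"
      \<comment> \<open>X exceeds the real parts of all left poles, so this segment separates them
        as c does, and the segments that join its ends to those of c are the truncated rays.\<close>
      let ?c = "linepath (Complex X (- h)) (Complex X h)"
      have nn: "0 \<le> (\<Sum>i=1..p. norm (a i))"
        by (intro sum_nonneg) auto
      have X: "X \<ge> H'" "X > (\<Sum>i=1..p. norm (a i))" "Y \<ge> 0"
        using elim CH(2) nn by (auto simp: X_def X0_def)
      have left: "Re w < X" if "w \<in> ?A" for w
        using left_poles_Re_le[OF _ that] X(2) by simp
      have sepX: "separating_contour ?A {} ?c"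
      proof (rule separating_contour_vertical_line)
        show "\<bar>Im w\<bar> < h" if "w \<in> ?A" for w
          using separating_contourD(3,4)[OF sepA, of w] that h by auto
      qed (use h0 left in auto)
      have ends: "pathstart c + 1 * of_real Y = pathstart ?c" "pathfinish c + 1 * of_real Y = pathfinish ?c"
        by (simp_all add: h X_def complex_eq_iff)
      have "contour_integral c ?f + contour_integral (linepath (pathfinish c) (pathfinish ?c)) ?f
          = contour_integral (linepath (pathstart c) (pathstart ?c)) ?f + contour_integral ?c ?f"
        by (rule separating_contour_integral_eq[OF cl hol sepA sepX])
      then have "contour_integral c ?f
        - contour_integral (linepath (pathstart c) (pathstart c + 1 * of_real Y)) ?f
        + contour_integral (linepath (pathfinish c) (pathfinish c + 1 * of_real Y)) ?f = contour_integral ?c ?f"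
        unfolding ends by (simp add: algebra_simps)
      also have "norm \<dots> \<le> (C' * (1 + (h + \<bar>X\<bar>)) ^ N' * (exp (norm \<zeta> * h) * exp (- Re \<zeta> * X))) * (2 * h)"
      proof (rule norm_contour_integral_vertical_le)
        have "closed_segment (Complex X (- h)) (Complex X h) \<subseteq> - (?A \<union> {})"
          using left closed_segment_same_Re[of "Complex X (- h)" "Complex X h"] by fastforce
        then show "continuous_on (closed_segment (Complex X (- h)) (Complex X h)) ?f"
          using hol by (meson continuous_on_subset holomorphic_on_imp_continuous_on)
        fix t assume t: "Re t = X" "\<bar>Im t\<bar> \<le> h"
        have "norm (Gamma_ratio' p a b t) \<le> C' * (1 + norm t) ^ N'"
          by (rule CH(3)) (use t X in simp)
        also have "\<dots> \<le> C' * (1 + (h + \<bar>X\<bar>)) ^ N'"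
          using CH(1) norm_power_vertical_le[OF t] by (intro mult_left_mono) auto
        finally show "norm (?f t) \<le> C' * (1 + (h + \<bar>X\<bar>)) ^ N' * (exp (norm \<zeta> * h) * exp (- Re \<zeta> * X))"
          by (rule norm_mult_le[OF _ norm_exp_vertical_le[OF t]])
      qed (use h0 CH in auto)
      also have "\<dots> = K * (1 + (h + \<bar>X\<bar>)) ^ N' * exp (- Re \<zeta> * Y)"
        unfolding K_def X_def distrib_left exp_add by (simp only: mult_ac)
      also have "\<dots> \<le> K * (1 + ((h + \<bar>\<gamma>\<bar>) + Y)) ^ N' * exp (- Re \<zeta> * Y)"
        using CH h0 X(3) by (intro mult_right_mono mult_left_mono power_mono) (auto simp: K_def X_def)
      finally show ?case .
    qed
    show "((\<lambda>Y. K * (1 + ((h + \<bar>\<gamma>\<bar>) + Y)) ^ N' * exp (- Re \<zeta> * Y)) \<longlongrightarrow> 0) at_top"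
      by (rule polynomial_exp_tendsto_0) (use \<zeta> h0 in auto)
  qed
  ultimately show ?thesis
    by (rule tendsto_unique[OF trivial_limit_at_top_linorder])
qed

section \<open>Closing the contour to the left\<close>

definition hyp_coeff :: "nat \<Rightarrow> (nat \<Rightarrow> complex) \<Rightarrow> (nat \<Rightarrow> complex) \<Rightarrow> nat \<Rightarrow> nat \<Rightarrow> complex" where
  "hyp_coeff p a b s n = (\<Prod>i=1..p. Gamma (1 - b i + a s + of_nat n))
          * (\<Prod>i\<in>{1..p}-{s}. rGamma (1 - a i + a s + of_nat n)) / fact n"

lemma separating_contour_disjoint:
  assumes "separating_contour A B c" "w \<in> A" "w \<in> B"
  shows False
proof -
  have "\<forall>\<^sub>F M in at_top. winding_number (left_loop c M) w = 1"
    "\<forall>\<^sub>F M in at_top. winding_number (left_loop c M) w = 0"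
    using assms by (auto simp: separating_contour_def)
  then have "\<forall>\<^sub>F M :: real in at_top. False"
    by eventually_elim simp
  then show False by simp
qed

text \<open>Gamma contributes (-1)^m / m! and the exponential factor of the kernel another (-1)^m;
  the reciprocal and the remaining Gamma factors at the pole are those of the coefficient.\<close>

lemma residue_F_kernel:
  assumes s: "s \<in> {1..p}" and \<sigma>: "\<sigma> = 1 \<or> \<sigma> = - 1"
    and np: "- a s - of_nat m \<notin> G_right_poles p b"
  shows "residue (\<lambda>t. F_kernel p a b s \<sigma> t * exp (- \<zeta> * t)) (- a s - of_nat m)
    = hyp_coeff p a b s m * exp \<zeta> ^ m * exp (a s * \<zeta>)"
proof -
  let ?w = "- a s - of_nat m" and ?f = "\<lambda>t. F_kernel p a b s \<sigma> t * exp (- \<zeta> * t)"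
  define g where "g t = (\<Prod>i=1..p. Gamma (1 - b i - t)) * (\<Prod>i\<in>{1..p}-{s}. rGamma (1 - a i - t))
     * exp (of_real \<sigma> * \<i> * (of_real pi * (a s + t))) * exp (- \<zeta> * t)" for t
  define S where "S = - ((left_poles a {s} - {?w}) \<union> G_right_poles p b)"
  have opS: "open S" "open (- G_right_poles p b)"
    unfolding S_def by (intro open_Compl closed_subset_poles[of "{s}" _ a p b]; auto)+
  have "residue ?f ?w = (- 1) ^ m / fact m * g ?w"
  proof (rule residue_simple'[of S])
    show "open S" "?w \<in> S"
      using opS np by (auto simp: S_def)
    have "?w \<in> left_poles a {s}"
      by (auto simp: left_poles_def)
    then have S: "S - {?w} = - (left_poles a {s} \<union> G_right_poles p b)"
      using np by (auto simp: S_def)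
    show "?f holomorphic_on S - {?w}"
      unfolding S by (intro holomorphic_on_mult F_kernel_holomorphic holomorphic_intros) simp
    have "g holomorphic_on - ({} \<union> G_right_poles p b)"
      unfolding g_def[abs_def]
      by (intro holomorphic_on_mult holomorphic_on_prod Gamma_holomorphic_off_right_poles
          holomorphic_rGamma' holomorphic_intros)
    then have "continuous_on (- G_right_poles p b) g"
      using holomorphic_on_imp_continuous_on by (simp only: sup_bot_left)
    then have "isCont g ?w"
      using np continuous_on_eq_continuous_at[OF opS(2)] by blast
    then have g: "g \<midarrow>?w\<rightarrow> g ?w"
      by (rule isContD)
    have "filterlim (\<lambda>t. a s + t) (at (- of_nat m)) (at ?w)"
      unfolding filterlim_at
    proof (intro conjI)
      show "(\<lambda>t. a s + t) \<midarrow>?w\<rightarrow> - of_nat m"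
        by (auto intro!: tendsto_eq_intros)
      show "\<forall>\<^sub>F t in at ?w. a s + t \<in> UNIV \<and> a s + t \<noteq> - of_nat m"
      proof (rule eventually_mono[OF eventually_neq_at_within[of ?w]])
        fix t assume t: "t \<noteq> ?w"
        have "a s + t \<noteq> - of_nat m"
        proof
          assume "a s + t = - of_nat m"
          then have "t = - of_nat m - a s"
            by (metis add_diff_cancel_left')
          with t show False by simp
        qed
        then show "a s + t \<in> UNIV \<and> a s + t \<noteq> - of_nat m"
          by simp
      qed
    qed
    from filterlim_compose[OF Gamma_residues[of m] this]
    have "(\<lambda>t. Gamma (a s + t) * (a s + t + of_nat m)) \<midarrow>?w\<rightarrow> (- 1) ^ m / fact m" .
    from tendsto_mult[OF this g]
    have "(\<lambda>t. Gamma (a s + t) * (a s + t + of_nat m) * g t) \<midarrow>?w\<rightarrow> (- 1) ^ m / fact m * g ?w" .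
    moreover have "?f t * (t - ?w) = Gamma (a s + t) * (a s + t + of_nat m) * g t" for t
    proof -
      have "t - ?w = a s + t + of_nat m"
        by simp
      then show ?thesis
        unfolding F_kernel_def g_def by (simp only: mult_ac)
    qed
    ultimately show "(\<lambda>t. ?f t * (t - ?w)) \<midarrow>?w\<rightarrow> (- 1) ^ m / fact m * g ?w"
      by (simp only:)
  qed
  also have "\<dots> = hyp_coeff p a b s m * exp \<zeta> ^ m * exp (a s * \<zeta>)"
  proof -
    have args: "1 - x - ?w = 1 - x + a s + of_nat m" for x
      by simp
    have "exp (of_real \<sigma> * \<i> * (of_real pi * (a s + ?w))) = (- 1) ^ m"
    proof -
      have "of_real \<sigma> * \<i> * (of_real pi * (a s + ?w)) = of_nat m * (- of_real \<sigma> * \<i> * of_real pi)"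
        by simp
      also have "exp \<dots> = exp (- of_real \<sigma> * \<i> * of_real pi) ^ m"
        by (rule exp_of_nat_mult)
      also have "exp (- of_real \<sigma> * \<i> * of_real pi) = - 1"
        using \<sigma> by (auto simp: exp_minus mult.commute)
      finally show ?thesis .
    qed
    moreover have "exp (- \<zeta> * ?w) = exp \<zeta> ^ m * exp (a s * \<zeta>)"
      by (simp add: algebra_simps exp_add flip: exp_of_nat_mult)
    moreover have "(- 1) ^ m * (- 1) ^ m = (1 :: complex)"
      by (simp flip: power_mult_distrib)
    ultimately show ?thesis
      unfolding g_def hyp_coeff_def args by (simp add: field_simps)
  qed
  finally show ?thesis .
qed

text \<open>With this M the left side of the loop has real part - Re (a s) - n - 1/2, half way
  between two consecutive poles. The loop encloses exactly the poles with m \<le> n; the other left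
  poles of index s lie outside, and the right poles have winding number 0.\<close>

lemma left_loop_F_kernel:
  assumes c: "poles_contour p a b {1..p} H0 c" and s: "s \<in> {1..p}" and \<sigma>: "\<sigma> = 1 \<or> \<sigma> = - 1"
    and \<gamma>: "Re (pathstart c) = \<gamma>" and M: "M = \<gamma> + Re (a s) + real n + 1/2" "M > 0"
    and far: "\<And>w. w \<in> path_image c \<union> G_right_poles p b \<Longrightarrow> \<gamma> - M < Re w"
  shows "(\<lambda>t. F_kernel p a b s \<sigma> t * exp (- \<zeta> * t)) holomorphic_on - (left_poles a {s} \<union> G_right_poles p b)"
    and "path_image (left_loop c M) \<subseteq> - (left_poles a {s} \<union> G_right_poles p b)"
    and "contour_integral (left_loop c M) (\<lambda>t. F_kernel p a b s \<sigma> t * exp (- \<zeta> * t))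
      = 2 * of_real pi * \<i> * (\<Sum>m\<le>n. hyp_coeff p a b s m * exp \<zeta> ^ m * exp (a s * \<zeta>))"
proof -
  let ?f = "\<lambda>t. F_kernel p a b s \<sigma> t * exp (- \<zeta> * t)" and ?w = "\<lambda>m::nat. - a s - of_nat m"
  let ?R = "G_right_poles p b" and ?A = "left_poles a {s}"
  have "?A \<subseteq> left_poles a {1..p}"
    using s by (auto simp: left_poles_def)
  then have sep: "separating_contour ?A ?R c"
    using c separating_contour_subset[of "left_poles a {1..p}" ?R c ?A ?R] by (simp add: poles_contour_def)
  note cD = separating_contourD[OF sep]
  define pts where "pts = ?w ` {..n}"
  define S where "S = - ((?A - pts) \<union> ?R)"
  show hol: "?f holomorphic_on - (?A \<union> ?R)"
    by (intro holomorphic_intros F_kernel_holomorphic) auto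
  have pts: "pts \<subseteq> ?A" "pts \<inter> ?R = {}"
    using separating_contour_disjoint[OF sep] by (auto simp: pts_def left_poles_def)
  have S_pts: "S - pts = - (?A \<union> ?R)"
    using pts by (auto simp: S_def)
  have near: "\<gamma> - M < Re w" if "w \<in> pts \<union> ?R" for w
    using that far[of w] by (auto simp: pts_def M)
  have far_left: "Re w < \<gamma> - M" if w: "w \<in> ?A - pts" for w
  proof -
    obtain m :: nat where m: "w = ?w m"
      using w by (auto simp: left_poles_def)
    then have "m > n"
      using w by (auto simp: pts_def not_le[symmetric])
    then have "real m \<ge> real n + 1"
      by linarith
    then show ?thesis
      by (simp add: m M)
  qed
  have half: "path_image (left_loop c M) \<subseteq> {t. \<gamma> - M \<le> Re t}"
    unfolding path_image_left_loop
    by (intro Un_least closed_segment_subset convex_halfspace_Re_ge) (use far M(2) \<gamma> cD(2) in \<open>auto intro: less_imp_le\<close>)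
  have notin: "w \<notin> path_image (left_loop c M)" if "w \<in> ?A \<union> ?R" for w
  proof (cases "w \<in> ?A - pts")
    case True
    then show ?thesis
      using far_left half by fastforce
  next
    case False
    then have "\<gamma> - M < Re w"
      using near that by auto
    then show ?thesis
      by (intro not_in_left_loop) (use cD that \<gamma> in auto)
  qed
  then show "path_image (left_loop c M) \<subseteq> - (?A \<union> ?R)"
    by blast
  have "contour_integral (left_loop c M) ?f
      = 2 * pi * \<i> * (\<Sum>w\<in>pts. winding_number (left_loop c M) w * residue ?f w)"
  proof (rule Residue_theorem)
    have sub: "(?A - pts) \<union> ?R \<subseteq> ?A \<union> ?R" by auto
    show "open S"
      unfolding S_def by (rule open_Compl[OF closed_subset_poles[OF _ sub]]) simp
    have "countable ((?A - pts) \<union> ?R)"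
      by (rule countable_subset[OF sub]) (auto simp: left_poles_def G_right_poles_eq)
    then show "connected S"
      unfolding S_def by (intro path_connected_imp_connected path_connected_complement_countable) simp_all
    show "finite pts" by (simp add: pts_def)
    show "?f holomorphic_on S - pts"
      unfolding S_pts by (rule hol)
    show "path_image (left_loop c M) \<subseteq> S - pts"
      unfolding S_pts using notin by blast
    show "\<forall>z. z \<notin> S \<longrightarrow> winding_number (left_loop c M) z = 0"
    proof (intro allI impI)
      fix z assume "z \<notin> S"
      then consider "z \<in> ?A - pts" | "z \<in> ?R"
        by (auto simp: S_def)
      then show "winding_number (left_loop c M) z = 0"
      proof cases
        case 1
        show ?thesis
          by (rule winding_number_zero_outside[OF _ convex_halfspace_Re_ge _ _ half])
            (use far_left[OF 1] cD(1) in \<open>auto simp: valid_path_imp_path valid_path_left_loop\<close>)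
      next
        case 2
        have "z \<notin> ?A"
          using separating_contour_disjoint[OF sep] 2 by blast
        then show ?thesis
          using winding_number_left_loop_eq[OF sep, of z M] 2 near[of z] \<gamma> by auto
      qed
    qed
  qed (use cD(1) valid_path_left_loop in auto)
  also have "(\<Sum>w\<in>pts. winding_number (left_loop c M) w * residue ?f w)
      = (\<Sum>m\<le>n. hyp_coeff p a b s m * exp \<zeta> ^ m * exp (a s * \<zeta>))"
  proof -
    have "inj_on ?w {..n}"
      by (auto simp: inj_on_def)
    then have "(\<Sum>w\<in>pts. winding_number (left_loop c M) w * residue ?f w)
        = (\<Sum>m\<le>n. winding_number (left_loop c M) (?w m) * residue ?f (?w m))"
      unfolding pts_def by (simp add: sum.reindex)
    also have "\<dots> = (\<Sum>m\<le>n. hyp_coeff p a b s m * exp \<zeta> ^ m * exp (a s * \<zeta>))"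
    proof (rule sum.cong [OF refl])
      fix m assume "m \<in> {..n}"
      then have m: "?w m \<in> pts"
        by (auto simp: pts_def)
      have "winding_number (left_loop c M) (?w m) = 1"
        using winding_number_left_loop_eq[OF sep, of "?w m" M] m pts near[of "?w m"] \<gamma> by auto
      moreover have "?w m \<notin> ?R"
        using m pts by auto
      ultimately show "winding_number (left_loop c M) (?w m) * residue ?f (?w m)
          = hyp_coeff p a b s m * exp \<zeta> ^ m * exp (a s * \<zeta>)"
        using residue_F_kernel[OF s \<sigma>] by simp
    qed
    finally show ?thesis .
  qed
  finally show "contour_integral (left_loop c M) ?f
      = 2 * of_real pi * \<i> * (\<Sum>m\<le>n. hyp_coeff p a b s m * exp \<zeta> ^ m * exp (a s * \<zeta>))"
    by simp
qed


text \<open>Midway between zeros the squared modulus is (cosh (2 pi y) + 1) / 2 with y = Im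
  w.\<close>

lemma norm_sin_pi_half_integer_ge:
  assumes "Re w = - (real n + 1/2)"
  shows "norm (sin (of_real pi * w)) \<ge> 1"
proof -
  define E where "E = exp (2 * Im (of_real pi * w))"
  have "2 * Re (of_real pi * w) = - ((2 * real n + 1) * pi)"
  proof -
    have "Re (of_real pi * w) = pi * Re w"
      by simp
    then show ?thesis
      unfolding assms by (simp add: field_simps)
  qed
  then have "cos (2 * Re (of_real pi * w)) = cos ((2 * real n + 1) * pi)"
    by (simp only: cos_minus)
  also have "\<dots> = - 1"
    using cos_npi[of "2 * n + 1"] by (simp add: add.commute)
  finally have "norm (sin (of_real pi * w)) ^ 2 = (E + inverse E + 2) / 4"
    unfolding norm_sin_squared E_def by simp
  moreover have "E + inverse E \<ge> 2"
  proof -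
    have "E > 0"
      by (simp add: E_def)
    then have "E + inverse E - 2 = (E - 1)\<^sup>2 / E"
      by (simp add: field_simps power2_eq_square)
    also have "\<dots> \<ge> 0"
      using \<open>E > 0\<close> by simp
    finally show ?thesis by simp
  qed
  ultimately have "1\<^sup>2 \<le> norm (sin (of_real pi * w)) ^ 2"
    by simp
  then show ?thesis
    by (rule power2_le_imp_le) simp
qed

text \<open>The left loops tend to the contour with both ends turned left because their vertical
  sides contribute less and less, so the partial sums of residues converge to its integral. The
  series is the same for both \<sigma>, which later identifies the two integrals.\<close>

lemma horn_integral_F_kernel_sums:
  assumes c: "poles_contour p a b {1..p} H0 c" and s: "s \<in> {1..p}" and \<sigma>: "\<sigma> = 1 \<or> \<sigma> = - 1"
    and \<zeta>: "Re \<zeta> < 0" and sb: "strip_bound (F_kernel p a b s \<sigma>) C N H \<alpha> \<alpha>'" "H \<le> H0"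
  shows "(\<lambda>m. hyp_coeff p a b s m * exp \<zeta> ^ m) sums
    (horn_integral c (- 1) (- 1) (\<lambda>t. F_kernel p a b s \<sigma> t * exp (- \<zeta> * t)) * exp (- a s * \<zeta>) / (2 * of_real pi * \<i>))"
proof -
  let ?f = "\<lambda>t. F_kernel p a b s \<sigma> t * exp (- \<zeta> * t)" and ?R = "G_right_poles p b"
  let ?h = "horn_integral c (- 1) (- 1) ?f"
  obtain \<gamma> h where h: "pathstart c = Complex \<gamma> (- h)" "pathfinish c = Complex \<gamma> h" "h > H"
    and sep: "separating_contour (left_poles a {1..p}) ?R c"
    using c sb(2) by (fastforce simp: poles_contour_def)
  have h0: "h > 0"
    using sb(1) h by (auto simp: strip_bound_def)
  have "has_horn_integral c (- 1) (- 1) ?f ?h"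
    by (rule has_horn_integral_horizontal[OF c _ F_kernel_holomorphic sb]) (use \<zeta> s in auto)
  then obtain l1 l2 where l: "?h = contour_integral c ?f - l1 + l2" "?f contour_integrable_on c"
    "((\<lambda>Y. contour_integral (linepath (pathstart c) (pathstart c + - 1 * of_real Y)) ?f) \<longlongrightarrow> l1) at_top"
    "((\<lambda>Y. contour_integral (linepath (pathfinish c) (pathfinish c + - 1 * of_real Y)) ?f) \<longlongrightarrow> l2) at_top"
    unfolding has_horn_integral_def has_ray_integral_def by blast
  obtain C' N' H' where CH: "C' > 0" "H' > 0"
    "\<And>t. Re t \<le> - H' \<or> \<bar>Im t\<bar> \<ge> H' \<Longrightarrow> norm (Gamma_ratio p a b t) \<le> C' * (1 + norm t) ^ N'"
    by (rule Gamma_ratio_bound[of p a b]) blast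
  obtain r where r: "\<And>w. w \<in> path_image c \<Longrightarrow> - r \<le> Re w"
  proof -
    have "bounded (path_image c)"
      using separating_contourD(1)[OF sep] by (simp add: compact_imp_bounded compact_valid_path_image)
    then obtain r where "\<forall>w\<in>path_image c. norm w \<le> r"
      by (auto simp: bounded_iff)
    then have "- r \<le> Re w" if "w \<in> path_image c" for w
      using abs_Re_le_cmod[of w] that by fastforce
    then show ?thesis
      using that by blast
  qed
  \<comment> \<open>The summand 1/2 keeps the vertical sides away from the zeros of the sine,
    uniformly in n.\<close>
  define M where "M n = \<gamma> + Re (a s) + real n + 1/2" for n
  define E where "E = exp (pi * (norm (a s) + h))"
  define K where "K = pi * E * C' * exp (norm \<zeta> * h) * (2 * h)"
  define V where "V n = contour_integral (linepath (Complex (\<gamma> - M n) (- h)) (Complex (\<gamma> - M n) h)) ?f" for n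
  \<comment> \<open>Far enough that the vertical side passes to the left of c and of all right poles
    and lies in the half-plane where \<open>Gamma_ratio\<close> is bounded polynomially.\<close>
  define Z where "Z = 1 + \<bar>\<gamma>\<bar> + \<bar>r\<bar> + H' + (\<Sum>i=1..p. norm (b i))"
  have M: "filterlim M at_top sequentially"
    unfolding M_def by real_asymp
  then have ev: "\<forall>\<^sub>F n in sequentially. M n \<ge> Z + \<gamma> \<and> M n \<ge> Z"
    by (intro eventually_conj) (auto simp: filterlim_at_top)
  have nn: "0 \<le> (\<Sum>i=1..p. norm (b i))"
    by (intro sum_nonneg) auto
  have far: "\<gamma> - M n < Re w" if n: "M n \<ge> Z + \<gamma>" and w: "w \<in> path_image c \<union> ?R" for n w
    using w
  proof
    assume "w \<in> path_image c"
    then show ?thesis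
      using r[of w] n nn CH(2) unfolding Z_def by linarith
  next
    assume "w \<in> ?R"
    then show ?thesis
      using right_poles_Re_ge[of w p b] n CH(2) unfolding Z_def by linarith
  qed
  have loop: "?f holomorphic_on - (left_poles a {s} \<union> ?R)"
    "path_image (left_loop c (M n)) \<subseteq> - (left_poles a {s} \<union> ?R)"
    "contour_integral (left_loop c (M n)) ?f
      = 2 * of_real pi * \<i> * (\<Sum>m\<le>n. hyp_coeff p a b s m * exp \<zeta> ^ m * exp (a s * \<zeta>))"
    if n: "M n \<ge> Z + \<gamma>" "M n \<ge> Z" for n
  proof -
    have M0: "M n > 0"
      using n(2) nn CH(2) unfolding Z_def by linarith
    have \<gamma>: "Re (pathstart c) = \<gamma>"
      by (simp add: h)
    note L = left_loop_F_kernel[OF c s \<sigma> _ M_def _ far[OF n(1)]]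
    show "?f holomorphic_on - (left_poles a {s} \<union> ?R)"
      by (rule L(1)) (fact \<gamma> M0)+
    show "path_image (left_loop c (M n)) \<subseteq> - (left_poles a {s} \<union> ?R)"
      by (rule L(2)) (fact \<gamma> M0)+
    show "contour_integral (left_loop c (M n)) ?f
      = 2 * of_real pi * \<i> * (\<Sum>m\<le>n. hyp_coeff p a b s m * exp \<zeta> ^ m * exp (a s * \<zeta>))"
      by (rule L(3)) (fact \<gamma> M0)+
  qed
  have split: "contour_integral (left_loop c (M n)) ?f = contour_integral c ?f
      - contour_integral (linepath (pathstart c) (pathstart c + - 1 * of_real (M n))) ?f
      + contour_integral (linepath (pathfinish c) (pathfinish c + - 1 * of_real (M n))) ?f - V n"
    and contV: "continuous_on (closed_segment (Complex (\<gamma> - M n) (- h)) (Complex (\<gamma> - M n) h)) ?f"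
    if n: "M n \<ge> Z + \<gamma>" "M n \<ge> Z" for n
  proof -
    let ?P = "pathfinish c - of_real (M n)" and ?Q = "pathstart c - of_real (M n)"
    have PQ: "?P = Complex (\<gamma> - M n) h" "?Q = Complex (\<gamma> - M n) (- h)"
      by (simp_all add: h Complex_diff_of_real)
    have cont: "continuous_on (closed_segment (pathfinish c) ?P) ?f" "continuous_on (closed_segment ?P ?Q) ?f"
      "continuous_on (closed_segment ?Q (pathstart c)) ?f"
      using loop(1)[OF n] loop(2)[OF n] unfolding path_image_left_loop
      by (meson continuous_on_subset holomorphic_on_imp_continuous_on le_sup_iff)+
    then have int: "?f contour_integrable_on linepath (pathfinish c) ?P" "?f contour_integrable_on linepath ?P ?Q"
      "?f contour_integrable_on linepath ?Q (pathstart c)"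
      by (auto intro: contour_integrable_continuous_linepath)
    have "contour_integral (left_loop c (M n)) ?f = contour_integral c ?f + (contour_integral (linepath (pathfinish c) ?P) ?f
        + (contour_integral (linepath ?P ?Q) ?f + contour_integral (linepath ?Q (pathstart c)) ?f))"
      unfolding left_loop_def using l(2) int separating_contourD(1)[OF sep] by simp
    moreover have "contour_integral (linepath ?P ?Q) ?f = - V n"
      unfolding V_def PQ [symmetric] by (rule contour_integral_reverse_linepath[OF cont(2)])
    moreover have "contour_integral (linepath ?Q (pathstart c)) ?f = - contour_integral (linepath (pathstart c) ?Q) ?f"
      by (rule contour_integral_reverse_linepath[OF cont(3)])
    ultimately show "contour_integral (left_loop c (M n)) ?f = contour_integral c ?f
      - contour_integral (linepath (pathstart c) (pathstart c + - 1 * of_real (M n))) ?f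
      + contour_integral (linepath (pathfinish c) (pathfinish c + - 1 * of_real (M n))) ?f - V n"
      by simp
    show "continuous_on (closed_segment (Complex (\<gamma> - M n) (- h)) (Complex (\<gamma> - M n) h)) ?f"
      using cont(2) unfolding PQ by (simp add: closed_segment_commute)
  qed
  have V: "norm (V n) \<le> K * (1 + (h + (M n - \<gamma>))) ^ N' * exp (- (- Re \<zeta>) * (M n - \<gamma>))"
    if n: "M n \<ge> Z + \<gamma>" "M n \<ge> Z" for n
  proof -
    have X: "M n - \<gamma> \<ge> H'" "\<bar>\<gamma> - M n\<bar> = M n - \<gamma>"
      using n nn CH(2) unfolding Z_def by linarith+
    have "norm (V n) \<le> (pi * E * (C' * (1 + (h + \<bar>\<gamma> - M n\<bar>)) ^ N') * (exp (norm \<zeta> * h) * exp (- Re \<zeta> * (\<gamma> - M n)))) * (2 * h)"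
      unfolding V_def
    proof (rule norm_contour_integral_vertical_le[OF contV[OF n]])
      fix t assume t: "Re t = \<gamma> - M n" "\<bar>Im t\<bar> \<le> h"
      have sin1: "norm (sin (of_real pi * (a s + t))) \<ge> 1"
        by (rule norm_sin_pi_half_integer_ge[of _ n]) (simp add: t M_def)
      then have nz: "sin (of_real pi * (a s + t)) \<noteq> 0"
        by auto
      have "norm (of_real pi / sin (of_real pi * (a s + t)) :: complex) \<le> pi"
        using sin1 by (simp add: norm_divide divide_le_eq mult_le_cancel_left1 pos_divide_le_eq)
      moreover have "norm (exp (of_real \<sigma> * \<i> * (of_real pi * (a s + t)))) \<le> E"
      proof -
        have "- \<sigma> * Im (a s + t) \<le> norm (a s) + h"
          using \<sigma> abs_Im_le_cmod[of "a s"] t(2) by auto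
        then have "pi * (- \<sigma> * Im (a s + t)) \<le> pi * (norm (a s) + h)"
          by (intro mult_left_mono) auto
        moreover have "Re (of_real \<sigma> * \<i> * (of_real pi * (a s + t))) = pi * (- \<sigma> * Im (a s + t))"
          by (simp add: algebra_simps)
        ultimately show ?thesis
          unfolding norm_exp_eq_Re E_def by (simp only: exp_le_cancel_iff)
      qed
      moreover have "norm (Gamma_ratio p a b t) \<le> C' * (1 + (h + \<bar>\<gamma> - M n\<bar>)) ^ N'"
      proof -
        have "norm (Gamma_ratio p a b t) \<le> C' * (1 + norm t) ^ N'"
          by (rule CH(3)) (use t X in simp)
        also have "\<dots> \<le> C' * (1 + (h + \<bar>\<gamma> - M n\<bar>)) ^ N'"
          using CH(1) norm_power_vertical_le[OF t] by (intro mult_left_mono) auto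
        finally show ?thesis .
      qed
      ultimately have "norm (F_kernel p a b s \<sigma> t) \<le> pi * E * (C' * (1 + (h + \<bar>\<gamma> - M n\<bar>)) ^ N')"
        unfolding F_kernel_eq[of s p a t b \<sigma>, OF s nz] by (intro norm_mult_le)
      then show "norm (?f t) \<le> pi * E * (C' * (1 + (h + \<bar>\<gamma> - M n\<bar>)) ^ N') * (exp (norm \<zeta> * h) * exp (- Re \<zeta> * (\<gamma> - M n)))"
        by (rule norm_mult_le[OF _ norm_exp_vertical_le[OF t]])
    qed (use h0 CH in \<open>auto simp: E_def\<close>)
    also have "\<dots> = K * (1 + (h + (M n - \<gamma>))) ^ N' * exp (- Re \<zeta> * (\<gamma> - M n))"
      unfolding K_def X(2) by (simp only: mult_ac)
    also have "- Re \<zeta> * (\<gamma> - M n) = - (- Re \<zeta>) * (M n - \<gamma>)"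
      by (simp add: algebra_simps)
    finally show ?thesis .
  qed
  have V0: "V \<longlonglongrightarrow> 0"
  proof (rule Lim_null_comparison)
    show "\<forall>\<^sub>F n in sequentially. norm (V n) \<le> K * (1 + (h + (M n - \<gamma>))) ^ N' * exp (- (- Re \<zeta>) * (M n - \<gamma>))"
      using ev by eventually_elim (rule V; simp)
    have "filterlim (\<lambda>n. M n - \<gamma>) at_top sequentially"
      unfolding M_def by real_asymp
    moreover have "((\<lambda>Y. K * (1 + (h + Y)) ^ N' * exp (- (- Re \<zeta>) * Y)) \<longlongrightarrow> 0) at_top"
      by (rule polynomial_exp_tendsto_0) (use \<zeta> h0 in auto)
    ultimately show "(\<lambda>n. K * (1 + (h + (M n - \<gamma>))) ^ N' * exp (- (- Re \<zeta>) * (M n - \<gamma>))) \<longlonglongrightarrow> 0"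
      by (rule filterlim_compose[rotated])
  qed
  have "(\<lambda>n. contour_integral c ?f
      - contour_integral (linepath (pathstart c) (pathstart c + - 1 * of_real (M n))) ?f
      + contour_integral (linepath (pathfinish c) (pathfinish c + - 1 * of_real (M n))) ?f - V n)
      \<longlonglongrightarrow> contour_integral c ?f - l1 + l2 - 0"
    by (intro tendsto_intros V0 filterlim_compose[OF l(3) M] filterlim_compose[OF l(4) M])
  then have "(\<lambda>n. contour_integral c ?f
      - contour_integral (linepath (pathstart c) (pathstart c + - 1 * of_real (M n))) ?f
      + contour_integral (linepath (pathfinish c) (pathfinish c + - 1 * of_real (M n))) ?f - V n) \<longlonglongrightarrow> ?h"
    unfolding l(1) by simp
  then have "(\<lambda>n. 2 * of_real pi * \<i> * (\<Sum>m\<le>n. hyp_coeff p a b s m * exp \<zeta> ^ m * exp (a s * \<zeta>))) \<longlonglongrightarrow> ?h"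
  proof (rule Lim_transform_eventually)
    show "\<forall>\<^sub>F n in sequentially. contour_integral c ?f
      - contour_integral (linepath (pathstart c) (pathstart c + - 1 * of_real (M n))) ?f
      + contour_integral (linepath (pathfinish c) (pathfinish c + - 1 * of_real (M n))) ?f - V n
      = 2 * of_real pi * \<i> * (\<Sum>m\<le>n. hyp_coeff p a b s m * exp \<zeta> ^ m * exp (a s * \<zeta>))"
      using ev
    proof eventually_elim
      case (elim n)
      then show ?case
        using trans[OF split(1)[of n, symmetric] loop(3)[of n]] by blast
    qed
  qed
  then have "(\<lambda>n. 2 * of_real pi * \<i> * (\<Sum>m\<le>n. hyp_coeff p a b s m * exp \<zeta> ^ m * exp (a s * \<zeta>))
      * (exp (- a s * \<zeta>) / (2 * of_real pi * \<i>))) \<longlonglongrightarrow> ?h * (exp (- a s * \<zeta>) / (2 * of_real pi * \<i>))"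
    by (intro tendsto_intros)
  moreover have "2 * of_real pi * \<i> * (\<Sum>m\<le>n. hyp_coeff p a b s m * exp \<zeta> ^ m * exp (a s * \<zeta>))
      * (exp (- a s * \<zeta>) / (2 * of_real pi * \<i>)) = (\<Sum>m\<le>n. hyp_coeff p a b s m * exp \<zeta> ^ m)" for n
  proof -
    have *: "(\<Sum>m\<le>n. hyp_coeff p a b s m * exp \<zeta> ^ m * exp (a s * \<zeta>)) = (\<Sum>m\<le>n. hyp_coeff p a b s m * exp \<zeta> ^ m) * exp (a s * \<zeta>)"
      by (simp only: sum_distrib_right)
    have "exp (a s * \<zeta>) * exp (- a s * \<zeta>) = 1"
      by (simp flip: exp_add)
    then have "X * (S * exp (a s * \<zeta>)) * (exp (- a s * \<zeta>) / X) = S" if "X \<noteq> 0" for X S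
      using that by simp
    from this[of "2 * of_real pi * \<i>"] show ?thesis
      unfolding * by simp
  qed
  ultimately show ?thesis
    by (simp add: sums_def_le)
qed

section \<open>Continuation around the singular point\<close>

lemma strip_boundI:
  assumes "C > 0" "H > 0" "\<alpha> \<ge> 0" "\<alpha>' \<ge> 0"
    and "\<And>t. Im t \<ge> H \<Longrightarrow> norm (f t) \<le> C * (1 + norm t) ^ N * exp (- \<alpha> * Im t)"
    and "\<And>t. Im t \<le> - H \<Longrightarrow> norm (f t) \<le> C * (1 + norm t) ^ N * exp (\<alpha>' * Im t)"
  shows "\<exists>C N H. strip_bound f C N H \<alpha> \<alpha>'"
  using assms unfolding strip_bound_def by (intro exI[of _ C] exI[of _ N] exI[of _ H]) auto

lemma G_kernel_strip_bound:
  assumes ks: "k \<in> {1..p}" "s \<in> {1..p}" "k \<noteq> s"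
  shows "\<exists>C N H. strip_bound (G_kernel p a b k s) C N H (2 * pi) (2 * pi)"
proof -
  obtain C N H where CH: "C > 0" "H > 0"
    "\<And>t. \<bar>Im t\<bar> \<ge> H \<Longrightarrow> norm (G_kernel p a b k s t) \<le> C * (1 + norm t) ^ N * exp (- 2 * pi * \<bar>Im t\<bar>)"
    by (rule G_kernel_bound[OF ks, of a b]) blast
  show ?thesis
  proof (rule strip_boundI[OF CH(1,2)])
    show "norm (G_kernel p a b k s t) \<le> C * (1 + norm t) ^ N * exp (- (2 * pi) * Im t)" if "Im t \<ge> H" for t
      using CH(3)[of t] that CH(2) by simp
    show "norm (G_kernel p a b k s t) \<le> C * (1 + norm t) ^ N * exp (2 * pi * Im t)" if "Im t \<le> - H" for t
      using CH(3)[of t] that CH(2) by simp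
  qed auto
qed

text \<open>One rate is 2 pi and the other 0, so the vertical integral converges for 0 < Im \<zeta>
  < 2 pi if \<sigma> = 1 and for - 2 pi < Im \<zeta> < 0 if \<sigma> = - 1.\<close>

lemma F_kernel_strip_bound:
  assumes s: "s \<in> {1..p}" and \<sigma>: "\<sigma> = 1 \<or> \<sigma> = - 1"
  shows "\<exists>C N H. strip_bound (F_kernel p a b s \<sigma>) C N H (pi * (1 + \<sigma>)) (pi * (1 - \<sigma>))"
proof -
  obtain C N H where CH: "C > 0" "H > 0"
    "\<And>t. \<bar>Im t\<bar> \<ge> H \<Longrightarrow> norm (F_kernel p a b s \<sigma> t)
      \<le> C * (1 + norm t) ^ N * exp (- pi * (\<bar>Im t\<bar> + \<sigma> * Im t))"
    by (rule F_kernel_bound[OF s \<sigma>, of a b]) blast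
  show ?thesis
  proof (rule strip_boundI[OF CH(1,2)])
    show "norm (F_kernel p a b s \<sigma> t) \<le> C * (1 + norm t) ^ N * exp (- (pi * (1 + \<sigma>)) * Im t)" if "Im t \<ge> H" for t
    proof -
      have "- pi * (\<bar>Im t\<bar> + \<sigma> * Im t) = - (pi * (1 + \<sigma>)) * Im t"
        using that CH(2) by (simp add: algebra_simps)
      moreover have "\<bar>Im t\<bar> \<ge> H"
        using that by simp
      ultimately show ?thesis
        using CH(3)[of t] by metis
    qed
    show "norm (F_kernel p a b s \<sigma> t) \<le> C * (1 + norm t) ^ N * exp (pi * (1 - \<sigma>) * Im t)" if "Im t \<le> - H" for t
    proof -
      have "- pi * (\<bar>Im t\<bar> + \<sigma> * Im t) = pi * (1 - \<sigma>) * Im t"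
        using that CH(2) by (simp add: algebra_simps)
      moreover have "\<bar>Im t\<bar> \<ge> H"
        using that by simp
      ultimately show ?thesis
        using CH(3)[of t] by metis
    qed
  qed (use \<sigma> in auto)
qed

lemma Gamma_ratio_strip_bound: "\<exists>C N H. strip_bound (Gamma_ratio p a b) C N H 0 0"
proof -
  obtain C N H where CH: "C > 0" "H > 0"
    "\<And>t. Re t \<le> - H \<or> \<bar>Im t\<bar> \<ge> H \<Longrightarrow> norm (Gamma_ratio p a b t) \<le> C * (1 + norm t) ^ N"
    by (rule Gamma_ratio_bound[of p a b]) blast
  show ?thesis
    by (rule strip_boundI[OF CH(1,2), where N=N]) (use CH in auto)
qed

lemma Gamma_ratio'_strip_bound: "\<exists>C N H. strip_bound (Gamma_ratio' p a b) C N H 0 0"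
proof -
  obtain C N H where CH: "C > 0" "H > 0"
    "\<And>t. Re t \<ge> H \<or> \<bar>Im t\<bar> \<ge> H \<Longrightarrow> norm (Gamma_ratio' p a b t) \<le> C * (1 + norm t) ^ N"
    by (rule Gamma_ratio'_bound[of p a b]) blast
  show ?thesis
    by (rule strip_boundI[OF CH(1,2), where N=N]) (use CH in auto)
qed

text \<open>The open strip is exhausted by slightly smaller ones. In the upper sector the ray
  towards - \<i> has polynomial growth because \<open>Re (\<zeta> * - \<i>) = Im \<zeta>\<close>,
  and a rate above 6 makes the other ray bounded near 0; the lower sector is symmetric.\<close>

lemma horn_vertical:
  assumes c: "poles_contour p a b I H0 c" and I: "finite I"
    and f: "f holomorphic_on - (left_poles a I \<union> G_right_poles p b)"
    and b: "strip_bound f C N H \<alpha> \<alpha>'" "H \<le> H0"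
  shows horn_vertical_holomorphic:
      "(\<lambda>\<zeta>. horn_integral c (- \<i>) \<i> (\<lambda>t. f t * exp (- \<zeta> * t))) holomorphic_on {\<zeta>. - \<alpha>' < Im \<zeta> \<and> Im \<zeta> < \<alpha>}"
    and horn_vertical_growth_upper: "\<alpha> > 6 \<Longrightarrow>
      polynomial_growth (\<lambda>\<zeta>. norm \<zeta> / 2 \<le> Im \<zeta>) (\<lambda>\<zeta>. horn_integral c (- \<i>) \<i> (\<lambda>t. f t * exp (- \<zeta> * t)))"
    and horn_vertical_growth_lower: "\<alpha>' > 6 \<Longrightarrow>
      polynomial_growth (\<lambda>\<zeta>. norm \<zeta> / 2 \<le> - Im \<zeta>) (\<lambda>\<zeta>. horn_integral c (- \<i>) \<i> (\<lambda>t. f t * exp (- \<zeta> * t)))"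
proof -
  let ?S = "- (left_poles a I \<union> G_right_poles p b)"
  obtain \<gamma> h where h: "pathstart c = Complex \<gamma> (- h)" "pathfinish c = Complex \<gamma> h" "h > H"
    and sep: "separating_contour (left_poles a I) (G_right_poles p b) c"
    using c b(2) by (fastforce simp: poles_contour_def)
  have C: "C \<ge> 0" "H \<ge> 0" "\<alpha> \<ge> 0" "\<alpha>' \<ge> 0"
    and fup: "\<And>t. Im t \<ge> H \<Longrightarrow> norm (f t) \<le> C * (1 + norm t) ^ N * exp (- \<alpha> * Im t)"
    and flow: "\<And>t. Im t \<le> - H \<Longrightarrow> norm (f t) \<le> C * (1 + norm t) ^ N * exp (\<alpha>' * Im t)"
    using b(1) unfolding strip_bound_def by blast+
  have up: "norm (f (pathfinish c + \<i> * of_real x))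
      \<le> C * (1 + norm (pathfinish c + \<i> * of_real x)) ^ N * exp (- \<alpha> * x)" if "x \<ge> 0" for x
  proof -
    have "norm (f (pathfinish c + \<i> * of_real x)) \<le> C * (1 + norm (pathfinish c + \<i> * of_real x)) ^ N
        * exp (- \<alpha> * Im (pathfinish c + \<i> * of_real x))"
      by (rule fup) (use that h in simp)
    also have "\<dots> \<le> C * (1 + norm (pathfinish c + \<i> * of_real x)) ^ N * exp (- \<alpha> * x)"
      using that h C by (intro mult_left_mono) (auto intro: mult_left_mono)
    finally show ?thesis .
  qed
  have low: "norm (f (pathstart c + - \<i> * of_real x))
      \<le> C * (1 + norm (pathstart c + - \<i> * of_real x)) ^ N * exp (- \<alpha>' * x)" if "x \<ge> 0" for x
  proof -
    have "norm (f (pathstart c + - \<i> * of_real x)) \<le> C * (1 + norm (pathstart c + - \<i> * of_real x)) ^ N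
        * exp (\<alpha>' * Im (pathstart c + - \<i> * of_real x))"
      by (rule flow) (use that h in simp)
    also have "\<dots> \<le> C * (1 + norm (pathstart c + - \<i> * of_real x)) ^ N * exp (- \<alpha>' * x)"
    proof (intro mult_left_mono)
      have "\<alpha>' * (- h - x) \<le> \<alpha>' * (- x)"
        using h(3) C by (intro mult_left_mono) auto
      then show "exp (\<alpha>' * Im (pathstart c + - \<i> * of_real x)) \<le> exp (- \<alpha>' * x)"
        using h by simp
    qed (use C in auto)
    finally show ?thesis .
  qed
  have S: "open ?S"
    by (rule open_Compl[OF closed_subset_poles[OF I order_refl]])
  have cS: "valid_path c" "path_image c \<subseteq> ?S"
    using separating_contourD[OF sep] by auto
  have i: "norm (- \<i>) = 1" "norm \<i> = 1"
    by simp_all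
  note rays = poles_contour_rays[OF c]
  have upper: "\<exists>C2. \<forall>x\<ge>0. norm (f (pathfinish c + \<i> * of_real x)) \<le> C2 * exp (- \<beta> * x)" if less: "\<beta> < \<alpha>" for \<beta>
  proof (rule ray_exp_bound[where f=f and z="pathfinish c" and u="\<i>", OF i(2) C(1) less up])
    fix C' assume "\<And>x. x \<ge> 0 \<Longrightarrow> norm (f (pathfinish c + \<i> * of_real x)) \<le> C' * exp (- \<beta> * x)"
    then show ?thesis by blast
  qed
  have lower: "\<exists>C1. \<forall>x\<ge>0. norm (f (pathstart c + - \<i> * of_real x)) \<le> C1 * exp (- \<beta> * x)" if less: "\<beta> < \<alpha>'" for \<beta>
  proof (rule ray_exp_bound[where f=f and z="pathstart c" and u="- \<i>", OF i(1) C(1) less low])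
    fix C' assume "\<And>x. x \<ge> 0 \<Longrightarrow> norm (f (pathstart c + - \<i> * of_real x)) \<le> C' * exp (- \<beta> * x)"
    then show ?thesis by blast
  qed
  have "(\<lambda>\<zeta>. horn_integral c (- \<i>) \<i> (\<lambda>t. f t * exp (- \<zeta> * t)))
      holomorphic_on (\<Union>\<epsilon>\<in>{0<..}. {\<zeta>. - \<alpha>' + \<epsilon> < Im \<zeta> \<and> Im \<zeta> < \<alpha> - \<epsilon>})"
  proof (rule holomorphic_on_UN_open)
    fix \<epsilon> :: real assume "\<epsilon> \<in> {0<..}"
    then obtain C1 C2 where *: "\<And>x. x \<ge> 0 \<Longrightarrow> norm (f (pathstart c + - \<i> * of_real x)) \<le> C1 * exp (- (\<alpha>' - \<epsilon>) * x)"
      "\<And>x. x \<ge> 0 \<Longrightarrow> norm (f (pathfinish c + \<i> * of_real x)) \<le> C2 * exp (- (\<alpha> - \<epsilon>) * x)"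
      using upper[of "\<alpha> - \<epsilon>"] lower[of "\<alpha>' - \<epsilon>"] by auto
    show "(\<lambda>\<zeta>. horn_integral c (- \<i>) \<i> (\<lambda>t. f t * exp (- \<zeta> * t))) holomorphic_on {\<zeta>. - \<alpha>' + \<epsilon> < Im \<zeta> \<and> Im \<zeta> < \<alpha> - \<epsilon>}"
      by (rule holomorphic_on_subset[OF horn_integral_exp_holomorphic[OF S f cS rays(2) i(1) *(1) rays(1) i(2) *(2)]]) auto
    show "open {\<zeta>. - \<alpha>' + \<epsilon> < Im \<zeta> \<and> Im \<zeta> < \<alpha> - \<epsilon>}"
      by (intro open_Collect_conj open_Collect_less continuous_intros)
  qed
  moreover have "{\<zeta>. - \<alpha>' < Im \<zeta> \<and> Im \<zeta> < \<alpha>} \<subseteq> (\<Union>\<epsilon>\<in>{0<..}. {\<zeta>. - \<alpha>' + \<epsilon> < Im \<zeta> \<and> Im \<zeta> < \<alpha> - \<epsilon>})"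
  proof
    fix \<zeta> assume "\<zeta> \<in> {\<zeta>. - \<alpha>' < Im \<zeta> \<and> Im \<zeta> < \<alpha>}"
    then have "min (Im \<zeta> + \<alpha>') (\<alpha> - Im \<zeta>) > 0"
      by auto
    then show "\<zeta> \<in> (\<Union>\<epsilon>\<in>{0<..}. {\<zeta>. - \<alpha>' + \<epsilon> < Im \<zeta> \<and> Im \<zeta> < \<alpha> - \<epsilon>})"
      by (intro UN_I[of "min (Im \<zeta> + \<alpha>') (\<alpha> - Im \<zeta>) / 2"]) (auto simp: min_def field_simps)
  qed
  ultimately show "(\<lambda>\<zeta>. horn_integral c (- \<i>) \<i> (\<lambda>t. f t * exp (- \<zeta> * t))) holomorphic_on {\<zeta>. - \<alpha>' < Im \<zeta> \<and> Im \<zeta> < \<alpha>}"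
    by (rule holomorphic_on_subset)
  have up0: "norm (f (pathfinish c + \<i> * of_real x)) \<le> C * (1 + norm (pathfinish c + \<i> * of_real x)) ^ N" if "x \<ge> 0" for x
  proof -
    have "C * (1 + norm (pathfinish c + \<i> * of_real x)) ^ N * exp (- \<alpha> * x) \<le> C * (1 + norm (pathfinish c + \<i> * of_real x)) ^ N * 1"
      using C that by (intro mult_left_mono) auto
    then show ?thesis
      using up[OF that] by linarith
  qed
  have low0: "norm (f (pathstart c + - \<i> * of_real x)) \<le> C * (1 + norm (pathstart c + - \<i> * of_real x)) ^ N" if "x \<ge> 0" for x
  proof -
    have "C * (1 + norm (pathstart c + - \<i> * of_real x)) ^ N * exp (- \<alpha>' * x) \<le> C * (1 + norm (pathstart c + - \<i> * of_real x)) ^ N * 1"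
      using C that by (intro mult_left_mono) auto
    then show ?thesis
      using low[OF that] by linarith
  qed
  show "polynomial_growth (\<lambda>\<zeta>. norm \<zeta> / 2 \<le> Im \<zeta>) (\<lambda>\<zeta>. horn_integral c (- \<i>) \<i> (\<lambda>t. f t * exp (- \<zeta> * t)))" if big: "\<alpha> > 6"
  proof (rule horn_polynomial_growth[OF S f cS])
    show "polynomial_growth (\<lambda>\<zeta>. norm \<zeta> / 2 \<le> Im \<zeta>) (\<lambda>\<zeta>. ray_integral (pathstart c) (- \<i>) (\<lambda>t. f t * exp (- \<zeta> * t)))"
      by (rule polynomial_growth_mono[OF ray_polynomial_growth[OF S f rays(2) i(1) C(1) low0]]) auto
    obtain C2 where "\<And>x. x \<ge> 0 \<Longrightarrow> norm (f (pathfinish c + \<i> * of_real x)) \<le> C2 * exp (- 6 * x)"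
      using upper[OF big] by blast
    then show "polynomial_growth (\<lambda>\<zeta>. norm \<zeta> / 2 \<le> Im \<zeta>) (\<lambda>\<zeta>. ray_integral (pathfinish c) \<i> (\<lambda>t. f t * exp (- \<zeta> * t)))"
      by (rule ray_bounded_growth[OF S f rays(1) i(2)])
  qed
  show "polynomial_growth (\<lambda>\<zeta>. norm \<zeta> / 2 \<le> - Im \<zeta>) (\<lambda>\<zeta>. horn_integral c (- \<i>) \<i> (\<lambda>t. f t * exp (- \<zeta> * t)))" if big: "\<alpha>' > 6"
  proof (rule horn_polynomial_growth[OF S f cS])
    show "polynomial_growth (\<lambda>\<zeta>. norm \<zeta> / 2 \<le> - Im \<zeta>) (\<lambda>\<zeta>. ray_integral (pathfinish c) \<i> (\<lambda>t. f t * exp (- \<zeta> * t)))"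
      by (rule polynomial_growth_mono[OF ray_polynomial_growth[OF S f rays(1) i(2) C(1) up0]]) auto
    obtain C2 where "\<And>x. x \<ge> 0 \<Longrightarrow> norm (f (pathstart c + - \<i> * of_real x)) \<le> C2 * exp (- 6 * x)"
      using lower[OF big] by blast
    then show "polynomial_growth (\<lambda>\<zeta>. norm \<zeta> / 2 \<le> - Im \<zeta>) (\<lambda>\<zeta>. ray_integral (pathstart c) (- \<i>) (\<lambda>t. f t * exp (- \<zeta> * t)))"
      by (rule ray_bounded_growth[OF S f rays(2) i(1)])
  qed
qed

text \<open>
  The half discs \<open>Re \<zeta> < 0\<close>, \<open>Im \<zeta> > 0\<close>, \<open>Im \<zeta> < 0\<close>, \<open>Re \<zeta> > 0\<close> cover the punctured disc, and
  each point lies in one of the sectors in which the growth is controlled.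
\<close>

lemma glue_half_discs:
  fixes f1 f2 f3 f4 :: "complex \<Rightarrow> complex"
  assumes hol: "f1 holomorphic_on {\<zeta> \<in> ball 0 1. Re \<zeta> < 0}" "f2 holomorphic_on {\<zeta> \<in> ball 0 1. Im \<zeta> > 0}"
      "f3 holomorphic_on {\<zeta> \<in> ball 0 1. Im \<zeta> < 0}" "f4 holomorphic_on {\<zeta> \<in> ball 0 1. Re \<zeta> > 0}"
    and eq: "\<And>\<zeta>. norm \<zeta> < 1 \<Longrightarrow> Re \<zeta> < 0 \<Longrightarrow> Im \<zeta> > 0 \<Longrightarrow> f1 \<zeta> = f2 \<zeta>"
      "\<And>\<zeta>. norm \<zeta> < 1 \<Longrightarrow> Re \<zeta> < 0 \<Longrightarrow> Im \<zeta> < 0 \<Longrightarrow> f1 \<zeta> = f3 \<zeta>"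
      "\<And>\<zeta>. norm \<zeta> < 1 \<Longrightarrow> Re \<zeta> > 0 \<Longrightarrow> Im \<zeta> > 0 \<Longrightarrow> f4 \<zeta> = f2 \<zeta>"
      "\<And>\<zeta>. norm \<zeta> < 1 \<Longrightarrow> Re \<zeta> > 0 \<Longrightarrow> Im \<zeta> < 0 \<Longrightarrow> f4 \<zeta> = f3 \<zeta>"
    and growth: "polynomial_growth (\<lambda>\<zeta>. norm \<zeta> / 2 \<le> - Re \<zeta>) f1" "polynomial_growth (\<lambda>\<zeta>. norm \<zeta> / 2 \<le> Im \<zeta>) f2"
      "polynomial_growth (\<lambda>\<zeta>. norm \<zeta> / 2 \<le> - Im \<zeta>) f3" "polynomial_growth (\<lambda>\<zeta>. norm \<zeta> / 2 \<le> Re \<zeta>) f4"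
  obtains h M where "h holomorphic_on ball 0 1"
    "\<And>\<zeta>. norm \<zeta> < 1 \<Longrightarrow> Re \<zeta> < 0 \<Longrightarrow> f1 \<zeta> = h \<zeta> / \<zeta> ^ M"
proof -
  \<comment> \<open>On the imaginary axis only f2 or f3 is available; in the open quadrants the
    agreement of the pieces makes the choice immaterial.\<close>
  define v where "v \<zeta> = (if Re \<zeta> < 0 then f1 \<zeta> else if Re \<zeta> > 0 then f4 \<zeta> else if Im \<zeta> > 0 then f2 \<zeta> else f3 \<zeta>)" for \<zeta>
  have v: "Re \<zeta> < 0 \<Longrightarrow> v \<zeta> = f1 \<zeta>" "Re \<zeta> > 0 \<Longrightarrow> v \<zeta> = f4 \<zeta>" for \<zeta>
    by (auto simp: v_def)
  have v2: "v \<zeta> = f2 \<zeta>" if "norm \<zeta> < 1" "Im \<zeta> > 0" for \<zeta>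
    using that eq(1)[of \<zeta>] eq(3)[of \<zeta>] by (auto simp: v_def)
  have v3: "v \<zeta> = f3 \<zeta>" if "norm \<zeta> < 1" "Im \<zeta> < 0" for \<zeta>
    using that eq(2)[of \<zeta>] eq(4)[of \<zeta>] by (auto simp: v_def)
  have op: "open {\<zeta> \<in> ball (0::complex) 1. Re \<zeta> < 0}" "open {\<zeta> \<in> ball (0::complex) 1. Im \<zeta> > 0}"
    "open {\<zeta> \<in> ball (0::complex) 1. Im \<zeta> < 0}" "open {\<zeta> \<in> ball (0::complex) 1. Re \<zeta> > 0}"
    unfolding Collect_conj_eq Collect_mem_eq
    by (intro open_Int open_ball open_halfspace_Re_lt open_halfspace_Im_gt open_halfspace_Im_lt open_halfspace_Re_gt)+
  have "v holomorphic_on ({\<zeta> \<in> ball 0 1. Re \<zeta> < 0} \<union> {\<zeta> \<in> ball 0 1. Im \<zeta> > 0})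
      \<union> ({\<zeta> \<in> ball 0 1. Im \<zeta> < 0} \<union> {\<zeta> \<in> ball 0 1. Re \<zeta> > 0})"
    by (intro holomorphic_on_Un open_Un op; (rule holomorphic_transform[OF hol(1)] holomorphic_transform[OF hol(2)]
        holomorphic_transform[OF hol(3)] holomorphic_transform[OF hol(4)]); simp add: v v2 v3)
  moreover have "ball (0::complex) 1 - {0} = ({\<zeta> \<in> ball 0 1. Re \<zeta> < 0} \<union> {\<zeta> \<in> ball 0 1. Im \<zeta> > 0})
      \<union> ({\<zeta> \<in> ball 0 1. Im \<zeta> < 0} \<union> {\<zeta> \<in> ball 0 1. Re \<zeta> > 0})"
    by (auto simp: complex_eq_iff)
  ultimately have hol_v: "v holomorphic_on ball 0 1 - {0}"
    by simp
  obtain C1 M1 where 1: "C1 \<ge> 0" "\<And>\<zeta>. \<zeta> \<noteq> 0 \<Longrightarrow> norm \<zeta> \<le> 1 \<Longrightarrow> norm \<zeta> / 2 \<le> - Re \<zeta> \<Longrightarrow> norm (f1 \<zeta>) \<le> C1 / norm \<zeta> ^ M1"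
    using growth(1) unfolding polynomial_growth_def by blast
  obtain C2 M2 where 2: "C2 \<ge> 0" "\<And>\<zeta>. \<zeta> \<noteq> 0 \<Longrightarrow> norm \<zeta> \<le> 1 \<Longrightarrow> norm \<zeta> / 2 \<le> Im \<zeta> \<Longrightarrow> norm (f2 \<zeta>) \<le> C2 / norm \<zeta> ^ M2"
    using growth(2) unfolding polynomial_growth_def by blast
  obtain C3 M3 where 3: "C3 \<ge> 0" "\<And>\<zeta>. \<zeta> \<noteq> 0 \<Longrightarrow> norm \<zeta> \<le> 1 \<Longrightarrow> norm \<zeta> / 2 \<le> - Im \<zeta> \<Longrightarrow> norm (f3 \<zeta>) \<le> C3 / norm \<zeta> ^ M3"
    using growth(3) unfolding polynomial_growth_def by blast
  obtain C4 M4 where 4: "C4 \<ge> 0" "\<And>\<zeta>. \<zeta> \<noteq> 0 \<Longrightarrow> norm \<zeta> \<le> 1 \<Longrightarrow> norm \<zeta> / 2 \<le> Re \<zeta> \<Longrightarrow> norm (f4 \<zeta>) \<le> C4 / norm \<zeta> ^ M4"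
    using growth(4) unfolding polynomial_growth_def by blast
  define M where "M = M1 + M2 + M3 + M4"
  define C where "C = C1 + C2 + C3 + C4"
  have bound: "norm (v \<zeta>) \<le> C / norm \<zeta> ^ M" if \<zeta>: "\<zeta> \<noteq> 0" "norm \<zeta> < 1" for \<zeta>
  proof -
    have up: "c / norm \<zeta> ^ m \<le> C / norm \<zeta> ^ M" if "0 \<le> c" "c \<le> C" "m \<le> M" for c m
    proof -
      have "c / norm \<zeta> ^ m \<le> c / norm \<zeta> ^ M"
        by (rule polynomial_growth_raise) (use that \<zeta> in auto)
      also have "\<dots> \<le> C / norm \<zeta> ^ M"
        using that by (intro divide_right_mono) auto
      finally show ?thesis .
    qed
    have z1: "norm \<zeta> \<le> 1" "norm \<zeta> > 0"
      using \<zeta> by auto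
    \<comment> \<open>As |\<zeta>| \<le> |Re \<zeta>| + |Im \<zeta>|, one of the two parts has
      modulus at least |\<zeta>| / 2.\<close>
    consider "norm \<zeta> / 2 \<le> - Re \<zeta>" | "norm \<zeta> / 2 \<le> Re \<zeta>" | "norm \<zeta> / 2 \<le> - Im \<zeta>" | "norm \<zeta> / 2 \<le> Im \<zeta>"
      using cmod_le[of \<zeta>] by linarith
    then show ?thesis
    proof cases
      case 1
      then have "v \<zeta> = f1 \<zeta>" using z1 by (intro v) linarith
      then show ?thesis
        using order.trans[OF \<open>\<And>\<zeta>. \<zeta> \<noteq> 0 \<Longrightarrow> norm \<zeta> \<le> 1 \<Longrightarrow> norm \<zeta> / 2 \<le> - Re \<zeta> \<Longrightarrow> norm (f1 \<zeta>) \<le> C1 / norm \<zeta> ^ M1\<close>[OF \<zeta>(1) z1(1) 1] up]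
          \<open>C1 \<ge> 0\<close> 2(1) 3(1) 4(1) by (simp add: C_def M_def)
    next
      case 2
      then have "v \<zeta> = f4 \<zeta>" using z1 by (intro v) linarith
      then show ?thesis
        using order.trans[OF 4(2)[OF \<zeta>(1) z1(1) 2] up] 1(1) \<open>C2 \<ge> 0\<close> 3(1) 4(1) by (simp add: C_def M_def)
    next
      case 3
      then have "v \<zeta> = f3 \<zeta>" using z1 \<zeta> by (intro v3) linarith+
      then show ?thesis
        using order.trans[OF \<open>\<And>\<zeta>. \<zeta> \<noteq> 0 \<Longrightarrow> norm \<zeta> \<le> 1 \<Longrightarrow> norm \<zeta> / 2 \<le> - Im \<zeta> \<Longrightarrow> norm (f3 \<zeta>) \<le> C3 / norm \<zeta> ^ M3\<close>[OF \<zeta>(1) z1(1) 3] up]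
          1(1) 2(1) \<open>C3 \<ge> 0\<close> 4(1) by (simp add: C_def M_def)
    next
      case 4
      then have "v \<zeta> = f2 \<zeta>" using z1 \<zeta> by (intro v2) linarith+
      then show ?thesis
        using order.trans[OF 2(2)[OF \<zeta>(1) z1(1) 4] up] 1(1) 2(1) 3(1) \<open>C4 \<ge> 0\<close> by (simp add: C_def M_def)
    qed
  qed
  \<comment> \<open>The product is bounded near 0, so Riemann's theorem removes its
    singularity.\<close>
  have "(\<lambda>\<zeta>. \<zeta> ^ M * v \<zeta>) holomorphic_on ball 0 1 - {0}"
    by (intro holomorphic_intros hol_v)
  moreover have "\<forall>\<^sub>F \<zeta> in at 0. norm (\<zeta> ^ M * v \<zeta>) \<le> C"
  proof -
    have "\<forall>\<^sub>F \<zeta> in at (0::complex). \<zeta> \<in> ball 0 1 - {0}"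
      by (intro eventually_at_in_open) auto
    then show ?thesis
    proof eventually_elim
      case (elim \<zeta>)
      then show ?case
        using bound[of \<zeta>] by (simp add: norm_mult norm_power field_simps)
    qed
  qed
  ultimately obtain h where h: "h holomorphic_on ball 0 1" "\<forall>z\<in>ball 0 1 - {0}. h z = z ^ M * v z"
    using holomorphic_on_extend_bounded[of "\<lambda>\<zeta>. \<zeta> ^ M * v \<zeta>" "ball 0 1" 0] by auto
  show ?thesis
  proof (rule that[OF h(1)])
    fix \<zeta> :: complex assume "norm \<zeta> < 1" "Re \<zeta> < 0"
    moreover from this have "\<zeta> \<noteq> 0"
      by auto
    ultimately show "f1 \<zeta> = h \<zeta> / \<zeta> ^ M"
      using h(2) v(1)[of \<zeta>] by simp
  qed
qed

text \<open>The modulus is |w|^(Re z) exp (- Im z arg w), and the argument is at most pi in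
  modulus.\<close>

lemma norm_powr_le_power:
  fixes w z :: complex
  assumes "w \<noteq> 0" "norm w \<le> 1"
  shows "norm (w powr z) \<le> exp (pi * \<bar>Im z\<bar>) / norm w ^ nat \<lceil>\<bar>Re z\<bar>\<rceil>"
proof -
  define n where "n = nat \<lceil>\<bar>Re z\<bar>\<rceil>"
  have l: "ln (norm w) \<le> 0"
    using assms by simp
  have "- (Im z * Im (Ln w)) \<le> \<bar>Im z\<bar> * \<bar>Im (Ln w)\<bar>"
    by (metis abs_ge_minus_self abs_mult)
  also have "\<dots> \<le> \<bar>Im z\<bar> * pi"
    using mpi_less_Im_Ln[OF assms(1)] Im_Ln_le_pi[OF assms(1)] by (intro mult_left_mono) auto
  finally have 1: "- (Im z * Im (Ln w)) \<le> pi * \<bar>Im z\<bar>"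
    by (simp add: mult.commute)
  have n: "\<bar>Re z\<bar> \<le> real n"
    unfolding n_def by (rule of_nat_ceiling)
  have 2: "Re z * ln (norm w) \<le> - real n * ln (norm w)"
    using l n by (intro mult_right_mono_neg) auto
  have "norm (w powr z) = exp (Re z * ln (norm w) - Im z * Im (Ln w))"
    using assms(1) by (simp add: powr_def norm_exp_eq_Re)
  also have "\<dots> \<le> exp (pi * \<bar>Im z\<bar> + - real n * ln (norm w))"
    using 1 2 by simp
  also have "\<dots> = exp (pi * \<bar>Im z\<bar>) / norm w ^ n"
  proof -
    have "exp (real n * ln (norm w)) = norm w ^ n"
      using assms(1) by (simp add: exp_of_nat_mult)
    then show ?thesis
      by (simp add: exp_diff divide_inverse)
  qed
  finally show ?thesis
    unfolding n_def .
qed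

text \<open>For Re \<zeta> > 0 all vertical ends can be turned to the right, where both terms of the
  kernel identity are integrable. \<open>Gamma_ratio'\<close> contributes 0; the surviving integral
  depends on \<sigma> only through its phase.\<close>

lemma kernels_horn_eq:
  fixes p :: nat and a b :: "nat \<Rightarrow> complex" and s :: nat
  defines "P \<equiv> {1..p} - {s}" and "\<psi> \<equiv> of_real pi * psi a b p"
  assumes c: "poles_contour p a b {1..p} H0 c"
    and s: "s \<in> {1..p}" and \<sigma>: "\<sigma> = 1 \<or> \<sigma> = - 1" and \<psi>: "psi a b p \<notin> \<int>"
    and a: "\<And>i k. i \<in> P \<Longrightarrow> k \<in> P \<Longrightarrow> i \<noteq> k \<Longrightarrow> a i - a k \<notin> \<int>"
    and G: "\<And>k. k \<in> P \<Longrightarrow> strip_bound (G_kernel p a b k s) (CG k) (NG k) (HG k) (2 * pi) (2 * pi)" "\<And>k. k \<in> P \<Longrightarrow> HG k \<le> H0"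
    and F: "strip_bound (F_kernel p a b s \<sigma>) C1 N1 H1 (pi * (1 + \<sigma>)) (pi * (1 - \<sigma>))" "H1 \<le> H0"
    and R: "strip_bound (Gamma_ratio p a b) C2 N2 H2 0 0" "H2 \<le> H0"
    and R': "strip_bound (Gamma_ratio' p a b) C3 N3 H3 0 0" "H3 \<le> H0"
    and \<zeta>: "Re \<zeta> > 0" "Im \<zeta> < pi * (1 + \<sigma>)" "- (pi * (1 - \<sigma>)) < Im \<zeta>"
  shows "1 / (of_real pi * sin \<psi>) * (\<Sum>k\<in>P. residue_weight p a b s k
        * horn_integral c (- \<i>) \<i> (\<lambda>t. G_kernel p a b k s t * exp (- \<zeta> * t)))
      + horn_integral c (- \<i>) \<i> (\<lambda>t. F_kernel p a b s \<sigma> t * exp (- \<zeta> * t))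
    = - (of_real pi / sin \<psi> * exp (- of_real \<sigma> * \<i> * \<psi>))
      * horn_integral c 1 1 (\<lambda>t. Gamma_ratio p a b t * exp (- \<zeta> * t))"
proof -
  have fin: "finite {1..p}" "finite P"
    by (auto simp: P_def)
  have \<zeta>2: "Im \<zeta> < 2 * pi" "- (2 * pi) < Im \<zeta>" "Re (\<zeta> * 1) > 0"
    using \<zeta> \<sigma> by (auto simp: algebra_simps)
  have one: "(1::complex) = 1 \<or> (1::complex) = - 1"
    by simp
  have hG: "G_kernel p a b k s holomorphic_on - (left_poles a {1..p} \<union> G_right_poles p b)" if "k \<in> P" for k
    by (rule G_kernel_holomorphic) (use that s in \<open>auto simp: P_def\<close>)
  note hF = F_kernel_holomorphic[OF s, of p a b \<sigma>]
  note hR = Gamma_ratio_holomorphic[of p a b "left_poles a {1..p}"]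
  note hR' = Gamma_ratio'_holomorphic[of p a b "G_right_poles p b"]
  have eqG: "horn_integral c (- \<i>) \<i> (\<lambda>t. G_kernel p a b k s t * exp (- \<zeta> * t))
      = horn_integral c 1 1 (\<lambda>t. G_kernel p a b k s t * exp (- \<zeta> * t))" if "k \<in> P" for k
    by (rule horn_integral_rotate_eq[OF c fin(1) hG[OF that] G(1,2)[OF that] \<zeta>2(1,2) one \<zeta>2(3)])
  have eqF: "horn_integral c (- \<i>) \<i> (\<lambda>t. F_kernel p a b s \<sigma> t * exp (- \<zeta> * t))
      = horn_integral c 1 1 (\<lambda>t. F_kernel p a b s \<sigma> t * exp (- \<zeta> * t))"
    by (rule horn_integral_rotate_eq[OF c fin(1) hF F \<zeta>(2,3) one \<zeta>2(3)])
  have "has_horn_integral c 1 1 (\<lambda>t. 1 / (of_real pi * sin \<psi>) * (\<Sum>k\<in>P. residue_weight p a b s k * (G_kernel p a b k s t * exp (- \<zeta> * t)))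
      + F_kernel p a b s \<sigma> t * exp (- \<zeta> * t))
      (1 / (of_real pi * sin \<psi>) * (\<Sum>k\<in>P. residue_weight p a b s k
        * horn_integral c 1 1 (\<lambda>t. G_kernel p a b k s t * exp (- \<zeta> * t)))
      + horn_integral c 1 1 (\<lambda>t. F_kernel p a b s \<sigma> t * exp (- \<zeta> * t)))"
    by (intro has_horn_integral_add has_horn_integral_cmult has_horn_integral_sum fin
        has_horn_integral_horizontal[OF c fin(1) hG G one \<zeta>2(3)] has_horn_integral_horizontal[OF c fin(1) hF F one \<zeta>2(3)])
  moreover have "has_horn_integral c 1 1 (\<lambda>t. of_real pi / sin \<psi> * (Gamma_ratio' p a b t * exp (- \<zeta> * t)
        + - exp (- of_real \<sigma> * \<i> * \<psi>) * (Gamma_ratio p a b t * exp (- \<zeta> * t))))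
      (of_real pi / sin \<psi> * (horn_integral c 1 1 (\<lambda>t. Gamma_ratio' p a b t * exp (- \<zeta> * t))
        + - exp (- of_real \<sigma> * \<i> * \<psi>) * horn_integral c 1 1 (\<lambda>t. Gamma_ratio p a b t * exp (- \<zeta> * t))))"
    by (intro has_horn_integral_add has_horn_integral_cmult
        has_horn_integral_horizontal[OF c fin(1) hR R one \<zeta>2(3)] has_horn_integral_horizontal[OF c fin(1) hR' R' one \<zeta>2(3)])
  then have "has_horn_integral c 1 1 (\<lambda>t. 1 / (of_real pi * sin \<psi>) * (\<Sum>k\<in>P. residue_weight p a b s k * (G_kernel p a b k s t * exp (- \<zeta> * t)))
      + F_kernel p a b s \<sigma> t * exp (- \<zeta> * t))
      (of_real pi / sin \<psi> * (horn_integral c 1 1 (\<lambda>t. Gamma_ratio' p a b t * exp (- \<zeta> * t))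
        + - exp (- of_real \<sigma> * \<i> * \<psi>) * horn_integral c 1 1 (\<lambda>t. Gamma_ratio p a b t * exp (- \<zeta> * t))))"
  proof (rule has_horn_integral_cong)
    fix t assume t: "t \<in> path_image c \<union> ray (pathstart c) 1 \<union> ray (pathfinish c) 1"
    have "ray (pathstart c) 1 \<subseteq> {t. Im t \<le> Im (pathstart c)}" "ray (pathfinish c) 1 \<subseteq> {t. Im t \<ge> Im (pathfinish c)}"
      by (auto simp: ray_def)
    moreover have "path_image c \<subseteq> - (left_poles a {1..p} \<union> G_right_poles p b)"
      using separating_contourD[OF conjunct1[OF c[unfolded poles_contour_def]]] by auto
    ultimately have "t \<in> - (left_poles a {1..p} \<union> G_right_poles p b)"
      using t poles_contour_sector[OF c] by blast
    then have t': "t \<notin> left_poles a {1..p} \<union> G_right_poles p b"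
      by simp
    have S: "(\<Sum>k\<in>P. residue_weight p a b s k * (G_kernel p a b k s t * exp (- \<zeta> * t)))
        = (\<Sum>k\<in>P. residue_weight p a b s k * G_kernel p a b k s t) * exp (- \<zeta> * t)"
      by (simp only: sum_distrib_right mult.assoc)
    have "(1 / (of_real pi * sin \<psi>) * (\<Sum>k\<in>P. residue_weight p a b s k * G_kernel p a b k s t) + F_kernel p a b s \<sigma> t) * exp (- \<zeta> * t)
      = of_real pi / sin \<psi> * (Gamma_ratio' p a b t - exp (- of_real \<sigma> * \<i> * \<psi>) * Gamma_ratio p a b t) * exp (- \<zeta> * t)"
      using kernel_identity[OF s \<sigma> \<psi> a[unfolded P_def] t'] unfolding P_def \<psi>_def by simp
    then show "of_real pi / sin \<psi> * (Gamma_ratio' p a b t * exp (- \<zeta> * t)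
        + - exp (- of_real \<sigma> * \<i> * \<psi>) * (Gamma_ratio p a b t * exp (- \<zeta> * t)))
      = 1 / (of_real pi * sin \<psi>) * (\<Sum>k\<in>P. residue_weight p a b s k * (G_kernel p a b k s t * exp (- \<zeta> * t)))
      + F_kernel p a b s \<sigma> t * exp (- \<zeta> * t)"
      unfolding S by (simp only: ring_distribs mult.assoc diff_conv_add_uminus mult_minus_left mult_minus_right)
  qed
  ultimately have "1 / (of_real pi * sin \<psi>) * (\<Sum>k\<in>P. residue_weight p a b s k
        * horn_integral c 1 1 (\<lambda>t. G_kernel p a b k s t * exp (- \<zeta> * t)))
      + horn_integral c 1 1 (\<lambda>t. F_kernel p a b s \<sigma> t * exp (- \<zeta> * t))
    = of_real pi / sin \<psi> * (horn_integral c 1 1 (\<lambda>t. Gamma_ratio' p a b t * exp (- \<zeta> * t))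
        + - exp (- of_real \<sigma> * \<i> * \<psi>) * horn_integral c 1 1 (\<lambda>t. Gamma_ratio p a b t * exp (- \<zeta> * t)))"
    by (rule trans[OF sym[OF horn_integral_unique] horn_integral_unique])
  moreover have "(\<Sum>k\<in>P. residue_weight p a b s k * horn_integral c (- \<i>) \<i> (\<lambda>t. G_kernel p a b k s t * exp (- \<zeta> * t)))
    = (\<Sum>k\<in>P. residue_weight p a b s k * horn_integral c 1 1 (\<lambda>t. G_kernel p a b k s t * exp (- \<zeta> * t)))"
    by (intro sum.cong refl) (simp only: eqG)
  ultimately show ?thesis
    using horn_integral_Gamma_ratio'_eq_0[OF c \<zeta>(1) R'] eqF by simp
qed

text \<open>On the side where Im \<zeta> has the sign \<sigma>, ln (- \<zeta>) = ln \<zeta> -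
  \<sigma> i pi. This shift cancels the phase of the kernel identity, so that both signs lead to the
  same function on the right half disc.\<close>

lemma minus_powr:
  fixes \<zeta> \<psi> :: complex
  assumes "\<zeta> \<noteq> 0" "\<sigma> * Im \<zeta> > 0" "\<sigma> = 1 \<or> \<sigma> = - 1"
  shows "(- \<zeta>) powr (1 - \<psi>) * exp (- of_real \<sigma> * \<i> * (of_real pi * \<psi>)) = - (\<zeta> powr (1 - \<psi>))"
proof -
  have "Ln (- \<zeta>) = Ln \<zeta> - of_real \<sigma> * \<i> * of_real pi"
    using assms by (auto simp: Ln_minus algebra_simps)
  then have L: "(1 - \<psi>) * Ln (- \<zeta>) + - of_real \<sigma> * \<i> * (of_real pi * \<psi>)
      = (1 - \<psi>) * Ln \<zeta> - of_real \<sigma> * \<i> * of_real pi"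
    by (simp only:) (simp add: algebra_simps)
  have "(- \<zeta>) powr (1 - \<psi>) * exp (- of_real \<sigma> * \<i> * (of_real pi * \<psi>))
      = exp ((1 - \<psi>) * Ln (- \<zeta>) + - of_real \<sigma> * \<i> * (of_real pi * \<psi>))"
    using assms(1) by (simp only: powr_def exp_add) simp
  also have "\<dots> = exp ((1 - \<psi>) * Ln \<zeta> - of_real \<sigma> * \<i> * of_real pi)"
    by (simp only: L)
  also have "\<dots> = \<zeta> powr (1 - \<psi>) * exp (- (of_real \<sigma> * \<i> * of_real pi))"
    using assms by (simp add: powr_def exp_diff exp_minus divide_inverse)
  also have "exp (- (of_real \<sigma> * \<i> * of_real pi)) = - 1"
    using assms(3) by (auto simp: exp_minus mult.commute)
  finally show ?thesis by simp
qed

lemma polynomial_growth_powr: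
  fixes w :: complex
  shows "polynomial_growth P (\<lambda>\<zeta>. (- \<zeta>) powr w)" "polynomial_growth P (\<lambda>\<zeta>. \<zeta> powr w)"
proof -
  show "polynomial_growth P (\<lambda>\<zeta>. (- \<zeta>) powr w)"
  proof (rule polynomial_growthI)
    fix \<zeta> :: complex assume "\<zeta> \<noteq> 0" "norm \<zeta> \<le> 1"
    then show "norm ((- \<zeta>) powr w) \<le> exp (pi * \<bar>Im w\<bar>) / norm \<zeta> ^ nat \<lceil>\<bar>Re w\<bar>\<rceil>"
      using norm_powr_le_power[of "- \<zeta>" w] by simp
  qed
  show "polynomial_growth P (\<lambda>\<zeta>. \<zeta> powr w)"
    by (rule polynomial_growthI) (rule norm_powr_le_power)
qed

text \<open>The integral with ends turned left lives on the left half disc. It continues to the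
  upper half disc by \<sigma> = 1 and to the lower one by \<sigma> = - 1. After addition of the
  G-functions and multiplication by (- \<zeta>)^(1 - psi) both continuations agree on the right half
  disc, so the function is single-valued around 0 with at most a pole there.\<close>

lemma hyp_coeff_sums_local:
  fixes p :: nat and a b :: "nat \<Rightarrow> complex" and s :: nat
  defines "P \<equiv> {1..p} - {s}"
  assumes p: "p \<ge> 2" and s: "s \<in> {1..p}" and \<psi>: "psi a b p \<notin> \<int>"
    and df: "\<And>k. k \<in> P \<Longrightarrow> meijer_G_defined p a b k s"
    and a: "\<And>i k. i \<in> P \<Longrightarrow> k \<in> P \<Longrightarrow> i \<noteq> k \<Longrightarrow> a i - a k \<notin> \<int>"
  obtains h M where "h holomorphic_on ball 0 1"
    "\<And>\<zeta>. norm \<zeta> < 1 \<Longrightarrow> Re \<zeta> < 0 \<Longrightarrow> (\<lambda>m. hyp_coeff p a b s m * exp \<zeta> ^ m) sums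
      ((- \<zeta>) powr (psi a b p - 1) * (h \<zeta> / \<zeta> ^ M) * exp (- a s * \<zeta>) / (2 * of_real pi * \<i>)
       - 1 / (of_real pi * sin (of_real pi * psi a b p))
         * (\<Sum>k\<in>P. residue_weight p a b s k * (meijer_G p a b k s (exp \<zeta>) * exp (- a s * \<zeta>))))"
proof -
  define \<psi> where "\<psi> = psi a b p"
  define K where "K = 1 / (of_real pi * sin (of_real pi * \<psi>))"
  have fin: "finite {1..p}" "finite P"
    by (auto simp: P_def)
  have "\<forall>k\<in>P. \<exists>CNH. strip_bound (G_kernel p a b k s) (fst CNH) (fst (snd CNH)) (snd (snd CNH)) (2 * pi) (2 * pi)"
    using G_kernel_strip_bound[of _ p s a b] s unfolding P_def by fastforce
  then obtain D where D: "\<And>k. k \<in> P \<Longrightarrow> strip_bound (G_kernel p a b k s) (fst (D k)) (fst (snd (D k))) (snd (snd (D k))) (2 * pi) (2 * pi)"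
    by (meson bchoice)
  define CG NG HG where "CG = (\<lambda>k. fst (D k))" and "NG = (\<lambda>k. fst (snd (D k)))" and "HG = (\<lambda>k. snd (snd (D k)))"
  have G: "strip_bound (G_kernel p a b k s) (CG k) (NG k) (HG k) (2 * pi) (2 * pi)" if "k \<in> P" for k
    using D[OF that] by (simp add: CG_def NG_def HG_def)
  obtain C1 N1 H1 where F1: "strip_bound (F_kernel p a b s 1) C1 N1 H1 (pi * (1 + 1)) (pi * (1 - 1))"
    using F_kernel_strip_bound[OF s, of 1 a b] by blast
  obtain C2 N2 H2 where F2: "strip_bound (F_kernel p a b s (- 1)) C2 N2 H2 (pi * (1 + - 1)) (pi * (1 - - 1))"
    using F_kernel_strip_bound[OF s, of "- 1" a b] by blast
  obtain C3 N3 H3 where R: "strip_bound (Gamma_ratio p a b) C3 N3 H3 0 0"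
    using Gamma_ratio_strip_bound by blast
  obtain C4 N4 H4 where R': "strip_bound (Gamma_ratio' p a b) C4 N4 H4 0 0"
    using Gamma_ratio'_strip_bound by blast
  \<comment> \<open>One contour serves all kernels, so its ends lie beyond the thresholds of all
    bounds; the sum of these nonnegative numbers dominates each of them.\<close>
  define H0 where "H0 = (\<Sum>k\<in>P. HG k) + H1 + H2 + H3 + H4"
  have nn: "H1 \<ge> 0" "H2 \<ge> 0" "H3 \<ge> 0" "H4 \<ge> 0" "\<And>k. k \<in> P \<Longrightarrow> HG k \<ge> 0"
    using F1 F2 R R' G by (auto simp: strip_bound_def)
  have nS: "(\<Sum>k\<in>P. HG k) \<ge> 0"
    by (intro sum_nonneg nn)
  have le: "H1 \<le> H0" "H2 \<le> H0" "H3 \<le> H0" "H4 \<le> H0"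
    using nn(1-4) nS by (auto simp: H0_def)
  have leG: "HG k \<le> H0" if "k \<in> P" for k
  proof -
    have "HG k \<le> (\<Sum>k\<in>P. HG k)"
      by (rule member_le_sum[OF that _ fin(2)]) (use nn(5) in auto)
    then show ?thesis
      using nn(1-4) by (simp add: H0_def)
  qed
  have ab: "b j - a i \<notin> \<nat> - {0}" if i: "i \<in> {1..p}" and j: "j \<in> {1..p}" for i j
  proof (cases "i = s")
    case True
    \<comment> \<open>Since p \<ge> 2, the index s forms a pair with another one, and definedness of
      that G-function also covers the left poles of index s.\<close>
    have "(if s = 1 then 2 else 1) \<in> P"
      using p by (auto simp: P_def)
    from df[OF this] show ?thesis
      using j True by (auto simp: meijer_G_defined_def)
  next
    case False
    then show ?thesis
      using df[of i] i j by (auto simp: meijer_G_defined_def P_def)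
  qed
  obtain c where c: "poles_contour p a b {1..p} H0 c"
    using exists_poles_contour[of "{1..p}" p b a H0, OF fin(1) ab] by blast
  let ?G = "\<lambda>k \<zeta>. horn_integral c (- \<i>) \<i> (\<lambda>t. G_kernel p a b k s t * exp (- \<zeta> * t))"
  \<comment> \<open>X collects the weighted G-functions. U and L are the integrals of the
    hypergeometric kernel with vertical ends and with ends turned left; Q is the integral that
    survives on the right.\<close>
  define X where "X \<zeta> = K * (\<Sum>k\<in>P. residue_weight p a b s k * ?G k \<zeta>)" for \<zeta>
  define U where "U \<sigma> \<zeta> = horn_integral c (- \<i>) \<i> (\<lambda>t. F_kernel p a b s \<sigma> t * exp (- \<zeta> * t))" for \<sigma> \<zeta>
  define L where "L \<sigma> \<zeta> = horn_integral c (- 1) (- 1) (\<lambda>t. F_kernel p a b s \<sigma> t * exp (- \<zeta> * t))" for \<sigma> \<zeta>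
  define Q where "Q \<zeta> = horn_integral c 1 1 (\<lambda>t. Gamma_ratio p a b t * exp (- \<zeta> * t))" for \<zeta>
  have hG: "G_kernel p a b k s holomorphic_on - (left_poles a {1..p} \<union> G_right_poles p b)" if "k \<in> P" for k
    by (rule G_kernel_holomorphic) (use that s in \<open>auto simp: P_def\<close>)
  note hF = F_kernel_holomorphic[OF s, of p a b]
  note hR = Gamma_ratio_holomorphic[of p a b "left_poles a {1..p}"]
  have one: "(1::complex) = 1 \<or> (1::complex) = - 1" "(- 1::complex) = 1 \<or> (- 1::complex) = - 1"
    by simp_all
  have \<sigma>1: "(1::real) = 1 \<or> (1::real) = - 1" "(- 1::real) = 1 \<or> (- 1::real) = - 1"
    by simp_all
  have holX: "X holomorphic_on {\<zeta>. - (2 * pi) < Im \<zeta> \<and> Im \<zeta> < 2 * pi}"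
    unfolding X_def
    by (intro holomorphic_intros horn_vertical_holomorphic[OF c fin(1) hG G leG])
  have ball: "cball 0 1 \<subseteq> {\<zeta>. - (2 * pi) < Im \<zeta> \<and> Im \<zeta> < 2 * pi}"
  proof
    fix \<zeta> :: complex assume "\<zeta> \<in> cball 0 1"
    then have "\<bar>Im \<zeta>\<bar> \<le> 1"
      using abs_Im_le_cmod[of \<zeta>] by simp
    then show "\<zeta> \<in> {\<zeta>. - (2 * pi) < Im \<zeta> \<and> Im \<zeta> < 2 * pi}"
      using pi_gt3 by auto
  qed
  have ball': "- (2 * pi) < Im \<zeta>" "Im \<zeta> < 2 * pi" if "norm \<zeta> < 1" for \<zeta>
    using subsetD[OF ball, of \<zeta>] that by auto
  have growX: "polynomial_growth P X" for P
    by (rule polynomial_growth_continuous)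
      (rule continuous_on_subset[OF holomorphic_on_imp_continuous_on[OF holX] ball])
  have hol_L: "L 1 holomorphic_on {\<zeta>. Re (\<zeta> * - 1) > 0}"
    unfolding L_def by (rule horn_horizontal_holomorphic[OF c fin(1) hF F1 le(1) one(2)])
  have hol_Q: "Q holomorphic_on {\<zeta>. Re (\<zeta> * 1) > 0}"
    unfolding Q_def by (rule horn_horizontal_holomorphic[OF c fin(1) hR R le(3) one(1)])
  have hol_U1: "U 1 holomorphic_on {\<zeta>. - (pi * (1 - 1)) < Im \<zeta> \<and> Im \<zeta> < pi * (1 + 1)}"
    unfolding U_def by (rule horn_vertical_holomorphic[OF c fin(1) hF F1 le(1)])
  have hol_U2: "U (- 1) holomorphic_on {\<zeta>. - (pi * (1 - - 1)) < Im \<zeta> \<and> Im \<zeta> < pi * (1 + - 1)}"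
    unfolding U_def by (rule horn_vertical_holomorphic[OF c fin(1) hF F2 le(2)])
  have grow_L: "polynomial_growth (\<lambda>\<zeta>. norm \<zeta> / 2 \<le> - Re \<zeta>) (L 1)"
    using horn_horizontal_growth[OF c fin(1) hF F1 le(1) one(2)] by (simp add: L_def[abs_def])
  have grow_Q: "polynomial_growth (\<lambda>\<zeta>. norm \<zeta> / 2 \<le> Re \<zeta>) Q"
    using horn_horizontal_growth[OF c fin(1) hR R le(3) one(1)] by (simp add: Q_def[abs_def])
  have grow_U1: "polynomial_growth (\<lambda>\<zeta>. norm \<zeta> / 2 \<le> Im \<zeta>) (U 1)"
    unfolding U_def[abs_def]
    by (rule horn_vertical_growth_upper[OF c fin(1) hF F1 le(1)]) (use pi_gt3 in simp)
  have grow_U2: "polynomial_growth (\<lambda>\<zeta>. norm \<zeta> / 2 \<le> - Im \<zeta>) (U (- 1))"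
    unfolding U_def[abs_def]
    by (rule horn_vertical_growth_lower[OF c fin(1) hF F2 le(2)]) (use pi_gt3 in simp)
  have sums1: "(\<lambda>m. hyp_coeff p a b s m * exp \<zeta> ^ m) sums (L 1 \<zeta> * exp (- a s * \<zeta>) / (2 * of_real pi * \<i>))"
    if "Re \<zeta> < 0" for \<zeta>
    unfolding L_def by (rule horn_integral_F_kernel_sums[OF c s \<sigma>1(1) that F1 le(1)])
  have sums2: "(\<lambda>m. hyp_coeff p a b s m * exp \<zeta> ^ m) sums (L (- 1) \<zeta> * exp (- a s * \<zeta>) / (2 * of_real pi * \<i>))"
    if "Re \<zeta> < 0" for \<zeta>
    unfolding L_def by (rule horn_integral_F_kernel_sums[OF c s \<sigma>1(2) that F2 le(2)])
  \<comment> \<open>Both sides are the same multiple of the sum of one series.\<close>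
  have LL: "L (- 1) \<zeta> = L 1 \<zeta>" if "Re \<zeta> < 0" for \<zeta>
    using sums_unique2[OF sums1[OF that] sums2[OF that]] by simp
  have UL1: "U 1 \<zeta> = L 1 \<zeta>" if "norm \<zeta> < 1" "Re \<zeta> < 0" "Im \<zeta> > 0" for \<zeta>
    unfolding U_def L_def
    by (rule horn_integral_rotate_eq[OF c fin(1) hF F1 le(1)]) (use that ball'[of \<zeta>] in auto)
  have UL2: "U (- 1) \<zeta> = L 1 \<zeta>" if "norm \<zeta> < 1" "Re \<zeta> < 0" "Im \<zeta> < 0" for \<zeta>
    unfolding LL[OF that(2), symmetric] unfolding U_def L_def
    by (rule horn_integral_rotate_eq[OF c fin(1) hF F2 le(2)]) (use that ball'[of \<zeta>] in auto)
  have XU1: "X \<zeta> + U 1 \<zeta> = - (of_real pi / sin (of_real pi * \<psi>) * exp (- of_real 1 * \<i> * (of_real pi * \<psi>))) * Q \<zeta>"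
    if "norm \<zeta> < 1" "Re \<zeta> > 0" "Im \<zeta> > 0" for \<zeta>
    unfolding X_def U_def Q_def K_def \<psi>_def P_def
    by (rule kernels_horn_eq[OF c s \<sigma>1(1) \<psi> a[unfolded P_def] G[unfolded P_def] leG[unfolded P_def] F1 le(1) R le(3) R' le(4)])
       (use that ball'[of \<zeta>] in auto)
  have XU2: "X \<zeta> + U (- 1) \<zeta> = - (of_real pi / sin (of_real pi * \<psi>) * exp (- of_real (- 1) * \<i> * (of_real pi * \<psi>))) * Q \<zeta>"
    if "norm \<zeta> < 1" "Re \<zeta> > 0" "Im \<zeta> < 0" for \<zeta>
    unfolding X_def U_def Q_def K_def \<psi>_def P_def
    by (rule kernels_horn_eq[OF c s \<sigma>1(2) \<psi> a[unfolded P_def] G[unfolded P_def] leG[unfolded P_def] F2 le(2) R le(3) R' le(4)])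
       (use that ball'[of \<zeta>] in auto)
  have powr_eq: "of_real pi / sin (of_real pi * \<psi>) * (\<zeta> powr (1 - \<psi>) * q)
      = (- \<zeta>) powr (1 - \<psi>) * (- (of_real pi / sin (of_real pi * \<psi>) * exp (- of_real \<sigma> * \<i> * (of_real pi * \<psi>))) * q)"
    if "\<zeta> \<noteq> 0" "\<sigma> * Im \<zeta> > 0" "\<sigma> = 1 \<or> \<sigma> = - 1" for \<zeta> \<sigma> q
  proof -
    have "(- \<zeta>) powr (1 - \<psi>) * (- (of_real pi / sin (of_real pi * \<psi>) * exp (- of_real \<sigma> * \<i> * (of_real pi * \<psi>))) * q)
      = - (of_real pi / sin (of_real pi * \<psi>) * ((- \<zeta>) powr (1 - \<psi>) * exp (- of_real \<sigma> * \<i> * (of_real pi * \<psi>))) * q)"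
      by (simp only: mult_ac mult_minus_left mult_minus_right)
    then show ?thesis
      unfolding minus_powr[OF that] by simp
  qed
  obtain h M where h: "h holomorphic_on ball 0 1"
    "\<And>\<zeta>. norm \<zeta> < 1 \<Longrightarrow> Re \<zeta> < 0 \<Longrightarrow> (- \<zeta>) powr (1 - \<psi>) * (X \<zeta> + L 1 \<zeta>) = h \<zeta> / \<zeta> ^ M"
  proof (rule glue_half_discs)
    show "(\<lambda>\<zeta>. (- \<zeta>) powr (1 - \<psi>) * (X \<zeta> + L 1 \<zeta>)) holomorphic_on {\<zeta> \<in> ball 0 1. Re \<zeta> < 0}"
      by (intro holomorphic_intros holomorphic_on_subset[OF holX] holomorphic_on_subset[OF hol_L])
         (auto simp: complex_nonpos_Reals_iff ball' mult.commute[of pi 2])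
    show "(\<lambda>\<zeta>. (- \<zeta>) powr (1 - \<psi>) * (X \<zeta> + U 1 \<zeta>)) holomorphic_on {\<zeta> \<in> ball 0 1. Im \<zeta> > 0}"
      by (intro holomorphic_intros holomorphic_on_subset[OF holX] holomorphic_on_subset[OF hol_U1])
         (auto simp: complex_nonpos_Reals_iff ball' mult.commute[of pi 2])
    show "(\<lambda>\<zeta>. (- \<zeta>) powr (1 - \<psi>) * (X \<zeta> + U (- 1) \<zeta>)) holomorphic_on {\<zeta> \<in> ball 0 1. Im \<zeta> < 0}"
      by (intro holomorphic_intros holomorphic_on_subset[OF holX] holomorphic_on_subset[OF hol_U2])
         (auto simp: complex_nonpos_Reals_iff ball' mult.commute[of pi 2])
    show "(\<lambda>\<zeta>. of_real pi / sin (of_real pi * \<psi>) * (\<zeta> powr (1 - \<psi>) * Q \<zeta>)) holomorphic_on {\<zeta> \<in> ball 0 1. Re \<zeta> > 0}"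
      by (intro holomorphic_intros holomorphic_on_subset[OF hol_Q])
         (auto simp: complex_nonpos_Reals_iff)
    show "(- \<zeta>) powr (1 - \<psi>) * (X \<zeta> + L 1 \<zeta>) = (- \<zeta>) powr (1 - \<psi>) * (X \<zeta> + U 1 \<zeta>)"
      if "norm \<zeta> < 1" "Re \<zeta> < 0" "Im \<zeta> > 0" for \<zeta>
      using UL1[OF that] by simp
    show "(- \<zeta>) powr (1 - \<psi>) * (X \<zeta> + L 1 \<zeta>) = (- \<zeta>) powr (1 - \<psi>) * (X \<zeta> + U (- 1) \<zeta>)"
      if "norm \<zeta> < 1" "Re \<zeta> < 0" "Im \<zeta> < 0" for \<zeta>
      using UL2[OF that] by simp
    show "of_real pi / sin (of_real pi * \<psi>) * (\<zeta> powr (1 - \<psi>) * Q \<zeta>) = (- \<zeta>) powr (1 - \<psi>) * (X \<zeta> + U 1 \<zeta>)"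
      if "norm \<zeta> < 1" "Re \<zeta> > 0" "Im \<zeta> > 0" for \<zeta>
      unfolding XU1[OF that] by (rule powr_eq) (use that in auto)
    show "of_real pi / sin (of_real pi * \<psi>) * (\<zeta> powr (1 - \<psi>) * Q \<zeta>) = (- \<zeta>) powr (1 - \<psi>) * (X \<zeta> + U (- 1) \<zeta>)"
      if "norm \<zeta> < 1" "Re \<zeta> > 0" "Im \<zeta> < 0" for \<zeta>
      unfolding XU2[OF that] by (rule powr_eq) (use that in auto)
    show "polynomial_growth (\<lambda>\<zeta>. norm \<zeta> / 2 \<le> - Re \<zeta>) (\<lambda>\<zeta>. (- \<zeta>) powr (1 - \<psi>) * (X \<zeta> + L 1 \<zeta>))"
      by (intro polynomial_growth_mult polynomial_growth_add polynomial_growth_powr growX grow_L)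
    show "polynomial_growth (\<lambda>\<zeta>. norm \<zeta> / 2 \<le> Im \<zeta>) (\<lambda>\<zeta>. (- \<zeta>) powr (1 - \<psi>) * (X \<zeta> + U 1 \<zeta>))"
      by (intro polynomial_growth_mult polynomial_growth_add polynomial_growth_powr growX grow_U1)
    show "polynomial_growth (\<lambda>\<zeta>. norm \<zeta> / 2 \<le> - Im \<zeta>) (\<lambda>\<zeta>. (- \<zeta>) powr (1 - \<psi>) * (X \<zeta> + U (- 1) \<zeta>))"
      by (intro polynomial_growth_mult polynomial_growth_add polynomial_growth_powr growX grow_U2)
    show "polynomial_growth (\<lambda>\<zeta>. norm \<zeta> / 2 \<le> Re \<zeta>) (\<lambda>\<zeta>. of_real pi / sin (of_real pi * \<psi>) * (\<zeta> powr (1 - \<psi>) * Q \<zeta>))"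
      by (intro polynomial_growth_mult polynomial_growth_powr grow_Q polynomial_growth_continuous[OF continuous_on_const])
  qed blast
  show ?thesis
  proof (rule that[OF h(1)])
    fix \<zeta> :: complex assume \<zeta>: "norm \<zeta> < 1" "Re \<zeta> < 0"
    have nz: "- \<zeta> \<noteq> 0"
      using \<zeta> by auto
    have "X \<zeta> + L 1 \<zeta> = (- \<zeta>) powr (\<psi> - 1) * ((- \<zeta>) powr (1 - \<psi>) * (X \<zeta> + L 1 \<zeta>))"
      using nz by (simp flip: powr_add mult.assoc)
    also have "\<dots> = (- \<zeta>) powr (\<psi> - 1) * (h \<zeta> / \<zeta> ^ M)"
      by (simp only: h(2)[OF \<zeta>])
    finally have XL: "L 1 \<zeta> = (- \<zeta>) powr (\<psi> - 1) * (h \<zeta> / \<zeta> ^ M) - X \<zeta>"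
      by (simp add: algebra_simps)
    have "\<bar>Im \<zeta>\<bar> < 1"
      using \<zeta>(1) abs_Im_le_cmod[of \<zeta>] by linarith
    then have Ln: "Ln (exp \<zeta>) = \<zeta>"
      using pi_gt3 by (intro Ln_exp) linarith+
    have mG: "meijer_G p a b k s (exp \<zeta>) = 1 / (2 * of_real pi * \<i>) * ?G k \<zeta>" if k: "k \<in> P" for k
      using meijer_G_eq_horn_integral[of k p s "{1..p}" a b H0 c "exp \<zeta>"] k s df[OF k] c unfolding Ln
      by (auto simp: P_def)
    have "X \<zeta> * exp (- a s * \<zeta>) / (2 * of_real pi * \<i>)
      = K * (\<Sum>k\<in>P. residue_weight p a b s k * (meijer_G p a b k s (exp \<zeta>) * exp (- a s * \<zeta>)))"
      unfolding X_def by (simp add: sum_distrib_left sum_distrib_right sum_divide_distrib mG mult_ac)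
    then have "L 1 \<zeta> * exp (- a s * \<zeta>) / (2 * of_real pi * \<i>)
      = (- \<zeta>) powr (\<psi> - 1) * (h \<zeta> / \<zeta> ^ M) * exp (- a s * \<zeta>) / (2 * of_real pi * \<i>)
       - K * (\<Sum>k\<in>P. residue_weight p a b s k * (meijer_G p a b k s (exp \<zeta>) * exp (- a s * \<zeta>)))"
      unfolding XL left_diff_distrib diff_divide_distrib by simp
    with sums1[OF \<zeta>(2)] show "(\<lambda>m. hyp_coeff p a b s m * exp \<zeta> ^ m) sums
      ((- \<zeta>) powr (psi a b p - 1) * (h \<zeta> / \<zeta> ^ M) * exp (- a s * \<zeta>) / (2 * of_real pi * \<i>)
       - 1 / (of_real pi * sin (of_real pi * psi a b p))
         * (\<Sum>k\<in>P. residue_weight p a b s k * (meijer_G p a b k s (exp \<zeta>) * exp (- a s * \<zeta>))))"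
      unfolding K_def \<psi>_def by simp
  qed
qed

section \<open>Elimination of the pole\<close>

text \<open>The assumptions say u n = 1 + r / n + o(1 / n), and likewise for v with q. The numbers r
  and q add under multiplication, which suffices to follow quotients of consecutive
  coefficients.\<close>

lemma unit_rate_mult:
  fixes u v :: "nat \<Rightarrow> real"
  assumes u: "(\<lambda>n. real n * (u n - 1)) \<longlonglongrightarrow> r" and v: "(\<lambda>n. real n * (v n - 1)) \<longlonglongrightarrow> q"
  shows "v \<longlonglongrightarrow> 1" and "(\<lambda>n. real n * (u n * v n - 1)) \<longlonglongrightarrow> r + q"
proof -
  have "(\<lambda>n. real n * (v n - 1) * (1 / real n)) \<longlonglongrightarrow> q * 0"
    by (intro tendsto_mult v) real_asymp
  moreover have "\<forall>\<^sub>F n in sequentially. real n * (v n - 1) * (1 / real n) = v n - 1"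
    using eventually_gt_at_top[of 0] by eventually_elim simp
  ultimately have "(\<lambda>n. v n - 1) \<longlonglongrightarrow> 0"
    by (simp add: Lim_transform_eventually)
  then show v1: "v \<longlonglongrightarrow> 1"
    by (simp add: LIM_zero_iff)
  have "(\<lambda>n. real n * (u n - 1) * v n + real n * (v n - 1)) \<longlonglongrightarrow> r * 1 + q"
    by (intro tendsto_intros u v v1)
  then show "(\<lambda>n. real n * (u n * v n - 1)) \<longlonglongrightarrow> r + q"
    by (simp add: algebra_simps)
qed

lemma unit_rate_divide:
  fixes u v :: "nat \<Rightarrow> real"
  assumes u: "(\<lambda>n. real n * (u n - 1)) \<longlonglongrightarrow> r" and v: "(\<lambda>n. real n * (v n - 1)) \<longlonglongrightarrow> q"
  shows "(\<lambda>n. real n * (u n / v n - 1)) \<longlonglongrightarrow> r - q"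
proof -
  have v1: "v \<longlonglongrightarrow> 1"
    by (rule unit_rate_mult(1)[OF u v])
  have "(\<lambda>n. (real n * (u n - 1) - real n * (v n - 1)) / v n) \<longlonglongrightarrow> (r - q) / 1"
    by (intro tendsto_intros u v v1) simp
  moreover have "\<forall>\<^sub>F n in sequentially. v n > 0"
    using order_tendstoD(1)[OF v1, of 0] by simp
  then have "\<forall>\<^sub>F n in sequentially. (real n * (u n - 1) - real n * (v n - 1)) / v n = real n * (u n / v n - 1)"
    by eventually_elim (simp add: field_simps)
  ultimately show ?thesis
    by (simp add: Lim_transform_eventually)
qed

lemma unit_rate_norm:
  fixes \<beta> :: complex
  shows "(\<lambda>n. real n * (norm (\<beta> + of_nat n) / real n - 1)) \<longlonglongrightarrow> Re \<beta>"
proof -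
  have "(\<lambda>n. sqrt ((Re \<beta> + real n) ^ 2 + Im \<beta> ^ 2) - real n) \<longlonglongrightarrow> Re \<beta>"
    by real_asymp
  moreover have "\<forall>\<^sub>F n in sequentially. sqrt ((Re \<beta> + real n) ^ 2 + Im \<beta> ^ 2) - real n
      = real n * (norm (\<beta> + of_nat n) / real n - 1)"
    using eventually_gt_at_top[of 0] by eventually_elim (simp add: cmod_def field_simps)
  ultimately show ?thesis
    by (rule Lim_transform_eventually)
qed

lemma unit_rate_prod:
  fixes \<beta> :: "'a \<Rightarrow> complex"
  assumes "finite K"
  shows "(\<lambda>n. real n * ((\<Prod>i\<in>K. norm (\<beta> i + of_nat n) / real n) - 1)) \<longlonglongrightarrow> (\<Sum>i\<in>K. Re (\<beta> i))"
  using assms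
proof (induction K)
  case (insert i K)
  have "(\<lambda>n. real n * ((norm (\<beta> i + of_nat n) / real n) * (\<Prod>i\<in>K. norm (\<beta> i + of_nat n) / real n) - 1))
      \<longlonglongrightarrow> Re (\<beta> i) + (\<Sum>i\<in>K. Re (\<beta> i))"
    by (rule unit_rate_mult(2)[OF unit_rate_norm insert.IH])
  then show ?case
    using insert by simp
qed simp

text \<open>By the functional equation the quotient of consecutive coefficients consists of p linear
  factors over p - 1 others and n + 1; the first-order term of the linear factors is the difference
  of the parameter sums, 1 - Re psi. The constant 3/2 leaves a margin of 1/2, less than one full
  power of 1 - z.\<close>

lemma eventually_hyp_coeff_ratio:
  assumes s: "s \<in> {1..p}"
  shows "\<forall>\<^sub>F n in sequentially. norm (hyp_coeff p a b s (Suc n)) * real (Suc n)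
    \<le> (3/2 - Re (psi a b p) + real n) * norm (hyp_coeff p a b s n)"
proof -
  define \<alpha> \<beta> where "\<alpha> = (\<lambda>i. 1 - a i + a s)" and "\<beta> = (\<lambda>i. 1 - b i + a s)"
  let ?P = "{1..p} - {s}"
  have "(\<Sum>i=1..p. \<beta> i) - (\<Sum>i\<in>?P. \<alpha> i) = 1 - psi a b p"
  proof -
    have "(\<Sum>i=1..p. \<alpha> i) = \<alpha> s + (\<Sum>i\<in>?P. \<alpha> i)"
      using s by (simp add: sum.remove)
    moreover have "(\<Sum>i=1..p. \<beta> i) - (\<Sum>i=1..p. \<alpha> i) = - psi a b p"
      by (simp add: psi_def \<alpha>_def \<beta>_def flip: sum_subtractf sum_negf)
    ultimately show ?thesis
      by (simp add: \<alpha>_def algebra_simps)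
  qed
  then have sum: "(\<Sum>i=1..p. Re (\<beta> i)) - (\<Sum>i\<in>?P. Re (\<alpha> i)) = 1 - Re (psi a b p)"
    by (metis Re_sum minus_complex.simps(1) one_complex.simps(1))
  have "(\<lambda>n. real n * ((\<Prod>i=1..p. norm (\<beta> i + of_nat n) / real n) / (\<Prod>i\<in>?P. norm (\<alpha> i + of_nat n) / real n) - 1))
      \<longlonglongrightarrow> 1 - Re (psi a b p)"
    unfolding sum [symmetric] by (intro unit_rate_divide unit_rate_prod) auto
  then have "\<forall>\<^sub>F n in sequentially. real n * ((\<Prod>i=1..p. norm (\<beta> i + of_nat n) / real n) / (\<Prod>i\<in>?P. norm (\<alpha> i + of_nat n) / real n) - 1)
      < 3/2 - Re (psi a b p)"
    by (rule order_tendstoD(2)) simp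
  \<comment> \<open>Excludes poles of the Gamma factors and zeros of the linear factors in the
    denominator.\<close>
  moreover have "\<forall>\<^sub>F n in sequentially. real n > (\<Sum>i=1..p. norm (\<beta> i)) + (\<Sum>i\<in>?P. norm (\<alpha> i))"
    by (rule eventually_compose_filterlim[OF eventually_gt_at_top filterlim_real_sequentially])
  ultimately show ?thesis
  proof eventually_elim
    case (elim n)
    have nn: "(\<Sum>i=1..p. norm (\<beta> i)) \<ge> 0" "(\<Sum>i\<in>?P. norm (\<alpha> i)) \<ge> 0"
      by (intro sum_nonneg; simp)+
    have n: "real n > 0"
      using elim(2) nn by linarith
    have \<beta>0: "\<beta> i + of_nat n \<notin> \<int>\<^sub>\<le>\<^sub>0" if "i \<in> {1..p}" for i
    proof (rule pos_Re_not_nonpos_Int)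
      have "norm (\<beta> i) \<le> (\<Sum>i=1..p. norm (\<beta> i))"
        by (rule member_le_sum[OF that]) auto
      then show "Re (\<beta> i + of_nat n) > 0"
        using elim(2) nn abs_Re_le_cmod[of "\<beta> i"] by simp
    qed
    have \<alpha>0: "\<alpha> i + of_nat n \<noteq> 0" if "i \<in> ?P" for i
    proof
      assume "\<alpha> i + of_nat n = 0"
      then have "norm (\<alpha> i) = real n"
        by (metis add_eq_0_iff2 norm_minus_cancel norm_of_nat)
      moreover
      have "norm (\<alpha> i) \<le> (\<Sum>i\<in>?P. norm (\<alpha> i))"
        by (rule member_le_sum[OF that]) auto
      ultimately show False
        using elim(2) nn by linarith
    qed
    define A B where "A = (\<Prod>i\<in>?P. \<alpha> i + of_nat n)" and "B = (\<Prod>i=1..p. \<beta> i + of_nat n)"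
    have A: "norm A > 0"
      using \<alpha>0 by (simp add: A_def)
    have Suc: "x + of_nat (Suc n) = (x + of_nat n) + 1" for x :: complex
      by simp
    have "(\<Prod>i=1..p. Gamma (\<beta> i + of_nat (Suc n))) = B * (\<Prod>i=1..p. Gamma (\<beta> i + of_nat n))"
      unfolding B_def prod.distrib [symmetric] Suc
      by (intro prod.cong refl Gamma_plus1 \<beta>0)
    moreover have "(\<Prod>i\<in>?P. rGamma (\<alpha> i + of_nat n)) = A * (\<Prod>i\<in>?P. rGamma (\<alpha> i + of_nat (Suc n)))"
      unfolding A_def prod.distrib [symmetric] Suc
      by (intro prod.cong refl rGamma_plus1 [symmetric])
    ultimately have "A * (hyp_coeff p a b s (Suc n) * of_nat (Suc n)) = B * hyp_coeff p a b s n"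
      by (simp add: hyp_coeff_def \<alpha>_def \<beta>_def field_simps del: of_nat_Suc)
    then have eq: "norm A * (norm (hyp_coeff p a b s (Suc n)) * real (Suc n)) = norm B * norm (hyp_coeff p a b s n)"
      by (metis norm_mult norm_of_nat)
    have "(\<Prod>i=1..p. norm (\<beta> i + of_nat n) / real n) = norm B / real n ^ p"
      by (simp add: B_def prod_norm prod_dividef)
    moreover have "(\<Prod>i\<in>?P. norm (\<alpha> i + of_nat n) / real n) = norm A / real n ^ (p - 1)"
      using s by (simp add: A_def prod_norm prod_dividef)
    moreover have "real n ^ p = real n * real n ^ (p - 1)"
      using s by (cases p) auto
    ultimately have "real n * (norm B / (real n * norm A) - 1) < 3/2 - Re (psi a b p)"
      using elim(1) n by simp
    then have "norm B / norm A \<le> 3/2 - Re (psi a b p) + real n"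
      using n A by (simp add: field_simps)
    then have "norm B \<le> (3/2 - Re (psi a b p) + real n) * norm A"
      using A by (simp add: pos_divide_le_eq)
    then have "norm A * (norm (hyp_coeff p a b s (Suc n)) * real (Suc n))
        \<le> (3/2 - Re (psi a b p) + real n) * norm A * norm (hyp_coeff p a b s n)"
      unfolding eq by (rule mult_right_mono) simp
    then have "norm A * (norm (hyp_coeff p a b s (Suc n)) * real (Suc n))
        \<le> norm A * ((3/2 - Re (psi a b p) + real n) * norm (hyp_coeff p a b s n))"
      by (simp only: mult_ac)
    then show ?case
      using A by (rule mult_left_le_imp_le)
  qed
qed

text \<open>The majorant satisfies the recursion with equality, so the bound propagates from n0 on.
  The sum defining C covers the finitely many earlier indices.\<close>

lemma ratio_imp_pochhammer_bound:
  fixes c :: "nat \<Rightarrow> complex" and \<kappa> :: real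
  assumes "\<kappa> > 0" and "\<forall>\<^sub>F n in sequentially. norm (c (Suc n)) * real (Suc n) \<le> (\<kappa> + real n) * norm (c n)"
  shows "\<exists>C. \<forall>n. norm (c n) \<le> C * (pochhammer \<kappa> n / fact n)"
proof -
  obtain n0 where n0: "\<And>n. n \<ge> n0 \<Longrightarrow> norm (c (Suc n)) * real (Suc n) \<le> (\<kappa> + real n) * norm (c n)"
    using assms(2) by (auto simp: eventually_sequentially)
  have pos: "pochhammer \<kappa> n / fact n > 0" for n
    using assms(1) by (simp add: pochhammer_pos)
  define C where "C = (\<Sum>k\<le>n0. norm (c k) / (pochhammer \<kappa> k / fact k))"
  have small: "norm (c n) \<le> C * (pochhammer \<kappa> n / fact n)" if "n \<le> n0" for n
  proof -
    have "norm (c n) / (pochhammer \<kappa> n / fact n) \<le> C"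
      unfolding C_def
      by (rule member_le_sum[where f="\<lambda>k. norm (c k) / (pochhammer \<kappa> k / fact k)"])
         (use that in simp, rule divide_nonneg_pos[OF norm_ge_zero pos], simp)
    then show ?thesis
      using pos[of n] by (simp only: pos_divide_le_eq)
  qed
  have large: "norm (c n) \<le> C * (pochhammer \<kappa> n / fact n)" if "n \<ge> n0" for n
    using that
  proof (induction n rule: dec_induct)
    case base
    show ?case by (rule small) simp
  next
    case (step n)
    have "norm (c (Suc n)) * real (Suc n) \<le> (\<kappa> + real n) * norm (c n)"
      using n0 step by simp
    also have "\<dots> \<le> (\<kappa> + real n) * (C * (pochhammer \<kappa> n / fact n))"
      using step.IH assms(1) by (intro mult_left_mono) auto
    also have "\<dots> = C * (pochhammer \<kappa> (Suc n) / fact (Suc n)) * real (Suc n)"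
      by (simp add: pochhammer_Suc field_simps del: of_nat_Suc)
    finally show ?case
      by (rule mult_right_le_imp_le) simp
  qed
  show ?thesis
    using small large nat_le_linear by blast
qed

text \<open>The majorant of the coefficients is itself a binomial series, which turns the bound on
  coefficients into one on the sum.\<close>

lemma pochhammer_sums:
  fixes \<kappa> x :: real
  assumes "0 < x" "x < 1"
  shows "(\<lambda>n. pochhammer \<kappa> n / fact n * (1 - x) ^ n) sums (x powr (- \<kappa>))"
proof -
  have "(\<lambda>n. (- \<kappa> gchoose n) * (x - 1) ^ n) sums (1 + (x - 1)) powr (- \<kappa>)"
    by (rule gen_binomial_real) (use assms in auto)
  moreover have "(- \<kappa> gchoose n) * (x - 1) ^ n = pochhammer \<kappa> n / fact n * (1 - x) ^ n" for n
  proof -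
    have "(x - 1) ^ n = (- 1) ^ n * (1 - x) ^ n"
      by (metis minus_diff_eq mult_minus1 power_mult_distrib)
    then show ?thesis
      by (simp add: gbinomial_pochhammer flip: power_mult_distrib)
  qed
  ultimately show ?thesis by simp
qed

text \<open>The bound on the coefficients makes the sum \<open>O(x\<^bsup>-\<kappa>\<^esup>)\<close>, which is smaller than \<open>x\<^bsup>\<mu>\<^esup>\<close>.\<close>

lemma leading_coeff_eq_0_aux:
  fixes c :: "nat \<Rightarrow> complex"
  assumes \<delta>: "0 < \<delta>" "\<delta> \<le> 1" and E: "E holomorphic_on ball 0 \<delta>" and Q: "Q holomorphic_on ball 0 \<delta>"
    and \<kappa>: "\<kappa> > 0" "Re \<mu> < - \<kappa>"
    and ratio: "\<forall>\<^sub>F n in sequentially. norm (c (Suc n)) * real (Suc n) \<le> (\<kappa> + real n) * norm (c n)"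
    and sums: "\<And>x. 0 < x \<Longrightarrow> x < \<delta> \<Longrightarrow>
      (\<lambda>n. c n * (1 - of_real x) ^ n) sums (of_real x powr \<mu> * E (of_real x) + Q (of_real x))"
  shows "E 0 = 0"
proof -
  obtain C where C: "\<And>n. norm (c n) \<le> C * (pochhammer \<kappa> n / fact n)"
    using ratio_imp_pochhammer_bound[OF \<kappa>(1) ratio] by blast
  have bound: "norm (E (of_real x)) \<le> (C + x powr \<kappa> * norm (Q (of_real x))) * x powr (- Re \<mu> - \<kappa>)"
    if x: "0 < x" "x < \<delta>" for x
  proof -
    have s: "(\<lambda>n. C * (pochhammer \<kappa> n / fact n * (1 - x) ^ n)) sums (C * x powr (- \<kappa>))"
      by (intro sums_mult pochhammer_sums) (use x \<delta> in auto)
    have le: "norm (c n * (1 - of_real x) ^ n) \<le> C * (pochhammer \<kappa> n / fact n * (1 - x) ^ n)" for n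
    proof -
      have "norm (1 - of_real x :: complex) = 1 - x"
        using x \<delta> by (metis abs_of_nonneg diff_ge_0_iff_ge less_le_trans less_imp_le norm_of_real of_real_1 of_real_diff)
      then have "norm (c n * (1 - of_real x) ^ n) = norm (c n) * (1 - x) ^ n"
        by (simp add: norm_mult norm_power)
      also have "\<dots> \<le> C * (pochhammer \<kappa> n / fact n) * (1 - x) ^ n"
        using C[of n] x \<delta> by (intro mult_right_mono) auto
      finally show ?thesis
        by (simp only: mult.assoc)
    qed
    have "norm (\<Sum>n. c n * (1 - of_real x) ^ n) \<le> (\<Sum>n. C * (pochhammer \<kappa> n / fact n * (1 - x) ^ n))"
      by (rule norm_suminf_le[OF le sums_summable[OF s]])
    then have "norm (of_real x powr \<mu> * E (of_real x) + Q (of_real x)) \<le> C * x powr (- \<kappa>)"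
      using sums_unique[OF sums[OF x]] sums_unique[OF s] by simp
    then have "norm (of_real x powr \<mu> * E (of_real x)) \<le> C * x powr (- \<kappa>) + norm (Q (of_real x))"
      using norm_triangle_ineq4[of "of_real x powr \<mu> * E (of_real x) + Q (of_real x)" "Q (of_real x)"] by simp
    then have "x powr Re \<mu> * norm (E (of_real x)) \<le> C * x powr (- \<kappa>) + norm (Q (of_real x))"
      using x by (simp add: norm_mult norm_powr_real_powr)
    then have "x powr (- Re \<mu>) * (x powr Re \<mu> * norm (E (of_real x))) \<le> x powr (- Re \<mu>) * (C * x powr (- \<kappa>) + norm (Q (of_real x)))"
      by (intro mult_left_mono) auto
    also have "x powr (- Re \<mu>) * (x powr Re \<mu> * norm (E (of_real x))) = norm (E (of_real x))"
      using x by (simp flip: mult.assoc powr_add)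
    also have "x powr (- Re \<mu>) * (C * x powr (- \<kappa>) + norm (Q (of_real x)))
        = (C + x powr \<kappa> * norm (Q (of_real x))) * x powr (- Re \<mu> - \<kappa>)"
    proof -
      have "x powr (- Re \<mu>) = x powr \<kappa> * x powr (- Re \<mu> - \<kappa>)" "x powr (- Re \<mu> - \<kappa>) = x powr (- Re \<mu>) * x powr (- \<kappa>)"
        by (simp_all flip: powr_add)
      then show ?thesis
        by (simp add: ring_distribs mult_ac)
    qed
    finally show ?thesis .
  qed
  have lim: "((\<lambda>x. F (of_real x)) \<longlongrightarrow> F 0) (at_right (0::real))" if "F holomorphic_on ball 0 \<delta>" for F :: "complex \<Rightarrow> complex"
  proof -
    have "isCont F 0"
      using holomorphic_on_imp_continuous_on[OF that] \<delta> by (simp add: continuous_on_eq_continuous_at)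
    moreover have "((\<lambda>x. of_real x :: complex) \<longlongrightarrow> 0) (at_right (0::real))"
      by (auto intro!: tendsto_eq_intros)
    ultimately show ?thesis
      by (rule isCont_tendsto_compose)
  qed
  have p0: "((\<lambda>x::real. x powr e) \<longlongrightarrow> 0) (at_right 0)" if "e > 0" for e
    using that by real_asymp
  have "((\<lambda>x. (C + x powr \<kappa> * norm (Q (of_real x))) * x powr (- Re \<mu> - \<kappa>)) \<longlongrightarrow> (C + 0 * norm (Q 0)) * 0) (at_right 0)"
    by (intro tendsto_intros p0 lim Q) (use \<kappa> in auto)
  then have lim0: "((\<lambda>x. (C + x powr \<kappa> * norm (Q (of_real x))) * x powr (- Re \<mu> - \<kappa>)) \<longlongrightarrow> 0) (at_right 0)"
    by (simp only: mult_zero_right)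
  have "\<forall>\<^sub>F x in at_right 0. norm (E (of_real x)) \<le> (C + x powr \<kappa> * norm (Q (of_real x))) * x powr (- Re \<mu> - \<kappa>)"
    using eventually_at_right_real[OF \<delta>(1)] by eventually_elim (rule bound; simp)
  then have "((\<lambda>x. E (of_real x)) \<longlongrightarrow> 0) (at_right 0)"
    by (rule Lim_null_comparison[OF _ lim0])
  then show ?thesis
    using tendsto_unique[OF trivial_limit_at_right_real lim[OF E]] by blast
qed

text \<open>A real point 1 - x with small x lies in the region of the assumption and has modulus
  larger than that of z.\<close>

lemma summable_inside_from_sums:
  fixes c :: "nat \<Rightarrow> complex"
  assumes \<delta>: "0 < \<delta>" and sums: "\<And>w. norm w < \<delta> \<Longrightarrow> norm (1 - w) < 1 \<Longrightarrow> (\<lambda>n. c n * (1 - w) ^ n) sums F w"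
    and z: "norm z < 1"
  shows "summable (\<lambda>n. c n * z ^ n)"
proof -
  define x where "x = min (\<delta> / 2) ((1 - norm z) / 2)"
  have x: "0 < x" "x < \<delta>" "x < 1 - norm z" "x < 1"
    using \<delta> z norm_ge_zero[of z] unfolding x_def min_def by (simp_all, linarith+)
  have n1: "norm (1 - of_real x :: complex) = 1 - x"
    using x by (metis abs_of_nonneg diff_ge_0_iff_ge less_imp_le norm_of_real of_real_1 of_real_diff)
  have "summable (\<lambda>n. c n * (1 - of_real x) ^ n)"
    by (rule sums_summable[OF sums]) (use x n1 in auto)
  then show ?thesis
    by (rule powser_inside) (use x n1 in simp)
qed

lemma leading_coeff_eq_0:
  fixes c :: "nat \<Rightarrow> complex"
  assumes \<delta>: "0 < \<delta>" "\<delta> \<le> 1"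
    and "\<kappa> + real m > 0" "Re \<mu> < - \<kappa>" "\<mu> \<notin> \<int>" "E holomorphic_on ball 0 \<delta>" "Q holomorphic_on ball 0 \<delta>"
    and "\<forall>\<^sub>F n in sequentially. norm (c (Suc n)) * real (Suc n) \<le> (\<kappa> + real n) * norm (c n)"
    and "\<And>w. norm w < \<delta> \<Longrightarrow> norm (1 - w) < 1 \<Longrightarrow> (\<lambda>n. c n * (1 - w) ^ n) sums (w powr \<mu> * E w + Q w)"
  shows "E 0 = 0"
  using assms(3-)
proof (induction m arbitrary: \<kappa> \<mu> c E Q)
  case 0
  show ?case
  proof (rule leading_coeff_eq_0_aux[OF \<delta> "0.prems"(4,5) _ _ "0.prems"(6)])
    fix x :: real assume x: "0 < x" "x < \<delta>"
    have "norm (1 - of_real x :: complex) = 1 - x"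
      using x \<delta> by (metis abs_of_nonneg diff_ge_0_iff_ge less_le_trans less_imp_le norm_of_real of_real_1 of_real_diff)
    then show "(\<lambda>n. c n * (1 - of_real x) ^ n) sums (of_real x powr \<mu> * E (of_real x) + Q (of_real x))"
      using x by (intro "0.prems"(7)) auto
  qed (use 0 in auto)
next
  case (Suc m)
  \<comment> \<open>E1 and Q1 come from minus the derivative in w; the sign belongs to the inner
    function 1 - w of the series.\<close>
  define E1 where "E1 = (\<lambda>w. - (\<mu> * E w + w * deriv E w))"
  define Q1 where "Q1 = (\<lambda>w. - deriv Q w)"
  have "E1 0 = 0"
  proof (rule Suc.IH)
    show "\<kappa> + 1 + real m > 0" "Re (\<mu> - 1) < - (\<kappa> + 1)"
      using Suc.prems by auto
    show "\<mu> - 1 \<notin> \<int>"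
      using Suc.prems(3) by (metis Ints_1 Ints_add diff_add_cancel)
    show "E1 holomorphic_on ball 0 \<delta>" "Q1 holomorphic_on ball 0 \<delta>"
      unfolding E1_def Q1_def using Suc.prems(4,5) by (auto intro!: holomorphic_intros)
    have "\<forall>\<^sub>F n in sequentially. norm (c (Suc (Suc n))) * real (Suc (Suc n)) \<le> (\<kappa> + real (Suc n)) * norm (c (Suc n))"
      using Suc.prems(6) by (rule eventually_sequentially_Suc[THEN iffD2])
    then show "\<forall>\<^sub>F n in sequentially. norm (diffs c (Suc n)) * real (Suc n) \<le> (\<kappa> + 1 + real n) * norm (diffs c n)"
    proof eventually_elim
      case (elim n)
      have "norm (diffs c (Suc n)) * real (Suc n) = norm (c (Suc (Suc n))) * real (Suc (Suc n)) * real (Suc n)"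
        by (simp only: diffs_def norm_mult norm_of_nat mult_ac)
      also have "\<dots> \<le> (\<kappa> + real (Suc n)) * norm (c (Suc n)) * real (Suc n)"
        by (rule mult_right_mono[OF elim]) simp
      also have "\<dots> = (\<kappa> + real (Suc n)) * norm (diffs c n)"
        by (simp only: diffs_def norm_mult norm_of_nat mult_ac)
      finally show ?case
        by (simp add: add_ac)
    qed
    fix w :: complex assume w: "norm w < \<delta>" "norm (1 - w) < 1"
    have summ: "summable (\<lambda>n. c n * z ^ n)" if "norm z < 1" for z
      by (rule summable_inside_from_sums[OF \<delta>(1) Suc.prems(7) that])
    have "((\<lambda>z. \<Sum>n. c n * z ^ n) has_field_derivative (\<Sum>n. diffs c n * (1 - w) ^ n)) (at (1 - w))"
      by (rule termdiffs_strong'[OF summ w(2)])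
    then have "((\<lambda>w. \<Sum>n. c n * (1 - w) ^ n) has_field_derivative (\<Sum>n. diffs c n * (1 - w) ^ n) * - 1) (at w)"
      by (rule DERIV_chain2) (auto intro!: derivative_eq_intros)
    then have "((\<lambda>w. w powr \<mu> * E w + Q w) has_field_derivative (\<Sum>n. diffs c n * (1 - w) ^ n) * - 1) (at w)"
    proof (rule has_field_derivative_transform_within_open)
      show "open (ball 0 \<delta> \<inter> ball (1::complex) 1)"
        by auto
      show "w \<in> ball 0 \<delta> \<inter> ball 1 1"
        using w by (simp add: dist_norm)
      show "(\<Sum>n. c n * (1 - v) ^ n) = v powr \<mu> * E v + Q v" if "v \<in> ball 0 \<delta> \<inter> ball 1 1" for v
        by (rule sums_unique[symmetric, OF Suc.prems(7)]) (use that in \<open>auto simp: dist_norm\<close>)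
    qed
    moreover have "((\<lambda>w. w powr \<mu> * E w + Q w) has_field_derivative
        w powr (\<mu> - 1) * (\<mu> * E w + w * deriv E w) + deriv Q w) (at w)"
    proof -
      have Re: "Re w > 0"
        using w(2) abs_Re_le_cmod[of "1 - w"] by simp
      then have nz: "w \<noteq> 0" and np: "w \<notin> \<real>\<^sub>\<le>\<^sub>0"
        by (auto simp: complex_nonpos_Reals_iff)
      have "(E has_field_derivative deriv E w) (at w)" "(Q has_field_derivative deriv Q w) (at w)"
        using Suc.prems(4,5) w by (auto intro!: holomorphic_derivI)
      then have "((\<lambda>w. w powr \<mu> * E w + Q w) has_field_derivative
          (\<mu> * w powr (\<mu> - 1) * E w + w powr \<mu> * deriv E w) + deriv Q w) (at w)"
        using np by (auto intro!: derivative_eq_intros has_field_derivative_powr)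
      moreover have "w powr \<mu> = w powr (\<mu> - 1) * w"
        using nz powr_add[of w "\<mu> - 1" 1] by simp
      ultimately show ?thesis
        by (simp add: algebra_simps)
    qed
    ultimately have "(\<Sum>n. diffs c n * (1 - w) ^ n) * - 1 = w powr (\<mu> - 1) * (\<mu> * E w + w * deriv E w) + deriv Q w"
      by (rule DERIV_unique)
    then have "(\<Sum>n. diffs c n * (1 - w) ^ n) = w powr (\<mu> - 1) * E1 w + Q1 w"
      unfolding E1_def Q1_def by (simp add: algebra_simps minus_equation_iff[of "suminf _"])
    moreover have "summable (\<lambda>n. diffs c n * (1 - w) ^ n)"
      by (rule termdiff_converges[OF w(2) summ])
    ultimately show "(\<lambda>n. diffs c n * (1 - w) ^ n) sums (w powr (\<mu> - 1) * E1 w + Q1 w)"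
      by (simp add: sums_iff)
  qed
  moreover have "\<mu> \<noteq> 0"
    using Suc.prems(3) by auto
  ultimately show ?case
    by (simp add: E1_def)
qed

text \<open>Each negative power of w is cancelled by dividing out a zero of E at 0. The zero is
  forced because a pole lowers the exponent by at least 1, while the growth bound gives away only
  1/2.\<close>

lemma remove_pole:
  fixes c :: "nat \<Rightarrow> complex"
  assumes \<delta>: "0 < \<delta>" "\<delta> \<le> 1" and \<mu>: "\<mu> \<notin> \<int>" and Q: "Q holomorphic_on ball 0 \<delta>"
    and ratio: "\<forall>\<^sub>F n in sequentially. norm (c (Suc n)) * real (Suc n) \<le> (1/2 - Re \<mu> + real n) * norm (c n)"
    and E: "E holomorphic_on ball 0 \<delta>"
    and sums: "\<And>w. norm w < \<delta> \<Longrightarrow> norm (1 - w) < 1 \<Longrightarrow>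
      (\<lambda>n. c n * (1 - w) ^ n) sums (w powr (\<mu> - of_nat M) * E w + Q w)"
  shows "\<exists>E. E holomorphic_on ball 0 \<delta> \<and> (\<forall>w. norm w < \<delta> \<longrightarrow> norm (1 - w) < 1 \<longrightarrow>
      (\<lambda>n. c n * (1 - w) ^ n) sums (w powr \<mu> * E w + Q w))"
  using E sums
proof (induction M arbitrary: E)
  case 0
  then show ?case by auto
next
  case (Suc M)
  define E1 where "E1 = (\<lambda>w. if w = 0 then deriv E 0 else (E w - E 0) / (w - 0))"
  obtain m :: nat where m: "real m > Re \<mu>"
    using reals_Archimedean2 by blast
  have E0: "E 0 = 0"
  proof (rule leading_coeff_eq_0[OF \<delta> _ _ _ Suc.prems(1) Q ratio Suc.prems(2)])
    show "1/2 - Re \<mu> + real m > 0"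
      using m by simp
    show "Re (\<mu> - of_nat (Suc M)) < - (1/2 - Re \<mu>)"
      by simp
    show "\<mu> - of_nat (Suc M) \<notin> \<int>"
      using \<mu> by (metis Ints_add Ints_of_nat diff_add_cancel)
  qed
  show ?case
  proof (rule Suc.IH)
    show "E1 holomorphic_on ball 0 \<delta>"
      unfolding E1_def by (rule pole_lemma[OF Suc.prems(1)]) (use \<delta> in auto)
    fix w :: complex assume w: "norm w < \<delta>" "norm (1 - w) < 1"
    then have nz: "w \<noteq> 0"
      by auto
    have "w powr (\<mu> - of_nat M) = w powr (\<mu> - of_nat (Suc M)) * w"
      using nz powr_add[of w "\<mu> - of_nat (Suc M)" 1] by simp
    then have "w powr (\<mu> - of_nat (Suc M)) * E w = w powr (\<mu> - of_nat M) * E1 w"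
      using nz E0 by (simp add: E1_def)
    then show "(\<lambda>n. c n * (1 - w) ^ n) sums (w powr (\<mu> - of_nat M) * E1 w + Q w)"
      using Suc.prems(2)[OF w] by simp
  qed
qed

section \<open>From the logarithmic variable back to 1 - z\<close>

definition h_value :: "nat \<Rightarrow> (nat \<Rightarrow> complex) \<Rightarrow> (nat \<Rightarrow> complex) \<Rightarrow> nat \<Rightarrow> nat \<Rightarrow> complex" where
  "h_value p a b s n = - (1 / (of_real pi * sin (of_real pi * psi a b p)))
    * (\<Sum>k\<in>{1..p}-{s}. residue_weight p a b s k * D_coeff p a b k s n)"

text \<open>r is the factor between - ln z and w = 1 - z. As r 0 = 1, it stays in the right
  half-plane near 0, so its powers are holomorphic on the principal branch.\<close>

lemma holomorphic_log_quotient: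
  obtains r :: "complex \<Rightarrow> complex" and \<delta> where "0 < \<delta>" "\<delta> \<le> 1" "r holomorphic_on ball 0 \<delta>"
    "\<And>w. norm w < \<delta> \<Longrightarrow> - Ln (1 - w) = w * r w" "\<And>w. norm w < \<delta> \<Longrightarrow> Re (r w) > 0"
    "\<And>w. norm w < \<delta> \<Longrightarrow> norm (Ln (1 - w)) < 1"
proof -
  let ?L = "\<lambda>w::complex. - Ln (1 - w)"
  define r where "r = (\<lambda>w. if w = 0 then deriv ?L 0 else (?L w - ?L 0) / (w - 0))"
  have np: "1 - w \<notin> \<real>\<^sub>\<le>\<^sub>0" if "w \<in> ball 0 1" for w :: complex
  proof -
    have "Re w < 1"
      using that abs_Re_le_cmod[of w] by simp
    then show ?thesis
      by (auto simp: complex_nonpos_Reals_iff)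
  qed
  have hol: "?L holomorphic_on ball 0 1" "(\<lambda>w. Ln (1 - w)) holomorphic_on ball 0 1"
    by (intro holomorphic_intros np; assumption)+
  have r: "r holomorphic_on ball 0 1"
    unfolding r_def by (rule pole_lemma[OF hol(1)]) simp
  have "(?L has_field_derivative 1) (at 0)"
    by (auto intro!: derivative_eq_intros simp: complex_nonpos_Reals_iff)
  then have r0: "r 0 = 1"
    by (simp add: r_def DERIV_imp_deriv)
  have "open (ball 0 1 \<inter> r -` {z. Re z > 0})"
    by (rule continuous_open_preimage[OF holomorphic_on_imp_continuous_on[OF r] open_ball open_halfspace_Re_gt])
  moreover have "open (ball 0 1 \<inter> (\<lambda>w::complex. Ln (1 - w)) -` ball 0 1)"
    by (rule continuous_open_preimage[OF holomorphic_on_imp_continuous_on[OF hol(2)] open_ball open_ball])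
  ultimately have "open ((ball 0 1 \<inter> r -` {z. Re z > 0}) \<inter> (ball 0 1 \<inter> (\<lambda>w::complex. Ln (1 - w)) -` ball 0 1))"
    by (rule open_Int)
  moreover have "0 \<in> (ball 0 1 \<inter> r -` {z. Re z > 0}) \<inter> (ball 0 1 \<inter> (\<lambda>w::complex. Ln (1 - w)) -` ball 0 1)"
    using r0 by simp
  ultimately obtain e where e: "e > 0"
    "ball 0 e \<subseteq> (ball 0 1 \<inter> r -` {z. Re z > 0}) \<inter> (ball 0 1 \<inter> (\<lambda>w::complex. Ln (1 - w)) -` ball 0 1)"
    by (rule openE)
  show ?thesis
  proof (rule that[of "min e 1" r])
    show "r holomorphic_on ball 0 (min e 1)"
      by (rule holomorphic_on_subset[OF r]) auto
    show "?L w = w * r w" for w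
      by (simp add: r_def)
    show "Re (r w) > 0" "norm (Ln (1 - w)) < 1" if "norm w < min e 1" for w
      using subsetD[OF e(2), of w] that by simp_all
  qed (use e(1) in auto)
qed

text \<open>Both arguments have modulus below pi / 2, so their sum does not leave the principal
  branch.\<close>

lemma powr_mult_right_half_plane:
  fixes w z \<mu> :: complex
  assumes "Re w > 0" "Re z > 0"
  shows "(w * z) powr \<mu> = w powr \<mu> * z powr \<mu>"
proof -
  have nz: "w \<noteq> 0" "z \<noteq> 0"
    using assms by auto
  then have "\<bar>Im (Ln w)\<bar> < pi / 2" "\<bar>Im (Ln z)\<bar> < pi / 2"
    using assms Re_Ln_pos_lt by blast+
  then have "Ln (w * z) = Ln w + Ln z"
    by (intro Ln_times_simple nz) auto
  then show ?thesis
    using nz by (simp add: powr_def exp_add ring_distribs)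
qed

text \<open>Substituting \<zeta> = ln (1 - w), that is - \<zeta> = w r(w), turns powers of - \<zeta>
  into powers of w and collects the other factors in a holomorphic function; the growth of the
  coefficients then removes the pole. The G-functions divided by (1 - w)^(a s) generate the D, hence
  the second summand.\<close>

lemma hyp_coeff_expansion:
  assumes p: "p \<ge> 2" and s: "s \<in> {1..p}" and \<psi>: "psi a b p \<notin> \<int>"
    and df: "\<And>k. k \<in> {1..p} - {s} \<Longrightarrow> meijer_G_defined p a b k s"
    and a: "\<And>i k. i \<in> {1..p} - {s} \<Longrightarrow> k \<in> {1..p} - {s} \<Longrightarrow> i \<noteq> k \<Longrightarrow> a i - a k \<notin> \<int>"
  obtains E \<delta> where "0 < \<delta>" "\<delta> \<le> 1" "E holomorphic_on ball 0 \<delta>"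
    "\<And>w. norm w < \<delta> \<Longrightarrow> norm (1 - w) < 1 \<Longrightarrow>
      (\<lambda>n. hyp_coeff p a b s n * (1 - w) ^ n) sums (w powr (psi a b p - 1) * E w + (\<Sum>n. h_value p a b s n * w ^ n))"
    "\<And>w. norm w < 1 \<Longrightarrow> summable (\<lambda>n. h_value p a b s n * w ^ n)"
proof -
  define \<psi> where "\<psi> = psi a b p"
  define K where "K = 1 / (of_real pi * sin (of_real pi * \<psi>))"
  define Q where "Q w = - K * (\<Sum>k\<in>{1..p}-{s}. residue_weight p a b s k * (meijer_G p a b k s (1 - w) * (1 - w) powr (- a s)))" for w
  have Q: "(\<lambda>n. h_value p a b s n * w ^ n) sums Q w" if w: "norm w < 1" for w
  proof -
    have "(\<lambda>n. D_coeff p a b k s n * w ^ n) sums (meijer_G p a b k s (1 - w) * (1 - w) powr (- a s))"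
      if k: "k \<in> {1..p} - {s}" for k
      using D_coeff_sums[of k p s a b "1 - w"] k s df[OF k] w by auto
    then have "(\<lambda>n. - K * (\<Sum>k\<in>{1..p}-{s}. residue_weight p a b s k * (D_coeff p a b k s n * w ^ n))) sums Q w"
      unfolding Q_def by (intro sums_mult sums_sum)
    then show ?thesis
      by (simp add: h_value_def K_def \<psi>_def sum_distrib_left sum_distrib_right mult_ac)
  qed
  have holQ: "Q holomorphic_on ball 0 1"
    by (rule power_series_holomorphic[where a="h_value p a b s"]) (use Q in simp)
  obtain h M where h: "h holomorphic_on ball 0 1"
    "\<And>\<zeta>. norm \<zeta> < 1 \<Longrightarrow> Re \<zeta> < 0 \<Longrightarrow> (\<lambda>m. hyp_coeff p a b s m * exp \<zeta> ^ m) sums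
      ((- \<zeta>) powr (\<psi> - 1) * (h \<zeta> / \<zeta> ^ M) * exp (- a s * \<zeta>) / (2 * of_real pi * \<i>)
       - K * (\<Sum>k\<in>{1..p}-{s}. residue_weight p a b s k * (meijer_G p a b k s (exp \<zeta>) * exp (- a s * \<zeta>))))"
    unfolding K_def \<psi>_def by (rule hyp_coeff_sums_local[OF p s \<psi> df a]; (assumption | (rule that[unfolded K_def \<psi>_def]; assumption)))
  obtain r \<delta> where \<delta>: "0 < \<delta>" "\<delta> \<le> 1" and r: "r holomorphic_on ball 0 \<delta>"
    "\<And>w. norm w < \<delta> \<Longrightarrow> - Ln (1 - w) = w * r w" "\<And>w. norm w < \<delta> \<Longrightarrow> Re (r w) > 0"
    "\<And>w. norm w < \<delta> \<Longrightarrow> norm (Ln (1 - w)) < 1"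
    by (rule holomorphic_log_quotient) (rule that; assumption)
  \<comment> \<open>The sign comes from \<zeta>^M = (- w r(w))^M.\<close>
  define E where "E w = (- 1) ^ M * (r w powr (\<psi> - 1) / r w ^ M) * h (Ln (1 - w)) * exp (- a s * Ln (1 - w)) / (2 * of_real pi * \<i>)" for w
  have holE: "E holomorphic_on ball 0 \<delta>"
  proof -
    have np: "1 - w \<notin> \<real>\<^sub>\<le>\<^sub>0" "r w \<notin> \<real>\<^sub>\<le>\<^sub>0" "r w \<noteq> 0" if "w \<in> ball 0 \<delta>" for w
    proof -
      have "Re w < 1"
        using that abs_Re_le_cmod[of w] \<delta> by simp
      then show "1 - w \<notin> \<real>\<^sub>\<le>\<^sub>0"
        by (auto simp: complex_nonpos_Reals_iff)
      show "r w \<notin> \<real>\<^sub>\<le>\<^sub>0" "r w \<noteq> 0"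
        using r(3)[of w] that by (auto simp: complex_nonpos_Reals_iff)
    qed
    have L: "(\<lambda>w. Ln (1 - w)) holomorphic_on ball 0 \<delta>"
      by (intro holomorphic_intros np(1))
    have "(h \<circ> (\<lambda>w. Ln (1 - w))) holomorphic_on ball 0 \<delta>"
      by (rule holomorphic_on_compose_gen[OF L h(1)]) (use r(4) in auto)
    then have "(\<lambda>w. h (Ln (1 - w))) holomorphic_on ball 0 \<delta>"
      by (simp only: comp_def)
    then show ?thesis
      unfolding E_def[abs_def] using np by (intro holomorphic_intros L r(1)) auto
  qed
  have sums: "(\<lambda>n. hyp_coeff p a b s n * (1 - w) ^ n) sums (w powr (\<psi> - 1 - of_nat M) * E w + Q w)"
    if w: "norm w < \<delta>" "norm (1 - w) < 1" for w
  proof -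
    define \<zeta> where "\<zeta> = Ln (1 - w)"
    have Re: "Re w > 0"
      using w(2) abs_Re_le_cmod[of "1 - w"] by simp
    then have nz: "w \<noteq> 0"
      by auto
    have w1: "1 - w \<noteq> 0"
      using w(1) \<delta> by auto
    have e: "exp \<zeta> = 1 - w"
      using w1 by (simp add: \<zeta>_def)
    have "Re \<zeta> = ln (norm (1 - w))"
      using w1 by (simp add: \<zeta>_def)
    also have "\<dots> < 0"
      using w(2) w1 by simp
    finally have "Re \<zeta> < 0" .
    then have S: "(\<lambda>m. hyp_coeff p a b s m * (1 - w) ^ m) sums
      ((- \<zeta>) powr (\<psi> - 1) * (h \<zeta> / \<zeta> ^ M) * exp (- a s * \<zeta>) / (2 * of_real pi * \<i>)
       - K * (\<Sum>k\<in>{1..p}-{s}. residue_weight p a b s k * (meijer_G p a b k s (1 - w) * exp (- a s * \<zeta>))))"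
      using h(2)[of \<zeta>] r(4)[OF w(1)] unfolding e \<zeta>_def [symmetric] by blast
    have ex: "exp (- a s * \<zeta>) = (1 - w) powr (- a s)"
      using w1 by (simp add: powr_def \<zeta>_def)
    have \<zeta>r: "- \<zeta> = w * r w"
      using r(2)[OF w(1)] by (simp add: \<zeta>_def)
    have "(- \<zeta>) powr (\<psi> - 1) * (h \<zeta> / \<zeta> ^ M) = w powr (\<psi> - 1 - of_nat M) * ((- 1) ^ M * (r w powr (\<psi> - 1) / r w ^ M) * h \<zeta>)"
    proof -
      have "\<zeta> ^ M = (- 1) ^ M * (w ^ M * r w ^ M)"
        using \<zeta>r by (metis minus_equation_iff mult_minus1 power_mult_distrib)
      moreover have "w powr (\<psi> - 1 - of_nat M) = w powr (\<psi> - 1) / w ^ M"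
        using nz by (simp add: powr_diff powr_nat')
      moreover have "(- \<zeta>) powr (\<psi> - 1) = w powr (\<psi> - 1) * r w powr (\<psi> - 1)"
        unfolding \<zeta>r by (rule powr_mult_right_half_plane[OF Re r(3)[OF w(1)]])
      ultimately show ?thesis
        by (cases "even M") (simp_all add: field_simps)
    qed
    then have "(- \<zeta>) powr (\<psi> - 1) * (h \<zeta> / \<zeta> ^ M) * exp (- a s * \<zeta>) / (2 * of_real pi * \<i>) = w powr (\<psi> - 1 - of_nat M) * E w"
      unfolding E_def \<zeta>_def [symmetric] by (simp only: mult.assoc times_divide_eq_right)
    then show ?thesis
      using S unfolding ex Q_def by simp
  qed
  have "\<exists>E. E holomorphic_on ball 0 \<delta> \<and> (\<forall>w. norm w < \<delta> \<longrightarrow> norm (1 - w) < 1 \<longrightarrow>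
      (\<lambda>n. hyp_coeff p a b s n * (1 - w) ^ n) sums (w powr (\<psi> - 1) * E w + Q w))"
  proof (rule remove_pole[OF \<delta> _ _ _ holE sums])
    show "\<psi> - 1 \<notin> \<int>"
      using \<psi> unfolding \<psi>_def by (metis Ints_1 Ints_add diff_add_cancel)
    show "Q holomorphic_on ball 0 \<delta>"
      by (rule holomorphic_on_subset[OF holQ]) (use \<delta> in auto)
    show "\<forall>\<^sub>F n in sequentially. norm (hyp_coeff p a b s (Suc n)) * real (Suc n)
        \<le> (1/2 - Re (\<psi> - 1) + real n) * norm (hyp_coeff p a b s n)"
      using eventually_hyp_coeff_ratio[OF s, of a b] by (simp add: \<psi>_def)
  qed
  then obtain E' where E': "E' holomorphic_on ball 0 \<delta>" "\<And>w. norm w < \<delta> \<Longrightarrow> norm (1 - w) < 1 \<Longrightarrow>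
      (\<lambda>n. hyp_coeff p a b s n * (1 - w) ^ n) sums (w powr (\<psi> - 1) * E' w + Q w)"
    by blast
  show ?thesis
  proof (rule that[OF \<delta> E'(1)])
    fix w :: complex assume w: "norm w < \<delta>" "norm (1 - w) < 1"
    have "norm w < 1"
      using w(1) \<delta>(2) by simp
    from sums_unique[OF Q[OF this]] show "(\<lambda>n. hyp_coeff p a b s n * (1 - w) ^ n) sums
        (w powr (psi a b p - 1) * E' w + (\<Sum>n. h_value p a b s n * w ^ n))"
      using E'(2)[OF w] by (simp add: \<psi>_def)
  qed (rule sums_summable[OF Q])
qed

section \<open>Uniqueness of the expansion\<close>

text \<open>
  In the logarithmic variable \<open>x = exp u\<close> the relation \<open>x\<^bsup>c\<^esup> P(x) + R(x) = 0\<close> continues to a half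
  plane; comparing it at \<open>u\<close> and \<open>u + 2 \<pi> \<i>\<close> separates both terms.
\<close>

lemma powr_mult_holomorphic_unique:
  fixes P R :: "complex \<Rightarrow> complex" and c :: complex
  assumes c: "c \<notin> \<int>" and r: "r > 0" and hol: "P holomorphic_on ball 0 r" "R holomorphic_on ball 0 r"
    and eq: "\<And>x. 0 < x \<Longrightarrow> x < r \<Longrightarrow> of_real x powr c * P (of_real x) + R (of_real x) = 0"
    and w: "w \<in> ball 0 r" "w \<noteq> 0"
  shows "R w = 0"
proof -
  define S where "S = {u. Re u < ln r}"
  define G where "G u = exp (c * u) * P (exp u) + R (exp u)" for u
  have S: "open S" "connected S"
    unfolding S_def by (auto intro: open_halfspace_Re_lt convex_connected convex_halfspace_Re_lt)
  have exp_S: "exp u \<in> ball 0 r" if "u \<in> S" for u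
  proof -
    have "exp (Re u) < exp (ln r)"
      using that by (simp only: S_def mem_Collect_eq exp_less_cancel_iff)
    then show ?thesis
      using r by simp
  qed
  have "(P \<circ> exp) holomorphic_on S" "(R \<circ> exp) holomorphic_on S"
    by (rule holomorphic_on_compose_gen[OF holomorphic_on_exp hol(1)], use exp_S in blast,
        rule holomorphic_on_compose_gen[OF holomorphic_on_exp hol(2)], use exp_S in blast)
  then have holG: "G holomorphic_on S"
    unfolding G_def[abs_def] comp_def by (intro holomorphic_intros)
  have G0: "G u = 0" if u: "u \<in> S" for u
  proof (rule analytic_continuation[OF holG S])
    \<comment> \<open>The hypothesis holds on this half-line only; as it has a limit point in S, the
      identity theorem extends it to the half-plane.\<close>
    let ?U = "of_real ` {..<ln r} :: complex set"
    show "?U \<subseteq> S"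
      by (auto simp: S_def)
    show "of_real (ln r - 1) \<in> S"
      by (simp add: S_def)
    show "of_real (ln r - 1) islimpt ?U"
      unfolding islimpt_approachable
    proof (intro allI impI)
      fix e :: real assume e: "e > 0"
      show "\<exists>x'\<in>?U. x' \<noteq> of_real (ln r - 1) \<and> dist x' (of_real (ln r - 1)) < e"
        by (rule bexI[of _ "of_real (ln r - 1 - e / 2)"]) (use e in \<open>auto simp: dist_norm simp flip: of_real_diff\<close>)
    qed
    show "G z = 0" if z: "z \<in> ?U" for z
    proof -
      obtain y where y: "z = of_real y" "y < ln r"
        using z by auto
      have "exp y < exp (ln r)"
        using y(2) by (simp only: exp_less_cancel_iff)
      then have "of_real (exp y) powr c * P (of_real (exp y)) + R (of_real (exp y)) = 0"
        using r by (intro eq) auto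
      moreover have "of_real (exp y) powr c = exp (c * of_real y)"
        by (simp add: powr_def flip: exp_of_real)
      ultimately show ?thesis
        by (simp add: G_def y(1) exp_of_real)
    qed
  qed (rule u)
  define u where "u = Ln w"
  have u: "exp u = w"
    using w(2) by (simp add: u_def)
  have "ln (norm w) < ln r"
    using w r by simp
  then have uS: "u \<in> S" "u + 2 * of_real pi * \<i> \<in> S"
    using w(2) by (auto simp: S_def u_def)
  have e1: "exp (c * u) * P w + R w = 0"
    using G0[OF uS(1)] by (simp add: G_def u)
  \<comment> \<open>The shift leaves exp u unchanged and multiplies the power by exp (2 pi i c),
    which differs from 1 because c is not an integer.\<close>
  have "exp (c * (u + 2 * of_real pi * \<i>)) * P w + R w = 0"
    using G0[OF uS(2)] by (simp add: G_def u exp_add)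
  moreover have "exp (c * (u + 2 * of_real pi * \<i>)) = exp (c * u) * exp (2 * of_real pi * \<i> * c)"
    by (simp add: ring_distribs mult_ac flip: exp_add)
  ultimately have e2: "exp (c * u) * exp (2 * of_real pi * \<i> * c) * P w + R w = 0"
    by simp
  have "exp (c * u) * P w * (exp (2 * of_real pi * \<i> * c) - 1)
      = (exp (c * u) * exp (2 * of_real pi * \<i> * c) * P w + R w) - (exp (c * u) * P w + R w)"
    by (simp add: algebra_simps)
  then have "exp (c * u) * P w * (exp (2 * of_real pi * \<i> * c) - 1) = 0"
    unfolding e1 e2 by simp
  moreover have "exp (2 * of_real pi * \<i> * c) \<noteq> 1"
  proof
    assume "exp (2 * of_real pi * \<i> * c) = 1"
    then obtain n :: int where n: "Re (2 * of_real pi * \<i> * c) = 0" "Im (2 * of_real pi * \<i> * c) = of_int (2 * n) * pi"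
      unfolding exp_eq_1 by blast
    then have "c = of_int n"
      by (auto simp: complex_eq_iff)
    then show False
      using c by simp
  qed
  ultimately have "P w = 0"
    by simp
  then show "R w = 0"
    using e1 by simp
qed

text \<open>The logarithmic variable never reaches w = 0; continuity supplies the value
  there.\<close>

lemma power_series_eq_0:
  fixes a :: "nat \<Rightarrow> complex"
  assumes r: "r > 0" and a: "\<And>w. norm w < r \<Longrightarrow> summable (\<lambda>n. a n * w ^ n)"
    and eq: "\<And>w. norm w < r \<Longrightarrow> w \<noteq> 0 \<Longrightarrow> (\<Sum>n. a n * w ^ n) = 0"
  shows "a = (\<lambda>n. 0)"
proof (rule power_series_unique[OF r])
  let ?f = "\<lambda>w. \<Sum>n. a n * w ^ n"
  show "(\<lambda>n. a n * w ^ n) sums ?f w" if "norm w < r" for w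
    using a[OF that] by (rule summable_sums)
  have "?f holomorphic_on ball 0 r"
    by (rule power_series_holomorphic[where a=a]) (use a in \<open>auto intro: summable_sums\<close>)
  then have "isCont ?f 0"
    using r by (auto simp: continuous_on_eq_continuous_at dest: holomorphic_on_imp_continuous_on)
  then have lim: "(?f \<longlongrightarrow> ?f 0) (at 0)"
    by (simp add: isCont_def)
  have "\<forall>\<^sub>F w in at 0. w \<in> ball (0::complex) r - {0}"
    using r by (intro eventually_at_in_open) auto
  then have "\<forall>\<^sub>F w in at 0. ?f w = 0"
    by eventually_elim (rule eq; simp)
  then have "(?f \<longlongrightarrow> 0) (at 0)"
    by (rule tendsto_eventually)
  with lim have "?f 0 = 0"
    by (rule tendsto_unique[OF at_neq_bot])
  then show "(\<lambda>n. 0 * w ^ n) sums ?f w" if "norm w < r" for w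
    using eq[OF that] by (cases "w = 0") auto
qed

lemma buehring_expansion_unique:
  assumes \<psi>: "psi a b p \<notin> \<int>" and 1: "buehring_expansion p a b s f h" and 2: "buehring_expansion p a b s f' h'"
  shows "h = h'"
proof -
  have "\<forall>\<^sub>F z in at_left (1::real).
        (summable (\<lambda>n. f n * of_real (1 - z) ^ n) \<and> summable (\<lambda>n. h n * of_real (1 - z) ^ n) \<and>
        summable (\<lambda>n. f' n * of_real (1 - z) ^ n) \<and> summable (\<lambda>n. h' n * of_real (1 - z) ^ n)) \<and>
        of_real (1 - z) powr (psi a b p - 1) * (\<Sum>n. f n * of_real (1 - z) ^ n) + (\<Sum>n. h n * of_real (1 - z) ^ n)
        = of_real (1 - z) powr (psi a b p - 1) * (\<Sum>n. f' n * of_real (1 - z) ^ n) + (\<Sum>n. h' n * of_real (1 - z) ^ n)"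
    using 1 2 unfolding buehring_expansion_def by eventually_elim simp
  then obtain z0 where z0: "z0 < 1" "\<And>z. z0 < z \<Longrightarrow> z < 1 \<Longrightarrow>
        (summable (\<lambda>n. f n * of_real (1 - z) ^ n) \<and> summable (\<lambda>n. h n * of_real (1 - z) ^ n) \<and>
        summable (\<lambda>n. f' n * of_real (1 - z) ^ n) \<and> summable (\<lambda>n. h' n * of_real (1 - z) ^ n)) \<and>
        of_real (1 - z) powr (psi a b p - 1) * (\<Sum>n. f n * of_real (1 - z) ^ n) + (\<Sum>n. h n * of_real (1 - z) ^ n)
        = of_real (1 - z) powr (psi a b p - 1) * (\<Sum>n. f' n * of_real (1 - z) ^ n) + (\<Sum>n. h' n * of_real (1 - z) ^ n)"
    by (auto simp: eventually_at_left_real[of 0 1] eventually_at_left_field)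
  \<comment> \<open>Half the length of the interval, so that 1 - r is an interior point. Convergence
    there gives convergence in the whole disc of radius r.\<close>
  define r where "r = (1 - z0) / 2"
  have r: "r > 0"
    using z0(1) by (simp add: r_def)
  have "z0 < 1 - r" "1 - r < 1" "1 - (1 - r) = r"
    using z0(1) by (auto simp: r_def field_simps)
  from z0(2)[OF this(1,2)] have sr: "summable (\<lambda>n. f n * of_real r ^ n)" "summable (\<lambda>n. h n * of_real r ^ n)"
    "summable (\<lambda>n. f' n * of_real r ^ n)" "summable (\<lambda>n. h' n * of_real r ^ n)"
    by simp_all
  have inside: "summable (\<lambda>n. g n * w ^ n)" if "summable (\<lambda>n. g n * of_real r ^ n)" "norm w < r" for g and w :: complex
    by (rule powser_inside[OF that(1)]) (use that(2) r in simp)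
  have diff: "summable (\<lambda>n. (f n - f' n) * w ^ n)" "(\<Sum>n. (f n - f' n) * w ^ n) = (\<Sum>n. f n * w ^ n) - (\<Sum>n. f' n * w ^ n)"
    "summable (\<lambda>n. (h n - h' n) * w ^ n)" "(\<Sum>n. (h n - h' n) * w ^ n) = (\<Sum>n. h n * w ^ n) - (\<Sum>n. h' n * w ^ n)"
    if "norm w < r" for w :: complex
    using inside[OF sr(1) that] inside[OF sr(2) that] inside[OF sr(3) that] inside[OF sr(4) that]
    by (simp_all add: left_diff_distrib summable_diff suminf_diff)
  have hol: "(\<lambda>w. \<Sum>n. g n * w ^ n) holomorphic_on ball 0 r" if "\<And>w. norm w < r \<Longrightarrow> summable (\<lambda>n. g n * w ^ n)" for g :: "nat \<Rightarrow> complex"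
    by (rule power_series_holomorphic[where a=g]) (use that in \<open>auto intro: summable_sums\<close>)
  have "(\<lambda>n. h n - h' n) = (\<lambda>n. 0)"
  proof (rule power_series_eq_0[OF r])
    fix w :: complex assume w: "norm w < r"
    show "summable (\<lambda>n. (h n - h' n) * w ^ n)"
      by (rule diff(3)[OF w])
    assume "w \<noteq> 0"
    show "(\<Sum>n. (h n - h' n) * w ^ n) = 0"
    proof (rule powr_mult_holomorphic_unique[OF _ r hol hol _ _ \<open>w \<noteq> 0\<close>])
      show "psi a b p - 1 \<notin> \<int>"
        using \<psi> by (metis Ints_1 Ints_add diff_add_cancel)
      fix x :: real assume x: "0 < x" "x < r"
      then have "z0 < 1 - x" "1 - x < 1" "1 - (1 - x) = x"
        using r by (auto simp: r_def)
      from z0(2)[OF this(1,2)] this(3) have "of_real x powr (psi a b p - 1) * (\<Sum>n. f n * of_real x ^ n) + (\<Sum>n. h n * of_real x ^ n)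
        = of_real x powr (psi a b p - 1) * (\<Sum>n. f' n * of_real x ^ n) + (\<Sum>n. h' n * of_real x ^ n)"
        by simp
      moreover have nr: "norm (of_real x :: complex) < r"
        using x by simp
      ultimately show "of_real x powr (psi a b p - 1) * (\<Sum>n. (f n - f' n) * of_real x ^ n) + (\<Sum>n. (h n - h' n) * of_real x ^ n) = 0"
        unfolding diff(2)[OF nr] diff(4)[OF nr] by (simp add: algebra_simps)
    qed (use diff(1,3) w in auto)
  qed
  then show ?thesis
    by (auto simp: fun_eq_iff)
qed

text \<open>The Taylor coefficients of E serve as the f of the expansion; uniqueness of the second
  family then evaluates the definite description.\<close>

lemma h_coeff_eq:
  assumes p: "p \<ge> 2" and s: "s \<in> {1..p}" and \<psi>: "psi a b p \<notin> \<int>"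
    and df: "\<And>k. k \<in> {1..p} - {s} \<Longrightarrow> meijer_G_defined p a b k s"
    and a: "\<And>i k. i \<in> {1..p} - {s} \<Longrightarrow> k \<in> {1..p} - {s} \<Longrightarrow> i \<noteq> k \<Longrightarrow> a i - a k \<notin> \<int>"
  shows "h_coeff p a b s = h_value p a b s"
proof -
  obtain E \<delta> where \<delta>: "0 < \<delta>" "\<delta> \<le> 1" and E: "E holomorphic_on ball 0 \<delta>"
    "\<And>w. norm w < \<delta> \<Longrightarrow> norm (1 - w) < 1 \<Longrightarrow>
      (\<lambda>n. hyp_coeff p a b s n * (1 - w) ^ n) sums (w powr (psi a b p - 1) * E w + (\<Sum>n. h_value p a b s n * w ^ n))"
    "\<And>w. norm w < 1 \<Longrightarrow> summable (\<lambda>n. h_value p a b s n * w ^ n)"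
    by (rule hyp_coeff_expansion[OF p s \<psi> df a]; (assumption | (rule that; assumption)))
  define f where "f n = (deriv ^^ n) E 0 / fact n" for n
  have f: "(\<lambda>n. f n * w ^ n) sums E w" if "norm w < \<delta>" for w
    using holomorphic_power_series[OF E(1), of w] that by (simp add: f_def)
  have "\<forall>\<^sub>F z in at_left (1::real). z \<in> {1 - \<delta><..<1}"
    using \<delta> by (intro eventually_at_left_real) auto
  then have expansion: "buehring_expansion p a b s f (h_value p a b s)"
    unfolding buehring_expansion_def
  proof eventually_elim
    case (elim z)
    define w where "w = complex_of_real (1 - z)"
    have "norm w = 1 - z"
      unfolding w_def norm_of_real using elim by simp
    then have w: "norm w < \<delta>" "norm w < 1"
      using elim \<delta> by auto
    have z: "1 - w = of_real z"
      by (simp add: w_def)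
    have "norm (1 - w) < 1"
      unfolding z norm_of_real using elim \<delta> by auto
    from E(2)[OF w(1) this] have "(\<lambda>n. hyp_coeff p a b s n * of_real z ^ n) sums
        (w powr (psi a b p - 1) * (\<Sum>n. f n * w ^ n) + (\<Sum>n. h_value p a b s n * w ^ n))"
      using sums_unique[OF f[OF w(1)]] unfolding z by simp
    moreover have "hyp_coeff p a b s n * of_real z ^ n = (\<Prod>i=1..p. Gamma (1 - b i + a s + of_nat n))
          * (\<Prod>i\<in>{1..p}-{s}. rGamma (1 - a i + a s + of_nat n)) * of_real z ^ n / fact n" for n
      by (simp add: hyp_coeff_def)
    ultimately have "gamma_hypergeom p a b s (of_real z)
        = w powr (psi a b p - 1) * (\<Sum>n. f n * w ^ n) + (\<Sum>n. h_value p a b s n * w ^ n)"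
      unfolding gamma_hypergeom_def by (simp add: sums_iff)
    then show ?case
      using sums_summable[OF f[OF w(1)]] E(3)[OF w(2)] unfolding w_def by blast
  qed
  show ?thesis
    unfolding h_coeff_def
  proof (rule the_equality)
    show "\<exists>f. buehring_expansion p a b s f (h_value p a b s)"
      using expansion by blast
    show "h = h_value p a b s" if "\<exists>f. buehring_expansion p a b s f h" for h
      using that buehring_expansion_unique[OF \<psi> _ expansion] by blast
  qed
qed

text \<open>The premises spell out where the quantities are defined: a non-integer psi for h and for
  the sine in front, separated poles for each G-function that occurs, and non-integer differences of
  the a's where their sines are denominators.\<close>

theorem theorem3p10:
  fixes p :: nat and a b :: "nat \<Rightarrow> complex"
  assumes "p \<ge> 2"
  shows
    "(\<forall>n. \<forall>s\<in>{1..p}.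
        psi a b p \<notin> \<int> \<longrightarrow>
        (\<forall>k\<in>{1..p}-{s}. meijer_G_defined p a b k s) \<longrightarrow>
        (\<forall>i\<in>{1..p}-{s}. \<forall>k\<in>{1..p}-{s}. i \<noteq> k \<longrightarrow> a i - a k \<notin> \<int>) \<longrightarrow>
        h_coeff p a b s n =
          - (1 / (of_real pi * sin (of_real pi * psi a b p)))
          * (\<Sum>k\<in>{1..p}-{s}.
               (\<Prod>i=1..p. sin (of_real pi * (b i - a k)))
               / (\<Prod>i\<in>{1..p}-{k,s}. sin (of_real pi * (a i - a k)))
               * D_coeff p a b k s n))
     \<and>
     (\<forall>n. \<forall>s\<in>{1..p}. \<forall>i\<in>{1..p}. \<forall>k\<in>{1..p}.
        s \<noteq> i \<longrightarrow> i \<noteq> k \<longrightarrow> k \<noteq> s \<longrightarrow>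
        meijer_G_defined p a b s i \<longrightarrow>
        meijer_G_defined p a b i k \<longrightarrow>
        meijer_G_defined p a b k s \<longrightarrow>
        (\<Sum>j=0..n. (-1) ^ j / fact j *
           (falling_fact (a i) j * sin (of_real pi * (a s - a i)) * D_coeff p a b s i (n - j)
            + falling_fact (a k) j * sin (of_real pi * (a i - a k)) * D_coeff p a b i k (n - j)
            + falling_fact (a s) j * sin (of_real pi * (a k - a s)) * D_coeff p a b k s (n - j)))
        = 0)"
proof (intro conjI allI ballI impI)
  fix n s
  assume s: "s \<in> {1..p}" and \<psi>: "psi a b p \<notin> \<int>"
    and df: "\<forall>k\<in>{1..p}-{s}. meijer_G_defined p a b k s"
    and a: "\<forall>i\<in>{1..p}-{s}. \<forall>k\<in>{1..p}-{s}. i \<noteq> k \<longrightarrow> a i - a k \<notin> \<int>"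
  have "h_coeff p a b s = h_value p a b s"
    by (rule h_coeff_eq[OF assms s \<psi>]) (use df a in blast)+
  then show "h_coeff p a b s n =
          - (1 / (of_real pi * sin (of_real pi * psi a b p)))
          * (\<Sum>k\<in>{1..p}-{s}.
               (\<Prod>i=1..p. sin (of_real pi * (b i - a k)))
               / (\<Prod>i\<in>{1..p}-{k,s}. sin (of_real pi * (a i - a k)))
               * D_coeff p a b k s n)"
    by (simp only: h_value_def residue_weight_def)
qed (rule D_coeff_three_term)

end
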